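(* Let $\mathcal G$ be an ultragraph satisfying Condition (RFUM2), and let $K$ be a field. The following are equivalent: (i) the ultragraph $C^*$-algebra $C^*(\mathcal G)$ is residually finite-dimensional; (ii) the ultragraph Leavitt path algebra $L_K(\mathcal G)$ is residually finite-dimensional; (iii) $\mathcal G$ satisfies the graph-theoretic RFD conditions (B1)--(B4).
   Context: Ultragraphs. An ultragraph is a quadruple $\mathcal G=(G^0,\mathcal G^1,r,s)$ with $G^0$ a set of vertices, $\mathcal G^1$ a set of edges, $s:\mathcal G^1\to G^0$ and $r:\mathcal G^1\to\mathcal P(G^0)\setminus\{\emptyset\}$. $\mathcal G^0$ is the smallest collection of subsets of $G^0$ containing all singletons $\{v\}$ and all ranges $r(e)$ and closed under finite unions and finite intersections (with $\emptyset\in\mathcal G^0$). A path of length $n\ge1$ is a word $\alpha=e_1\cdots e_n$ of edges with $s(e_{i+1})\in r(e_i)$ for $1\le i<n$; $s(\alpha)=s(e_1)$, $r(\alpha)=r(e_n)$. A vertex $v$ is a sink if $s^{-1}(v)=\emptyset$, regular if $0<|s^{-1}(v)|<\infty$, and an infinite emitter if $|s^{-1}(v)|=\infty$. For $A\in\mathcal G^0$ let $\varepsilon(A)=\{e\in\mathcal G^1:s(e)\in A\}$; $A$ is an infinite emitter if $|\varepsilon(A)|=\infty$. $A\in\mathcal G^0$ is a minimal infinite emitter if $|\varepsilon(A)|=\infty$ and no proper subset $B\subsetneq A$ with $B\in\mathcal G^0$ is either an infinite emitter or an infinite set with $|\varepsilon(B)|<\infty$. $A\in\mathcal G^0$ is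 a minimal sink if $|A|=\infty$, $|\varepsilon(A)|<\infty$ and no proper subset $B\subsetneq A$ with $B\in\mathcal G^0$ is infinite. Condition (RFUM2): every range $r(e)$, $e\in\mathcal G^1$, is a finite union of minimal infinite emitters, minimal sinks, and singletons $\{v\}$ with $v$ a sink or a regular vertex. Terminal boundary sets. $\mathcal A\subseteq\mathcal G^0$ is the collection of all minimal infinite emitters, all minimal sinks, and all $\{v\}$ with $v$ a sink; its elements are terminal boundary sets. Cycles. A cycle is a path $c=e_1\cdots e_n$, $n\ge1$, with $s(e_1)\in r(e_n)$ and $s(e_1),\dots,s(e_n)$ distinct; the vertices on $c$ are the $s(e_i)$. An exit for $c$ is either an edge $f$ with $s(f)\in r(e_i)$ and $f\ne e_{i+1}$ for some $i$ (indices cyclic), or a sink $w\in r(e_i)$ for some $i$. Graph-theoretic RFD conditions. (B1) No infinite receivers: for every $v\in G^0$ the set $\{e\in\mathcal G^1:v\in r(e)\}$ is finite. (B2) No cycle has an exit. (B3) No infinite backward chains: there is no infinite sequence of distinct edges $e_1,e_2,e_3,\dots$ with $s(e_i)\in r(e_{i+1})$ for all $i\ge1$. (B4) Every $v\in G^0$ reaches a terminal boundary set (i.e. $\{v\}\in\mathcal A$, or there are a path $\alpha$ with $|\alpha|\ge1$, $s(\alpha)=v$, and $A\in\mathcal A$ with $A\subseteq r(\alpha)$) or reaches a cycle (i.e. $v$ lies on a cycle, or there is a path $\alpha$ with $|\alpha|\ge1$, $s(\alpha)=v$, such that $r(\alpha)$ contains a vertex lying on a cycle). Algebras. $L_K(\mathcal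 G)$ is the universal $K$-algebra generated by $\{s_e,s_e^*:e\in\mathcal G^1\}\cup\{p_A:A\in\mathcal G^0\}$ subject to: $p_\emptyset=0$, $p_Ap_B=p_{A\cap B}$, $p_{A\cup B}=p_A+p_B-p_{A\cap B}$; $p_{s(e)}s_e=s_ep_{r(e)}=s_e$ and $p_{r(e)}s_e^*=s_e^*p_{s(e)}=s_e^*$; $s_e^*s_f=\delta_{e,f}p_{r(e)}$; $p_v=\sum_{s(e)=v}s_es_e^*$ for every regular vertex $v$ (where $p_v:=p_{\{v\}}$). $C^*(\mathcal G)$ is the universal $C^*$-algebra generated by projections $p_A$ ($A\in\mathcal G^0$) and partial isometries $s_e$ ($e\in\mathcal G^1$) with mutually orthogonal ranges such that $p_\emptyset=0$, $p_Ap_B=p_{A\cap B}$, $p_{A\cup B}=p_A+p_B-p_{A\cap B}$, $s_e^*s_e=p_{r(e)}$, $s_es_e^*\le p_{s(e)}$, and $p_v=\sum_{s(e)=v}s_es_e^*$ for every regular $v$. RFD. A $K$-algebra $A$ is residually finite-dimensional (RFD) if for every $0\ne a\in A$ there are a finite-dimensional $K$-vector space $V$ and a $K$-algebra homomorphism $\pi:A\to\operatorname{End}_K(V)$ with $\pi(a)\ne0$. A $C^*$-algebra is RFD if its finite-dimensional $*$-representations separate points. *)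

theory Defs
  imports "HOL-Library.Poly_Mapping" "Jordan_Normal_Form.Schur_Decomposition"
begin

section \<open>Ultragraphs\<close>

record ('v, 'e) ultragraph =
  verts :: "'v set"
  edges :: "'e set"
  src :: "'e \<Rightarrow> 'v"
  rng :: "'e \<Rightarrow> 'v set"

definition is_ultragraph :: "('v, 'e) ultragraph \<Rightarrow> bool" where
  "is_ultragraph G \<longleftrightarrow>
    (\<forall>e\<in>edges G. src G e \<in> verts G \<and> rng G e \<subseteq> verts G \<and> rng G e \<noteq> {})"

inductive_set gen_verts :: "('v, 'e) ultragraph \<Rightarrow> 'v set set"
  for G :: "('v, 'e) ultragraph" where
  empty: "{} \<in> gen_verts G"
| vertex: "v \<in> verts G \<Longrightarrow> {v} \<in> gen_verts G"
| rng: "e \<in> edges G \<Longrightarrow> rng G e \<in> gen_verts G"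
| union: "A \<in> gen_verts G \<Longrightarrow> B \<in> gen_verts G \<Longrightarrow> A \<union> B \<in> gen_verts G"
| inter: "A \<in> gen_verts G \<Longrightarrow> B \<in> gen_verts G \<Longrightarrow> A \<inter> B \<in> gen_verts G"

definition emits :: "('v, 'e) ultragraph \<Rightarrow> 'v set \<Rightarrow> 'e set" where
  "emits G A = {e \<in> edges G. src G e \<in> A}"

definition is_sink :: "('v, 'e) ultragraph \<Rightarrow> 'v \<Rightarrow> bool" where
  "is_sink G v \<longleftrightarrow> v \<in> verts G \<and> emits G {v} = {}"

definition is_regular :: "('v, 'e) ultragraph \<Rightarrow> 'v \<Rightarrow> bool" where
  "is_regular G v \<longleftrightarrow> v \<in> verts G \<and> emits G {v} \<noteq> {} \<and> finite (emits G {v})"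

definition min_inf_emitter :: "('v, 'e) ultragraph \<Rightarrow> 'v set \<Rightarrow> bool" where
  "min_inf_emitter G A \<longleftrightarrow>
    A \<in> gen_verts G \<and> infinite (emits G A) \<and>
    \<not> (\<exists>B\<in>gen_verts G. B \<subset> A \<and>
         (infinite (emits G B) \<or> (infinite B \<and> finite (emits G B))))"

definition min_sink :: "('v, 'e) ultragraph \<Rightarrow> 'v set \<Rightarrow> bool" where
  "min_sink G A \<longleftrightarrow>
    A \<in> gen_verts G \<and> infinite A \<and> finite (emits G A) \<and>
    \<not> (\<exists>B\<in>gen_verts G. B \<subset> A \<and> infinite B)"

definition RFUM2 :: "('v, 'e) ultragraph \<Rightarrow> bool" where
  "RFUM2 G \<longleftrightarrow>
    (\<forall>e\<in>edges G. \<exists>\<F>. finite \<F> \<and> rng G e = \<Union>\<F> \<and>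
       (\<forall>A\<in>\<F>. min_inf_emitter G A \<or> min_sink G A \<or>
          (\<exists>v. A = {v} \<and> (is_sink G v \<or> is_regular G v))))"

definition terminal_sets :: "('v, 'e) ultragraph \<Rightarrow> 'v set set" where
  "terminal_sets G = {A. min_inf_emitter G A \<or> min_sink G A \<or> (\<exists>v. A = {v} \<and> is_sink G v)}"

text \<open>Only paths of positive length are represented, as nonempty lists of edges.\<close>

definition ug_path :: "('v, 'e) ultragraph \<Rightarrow> 'e list \<Rightarrow> bool" where
  "ug_path G es \<longleftrightarrow> es \<noteq> [] \<and> set es \<subseteq> edges G \<and>
    (\<forall>i. Suc i < length es \<longrightarrow> src G (es ! Suc i) \<in> rng G (es ! i))"

definition path_src :: "('v, 'e) ultragraph \<Rightarrow> 'e list \<Rightarrow> 'v" where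
  "path_src G es = src G (hd es)"

definition path_rng :: "('v, 'e) ultragraph \<Rightarrow> 'e list \<Rightarrow> 'v set" where
  "path_rng G es = rng G (last es)"

definition ug_cycle :: "('v, 'e) ultragraph \<Rightarrow> 'e list \<Rightarrow> bool" where
  "ug_cycle G c \<longleftrightarrow> ug_path G c \<and> path_src G c \<in> path_rng G c \<and> distinct (map (src G) c)"

definition on_cycle :: "('v, 'e) ultragraph \<Rightarrow> 'v \<Rightarrow> bool" where
  "on_cycle G v \<longleftrightarrow> (\<exists>c. ug_cycle G c \<and> v \<in> src G ` set c)"

definition has_exit :: "('v, 'e) ultragraph \<Rightarrow> 'e list \<Rightarrow> bool" where
  "has_exit G c \<longleftrightarrow>
    (\<exists>i<length c.
      (\<exists>f\<in>edges G. src G f \<in> rng G (c ! i) \<and> f \<noteq> c ! (Suc i mod length c)) \<or>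
      (\<exists>w\<in>rng G (c ! i). is_sink G w))"

definition no_inf_receivers :: "('v, 'e) ultragraph \<Rightarrow> bool" where
  "no_inf_receivers G \<longleftrightarrow> (\<forall>v\<in>verts G. finite {e \<in> edges G. v \<in> rng G e})"

definition no_cycle_exits :: "('v, 'e) ultragraph \<Rightarrow> bool" where
  "no_cycle_exits G \<longleftrightarrow> (\<forall>c. ug_cycle G c \<longrightarrow> \<not> has_exit G c)"

definition no_inf_backward_chains :: "('v, 'e) ultragraph \<Rightarrow> bool" where
  "no_inf_backward_chains G \<longleftrightarrow>
    \<not> (\<exists>e :: nat \<Rightarrow> 'e. inj e \<and> (\<forall>i. e i \<in> edges G) \<and>
         (\<forall>i. src G (e i) \<in> rng G (e (Suc i))))"

definition reaches_terminal_set :: "('v, 'e) ultragraph \<Rightarrow> 'v \<Rightarrow> bool" where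
  "reaches_terminal_set G v \<longleftrightarrow>
    {v} \<in> terminal_sets G \<or>
    (\<exists>\<alpha> A. ug_path G \<alpha> \<and> path_src G \<alpha> = v \<and> A \<in> terminal_sets G \<and> A \<subseteq> path_rng G \<alpha>)"

definition reaches_cycle :: "('v, 'e) ultragraph \<Rightarrow> 'v \<Rightarrow> bool" where
  "reaches_cycle G v \<longleftrightarrow>
    on_cycle G v \<or>
    (\<exists>\<alpha> w. ug_path G \<alpha> \<and> path_src G \<alpha> = v \<and> w \<in> path_rng G \<alpha> \<and> on_cycle G w)"

definition graph_RFD :: "('v, 'e) ultragraph \<Rightarrow> bool" where
  "graph_RFD G \<longleftrightarrow>
    no_inf_receivers G \<and> no_cycle_exits G \<and> no_inf_backward_chains G \<and>
    (\<forall>v\<in>verts G. reaches_terminal_set G v \<or> reaches_cycle G v)"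


section \<open>Not necessarily unital algebras, with explicit carriers\<close>

record ('k, 'a) algebra_str =
  alg_carrier :: "'a set"
  alg_zero :: "'a"
  alg_add :: "'a \<Rightarrow> 'a \<Rightarrow> 'a"
  alg_scale :: "'k \<Rightarrow> 'a \<Rightarrow> 'a"
  alg_mult :: "'a \<Rightarrow> 'a \<Rightarrow> 'a"

record ('k, 'a) star_algebra_str = "('k, 'a) algebra_str" +
  alg_star :: "'a \<Rightarrow> 'a"

inductive_set ideal_generated ::
    "('k, 'a, 'm) algebra_str_scheme \<Rightarrow> 'a set \<Rightarrow> 'a set"
  for A :: "('k, 'a, 'm) algebra_str_scheme" and R :: "'a set" where
  zero: "alg_zero A \<in> ideal_generated A R"
| relator: "r \<in> R \<Longrightarrow> r \<in> ideal_generated A R"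
| add: "x \<in> ideal_generated A R \<Longrightarrow> y \<in> ideal_generated A R \<Longrightarrow>
    alg_add A x y \<in> ideal_generated A R"
| scale: "x \<in> ideal_generated A R \<Longrightarrow> alg_scale A c x \<in> ideal_generated A R"
| mult_left: "a \<in> alg_carrier A \<Longrightarrow> x \<in> ideal_generated A R \<Longrightarrow>
    alg_mult A a x \<in> ideal_generated A R"
| mult_right: "a \<in> alg_carrier A \<Longrightarrow> x \<in> ideal_generated A R \<Longrightarrow>
    alg_mult A x a \<in> ideal_generated A R"

definition alg_coset :: "('k, 'a, 'm) algebra_str_scheme \<Rightarrow> 'a set \<Rightarrow> 'a \<Rightarrow> 'a set" where
  "alg_coset A I x = alg_add A x ` I"

text \<open>The quotient by a two-sided ideal \<open>I\<close>.  Each union below is over cosets which all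
  coincide, so that it is the coset obtained from any choice of representatives.\<close>

definition quotient_algebra ::
    "('k, 'a, 'm) algebra_str_scheme \<Rightarrow> 'a set \<Rightarrow> ('k, 'a set) algebra_str" where
  "quotient_algebra A I =
    \<lparr> alg_carrier = alg_coset A I ` alg_carrier A,
      alg_zero = alg_coset A I (alg_zero A),
      alg_add = (\<lambda>X Y. \<Union>x\<in>X. \<Union>y\<in>Y. alg_coset A I (alg_add A x y)),
      alg_scale = (\<lambda>c X. \<Union>x\<in>X. alg_coset A I (alg_scale A c x)),
      alg_mult = (\<lambda>X Y. \<Union>x\<in>X. \<Union>y\<in>Y. alg_coset A I (alg_mult A x y)) \<rparr>"

definition quotient_star_algebra ::
    "('k, 'a) star_algebra_str \<Rightarrow> 'a set \<Rightarrow> ('k, 'a set) star_algebra_str" where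
  "quotient_star_algebra A I =
    algebra_str.extend (quotient_algebra A I)
      (star_algebra_str.fields (\<lambda>X. \<Union>x\<in>X. alg_coset A I (alg_star A x)))"


section \<open>The free algebra on the generators of an ultragraph\<close>

datatype ('v, 'e) generator = Proj "'v set" | Edge 'e | Ghost 'e

text \<open>Words, written additively as required by the multiplication of \<^typ>\<open>'a \<Rightarrow>\<^sub>0 'b\<close>, which
  then is the multiplication of the free associative algebra.\<close>

datatype 'g gen_word = Word (letters: "'g list")

instantiation gen_word :: (type) monoid_add
begin

definition "0 = Word []"

definition "u + w = Word (letters u @ letters w)"

instance
  by standard (simp_all add: zero_gen_word_def plus_gen_word_def)

end

type_synonym ('v, 'e, 'k) free_elem = "('v, 'e) generator gen_word \<Rightarrow>\<^sub>0 'k"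

definition generators :: "('v, 'e) ultragraph \<Rightarrow> ('v, 'e) generator set" where
  "generators G = Proj ` gen_verts G \<union> Edge ` edges G \<union> Ghost ` edges G"

text \<open>The free non-unital algebra: the empty word is excluded.\<close>

definition free_algebra ::
    "('v, 'e) ultragraph \<Rightarrow> ('k::field, ('v, 'e, 'k) free_elem) algebra_str" where
  "free_algebra G =
    \<lparr> alg_carrier =
        {x. \<forall>w\<in>Poly_Mapping.keys x. letters w \<noteq> [] \<and> set (letters w) \<subseteq> generators G},
      alg_zero = 0,
      alg_add = (+),
      alg_scale = (\<lambda>c. Poly_Mapping.map ((*) c)),
      alg_mult = (*) \<rparr>"

definition gen_proj :: "'v set \<Rightarrow> ('v, 'e, 'k::field) free_elem" where
  "gen_proj A = Poly_Mapping.single (Word [Proj A]) 1"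

definition gen_edge :: "'e \<Rightarrow> ('v, 'e, 'k::field) free_elem" where
  "gen_edge e = Poly_Mapping.single (Word [Edge e]) 1"

definition gen_ghost :: "'e \<Rightarrow> ('v, 'e, 'k::field) free_elem" where
  "gen_ghost e = Poly_Mapping.single (Word [Ghost e]) 1"

text \<open>Relations are given by relators, i.e.\ differences of the two sides.\<close>

definition lattice_relators :: "('v, 'e) ultragraph \<Rightarrow> ('v, 'e, 'k::field) free_elem set" where
  "lattice_relators G =
    {gen_proj {}} \<union>
    {gen_proj A * gen_proj B - gen_proj (A \<inter> B) |A B. A \<in> gen_verts G \<and> B \<in> gen_verts G} \<union>
    {gen_proj (A \<union> B) - (gen_proj A + gen_proj B - gen_proj (A \<inter> B)) |A B.
       A \<in> gen_verts G \<and> B \<in> gen_verts G}"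

definition cuntz_krieger_relators ::
    "('v, 'e) ultragraph \<Rightarrow> ('v, 'e, 'k::field) free_elem set" where
  "cuntz_krieger_relators G =
    {gen_proj {v} - (\<Sum>e\<in>emits G {v}. gen_edge e * gen_ghost e) |v. is_regular G v}"


section \<open>The ultragraph Leavitt path algebra\<close>

definition leavitt_relators :: "('v, 'e) ultragraph \<Rightarrow> ('v, 'e, 'k::field) free_elem set" where
  "leavitt_relators G =
    lattice_relators G \<union>
    (\<Union>e\<in>edges G.
      {gen_proj {src G e} * gen_edge e - gen_edge e,
       gen_edge e * gen_proj (rng G e) - gen_edge e,
       gen_proj (rng G e) * gen_ghost e - gen_ghost e,
       gen_ghost e * gen_proj {src G e} - gen_ghost e}) \<union>
    {gen_ghost e * gen_edge f - (if e = f then gen_proj (rng G e) else 0) |e f.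
       e \<in> edges G \<and> f \<in> edges G} \<union>
    cuntz_krieger_relators G"

definition leavitt_algebra ::
    "'k itself \<Rightarrow> ('v, 'e) ultragraph \<Rightarrow> ('k::field, ('v, 'e, 'k) free_elem set) algebra_str" where
  "leavitt_algebra K G =
    quotient_algebra (free_algebra G) (ideal_generated (free_algebra G) (leavitt_relators G))"


section \<open>Universal C*-algebras\<close>

definition cstar_seminorm :: "(complex, 'a) star_algebra_str \<Rightarrow> ('a \<Rightarrow> real) \<Rightarrow> bool" where
  "cstar_seminorm A \<rho> \<longleftrightarrow>
    (\<forall>x\<in>alg_carrier A. 0 \<le> \<rho> x) \<and>
    (\<forall>x\<in>alg_carrier A. \<forall>y\<in>alg_carrier A. \<rho> (alg_add A x y) \<le> \<rho> x + \<rho> y) \<and>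
    (\<forall>c. \<forall>x\<in>alg_carrier A. \<rho> (alg_scale A c x) = cmod c * \<rho> x) \<and>
    (\<forall>x\<in>alg_carrier A. \<forall>y\<in>alg_carrier A. \<rho> (alg_mult A x y) \<le> \<rho> x * \<rho> y) \<and>
    (\<forall>x\<in>alg_carrier A. \<rho> (alg_mult A (alg_star A x) x) = (\<rho> x)\<^sup>2)"

text \<open>The C*-seminorms on a *-algebra \<open>A\<close> that vanish on a set \<open>R\<close> of relators are precisely the
  functions \<open>x \<mapsto> \<parallel>\<phi> x\<parallel>\<close> with \<open>\<phi>\<close> a *-homomorphism from \<open>A\<close> to some C*-algebra such that
  \<open>\<phi>\<close> vanishes on \<open>R\<close>.  The universal C*-seminorm is the supremum of their values, provided that
  this is finite; for the relators below it is, since projections and partial isometries have norm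
  at most 1.\<close>

definition universal_seminorm ::
    "(complex, 'a) star_algebra_str \<Rightarrow> 'a set \<Rightarrow> 'a \<Rightarrow> real" where
  "universal_seminorm A R x = (SUP \<rho>\<in>{\<rho>. cstar_seminorm A \<rho> \<and> (\<forall>r\<in>R. \<rho> r = 0)}. \<rho> x)"

definition cauchy_algebra ::
    "(complex, 'a) star_algebra_str \<Rightarrow> ('a \<Rightarrow> real) \<Rightarrow> (complex, nat \<Rightarrow> 'a) star_algebra_str"
  where
  "cauchy_algebra A \<rho> =
    \<lparr> alg_carrier =
        {X. (\<forall>n. X n \<in> alg_carrier A) \<and>
            (\<forall>\<epsilon>>0. \<exists>N. \<forall>m\<ge>N. \<forall>n\<ge>N. \<rho> (alg_add A (X m) (alg_scale A (-1) (X n))) < \<epsilon>)},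
      alg_zero = (\<lambda>n. alg_zero A),
      alg_add = (\<lambda>X Y n. alg_add A (X n) (Y n)),
      alg_scale = (\<lambda>c X n. alg_scale A c (X n)),
      alg_mult = (\<lambda>X Y n. alg_mult A (X n) (Y n)),
      alg_star = (\<lambda>X n. alg_star A (X n)) \<rparr>"

definition null_sequences ::
    "(complex, 'a) star_algebra_str \<Rightarrow> ('a \<Rightarrow> real) \<Rightarrow> (nat \<Rightarrow> 'a) set" where
  "null_sequences A \<rho> = {X. (\<forall>n. X n \<in> alg_carrier A) \<and> (\<lambda>n. \<rho> (X n)) \<longlonglongrightarrow> 0}"

text \<open>The Hausdorff completion of \<open>A\<close> in the universal C*-seminorm.  Its norm is not recorded, as the
  norm of a C*-algebra is determined by its *-algebra structure.\<close>

definition universal_cstar_algebra ::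
    "(complex, 'a) star_algebra_str \<Rightarrow> 'a set \<Rightarrow> (complex, (nat \<Rightarrow> 'a) set) star_algebra_str" where
  "universal_cstar_algebra A R =
    quotient_star_algebra
      (cauchy_algebra A (universal_seminorm A R))
      (null_sequences A (universal_seminorm A R))"


section \<open>The ultragraph C*-algebra\<close>

text \<open>The generators \<open>p\<^sub>A\<close> are self-adjoint from the start; \<^const>\<open>Ghost\<close> is the adjoint of
  \<^const>\<open>Edge\<close>.\<close>

fun generator_star :: "('v, 'e) generator \<Rightarrow> ('v, 'e) generator" where
  "generator_star (Proj A) = Proj A"
| "generator_star (Edge e) = Ghost e"
| "generator_star (Ghost e) = Edge e"

definition word_star :: "('v, 'e) generator gen_word \<Rightarrow> ('v, 'e) generator gen_word" where
  "word_star w = Word (rev (map generator_star (letters w)))"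

definition free_star :: "('v, 'e, complex) free_elem \<Rightarrow> ('v, 'e, complex) free_elem" where
  "free_star x =
    (\<Sum>w\<in>Poly_Mapping.keys x. Poly_Mapping.single (word_star w) (cnj (Poly_Mapping.lookup x w)))"

definition free_star_algebra ::
    "('v, 'e) ultragraph \<Rightarrow> (complex, ('v, 'e, complex) free_elem) star_algebra_str" where
  "free_star_algebra G = algebra_str.extend (free_algebra G) (star_algebra_str.fields free_star)"

text \<open>That \<open>p\<^sub>A\<close> is idempotent is the case \<open>A = B\<close> of \<open>p\<^sub>A p\<^sub>B = p\<^bsub>A \<inter> B\<^esub>\<close>.  The relators in the
  \<open>e\<close>-indexed family say that \<open>s\<^sub>e\<close> is a partial isometry, \<open>s\<^sub>e\<^sup>* s\<^sub>e = p\<^bsub>r(e)\<^esub>\<close>, and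
  \<open>s\<^sub>e s\<^sub>e\<^sup>* \<le> p\<^bsub>s(e)\<^esub>\<close>, where \<open>q \<le> p\<close> means \<open>p q = q\<close> for projections; the next ones
  say that distinct \<open>s\<^sub>e\<close> have orthogonal ranges.\<close>

definition cstar_relators ::
    "('v, 'e) ultragraph \<Rightarrow> ('v, 'e, complex) free_elem set" where
  "cstar_relators G =
    lattice_relators G \<union>
    (\<Union>e\<in>edges G.
      {gen_edge e * gen_ghost e * gen_edge e - gen_edge e,
       gen_ghost e * gen_edge e - gen_proj (rng G e),
       gen_proj {src G e} * (gen_edge e * gen_ghost e) - gen_edge e * gen_ghost e}) \<union>
    {(gen_edge e * gen_ghost e) * (gen_edge f * gen_ghost f) |e f.
       e \<in> edges G \<and> f \<in> edges G \<and> e \<noteq> f} \<union>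
    cuntz_krieger_relators G"

definition ultragraph_cstar_algebra ::
    "('v, 'e) ultragraph \<Rightarrow>
      (complex, (nat \<Rightarrow> ('v, 'e, complex) free_elem) set) star_algebra_str" where
  "ultragraph_cstar_algebra G = universal_cstar_algebra (free_star_algebra G) (cstar_relators G)"


section \<open>Residual finite-dimensionality\<close>

text \<open>Finite-dimensional vector spaces over \<open>K\<close> are taken inside the space \<^typ>\<open>nat \<Rightarrow>\<^sub>0 'k\<close> of
  countably infinite dimension, which contains an isomorphic copy of each of them.\<close>

definition fin_dim_space :: "(nat \<Rightarrow>\<^sub>0 'k::field) set \<Rightarrow> bool" where
  "fin_dim_space V \<longleftrightarrow>
    (\<exists>B. finite B \<and> V = module.span (\<lambda>c. Poly_Mapping.map ((*) c)) B)"

definition is_endomorphism ::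
    "(nat \<Rightarrow>\<^sub>0 'k::field) set \<Rightarrow> ((nat \<Rightarrow>\<^sub>0 'k) \<Rightarrow> (nat \<Rightarrow>\<^sub>0 'k)) \<Rightarrow> bool" where
  "is_endomorphism V T \<longleftrightarrow>
    (\<forall>x\<in>V. T x \<in> V) \<and>
    (\<forall>x\<in>V. \<forall>y\<in>V. T (x + y) = T x + T y) \<and>
    (\<forall>c. \<forall>x\<in>V. T (Poly_Mapping.map ((*) c) x) = Poly_Mapping.map ((*) c) (T x))"

text \<open>Algebra homomorphisms \<open>A \<rightarrow> End(V)\<close>; endomorphisms of \<open>V\<close> are identified when they agree
  on \<open>V\<close>.\<close>

definition algebra_rep ::
    "('k::field, 'a) algebra_str \<Rightarrow> (nat \<Rightarrow>\<^sub>0 'k) set \<Rightarrow>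
      ('a \<Rightarrow> (nat \<Rightarrow>\<^sub>0 'k) \<Rightarrow> (nat \<Rightarrow>\<^sub>0 'k)) \<Rightarrow> bool" where
  "algebra_rep A V \<pi> \<longleftrightarrow>
    (\<forall>a\<in>alg_carrier A. is_endomorphism V (\<pi> a)) \<and>
    (\<forall>a\<in>alg_carrier A. \<forall>b\<in>alg_carrier A. \<forall>x\<in>V. \<pi> (alg_add A a b) x = \<pi> a x + \<pi> b x) \<and>
    (\<forall>c. \<forall>a\<in>alg_carrier A. \<forall>x\<in>V. \<pi> (alg_scale A c a) x = Poly_Mapping.map ((*) c) (\<pi> a x)) \<and>
    (\<forall>a\<in>alg_carrier A. \<forall>b\<in>alg_carrier A. \<forall>x\<in>V. \<pi> (alg_mult A a b) x = \<pi> a (\<pi> b x))"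

definition algebra_RFD :: "('k::field, 'a) algebra_str \<Rightarrow> bool" where
  "algebra_RFD A \<longleftrightarrow>
    (\<forall>a\<in>alg_carrier A. a \<noteq> alg_zero A \<longrightarrow>
      (\<exists>V \<pi>. fin_dim_space V \<and> algebra_rep A V \<pi> \<and> (\<exists>x\<in>V. \<pi> a x \<noteq> 0)))"

text \<open>*-Homomorphisms to \<open>B(\<complex>\<^sup>n) = M\<^sub>n(\<complex>)\<close>; these may be degenerate.\<close>

definition star_rep ::
    "(complex, 'a) star_algebra_str \<Rightarrow> nat \<Rightarrow> ('a \<Rightarrow> complex mat) \<Rightarrow> bool" where
  "star_rep A n \<pi> \<longleftrightarrow>
    (\<forall>a\<in>alg_carrier A. \<pi> a \<in> carrier_mat n n) \<and>
    (\<forall>a\<in>alg_carrier A. \<forall>b\<in>alg_carrier A. \<pi> (alg_add A a b) = \<pi> a + \<pi> b) \<and>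
    (\<forall>c. \<forall>a\<in>alg_carrier A. \<pi> (alg_scale A c a) = c \<cdot>\<^sub>m \<pi> a) \<and>
    (\<forall>a\<in>alg_carrier A. \<forall>b\<in>alg_carrier A. \<pi> (alg_mult A a b) = \<pi> a * \<pi> b) \<and>
    (\<forall>a\<in>alg_carrier A. \<pi> (alg_star A a) = mat_adjoint (\<pi> a))"

definition cstar_RFD :: "(complex, 'a) star_algebra_str \<Rightarrow> bool" where
  "cstar_RFD A \<longleftrightarrow>
    (\<forall>a\<in>alg_carrier A. \<forall>b\<in>alg_carrier A. a \<noteq> b \<longrightarrow>
      (\<exists>n \<pi>. star_rep A n \<pi> \<and> \<pi> a \<noteq> \<pi> b))"

end

theory Submission
  imports Defs "HOL-Analysis.L2_Norm"
begin

text \<open>A finite-dimensional representation cannot be nonzero on infinitely many orthogonal and mutually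
  equivalent idempotents.  An infinite receiver, an infinite backward chain, a cycle with an exit or
  a vertex from which no terminal set and no cycle is reached produces such idempotents below some
  \<open>p\<^sub>v\<close>, and \<open>p\<^sub>v\<close> is nonzero since the relations have a faithful action by partial bijections.

  Conversely, under the graph conditions the relations act by partial bijections on the boundary
  points \<open>(\<alpha>, t)\<close>, where the path \<open>\<alpha>\<close> ends in a terminal set or in a cycle vertex \<open>t\<close>; twisting by
  \<open>\<int>/N\<close>, through which every edge adds \<open>1\<close>, separates the powers of a cycle.  Without infinite
  receivers and backward chains these actions decompose into finite ones.  An element of the Leavitt
  path algebra is congruent to a combination of finitely many units \<open>s\<^sub>\<alpha> q\<^sub>t s\<^sub>\<beta>\<^sup>*\<close>, whose coefficients
  are matrix coefficients of the actions, so the finite actions separate its points.  For the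
  C*-algebra let \<open>\<epsilon>\<close> bound the operator norms of \<open>x\<close> in the finite actions.  The units occurring in
  \<open>(x\<^sup>*x)\<^sup>m\<close> are linearly many in \<open>m\<close> and of norm at most \<open>1\<close>, whence
  \<open>\<rho>(x)\<^bsup>2m\<^esup> \<le> C (m + 1) \<epsilon>\<^bsup>2m\<^esup>\<close> for every C*-seminorm \<open>\<rho>\<close> that respects the relations, and
  therefore \<open>\<rho>(x) \<le> \<epsilon>\<close>: the finite actions determine the universal norm.\<close>

text \<open>(RFUM2) matters because a minimal infinite set contained in a union A \<union> B of
  members of \<open>gen_verts G\<close> lies in A or in B. Such a set behaves like one extra point
  at which a path may stop, and every member of \<open>gen_verts G\<close> is a finite union of such
  sets and finitely many vertices. Injectivity is not taken from a uniqueness theorem. It comes from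
  explicit coefficient functionals that are biorthogonal to the units. For the Leavitt path algebra
  these settle the matter. For the C*-algebra the norm is needed, and a sum of units is controlled
  only up to the number of its terms. Passing to high powers of x^*x makes that number harmless as
  long as it grows slower than exponentially. It grows linearly because all windings around a cycle
  with the same ends and the same degree give the same unit. The order N of the cyclic group depends
  on the word length: degrees from -L to L must stay distinct modulo N, and N = 2L + 1 is the
  smallest choice. Computations use representatives in the free algebra; quotients and the
  completion enter only to transfer representations and norms.\<close>

abbreviation cst :: "'k::field \<Rightarrow> ('v, 'e, 'k) free_elem" where
  "cst c \<equiv> Poly_Mapping.single 0 c"

definition wd :: "('v, 'e) generator list \<Rightarrow> ('v, 'e, 'k::field) free_elem" where
  "wd u = Poly_Mapping.single (Word u) 1"

definition fcar :: "('v, 'e) ultragraph \<Rightarrow> ('v, 'e, 'k::field) free_elem set" where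
  "fcar G = {x. \<forall>w\<in>Poly_Mapping.keys x. letters w \<noteq> [] \<and> set (letters w) \<subseteq> generators G}"

text \<open>The unital companion of \<open>fcar\<close>. Paths may be empty, and then
  \<open>sp []\<close> and \<open>gp []\<close> are 1, which lies outside the non-unital algebra.
  Congruences may be multiplied by any element of \<open>fcar1 G\<close>, so empty paths need no
  separate treatment.\<close>

definition fcar1 :: "('v, 'e) ultragraph \<Rightarrow> ('v, 'e, 'k::field) free_elem set" where
  "fcar1 G = {x. \<forall>w\<in>Poly_Mapping.keys x. set (letters w) \<subseteq> generators G}"

lemma scale_eq_cst: "Poly_Mapping.map ((*) c) x = cst c * (x :: ('v, 'e, 'k::field) free_elem)"
  by (rule mult_map_scale_conv_mult)

lemma free_algebra_simps [simp]:
  "alg_carrier (free_algebra G) = fcar G" "alg_zero (free_algebra G) = 0"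
  "alg_add (free_algebra G) = (+)" "alg_mult (free_algebra G) = (*)"
  "alg_scale (free_algebra G) c x = cst c * x"
  by (simp_all add: free_algebra_def fcar_def scale_eq_cst)

lemma free_star_algebra_simps [simp]:
  "alg_carrier (free_star_algebra G) = fcar G" "alg_zero (free_star_algebra G) = 0"
  "alg_add (free_star_algebra G) = (+)" "alg_mult (free_star_algebra G) = (*)"
  "alg_scale (free_star_algebra G) c x = cst c * x"
  "alg_star (free_star_algebra G) = free_star"
  by (simp_all add: free_star_algebra_def free_algebra_def fcar_def scale_eq_cst
      algebra_str.extend_def star_algebra_str.fields_def)

lemma gen_eq_wd: "gen_proj A = wd [Proj A]" "gen_edge e = wd [Edge e]" "gen_ghost e = wd [Ghost e]"
  by (simp_all add: gen_proj_def gen_edge_def gen_ghost_def wd_def)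

lemma wd_Nil: "wd [] = 1"
  by (simp add: wd_def flip: zero_gen_word_def single_one)

lemma wd_append: "wd (u @ v) = wd u * wd v"
  by (simp add: wd_def mult_single plus_gen_word_def)

lemma wd_Cons: "wd (g # u) = wd [g] * wd u"
  using wd_append[of "[g]" u] by simp

lemma single_eq_cst: "Poly_Mapping.single w c = cst c * wd (letters w)"
  by (simp add: wd_def mult_single plus_gen_word_def zero_gen_word_def)

lemma cst_commute: "x * cst c = cst c * (x :: ('v, 'e, 'k::field) free_elem)"
proof -
  have "Poly_Mapping.keys x \<subseteq> UNIV" by simp
  have "x = (\<Sum>w\<in>Poly_Mapping.keys x. Poly_Mapping.single w (Poly_Mapping.lookup x w))"
    by (rule poly_mapping_eqI)
      (auto simp: lookup_sum lookup_single when_def in_keys_iff)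
  then obtain S f where x: "x = (\<Sum>w\<in>S. Poly_Mapping.single w (f w))" by blast
  show ?thesis
    unfolding x sum_distrib_left sum_distrib_right
    by (intro sum.cong refl) (simp add: mult_single mult.commute)
qed

lemma cst_mult_left: "x * (cst c * y) = cst c * (x * (y :: ('v, 'e, 'k::field) free_elem))"
  by (metis cst_commute mult.assoc)

lemma cst_simps: "cst a * cst b = cst (a * b)" "cst a + cst b = cst (a + b)"
  "cst 0 = 0" "cst 1 = 1" "cst (-a) = - cst a"
  by (simp_all add: mult_single single_add single_uminus flip: single_one)

lemma poly_mapping_sum_single:
  "x = (\<Sum>w\<in>Poly_Mapping.keys x. Poly_Mapping.single w (Poly_Mapping.lookup x w))"
  by (rule poly_mapping_eqI) (auto simp: lookup_sum lookup_single when_def in_keys_iff)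

text \<open>The coefficient c is arbitrary and only the keys of x are remembered. The keys carry
  what later inductions need: membership in the carrier and bounds on the length of words.\<close>

lemma poly_mapping_span_induct [case_names single zero add]:
  fixes x :: "'a \<Rightarrow>\<^sub>0 'b::comm_monoid_add"
  assumes "\<And>w c. w \<in> Poly_Mapping.keys x \<Longrightarrow> P (Poly_Mapping.single w c)" "P 0"
    and "\<And>y z. P y \<Longrightarrow> P z \<Longrightarrow> P (y + z)"
  shows "P x"
proof -
  have "P (\<Sum>w\<in>S. Poly_Mapping.single w (Poly_Mapping.lookup x w))"
    if "finite S" "S \<subseteq> Poly_Mapping.keys x" for S
    using that by (induction S rule: finite_induct) (auto intro: assms)
  from this[OF finite_keys subset_refl] show ?thesis
    using poly_mapping_sum_single[of x] by simp
qed

lemma fcar_subset_fcar1: "fcar G \<subseteq> fcar1 G"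
  by (auto simp: fcar_def fcar1_def)

lemma fcar_fcar1 [simp]: "x \<in> fcar G \<Longrightarrow> x \<in> fcar1 G"
  using fcar_subset_fcar1 by blast

lemma fcar1_wd [simp]: "set u \<subseteq> generators G \<Longrightarrow> wd u \<in> fcar1 G"
  by (auto simp: fcar1_def wd_def)

lemma fcar_wd [simp]: "u \<noteq> [] \<Longrightarrow> set u \<subseteq> generators G \<Longrightarrow> wd u \<in> fcar G"
  by (auto simp: fcar_def wd_def)

lemma fcar1_cst [simp]: "cst c \<in> fcar1 G" "0 \<in> fcar1 G" "1 \<in> fcar1 G"
  by (auto simp: fcar1_def zero_gen_word_def keys_one split: if_splits)

lemma fcar_0 [simp]: "0 \<in> fcar G"
  by (auto simp: fcar_def)

lemma fcar_add [simp]: "x \<in> fcar G \<Longrightarrow> y \<in> fcar G \<Longrightarrow> x + y \<in> fcar G"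
  using keys_add[of x y] unfolding fcar_def by blast

lemma fcar_uminus [simp]: "x \<in> fcar G \<Longrightarrow> - x \<in> fcar G"
  by (simp add: fcar_def)

lemma fcar_diff [simp]: "x \<in> fcar G \<Longrightarrow> y \<in> fcar G \<Longrightarrow> x - y \<in> fcar G"
  using fcar_add[of x G "-y"] by simp

lemma fcar_sum [simp]: "(\<And>i. i \<in> S \<Longrightarrow> f i \<in> fcar G) \<Longrightarrow> sum f S \<in> fcar G"
  by (induction S rule: infinite_finite_induct) auto

lemma keys_multE:
  assumes "w \<in> Poly_Mapping.keys (x * y :: ('v, 'e, 'k::field) free_elem)"
  obtains u v where "u \<in> Poly_Mapping.keys x" "v \<in> Poly_Mapping.keys y"
    "letters w = letters u @ letters v"
proof -
  have "w \<in> {a + b |a b. a \<in> Poly_Mapping.keys x \<and> b \<in> Poly_Mapping.keys y}"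
    using keys_mult[of x y] assms by blast
  then show ?thesis using that by (auto simp: plus_gen_word_def)
qed

lemma fcar1_mult [simp]:
  assumes "x \<in> fcar1 G" "y \<in> fcar1 G"
  shows "x * y \<in> fcar1 G"
  unfolding fcar1_def
proof (intro CollectI ballI)
  fix w assume "w \<in> Poly_Mapping.keys (x * y)"
  then obtain u v where *: "u \<in> Poly_Mapping.keys x" "v \<in> Poly_Mapping.keys y"
    "letters w = letters u @ letters v" by (rule keys_multE)
  from * assms show "set (letters w) \<subseteq> generators G"
    by (simp add: fcar_def fcar1_def)
qed

lemma fcar_mult1 [simp]:
  assumes "x \<in> fcar1 G" "y \<in> fcar G"
  shows "x * y \<in> fcar G"
  unfolding fcar_def
proof (intro CollectI ballI conjI)
  fix w assume "w \<in> Poly_Mapping.keys (x * y)"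
  then obtain u v where *: "u \<in> Poly_Mapping.keys x" "v \<in> Poly_Mapping.keys y"
    "letters w = letters u @ letters v" by (rule keys_multE)
  from * assms show "set (letters w) \<subseteq> generators G"
    by (simp add: fcar_def fcar1_def)
  from * assms show "letters w \<noteq> []"
    by (auto simp: fcar_def)
qed

lemma fcar_mult2 [simp]:
  assumes "x \<in> fcar G" "y \<in> fcar1 G"
  shows "x * y \<in> fcar G"
  unfolding fcar_def
proof (intro CollectI ballI conjI)
  fix w assume "w \<in> Poly_Mapping.keys (x * y)"
  then obtain u v where *: "u \<in> Poly_Mapping.keys x" "v \<in> Poly_Mapping.keys y"
    "letters w = letters u @ letters v" by (rule keys_multE)
  from * assms show "set (letters w) \<subseteq> generators G"
    by (simp add: fcar_def fcar1_def)
  from * assms show "letters w \<noteq> []"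
    by (auto simp: fcar_def)
qed

lemma fcar_induct [consumes 1, case_names word zero add]:
  assumes "x \<in> fcar G"
    and "\<And>u c. u \<noteq> [] \<Longrightarrow> set u \<subseteq> generators G \<Longrightarrow> P (cst c * wd u)" "P 0"
    and "\<And>y z. P y \<Longrightarrow> P z \<Longrightarrow> P (y + z)"
  shows "P x"
proof (rule poly_mapping_span_induct[of x P])
  fix w c assume "w \<in> Poly_Mapping.keys x"
  then show "P (Poly_Mapping.single w c)"
    using assms(1) by (subst single_eq_cst, intro assms(2)) (auto simp: fcar_def)
qed (fact assms)+

lemma fcar1_induct [consumes 1, case_names word zero add]:
  assumes "x \<in> fcar1 G"
    and "\<And>u c. set u \<subseteq> generators G \<Longrightarrow> P (cst c * wd u)" "P 0"
    and "\<And>y z. P y \<Longrightarrow> P z \<Longrightarrow> P (y + z)"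
  shows "P x"
proof (rule poly_mapping_span_induct[of x P])
  fix w c assume "w \<in> Poly_Mapping.keys x"
  then show "P (Poly_Mapping.single w c)"
    using assms(1) by (subst single_eq_cst, intro assms(2)) (auto simp: fcar1_def)
qed (fact assms)+

lemma generators_intros [simp]:
  "A \<in> gen_verts G \<Longrightarrow> Proj A \<in> generators G"
  "e \<in> edges G \<Longrightarrow> Edge e \<in> generators G"
  "e \<in> edges G \<Longrightarrow> Ghost e \<in> generators G"
  by (auto simp: generators_def)

declare gen_verts.empty [simp, intro] gen_verts.vertex [simp, intro] gen_verts.rng [simp, intro]
  gen_verts.union [simp, intro] gen_verts.inter [simp, intro]

section \<open>The ideal of the Leavitt relations and congruence modulo it\<close>

abbreviation LI :: "('v, 'e) ultragraph \<Rightarrow> ('v, 'e, 'k::field) free_elem set" where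
  "LI G \<equiv> ideal_generated (free_algebra G) (leavitt_relators G)"

lemma is_ultragraph_simps [simp]:
  assumes "is_ultragraph G" "e \<in> edges G"
  shows "src G e \<in> verts G" "rng G e \<subseteq> verts G" "rng G e \<noteq> {}"
  using assms by (auto simp: is_ultragraph_def)

lemma emits_subset: "emits G A \<subseteq> edges G"
  by (auto simp: emits_def)

lemma leavitt_relators_fcar:
  assumes "is_ultragraph G"
  shows "leavitt_relators G \<subseteq> fcar G"
proof -
  have "lattice_relators G \<subseteq> fcar G"
    unfolding lattice_relators_def gen_eq_wd by auto
  moreover have "cuntz_krieger_relators G \<subseteq> fcar G"
  proof -
    have "wd [Proj {v}] - (\<Sum>e\<in>emits G {v}. wd [Edge e] * wd [Ghost e]) \<in> fcar G"
      if "is_regular G v" for v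
      using that emits_subset[of G "{v}"] by (intro fcar_diff fcar_sum) (auto simp: is_regular_def)
    then show ?thesis unfolding cuntz_krieger_relators_def gen_eq_wd by blast
  qed
  ultimately show ?thesis
    using assms unfolding leavitt_relators_def gen_eq_wd by auto
qed

lemma LI_fcar: "is_ultragraph G \<Longrightarrow> x \<in> LI G \<Longrightarrow> x \<in> fcar G"
  by (erule ideal_generated.induct) (use leavitt_relators_fcar in auto)

lemma LI_0 [simp]: "0 \<in> LI G"
  using ideal_generated.zero[of "free_algebra G"] by simp

lemma LI_add [simp]: "x \<in> LI G \<Longrightarrow> y \<in> LI G \<Longrightarrow> x + y \<in> LI G"
  using ideal_generated.add[of _ "free_algebra G"] by simp

lemma LI_cst [simp]: "x \<in> LI G \<Longrightarrow> cst c * x \<in> LI G"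
  using ideal_generated.scale[of _ "free_algebra G"] by simp

lemma LI_uminus [simp]: "x \<in> LI G \<Longrightarrow> - x \<in> LI G"
  using LI_cst[of x G "-1"] by (simp add: cst_simps)

lemma LI_diff [simp]: "x \<in> LI G \<Longrightarrow> y \<in> LI G \<Longrightarrow> x - y \<in> LI G"
  using LI_add[of x G "-y"] by simp

text \<open>The ideal is generated inside the non-unital algebra but absorbs factors from
  \<open>fcar1 G\<close> as well: an empty word contributes only a scalar multiple.\<close>

lemma LI_mult1 [simp]: "a \<in> fcar1 G \<Longrightarrow> x \<in> LI G \<Longrightarrow> a * x \<in> LI G"
proof (induction rule: fcar1_induct)
  case (word u c)
  show ?case
  proof (cases "u = []")
    case False
    then have "wd u * x \<in> LI G"
      using ideal_generated.mult_left[of "wd u" "free_algebra G" x] word by simp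
    then show ?thesis by (simp add: mult.assoc)
  qed (use word in \<open>simp add: wd_Nil\<close>)
qed (auto simp: algebra_simps)

lemma LI_mult2 [simp]: "a \<in> fcar1 G \<Longrightarrow> x \<in> LI G \<Longrightarrow> x * a \<in> LI G"
proof (induction rule: fcar1_induct)
  case (word u c)
  show ?case
  proof (cases "u = []")
    case False
    then have "x * wd u \<in> LI G"
      using ideal_generated.mult_right[of "wd u" "free_algebra G" x] word by simp
    then show ?thesis by (simp add: cst_mult_left)
  qed (use word in \<open>simp add: wd_Nil cst_commute\<close>)
qed (auto simp: algebra_simps)

text \<open>Equality in the Leavitt path algebra, expressed on representatives. Cosets appear only
  where a representation of the quotient has to be built or read off.\<close>

definition lcong :: "('v, 'e) ultragraph \<Rightarrow> ('v, 'e, 'k::field) free_elem \<Rightarrow> ('v, 'e, 'k) free_elem \<Rightarrow> bool"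
  where "lcong G x y \<longleftrightarrow> x - y \<in> LI G"

lemma lcong_refl [simp]: "lcong G x x"
  by (simp add: lcong_def)

lemma lcong_sym: "lcong G x y \<Longrightarrow> lcong G y x"
  using LI_uminus unfolding lcong_def by fastforce

lemma lcong_trans [trans]: "lcong G x y \<Longrightarrow> lcong G y z \<Longrightarrow> lcong G x z"
  using LI_add unfolding lcong_def by fastforce

lemma lcong_add: "lcong G x x' \<Longrightarrow> lcong G y y' \<Longrightarrow> lcong G (x + y) (x' + y')"
  unfolding lcong_def using LI_add by (fastforce simp: algebra_simps)

lemma lcong_diff: "lcong G x x' \<Longrightarrow> lcong G y y' \<Longrightarrow> lcong G (x - y) (x' - y')"
  unfolding lcong_def using LI_diff[of "x - x'" G "y - y'"] by (simp add: algebra_simps)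

lemma lcong_cst: "lcong G x x' \<Longrightarrow> lcong G (cst c * x) (cst c * x')"
  unfolding lcong_def using LI_cst by (fastforce simp flip: right_diff_distrib)

lemma lcong_sum: "(\<And>i. i \<in> S \<Longrightarrow> lcong G (f i) (g i)) \<Longrightarrow> lcong G (sum f S) (sum g S)"
  by (induction S rule: infinite_finite_induct) (auto intro: lcong_add)

lemma lcong_multl: "a \<in> fcar1 G \<Longrightarrow> lcong G x x' \<Longrightarrow> lcong G (a * x) (a * x')"
  unfolding lcong_def using LI_mult1 by (fastforce simp flip: right_diff_distrib)

lemma lcong_multr: "a \<in> fcar1 G \<Longrightarrow> lcong G x x' \<Longrightarrow> lcong G (x * a) (x' * a)"
  unfolding lcong_def using LI_mult2 by (fastforce simp flip: left_diff_distrib)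

lemma lcong_0_iff: "lcong G x 0 \<longleftrightarrow> x \<in> LI G"
  by (simp add: lcong_def)

lemma relator_lcong: "x - y \<in> leavitt_relators G \<Longrightarrow> lcong G x y"
  unfolding lcong_def by (rule ideal_generated.relator)

section \<open>Projections, paths and ghost paths as words\<close>

abbreviation PP :: "'v set \<Rightarrow> ('v, 'e, 'k::field) free_elem" where "PP A \<equiv> wd [Proj A]"

definition sp :: "'e list \<Rightarrow> ('v, 'e, 'k::field) free_elem" where "sp \<alpha> = wd (map Edge \<alpha>)"
text \<open>The adjoint of \<open>sp \<alpha>\<close>: the ghosts stand in reverse order, so
  concatenation of paths is turned around.\<close>

definition gp :: "'e list \<Rightarrow> ('v, 'e, 'k::field) free_elem" where "gp \<alpha> = wd (map Ghost (rev \<alpha>))"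

lemma sp_simps: "sp [] = 1" "sp (\<alpha> @ \<beta>) = sp \<alpha> * sp \<beta>" "wd [Edge e] = sp [e]"
  by (simp_all add: sp_def wd_Nil wd_append)

lemma gp_simps: "gp [] = 1" "gp (\<alpha> @ \<beta>) = gp \<beta> * gp \<alpha>" "wd [Ghost e] = gp [e]"
  by (simp_all add: gp_def wd_Nil wd_append)

lemma sp_Cons: "sp (e # \<alpha>) = sp [e] * sp \<alpha>"
  using sp_simps(2)[of "[e]" \<alpha>] by simp

lemma gp_Cons: "gp (e # \<alpha>) = gp \<alpha> * gp [e]"
  using gp_simps(2)[of "[e]" \<alpha>] by simp

lemma sp_fcar1 [simp]: "set \<alpha> \<subseteq> edges G \<Longrightarrow> sp \<alpha> \<in> fcar1 G"
  unfolding sp_def by (rule fcar1_wd) auto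

lemma gp_fcar1 [simp]: "set \<alpha> \<subseteq> edges G \<Longrightarrow> gp \<alpha> \<in> fcar1 G"
  unfolding gp_def by (rule fcar1_wd) auto

lemma lcong_PP_PP: "A \<in> gen_verts G \<Longrightarrow> B \<in> gen_verts G \<Longrightarrow> lcong G (PP A * PP B) (PP (A \<inter> B))"
  by (rule relator_lcong)
    (auto simp: leavitt_relators_def lattice_relators_def gen_eq_wd)

lemma lcong_PP_empty: "lcong G (PP {}) 0"
  by (rule relator_lcong)
    (auto simp: leavitt_relators_def lattice_relators_def gen_eq_wd)

lemma lcong_PP_union: "A \<in> gen_verts G \<Longrightarrow> B \<in> gen_verts G \<Longrightarrow>
    lcong G (PP (A \<union> B)) (PP A + PP B - PP (A \<inter> B))"
  by (rule relator_lcong)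
    (unfold leavitt_relators_def lattice_relators_def gen_eq_wd, blast)

lemma lcong_edge:
  assumes "e \<in> edges G"
  shows "lcong G (PP {src G e} * sp [e]) (sp [e])" "lcong G (sp [e] * PP (rng G e)) (sp [e])"
    "lcong G (PP (rng G e) * gp [e]) (gp [e])" "lcong G (gp [e] * PP {src G e}) (gp [e])"
  using assms
  by (auto intro!: relator_lcong simp: leavitt_relators_def gen_eq_wd sp_simps gp_simps)

lemma lcong_ghost_edge:
  assumes "e \<in> edges G" "f \<in> edges G"
  shows "lcong G (gp [e] * sp [f]) (if e = f then PP (rng G e) else 0)"
  using assms by (intro relator_lcong) (unfold leavitt_relators_def gen_eq_wd sp_simps gp_simps, blast)

lemma lcong_CK:
  assumes "is_regular G v"
  shows "lcong G (PP {v}) (\<Sum>e\<in>emits G {v}. sp [e] * gp [e])"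
  using assms by (intro relator_lcong)
    (unfold leavitt_relators_def cuntz_krieger_relators_def gen_eq_wd sp_simps gp_simps, blast)

section \<open>Paths and cycles\<close>

lemma ug_path_Cons:
  "ug_path G (e # \<alpha>) \<longleftrightarrow>
    e \<in> edges G \<and> (\<alpha> = [] \<or> ug_path G \<alpha> \<and> src G (hd \<alpha>) \<in> rng G e)"
proof -
  have "(\<forall>i. Suc i < length (e # \<alpha>) \<longrightarrow> src G ((e # \<alpha>) ! Suc i) \<in> rng G ((e # \<alpha>) ! i)) \<longleftrightarrow>
     (\<alpha> = [] \<or> src G (hd \<alpha>) \<in> rng G e \<and>
       (\<forall>i. Suc i < length \<alpha> \<longrightarrow> src G (\<alpha> ! Suc i) \<in> rng G (\<alpha> ! i)))"
    by (cases \<alpha>) (auto simp: nth_Cons split: nat.splits)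
  then show ?thesis unfolding ug_path_def by auto
qed

lemma ug_path_edges: "ug_path G \<alpha> \<Longrightarrow> set \<alpha> \<subseteq> edges G"
  by (simp add: ug_path_def)

lemma ug_path_Nil [simp]: "\<not> ug_path G []"
  by (simp add: ug_path_def)

lemma ug_path_append:
  "\<alpha> \<noteq> [] \<Longrightarrow> \<beta> \<noteq> [] \<Longrightarrow> ug_path G (\<alpha> @ \<beta>) \<longleftrightarrow>
    ug_path G \<alpha> \<and> ug_path G \<beta> \<and> src G (hd \<beta>) \<in> rng G (last \<alpha>)"
  by (induction \<alpha>) (auto simp: ug_path_Cons)

lemma ug_path_single [simp]: "ug_path G [e] \<longleftrightarrow> e \<in> edges G"
  by (simp add: ug_path_Cons)

text \<open>At a repeated source the stretch between the two occurrences is a shorter closed path,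
  and the induction ends with distinct sources. That the cycle uses only edges of the given path is
  what later forbids closed paths that avoid the edges on cycles.\<close>

lemma closed_path_imp_cycle:
  assumes "ug_path G \<alpha>" "src G (hd \<alpha>) \<in> rng G (last \<alpha>)"
  shows "\<exists>c. ug_cycle G c \<and> set c \<subseteq> set \<alpha>"
  using assms
proof (induction "length \<alpha>" arbitrary: \<alpha> rule: less_induct)
  case less
  show ?case
  proof (cases "distinct (map (src G) \<alpha>)")
    case True
    then show ?thesis
      using less.prems by (auto simp: ug_cycle_def path_src_def path_rng_def)
  next
    case False
    then obtain us vs ws y where "map (src G) \<alpha> = us @ [y] @ vs @ [y] @ ws"
      using not_distinct_decomp by blast
    then obtain a e b f c where \<alpha>: "\<alpha> = a @ (e # b) @ (f # c)" and eq: "src G e = src G f"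
      by (clarsimp simp: map_eq_append_conv map_eq_Cons_conv append_eq_map_conv Cons_eq_map_conv)
    have path: "ug_path G ((e # b) @ (f # c))"
      using less.prems(1) ug_path_append[of a "(e # b) @ (f # c)"] unfolding \<alpha> by (cases "a = []") auto
    \<comment> \<open>The range of the last edge of \<open>e # b\<close> contains the source of f,
      which is also the source of e; hence \<open>e # b\<close> is closed.\<close>
    then have "ug_path G (e # b)" "src G f \<in> rng G (last (e # b))"
      using ug_path_append[of "e # b" "f # c" G] by auto
    then have "\<exists>c'. ug_cycle G c' \<and> set c' \<subseteq> set (e # b)"
      using less.hyps[of "e # b"] eq unfolding \<alpha> by auto
    then show ?thesis unfolding \<alpha> by auto
  qed
qed

section \<open>Path calculus in the Leavitt path algebra\<close>

lemma hd_edges: "\<alpha> \<noteq> [] \<Longrightarrow> set \<alpha> \<subseteq> S \<Longrightarrow> hd \<alpha> \<in> S"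
  by (cases \<alpha>) auto

lemma last_edges: "\<alpha> \<noteq> [] \<Longrightarrow> set \<alpha> \<subseteq> S \<Longrightarrow> last \<alpha> \<in> S"
  using last_in_set by blast

lemma lcong_PP_PP_if:
  assumes "A \<in> gen_verts G" "v \<in> verts G"
  shows "lcong G (PP A * PP {v}) (if v \<in> A then PP {v} else 0)"
    and "lcong G (PP {v} * PP A) (if v \<in> A then PP {v} else 0)"
proof -
  have eq: "A \<inter> {v} = (if v \<in> A then {v} else {})" "{v} \<inter> A = (if v \<in> A then {v} else {})" by auto
  show "lcong G (PP A * PP {v}) (if v \<in> A then PP {v} else 0)"
    using lcong_PP_PP[of A G "{v}"] lcong_PP_empty[of G] assms eq by (auto intro: lcong_trans)
  show "lcong G (PP {v} * PP A) (if v \<in> A then PP {v} else 0)"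
    using lcong_PP_PP[of "{v}" G A] lcong_PP_empty[of G] assms eq by (auto intro: lcong_trans)
qed

context
  fixes G :: "('v, 'e) ultragraph"
  assumes ug: "is_ultragraph G"
begin

text \<open>Inserting \<open>PP {src G e}\<close> before the first edge e reduces the product to p_A
  p_{s(e)}, which is p_{s(e)} or 0.\<close>

lemma lcong_PP_sp:
  assumes "A \<in> gen_verts G" "\<alpha> \<noteq> []" "set \<alpha> \<subseteq> edges G"
  shows "lcong G (PP A * sp \<alpha>) (if src G (hd \<alpha>) \<in> A then sp \<alpha> else 0)"
proof -
  obtain e \<beta> where \<alpha>: "\<alpha> = e # \<beta>" using assms(2) by (cases \<alpha>) auto
  have e: "e \<in> edges G" "set \<beta> \<subseteq> edges G" using assms \<alpha> by auto
  have s: "src G e \<in> verts G" using ug e by simp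
  have "lcong G (PP A * sp [e]) (PP A * (PP {src G e} * sp [e]))"
    by (rule lcong_multl) (use assms e lcong_edge(1)[of e G] lcong_sym in auto)
  also have "PP A * (PP {src G e} * sp [e]) = (PP A * PP {src G e}) * sp [e]"
    by (simp add: mult.assoc)
  also have "lcong G \<dots> ((if src G e \<in> A then PP {src G e} else 0) * sp [e])"
    by (rule lcong_multr) (use assms e s lcong_PP_PP_if(1)[of A G "src G e"] in auto)
  also have "lcong G \<dots> (if src G e \<in> A then sp [e] else 0)"
    using lcong_edge(1)[OF e(1)] by auto
  finally have "lcong G (PP A * sp [e] * sp \<beta>) ((if src G e \<in> A then sp [e] else 0) * sp \<beta>)"
    by (rule lcong_multr[rotated]) (use e in auto)
  then show ?thesis unfolding \<alpha> by (subst (1 2) sp_Cons) (auto simp: mult.assoc)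
qed

lemma lcong_gp_PP:
  assumes "A \<in> gen_verts G" "\<alpha> \<noteq> []" "set \<alpha> \<subseteq> edges G"
  shows "lcong G (gp \<alpha> * PP A) (if src G (hd \<alpha>) \<in> A then gp \<alpha> else 0)"
proof -
  obtain e \<beta> where \<alpha>: "\<alpha> = e # \<beta>" using assms(2) by (cases \<alpha>) auto
  have e: "e \<in> edges G" "set \<beta> \<subseteq> edges G" using assms \<alpha> by auto
  have s: "src G e \<in> verts G" using ug e by simp
  have "lcong G (gp [e] * PP A) ((gp [e] * PP {src G e}) * PP A)"
    by (rule lcong_multr) (use assms e lcong_edge(4)[of e G] lcong_sym in auto)
  also have "(gp [e] * PP {src G e}) * PP A = gp [e] * (PP {src G e} * PP A)"
    by (simp add: mult.assoc)
  also have "lcong G \<dots> (gp [e] * (if src G e \<in> A then PP {src G e} else 0))"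
    by (rule lcong_multl) (use assms e s lcong_PP_PP_if(2)[of A G "src G e"] in auto)
  also have "lcong G \<dots> (if src G e \<in> A then gp [e] else 0)"
    using lcong_edge(4)[OF e(1)] by auto
  finally have "lcong G (gp \<beta> * (gp [e] * PP A)) (gp \<beta> * (if src G e \<in> A then gp [e] else 0))"
    by (rule lcong_multl[rotated]) (use e in auto)
  then show ?thesis unfolding \<alpha> by (subst (1 2) gp_Cons) (auto simp: mult.assoc)
qed

lemma rng_gen_verts_last [simp]:
  "\<alpha> \<noteq> [] \<Longrightarrow> set \<alpha> \<subseteq> edges G \<Longrightarrow> rng G (last \<alpha>) \<in> gen_verts G"
  using last_edges by blast

text \<open>The innermost pair collapses to p_{r(e)}, which the next edge absorbs because its source
  lies in r(e); so the pairs disappear one at a time.\<close>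

lemma lcong_gp_sp:
  assumes "ug_path G \<alpha>"
  shows "lcong G (gp \<alpha> * sp \<alpha> :: ('v, 'e, 'k::field) free_elem) (PP (rng G (last \<alpha>)))"
  using assms
proof (induction \<alpha>)
  case (Cons e \<alpha>)
  have e: "e \<in> edges G" using Cons.prems by (simp add: ug_path_Cons)
  have ee: "lcong G (gp [e] * sp [e] :: ('v, 'e, 'k::field) free_elem) (PP (rng G e))"
    using lcong_ghost_edge[OF e e] by simp
  show ?case
  proof (cases "\<alpha> = []")
    case True
    then show ?thesis using ee by simp
  next
    case False
    then have p: "ug_path G \<alpha>" "src G (hd \<alpha>) \<in> rng G e" using Cons.prems by (auto simp: ug_path_Cons)
    have s: "set \<alpha> \<subseteq> edges G" using p ug_path_edges by blast
    have "gp (e # \<alpha>) * sp (e # \<alpha>) = (gp \<alpha> * ((gp [e] * sp [e]) * sp \<alpha>) :: ('v, 'e, 'k::field) free_elem)"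
      by (subst gp_Cons, subst sp_Cons) (simp add: mult.assoc)
    also have "lcong G \<dots> (gp \<alpha> * (PP (rng G e) * sp \<alpha>))"
      by (intro lcong_multl lcong_multr ee) (use s in auto)
    also have "lcong G \<dots> (gp \<alpha> * sp \<alpha>)"
      by (intro lcong_multl) (use s lcong_PP_sp[of "rng G e" \<alpha>] False p(2) e in auto)
    also have "lcong G \<dots> (PP (rng G (last \<alpha>)))" by (rule Cons.IH[OF p(1)])
    finally show ?thesis using False by simp
  qed
qed simp

lemma lcong_gp_sp_prefix:
  assumes "ug_path G (\<alpha> @ \<delta>)" "\<alpha> \<noteq> []" "\<delta> \<noteq> []"
  shows "lcong G (gp \<alpha> * sp (\<alpha> @ \<delta>)) (sp \<delta>)" "lcong G (gp (\<alpha> @ \<delta>) * sp \<alpha>) (gp \<delta>)"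
proof -
  have p: "ug_path G \<alpha>" "ug_path G \<delta>" "src G (hd \<delta>) \<in> rng G (last \<alpha>)"
    using assms ug_path_append by blast+
  then have s: "set \<alpha> \<subseteq> edges G" "set \<delta> \<subseteq> edges G" using ug_path_edges by auto
  have "lcong G ((gp \<alpha> * sp \<alpha>) * sp \<delta>) (PP (rng G (last \<alpha>)) * sp \<delta>)"
    by (intro lcong_multr lcong_gp_sp p) (use s in auto)
  also have "lcong G \<dots> (sp \<delta>)"
    using lcong_PP_sp[of "rng G (last \<alpha>)" \<delta>] s p assms by auto
  finally show "lcong G (gp \<alpha> * sp (\<alpha> @ \<delta>)) (sp \<delta>)" by (simp add: sp_simps mult.assoc)
  have "lcong G (gp \<delta> * (gp \<alpha> * sp \<alpha>)) (gp \<delta> * PP (rng G (last \<alpha>)))"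
    by (intro lcong_multl lcong_gp_sp p) (use s in auto)
  also have "lcong G \<dots> (gp \<delta>)"
    using lcong_gp_PP[of "rng G (last \<alpha>)" \<delta>] s p assms by auto
  finally show "lcong G (gp (\<alpha> @ \<delta>) * sp \<alpha>) (gp \<delta>)" by (simp add: gp_simps mult.assoc)
qed

text \<open>Once the common prefix has cancelled, s_e^* s_f = 0 stands in the middle. Pairwise
  diverging paths therefore give orthogonal elements, which is how most of the obstructions to
  finite dimension arise.\<close>

lemma lcong_gp_sp_diverging:
  assumes "ug_path G (\<gamma> @ e # \<alpha>)" "ug_path G (\<gamma> @ f # \<beta>)" "e \<noteq> f"
  shows "lcong G (gp (\<gamma> @ e # \<alpha>) * sp (\<gamma> @ f # \<beta>)) 0"
proof -
  have s: "set \<gamma> \<subseteq> edges G" "set \<alpha> \<subseteq> edges G" "set \<beta> \<subseteq> edges G" "e \<in> edges G" "f \<in> edges G"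
    using ug_path_edges[OF assms(1)] ug_path_edges[OF assms(2)] by auto
  have 1: "lcong G (gp \<gamma> * sp (\<gamma> @ f # \<beta>)) (sp (f # \<beta>))"
    using lcong_gp_sp_prefix(1)[of \<gamma> "f # \<beta>"] assms by (cases "\<gamma> = []") (auto simp: gp_simps)
  have "gp (\<gamma> @ e # \<alpha>) * sp (\<gamma> @ f # \<beta>) = gp \<alpha> * gp [e] * (gp \<gamma> * sp (\<gamma> @ f # \<beta>))"
    by (simp only: gp_simps gp_Cons[of e \<alpha>] mult.assoc)
  also have "lcong G \<dots> (gp \<alpha> * gp [e] * sp (f # \<beta>))"
    by (rule lcong_multl[OF _ 1]) (use s in auto)
  also have "gp \<alpha> * gp [e] * sp (f # \<beta>) = gp \<alpha> * ((gp [e] * sp [f]) * sp \<beta>)"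
    by (subst sp_Cons) (simp add: mult.assoc)
  also have "lcong G \<dots> (gp \<alpha> * (0 * sp \<beta>))"
    by (intro lcong_multl lcong_multr) (use s assms(3) lcong_ghost_edge[of e G f] in auto)
  finally show ?thesis by simp
qed

lemma finite_gen_verts: "finite U \<Longrightarrow> U \<subseteq> verts G \<Longrightarrow> U \<in> gen_verts G"
proof (induction U rule: finite_induct)
  case (insert v U)
  then have "{v} \<union> U \<in> gen_verts G" by (intro gen_verts.union) auto
  then show ?case by simp
qed simp

lemma gen_verts_subset: "A \<in> gen_verts G \<Longrightarrow> A \<subseteq> verts G"
proof (induction rule: gen_verts.induct)
  case (rng e)
  then show ?case by (rule is_ultragraph_simps(2)[OF ug])
qed blast+

lemma lcong_PP_finite: "finite U \<Longrightarrow> U \<subseteq> verts G \<Longrightarrow>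
    lcong G (PP U :: ('v, 'e, 'k::field) free_elem) (\<Sum>v\<in>U. PP {v})"
proof (induction U rule: finite_induct)
  case (insert v U)
  have "lcong G (PP ({v} \<union> U) :: ('v, 'e, 'k::field) free_elem) (PP {v} + PP U - PP ({v} \<inter> U))"
    using insert.prems finite_gen_verts insert.hyps by (intro lcong_PP_union) auto
  also have "{v} \<inter> U = {}" using insert.hyps by auto
  also have "lcong G (PP {v} + PP U - PP {} :: ('v, 'e, 'k::field) free_elem) (PP {v} + (\<Sum>v\<in>U. PP {v}) - 0)"
    using insert by (intro lcong_diff lcong_add lcong_PP_empty) auto
  finally show ?case using insert.hyps by simp
qed (simp add: lcong_PP_empty)

end

section \<open>Actions of an ultragraph by partial bijections\<close>

text \<open>\<open>th e : D (r(e)) \<rightarrow> R e\<close> and its inverse \<open>sg e\<close> implement \<open>s\<^sub>e\<close> and \<open>s\<^sub>e\<^sup>*\<close> on functions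
  on \<open>'x\<close>, on which \<open>p\<^sub>A\<close> restricts to \<open>D A\<close>.\<close>

locale gset =
  fixes G :: "('v, 'e) ultragraph" and D :: "'v set \<Rightarrow> 'x set" and R :: "'e \<Rightarrow> 'x set"
    and th sg :: "'e \<Rightarrow> 'x \<Rightarrow> 'x"
  assumes D_empty: "D {} = {}"
    and D_Int: "\<And>A B. A \<in> gen_verts G \<Longrightarrow> B \<in> gen_verts G \<Longrightarrow> D (A \<inter> B) = D A \<inter> D B"
    and D_Un: "\<And>A B. A \<in> gen_verts G \<Longrightarrow> B \<in> gen_verts G \<Longrightarrow> D (A \<union> B) = D A \<union> D B"
    and th_R: "\<And>e \<xi>. e \<in> edges G \<Longrightarrow> \<xi> \<in> D (rng G e) \<Longrightarrow> th e \<xi> \<in> R e"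
    and sg_th: "\<And>e \<xi>. e \<in> edges G \<Longrightarrow> \<xi> \<in> D (rng G e) \<Longrightarrow> sg e (th e \<xi>) = \<xi>"
    and sg_D: "\<And>e \<xi>. e \<in> edges G \<Longrightarrow> \<xi> \<in> R e \<Longrightarrow> sg e \<xi> \<in> D (rng G e)"
    and th_sg: "\<And>e \<xi>. e \<in> edges G \<Longrightarrow> \<xi> \<in> R e \<Longrightarrow> th e (sg e \<xi>) = \<xi>"
    and R_src: "\<And>e \<xi>. e \<in> edges G \<Longrightarrow> \<xi> \<in> R e \<Longrightarrow> \<xi> \<in> D {src G e}"
    and R_disj: "\<And>e f \<xi>. e \<in> edges G \<Longrightarrow> f \<in> edges G \<Longrightarrow> \<xi> \<in> R e \<Longrightarrow> \<xi> \<in> R f \<Longrightarrow> e = f"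
    and D_regular: "\<And>v \<xi>. is_regular G v \<Longrightarrow> \<xi> \<in> D {v} \<Longrightarrow> \<exists>e\<in>emits G {v}. \<xi> \<in> R e"
begin

text \<open>Functions are transported by pullback, so s_e uses \<open>sg e\<close>: the unit
  function at a point \<xi> of \<open>D (rng G e)\<close> goes to the one at
  \<open>th e \<xi>\<close>.\<close>

fun gop :: "('v, 'e) generator \<Rightarrow> ('x \<Rightarrow> 'k::field) \<Rightarrow> 'x \<Rightarrow> 'k" where
  "gop (Proj A) f \<xi> = (if \<xi> \<in> D A then f \<xi> else 0)"
| "gop (Edge e) f \<xi> = (if \<xi> \<in> R e then f (sg e \<xi>) else 0)"
| "gop (Ghost e) f \<xi> = (if \<xi> \<in> D (rng G e) then f (th e \<xi>) else 0)"

definition opw :: "('v, 'e) generator list \<Rightarrow> ('x \<Rightarrow> 'k::field) \<Rightarrow> 'x \<Rightarrow> 'k" where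
  "opw u f = foldr gop u f"

definition act :: "('v, 'e, 'k::field) free_elem \<Rightarrow> ('x \<Rightarrow> 'k) \<Rightarrow> 'x \<Rightarrow> 'k" where
  "act x f \<xi> = (\<Sum>w\<in>Poly_Mapping.keys x. Poly_Mapping.lookup x w * opw (letters w) f \<xi>)"

lemma gop_add: "gop g (\<lambda>\<xi>. f \<xi> + h \<xi>) = (\<lambda>\<xi>. gop g f \<xi> + gop g h \<xi>)"
  by (cases g) auto

lemma gop_scale: "gop g (\<lambda>\<xi>. c * f \<xi>) = (\<lambda>\<xi>. c * gop g f \<xi>)"
  by (cases g) auto

lemma opw_simps [simp]: "opw [] f = f" "opw (g # u) f = gop g (opw u f)"
  "opw (u @ u') f = opw u (opw u' f)"
  by (simp_all add: opw_def)

lemma opw_add: "opw u (\<lambda>\<xi>. f \<xi> + h \<xi>) = (\<lambda>\<xi>. opw u f \<xi> + opw u h \<xi>)"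
  by (induction u) (simp_all add: gop_add)

lemma opw_scale: "opw u (\<lambda>\<xi>. c * f \<xi>) = (\<lambda>\<xi>. c * opw u f \<xi>)"
  by (induction u) (simp_all add: gop_scale)

lemma act_superset:
  assumes "finite S" "Poly_Mapping.keys x \<subseteq> S"
  shows "act x f \<xi> = (\<Sum>w\<in>S. Poly_Mapping.lookup x w * opw (letters w) f \<xi>)"
  unfolding act_def
  by (rule sum.mono_neutral_left) (use assms in \<open>auto simp: in_keys_iff\<close>)

lemma act_add_left: "act (x + y) f = (\<lambda>\<xi>. act x f \<xi> + act y f \<xi>)"
proof
  fix \<xi>
  let ?S = "Poly_Mapping.keys x \<union> Poly_Mapping.keys y"
  show "act (x + y) f \<xi> = act x f \<xi> + act y f \<xi>"
    using keys_add[of x y]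
    by (simp add: act_superset[of ?S] lookup_add algebra_simps sum.distrib)
qed

lemma act_0 [simp]: "act 0 f = (\<lambda>\<xi>. 0)"
  by (simp add: act_def fun_eq_iff)

lemma act_single: "act (Poly_Mapping.single w c) f = (\<lambda>\<xi>. c * opw (letters w) f \<xi>)"
  by (rule ext) (simp add: act_superset[of "{w}"])

lemma act_wd: "act (wd u) f = opw u f"
  by (simp add: wd_def act_single)

lemma act_add_right: "act x (\<lambda>\<xi>. f \<xi> + h \<xi>) = (\<lambda>\<xi>. act x f \<xi> + act x h \<xi>)"
  by (simp add: fun_eq_iff act_def opw_add algebra_simps sum.distrib)

lemma act_scale_right: "act x (\<lambda>\<xi>. c * f \<xi>) = (\<lambda>\<xi>. c * act x f \<xi>)"
  by (simp add: fun_eq_iff act_def opw_scale sum_distrib_left mult.left_commute)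

lemma act_zero_right [simp]: "act x (\<lambda>\<xi>. 0) = (\<lambda>\<xi>. 0)"
  using act_scale_right[of x 0] by simp

lemma act_mult: "act (x * y) f = act x (act y f)"
proof (induction x rule: poly_mapping_span_induct)
  case (single w c)
  show ?case
  proof (induction y rule: poly_mapping_span_induct)
    case (single w' c')
    show ?case
      by (simp add: mult_single act_single plus_gen_word_def opw_scale mult.assoc)
  next
    case (add y z)
    then show ?case by (simp add: distrib_left act_add_left act_add_right)
  qed simp
next
  case (add y z)
  then show ?case by (simp add: distrib_right act_add_left)
qed simp

lemma act_scale_left: "act (cst c * x) f = (\<lambda>\<xi>. c * act x f \<xi>)"
  by (simp add: act_mult act_single zero_gen_word_def)

lemma act_uminus: "act (- x) f = (\<lambda>\<xi>. - act x f \<xi>)"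
  using act_scale_left[of "-1" x f] by (simp add: cst_simps)

lemma act_diff_left: "act (x - y) f = (\<lambda>\<xi>. act x f \<xi> - act y f \<xi>)"
  using act_add_left[of x "-y" f] by (simp add: act_uminus)

lemma act_sum_left: "act (sum x S) f = (\<lambda>\<xi>. \<Sum>i\<in>S. act (x i) f \<xi>)"
  by (induction S rule: infinite_finite_induct) (auto simp: act_add_left)

lemma act_sum_right: "act x (\<lambda>\<xi>. \<Sum>i\<in>S. f i \<xi>) = (\<lambda>\<xi>. \<Sum>i\<in>S. act x (f i) \<xi>)"
  by (induction S rule: infinite_finite_induct) (auto simp: act_add_right)

lemmas act_gens = act_wd[of "[_]", unfolded opw_simps]

lemma act_lattice_relators:
  assumes "x \<in> lattice_relators G"
  shows "act x f = (\<lambda>\<xi>. 0)"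
  using assms unfolding lattice_relators_def gen_eq_wd
  by (auto simp: fun_eq_iff act_add_left act_diff_left act_mult act_gens D_empty D_Int D_Un)

lemma act_leavitt_relators:
  assumes "x \<in> leavitt_relators G"
  shows "act x f = (\<lambda>\<xi>. 0)"
proof -
  consider "x \<in> lattice_relators G"
    | e where "e \<in> edges G" "x \<in> {gen_proj {src G e} * gen_edge e - gen_edge e,
       gen_edge e * gen_proj (rng G e) - gen_edge e,
       gen_proj (rng G e) * gen_ghost e - gen_ghost e,
       gen_ghost e * gen_proj {src G e} - gen_ghost e}"
    | e f where "e \<in> edges G" "f \<in> edges G"
      "x = gen_ghost e * gen_edge f - (if e = f then gen_proj (rng G e) else 0)"
    | v where "is_regular G v" "x = gen_proj {v} - (\<Sum>e\<in>emits G {v}. gen_edge e * gen_ghost e)"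
    using assms unfolding leavitt_relators_def cuntz_krieger_relators_def by blast
  then show ?thesis
  proof cases
    case 1
    then show ?thesis by (rule act_lattice_relators)
  next
    case 2
    then show ?thesis unfolding gen_eq_wd
      by (auto simp: fun_eq_iff act_diff_left act_mult act_gens R_src[OF _ th_R] dest: R_src sg_D)
  next
    case 3
    then show ?thesis unfolding gen_eq_wd
      by (auto simp: fun_eq_iff act_diff_left act_mult act_gens sg_th dest: R_disj th_R)
  next
    case 4
    \<comment> \<open>Over a regular vertex the sets \<open>R e\<close> partition
      \<open>D {v}\<close>: they cover it by \<open>D_regular\<close>, are disjoint by
      \<open>R_disj\<close> and lie inside it by \<open>R_src\<close>. So exactly one summand
      survives on \<open>D {v}\<close>.\<close>
    have "(if \<xi> \<in> D {v} then f \<xi> else 0) = (\<Sum>e\<in>emits G {v}. if \<xi> \<in> R e then f \<xi> else 0)" for \<xi>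
    proof (cases "\<xi> \<in> D {v}")
      case True
      then obtain e where e: "e \<in> emits G {v}" "\<xi> \<in> R e" using D_regular 4 by blast
      have "(\<Sum>e\<in>emits G {v}. if \<xi> \<in> R e then f \<xi> else 0) = (\<Sum>e'\<in>emits G {v}. if e' = e then f \<xi> else 0)"
        by (rule sum.cong) (use e R_disj emits_subset in \<open>fastforce+\<close>)
      then show ?thesis using True e 4 by (simp add: is_regular_def)
    next
      case False
      have "\<xi> \<notin> R e" if "e \<in> emits G {v}" for e
        using that False R_src[of e \<xi>] by (auto simp: emits_def)
      then show ?thesis using False by simp
    qed
    moreover have "gop (Edge e) (gop (Ghost e) f) \<xi> = (if \<xi> \<in> R e then f \<xi> else 0)"
      if "e \<in> emits G {v}" for e \<xi>
      using that sg_D th_sg by (auto simp: emits_def)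
    ultimately show ?thesis unfolding 4 gen_eq_wd
      by (simp add: fun_eq_iff act_diff_left act_mult act_gens act_sum_left del: gop.simps(2,3))
  qed
qed

text \<open>The action factors through the Leavitt path algebra. The function f stays arbitrary in
  the induction because a right factor changes it.\<close>

lemma act_LI:
  assumes "x \<in> LI G"
  shows "act x f = (\<lambda>\<xi>. 0)"
  using assms
proof (induction arbitrary: f rule: ideal_generated.induct)
  case (relator r)
  then show ?case by (rule act_leavitt_relators)
qed (simp_all add: act_add_left act_scale_left act_mult)

end

section \<open>A faithful action\<close>

text \<open>Every vertex gets its own copy of the set of lists, and at a vertex \<open>v\<close> which is not a sink
  the disjoint union of the sets attached to the ranges of the edges from \<open>v\<close> has the same
  cardinality as that copy.\<close>

type_synonym ('v, 'e) big = "'v \<times> ('v + 'e + nat) list"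

lemma ex_bij_big:
  fixes G :: "('v, 'e) ultragraph"
  assumes "is_ultragraph G" "v \<in> verts G" "emits G {v} \<noteq> {}"
  shows "\<exists>h. bij_betw h {(e, w, y) |e w (y :: ('v + 'e + nat) list). e \<in> emits G {v} \<and> w \<in> rng G e}
    (UNIV :: ('v + 'e + nat) list set)"
proof -
  let ?S = "{(e, w, y) |e w (y :: ('v + 'e + nat) list). e \<in> emits G {v} \<and> w \<in> rng G e}"
  obtain e where e: "e \<in> emits G {v}" using assms by blast
  then have "rng G e \<noteq> {}" by (intro is_ultragraph_simps(3)[OF assms(1)]) (simp add: emits_def)
  then obtain w where w: "w \<in> rng G e" by blast
  \<comment> \<open>The list remembers the edge and the vertex under different tags, so triples
    inject into lists. Fixing one e and one w gives an injection back, and the Schroeder-Bernstein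
    theorem combines the two.\<close>
  have "inj_on (\<lambda>(e, w, y). Inr (Inl e) # Inl w # y) ?S"
    by (auto simp: inj_on_def)
  moreover have "inj_on (\<lambda>y. (e, w, y)) UNIV" "range (\<lambda>y. (e, w, y)) \<subseteq> ?S"
    using e w by (auto simp: inj_on_def)
  ultimately show ?thesis
    using Schroeder_Bernstein[of "\<lambda>(e, w, y). Inr (Inl e) # Inl w # y" ?S UNIV "\<lambda>y. (e, w, y)"]
    by blast
qed

text \<open>The bijection \<open>h v\<close> cuts the copy over a vertex v that is not a sink into
  one piece for each edge e from v, and identifies that piece with the part over r(e). The pieces
  exhaust the copy, also at infinite emitters, and this gives \<open>D_regular\<close>.\<close>

lemma ex_faithful_gset:
  fixes G :: "('v, 'e) ultragraph"
  assumes ug: "is_ultragraph G"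
  shows "\<exists>R th sg. gset G (\<lambda>A. A \<times> (UNIV :: ('v + 'e + nat) list set)) R th sg"
proof -
  define S where "S v = {(e, w, y) |e w (y :: ('v + 'e + nat) list). e \<in> emits G {v} \<and> w \<in> rng G e}" for v
  have "\<exists>h. v \<in> verts G \<and> emits G {v} \<noteq> {} \<longrightarrow> bij_betw h (S v) (UNIV :: ('v + 'e + nat) list set)" for v
    using ex_bij_big[OF ug, of v] unfolding S_def by metis
  then obtain h where h: "\<And>v. v \<in> verts G \<Longrightarrow> emits G {v} \<noteq> {} \<Longrightarrow>
      bij_betw (h v) (S v) (UNIV :: ('v + 'e + nat) list set)"
    by metis
  define k where "k v = the_inv_into (S v) (h v)" for v
  define th where "th e = (\<lambda>(w, y). (src G e, h (src G e) (e, w, y)))" for e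
  define R where "R e = {(v, z). v = src G e \<and> fst (k v z) = e}" for e
  define sg where "sg = (\<lambda>(e :: 'e) (v, z). snd (k v z))"
  have em: "src G e \<in> verts G" "e \<in> emits G {src G e}" if "e \<in> edges G" for e
    using ug that by (auto simp: emits_def)
  have hS: "(e, w, y) \<in> S (src G e)" if "e \<in> edges G" "w \<in> rng G e" for e w y
    using em that by (auto simp: S_def)
  have kh: "k v (h v s) = s" if "v \<in> verts G" "s \<in> S v" for v s
    using h[of v] that unfolding k_def by (auto simp: bij_betw_def S_def intro!: the_inv_into_f_f)
  have hk: "h v (k v z) = z" "k v z \<in> S v" if "v \<in> verts G" "emits G {v} \<noteq> {}" for v z
    using h[OF that] unfolding k_def
    by (auto simp: bij_betw_def f_the_inv_into_f intro!: the_inv_into_into)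
  have "gset G (\<lambda>A. A \<times> (UNIV :: ('v + 'e + nat) list set)) R th sg"
  proof
    fix e \<xi> assume e: "e \<in> edges G" and \<xi>: "\<xi> \<in> rng G e \<times> (UNIV :: ('v + 'e + nat) list set)"
    obtain w y where wy: "\<xi> = (w, y)" by fastforce
    show "th e \<xi> \<in> R e" "sg e (th e \<xi>) = \<xi>"
      using \<xi> kh[OF em(1)[OF e] hS[OF e]] unfolding wy th_def R_def sg_def by auto
  next
    fix e \<xi> assume e: "e \<in> edges G" and \<xi>: "\<xi> \<in> R e"
    obtain z where z: "\<xi> = (src G e, z)" "fst (k (src G e) z) = e" using \<xi> by (auto simp: R_def)
    have "emits G {src G e} \<noteq> {}" using em e by blast
    note hk' = hk[OF em(1)[OF e] this, of z]
    then obtain w y where wy: "k (src G e) z = (e, w, y)" "w \<in> rng G e" using z by (auto simp: S_def)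
    show "sg e \<xi> \<in> rng G e \<times> UNIV" "th e (sg e \<xi>) = \<xi>"
      using hk' wy unfolding z sg_def th_def by auto
    show "\<xi> \<in> {src G e} \<times> UNIV" using z by auto
  next
    fix v \<xi> assume v: "is_regular G v" "\<xi> \<in> {v} \<times> (UNIV :: ('v + 'e + nat) list set)"
    then obtain z where z: "\<xi> = (v, z)" by auto
    have "k v z \<in> S v" using v by (intro hk) (auto simp: is_regular_def)
    then show "\<exists>e\<in>emits G {v}. \<xi> \<in> R e" unfolding z R_def S_def by (auto simp: emits_def)
  qed (auto simp: R_def)
  then show ?thesis by blast
qed

text \<open>Nonvanishing of the vertex projections has to be known before (B1)-(B4), since residual
  finite-dimensionality is applied to exactly these elements in order to derive the
  conditions.\<close>

lemma PP_notin_LI: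
  fixes G :: "('v, 'e) ultragraph"
  assumes "is_ultragraph G" "v \<in> verts G"
  shows "(PP {v} :: ('v, 'e, 'k::field) free_elem) \<notin> LI G"
proof
  assume *: "(PP {v} :: ('v, 'e, 'k::field) free_elem) \<in> LI G"
  obtain R th sg where "gset G (\<lambda>A. A \<times> (UNIV :: ('v + 'e + nat) list set)) R th sg"
    using ex_faithful_gset[OF assms(1)] by blast
  then interpret gset G "\<lambda>A. A \<times> (UNIV :: ('v + 'e + nat) list set)" R th sg .
  show False
    using fun_cong[OF act_LI[OF *, of "\<lambda>_. 1"], of "(v, [])"] by (simp add: act_gens)
qed

section \<open>The involution of the free algebra\<close>

lemma free_star_superset:
  assumes "finite S" "Poly_Mapping.keys x \<subseteq> S"
  shows "free_star x = (\<Sum>w\<in>S. Poly_Mapping.single (word_star w) (cnj (Poly_Mapping.lookup x w)))"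
  unfolding free_star_def
  by (rule sum.mono_neutral_left) (use assms in \<open>auto simp: in_keys_iff\<close>)

lemma free_star_add: "free_star (x + y) = free_star x + free_star y"
proof -
  let ?S = "Poly_Mapping.keys x \<union> Poly_Mapping.keys y"
  show ?thesis
    using keys_add[of x y]
    by (simp add: free_star_superset[of ?S] lookup_add single_add sum.distrib)
qed

lemma free_star_0 [simp]: "free_star 0 = 0"
  by (simp add: free_star_def)

lemma free_star_single: "free_star (Poly_Mapping.single w c) = Poly_Mapping.single (word_star w) (cnj c)"
  by (simp add: free_star_superset[of "{w}"])

lemma word_star_word_star: "word_star (word_star w) = w"
proof -
  have "generator_star (generator_star g) = g" for g :: "('a, 'b) generator" by (cases g) auto
  then show ?thesis by (cases w) (simp add: word_star_def rev_map comp_def)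
qed

lemma word_star_plus: "word_star (u + w) = word_star w + word_star u"
  by (simp add: word_star_def plus_gen_word_def)

lemma free_star_star: "free_star (free_star x) = x"
  by (induction x rule: poly_mapping_span_induct)
    (simp_all add: free_star_single free_star_add word_star_word_star)

lemma free_star_mult: "free_star (x * y) = free_star y * free_star x"
proof (induction x rule: poly_mapping_span_induct)
  case (single w c)
  show ?case
    by (induction y rule: poly_mapping_span_induct)
      (simp_all add: mult_single free_star_single free_star_add distrib_left distrib_right word_star_plus
        mult.commute[of "cnj c"])
qed (simp_all add: free_star_add distrib_left distrib_right)

lemma free_star_cst: "free_star (cst c * x) = cst (cnj c) * free_star x"
proof -
  have "free_star (cst c :: ('a, 'b, complex) free_elem) = cst (cnj c)"
    by (simp add: free_star_single word_star_def zero_gen_word_def)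
  then show ?thesis by (simp add: free_star_mult cst_commute)
qed

lemma free_star_wd: "free_star (wd u) = wd (rev (map generator_star u))"
  by (simp add: wd_def free_star_single word_star_def)

lemma free_star_gens:
  "free_star (PP A) = PP A" "free_star (sp \<alpha>) = gp \<alpha>" "free_star (gp \<alpha>) = sp \<alpha>"
  by (simp_all add: free_star_wd sp_def gp_def rev_map comp_def)

lemma generator_star_generators:
  "u \<subseteq> generators G \<Longrightarrow> generator_star ` u \<subseteq> generators G"
  unfolding generators_def by (auto 4 3)

lemma free_star_fcar [simp]: "x \<in> fcar G \<Longrightarrow> free_star x \<in> fcar G"
proof (induction rule: fcar_induct)
  case (word u c)
  have "(wd (rev (map generator_star u)) :: ('a, 'b, complex) free_elem) \<in> fcar G"
    using word generator_star_generators[of "set u" G] by (intro fcar_wd) auto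
  then show ?case by (simp add: free_star_cst free_star_wd)
qed (simp_all add: free_star_add)

lemma free_star_uminus: "free_star (- x) = - free_star x"
  using free_star_cst[of "-1" x] by (simp add: cst_simps)

section \<open>The operator seminorm of an action\<close>

text \<open>Finitely supported functions stand in for l^2. They are invariant under all generators,
  so norms and adjoints of an action can be computed without a completion.\<close>

definition fs :: "('x \<Rightarrow> complex) \<Rightarrow> bool" where
  "fs f \<longleftrightarrow> finite {\<xi>. f \<xi> \<noteq> 0}"

text \<open>The l^2-norm when the support is finite. Over an infinite support the sum is 0 by
  default, so the triangle inequality and the bounds by norms assume \<open>fs f\<close>.\<close>

definition n2 :: "('x \<Rightarrow> complex) \<Rightarrow> real" where
  "n2 f = L2_set (\<lambda>\<xi>. cmod (f \<xi>)) {\<xi>. f \<xi> \<noteq> 0}"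

lemma n2_superset:
  assumes "finite S" "{\<xi>. f \<xi> \<noteq> 0} \<subseteq> S"
  shows "n2 f = L2_set (\<lambda>\<xi>. cmod (f \<xi>)) S"
  unfolding n2_def L2_set_def
  by (subst sum.mono_neutral_left[OF assms]) auto

lemma fs_add: "fs f \<Longrightarrow> fs g \<Longrightarrow> fs (\<lambda>\<xi>. f \<xi> + g \<xi>)"
  unfolding fs_def by (erule (1) finite_subset[rotated, OF finite_UnI]) auto

lemma fs_scale: "fs f \<Longrightarrow> fs (\<lambda>\<xi>. c * f \<xi>)"
  unfolding fs_def by (erule finite_subset[rotated]) auto

lemma fs_sum: "(\<And>i. i \<in> S \<Longrightarrow> fs (f i)) \<Longrightarrow> fs (\<lambda>\<xi>. \<Sum>i\<in>S. f i \<xi>)"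
  by (induction S rule: infinite_finite_induct) (auto simp: fs_add, auto simp: fs_def)

lemma n2_add:
  assumes "fs f" "fs g"
  shows "n2 (\<lambda>\<xi>. f \<xi> + g \<xi>) \<le> n2 f + n2 g"
proof -
  let ?S = "{\<xi>. f \<xi> \<noteq> 0} \<union> {\<xi>. g \<xi> \<noteq> 0}"
  have fin: "finite ?S" using assms by (simp add: fs_def)
  have "n2 (\<lambda>\<xi>. f \<xi> + g \<xi>) = L2_set (\<lambda>\<xi>. cmod (f \<xi> + g \<xi>)) ?S"
    by (rule n2_superset[OF fin]) auto
  also have "\<dots> \<le> L2_set (\<lambda>\<xi>. cmod (f \<xi>) + cmod (g \<xi>)) ?S"
    by (rule L2_set_mono) (auto simp: norm_triangle_ineq)
  also have "\<dots> \<le> L2_set (\<lambda>\<xi>. cmod (f \<xi>)) ?S + L2_set (\<lambda>\<xi>. cmod (g \<xi>)) ?S"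
    by (rule L2_set_triangle_ineq)
  also have "\<dots> = n2 f + n2 g"
    using n2_superset[OF fin, of f] n2_superset[OF fin, of g] by simp
  finally show ?thesis .
qed

lemma n2_scale: "n2 (\<lambda>\<xi>. c * f \<xi>) = cmod c * n2 f"
proof (cases "c = 0")
  case False
  then have "{\<xi>. c * f \<xi> \<noteq> 0} = {\<xi>. f \<xi> \<noteq> 0}" by auto
  then show ?thesis by (simp add: n2_def norm_mult L2_set_right_distrib)
qed (simp add: n2_def)

lemma n2_nonneg [simp]: "0 \<le> n2 f"
  by (simp add: n2_def)

lemma n2_ge: "fs f \<Longrightarrow> cmod (f \<xi>) \<le> n2 f"
proof (cases "f \<xi> = 0")
  case False
  assume "fs f"
  then show ?thesis unfolding n2_def fs_def
    using member_le_L2_set[of "{\<xi>. f \<xi> \<noteq> 0}" \<xi> "\<lambda>\<xi>. cmod (f \<xi>)"] False by simp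
qed simp

lemma n2_sum:
  assumes "\<And>i. i \<in> S \<Longrightarrow> fs (f i)"
  shows "n2 (\<lambda>\<xi>. \<Sum>i\<in>S. f i \<xi>) \<le> (\<Sum>i\<in>S. n2 (f i))"
  using assms
proof (induction S rule: infinite_finite_induct)
  case (insert i S)
  then have "n2 (\<lambda>\<xi>. f i \<xi> + (\<Sum>i\<in>S. f i \<xi>)) \<le> n2 (f i) + n2 (\<lambda>\<xi>. \<Sum>i\<in>S. f i \<xi>)"
    by (intro n2_add fs_sum) auto
  then show ?case using insert by fastforce
qed (simp_all add: n2_def)

text \<open>The map h sends the support of the new function injectively into that of f, so after
  reindexing the sum of squares has not grown.\<close>

lemma partial_bij_n2:
  assumes "fs f" "inj_on h S"
  shows "fs (\<lambda>\<xi>. if \<xi> \<in> S then f (h \<xi>) else 0)" "n2 (\<lambda>\<xi>. if \<xi> \<in> S then f (h \<xi>) else 0) \<le> n2 f"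
proof -
  let ?g = "\<lambda>\<xi>. if \<xi> \<in> S then f (h \<xi>) else 0"
  let ?U = "{\<xi>. ?g \<xi> \<noteq> 0}"
  have U: "?U \<subseteq> S" "h ` ?U \<subseteq> {\<xi>. f \<xi> \<noteq> 0}" by auto
  have inj: "inj_on h ?U" using U assms inj_on_subset by blast
  have "finite (h ` ?U)" using U(2) assms(1) unfolding fs_def by (rule finite_subset)
  then have "finite ?U" using inj finite_imageD by blast
  then show "fs ?g" by (simp add: fs_def)
  have "(\<Sum>\<xi>\<in>?U. (cmod (?g \<xi>))\<^sup>2) = (\<Sum>\<xi>\<in>h ` ?U. (cmod (f \<xi>))\<^sup>2)"
    by (subst sum.reindex[OF inj]) (auto intro!: sum.cong)
  also have "\<dots> \<le> (\<Sum>\<xi>\<in>{\<xi>. f \<xi> \<noteq> 0}. (cmod (f \<xi>))\<^sup>2)"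
    by (rule sum_mono2) (use assms U in \<open>auto simp: fs_def\<close>)
  finally show "n2 ?g \<le> n2 f" unfolding n2_def L2_set_def by (rule real_sqrt_le_mono)
qed

definition ip :: "('x \<Rightarrow> complex) \<Rightarrow> ('x \<Rightarrow> complex) \<Rightarrow> complex" where
  "ip f g = (\<Sum>\<xi>\<in>{\<xi>. f \<xi> \<noteq> 0}. f \<xi> * cnj (g \<xi>))"

lemma ip_superset:
  assumes "finite S" "{\<xi>. f \<xi> \<noteq> 0} \<subseteq> S"
  shows "ip f g = (\<Sum>\<xi>\<in>S. f \<xi> * cnj (g \<xi>))"
  unfolding ip_def by (subst sum.mono_neutral_left[OF assms]) auto

lemma ip_add_left: "fs f \<Longrightarrow> fs f' \<Longrightarrow> ip (\<lambda>\<xi>. f \<xi> + f' \<xi>) g = ip f g + ip f' g"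
proof -
  assume *: "fs f" "fs f'"
  let ?S = "{\<xi>. f \<xi> \<noteq> 0} \<union> {\<xi>. f' \<xi> \<noteq> 0}"
  have fin: "finite ?S" using * by (simp add: fs_def)
  have "{\<xi>. f \<xi> + f' \<xi> \<noteq> 0} \<subseteq> ?S" by auto
  then show ?thesis
    by (simp add: ip_superset[OF fin] algebra_simps sum.distrib)
qed

lemma ip_scale_left: "ip (\<lambda>\<xi>. c * f \<xi>) g = c * ip f g"
  by (cases "c = 0") (simp_all add: ip_def sum_distrib_left mult.assoc)

lemma ip_add_right: "ip f (\<lambda>\<xi>. g \<xi> + g' \<xi>) = ip f g + ip f g'"
  by (simp add: ip_def algebra_simps sum.distrib)

lemma ip_scale_right: "ip f (\<lambda>\<xi>. c * g \<xi>) = cnj c * ip f g"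
  by (simp add: ip_def sum_distrib_left algebra_simps)

lemma ip_self: "ip f f = of_real ((n2 f)\<^sup>2)"
  by (simp add: ip_def n2_def L2_set_def sum_nonneg complex_norm_square[symmetric] del: of_real_power)

lemma ip_le: "fs f \<Longrightarrow> fs g \<Longrightarrow> cmod (ip f g) \<le> n2 f * n2 g"
proof -
  assume *: "fs f" "fs g"
  let ?S = "{\<xi>. f \<xi> \<noteq> 0} \<union> {\<xi>. g \<xi> \<noteq> 0}"
  have fin: "finite ?S" using * by (simp add: fs_def)
  have "cmod (ip f g) \<le> (\<Sum>\<xi>\<in>?S. cmod (f \<xi> * cnj (g \<xi>)))"
    by (simp add: ip_superset[OF fin] norm_sum)
  also have "\<dots> = (\<Sum>\<xi>\<in>?S. \<bar>cmod (f \<xi>)\<bar> * \<bar>cmod (g \<xi>)\<bar>)" by (simp add: norm_mult)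
  also have "\<dots> \<le> L2_set (\<lambda>\<xi>. cmod (f \<xi>)) ?S * L2_set (\<lambda>\<xi>. cmod (g \<xi>)) ?S"
    by (rule L2_set_mult_ineq)
  also have "\<dots> = n2 f * n2 g"
    using n2_superset[OF fin, of f] n2_superset[OF fin, of g] by simp
  finally show ?thesis .
qed

text \<open>The adjoint of a partial bijection on l^2 is its inverse: both sides are the same sum,
  reindexed by h.\<close>

lemma ip_partial_bij:
  assumes "fs f" "bij_betw h S S'" "\<And>\<xi>. \<xi> \<in> S \<Longrightarrow> h' (h \<xi>) = \<xi>"
  shows "ip (\<lambda>\<xi>. if \<xi> \<in> S then f (h \<xi>) else 0) g = ip f (\<lambda>\<xi>. if \<xi> \<in> S' then g (h' \<xi>) else 0)"
proof -
  let ?U = "{\<xi>\<in>S. f (h \<xi>) \<noteq> 0}"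
  have inj: "inj_on h ?U" using assms(2) by (auto simp: bij_betw_def inj_on_def)
  have im: "h ` ?U = {\<xi>\<in>S'. f \<xi> \<noteq> 0}" using assms(2) by (auto simp: bij_betw_def)
  have "ip (\<lambda>\<xi>. if \<xi> \<in> S then f (h \<xi>) else 0) g = (\<Sum>\<xi>\<in>?U. f (h \<xi>) * cnj (g (h' (h \<xi>))))"
    unfolding ip_def using assms(3) by (intro sum.cong) auto
  also have "\<dots> = (\<Sum>\<xi>\<in>h ` ?U. f \<xi> * cnj (g (h' \<xi>)))"
    by (subst sum.reindex[OF inj]) simp
  also have "\<dots> = ip f (\<lambda>\<xi>. if \<xi> \<in> S' then g (h' \<xi>) else 0)"
    unfolding im ip_def
    by (rule sum.mono_neutral_cong_left) (use assms(1) in \<open>auto simp: fs_def\<close>)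
  finally show ?thesis .
qed

definition word_norm :: "('v, 'e, complex) free_elem \<Rightarrow> real" where
  "word_norm x = (\<Sum>w\<in>Poly_Mapping.keys x. cmod (Poly_Mapping.lookup x w))"

context gset
begin

text \<open>One shape for all three kinds of generators and their adjoints, so that contractivity
  and adjointness are each proved only once.\<close>

lemma gop_partial_bij:
  assumes "g \<in> generators G"
  obtains S S' h h' where "gop g = (\<lambda>(f :: 'x \<Rightarrow> complex) \<xi>. if \<xi> \<in> S then f (h \<xi>) else 0)"
    "gop (generator_star g) = (\<lambda>(f :: 'x \<Rightarrow> complex) \<xi>. if \<xi> \<in> S' then f (h' \<xi>) else 0)"
    "bij_betw h S S'" "\<And>\<xi>. \<xi> \<in> S \<Longrightarrow> h' (h \<xi>) = \<xi>"
proof (cases g)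
  case (Proj A)
  show ?thesis by (rule that[of "D A" id "D A" id]) (auto simp: Proj fun_eq_iff)
next
  case (Edge e)
  then have e: "e \<in> edges G" using assms by (auto simp: generators_def)
  have "bij_betw (sg e) (R e) (D (rng G e))"
    by (rule bij_betwI[of _ _ _ "th e"]) (use e th_R sg_th sg_D th_sg in auto)
  then show ?thesis
    by (intro that[of "R e" "sg e" "D (rng G e)" "th e"]) (use e th_sg in \<open>auto simp: Edge fun_eq_iff\<close>)
next
  case (Ghost e)
  then have e: "e \<in> edges G" using assms by (auto simp: generators_def)
  have "bij_betw (th e) (D (rng G e)) (R e)"
    by (rule bij_betwI[of _ _ _ "sg e"]) (use e th_R sg_th sg_D th_sg in auto)
  then show ?thesis
    by (intro that[of "D (rng G e)" "th e" "R e" "sg e"]) (use e sg_th in \<open>auto simp: Ghost fun_eq_iff\<close>)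
qed

lemma gop_n2:
  assumes "g \<in> generators G" "fs f"
  shows "fs (gop g f)" "n2 (gop g f) \<le> n2 f"
proof -
  obtain S S' h h' where "gop g = (\<lambda>(f :: 'x \<Rightarrow> complex) \<xi>. if \<xi> \<in> S then f (h \<xi>) else 0)"
    "bij_betw h S S'" using gop_partial_bij[OF assms(1)] by metis
  then show "fs (gop g f)" "n2 (gop g f) \<le> n2 f"
    using partial_bij_n2[OF assms(2), of h S] by (auto simp: bij_betw_def)
qed

lemma opw_n2:
  assumes "set u \<subseteq> generators G" "fs f"
  shows "fs (opw u f) \<and> n2 (opw u f) \<le> n2 f"
  using assms(1)
proof (induction u)
  case (Cons g u)
  then have "fs (opw u f)" "n2 (opw u f) \<le> n2 f" "g \<in> generators G" by auto
  with gop_n2[of g "opw u f"] show ?case by auto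
qed (use assms in auto)

lemma ip_gop:
  assumes "g \<in> generators G" "fs f"
  shows "ip (gop g f) k = ip f (gop (generator_star g) k)"
proof (rule gop_partial_bij[OF assms(1)])
  fix S S' and h h' :: "'x \<Rightarrow> 'x"
  assume *: "gop g = (\<lambda>(f :: 'x \<Rightarrow> complex) \<xi>. if \<xi> \<in> S then f (h \<xi>) else 0)"
    "gop (generator_star g) = (\<lambda>(f :: 'x \<Rightarrow> complex) \<xi>. if \<xi> \<in> S' then f (h' \<xi>) else 0)"
    "bij_betw h S S'" "\<And>\<xi>. \<xi> \<in> S \<Longrightarrow> h' (h \<xi>) = \<xi>"
  show ?thesis unfolding *(1,2) by (rule ip_partial_bij[OF assms(2) *(3,4)])
qed

lemma ip_opw:
  assumes "set u \<subseteq> generators G" "fs f"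
  shows "ip (opw u f) k = ip f (opw (rev (map generator_star u)) k)"
  using assms(1)
proof (induction u arbitrary: k)
  case (Cons g u)
  then show ?case using opw_n2[of u f] assms(2) by (simp add: ip_gop)
qed simp

lemma fs_act: "x \<in> fcar G \<Longrightarrow> fs f \<Longrightarrow> fs (act x f)"
  unfolding act_def by (intro fs_sum fs_scale) (use opw_n2 in \<open>auto simp: fcar_def\<close>)

lemma n2_act_le:
  assumes "x \<in> fcar G" "fs f"
  shows "n2 (act x f) \<le> word_norm x * n2 f"
proof -
  have *: "fs (opw (letters w) f)" "n2 (opw (letters w) f) \<le> n2 f" if "w \<in> Poly_Mapping.keys x" for w
    using that opw_n2[OF _ assms(2), of "letters w"] assms(1) by (auto simp: fcar_def)
  have "n2 (act x f) \<le> (\<Sum>w\<in>Poly_Mapping.keys x. n2 (\<lambda>\<xi>. Poly_Mapping.lookup x w * opw (letters w) f \<xi>))"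
    unfolding act_def by (intro n2_sum fs_scale *)
  also have "\<dots> \<le> (\<Sum>w\<in>Poly_Mapping.keys x. cmod (Poly_Mapping.lookup x w) * n2 f)"
    unfolding n2_scale by (intro sum_mono mult_left_mono *) auto
  finally show ?thesis by (simp add: word_norm_def sum_distrib_right)
qed

lemma ip_act:
  assumes "x \<in> fcar G" "fs f"
  shows "ip (act x f) k = ip f (act (free_star x) k)"
  using assms(1)
proof -
  have "fs (act x f) \<and> ip (act x f) k = ip f (act (free_star x) k)"
    using assms(1)
  proof (induction rule: fcar_induct)
    case (word u c)
    then show ?case
      using opw_n2[of u f] ip_opw[of u f k] assms(2)
      by (simp add: act_scale_left act_wd fs_scale ip_scale_left free_star_cst free_star_wd ip_scale_right)
  next
    case zero
    then show ?case by (simp add: fs_def ip_def)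
  next
    case (add y z)
    then show ?case by (simp add: act_add_left free_star_add fs_add ip_add_left ip_add_right)
  qed
  then show ?thesis by blast
qed

text \<open>The supremum is finite on the carrier: each word acts as a contraction, and
  \<open>word_norm\<close> adds up the moduli of the coefficients.\<close>

definition opn :: "('v, 'e, complex) free_elem \<Rightarrow> real" where
  "opn x = (SUP f\<in>{f. fs f \<and> n2 f \<le> 1}. n2 (act x f))"

lemma zero_in_ball: "(\<lambda>\<xi>. 0) \<in> {f :: 'x \<Rightarrow> complex. fs f \<and> n2 f \<le> 1}"
  by (simp add: fs_def n2_def)

lemma opn_upper:
  assumes "x \<in> fcar G" "fs f" "n2 f \<le> 1"
  shows "n2 (act x f) \<le> opn x"
proof -
  have "bdd_above ((\<lambda>f. n2 (act x f)) ` {f. fs f \<and> n2 f \<le> 1})"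
  proof (rule bdd_aboveI2)
    fix f :: "'x \<Rightarrow> complex" assume f: "f \<in> {f. fs f \<and> n2 f \<le> 1}"
    have "n2 (act x f) \<le> word_norm x * n2 f" using f assms(1) by (intro n2_act_le) auto
    also have "\<dots> \<le> word_norm x * 1"
      using f by (intro mult_left_mono) (auto simp: word_norm_def intro: sum_nonneg)
    finally show "n2 (act x f) \<le> word_norm x * 1" .
  qed
  then show ?thesis unfolding opn_def by (rule cSUP_upper[rotated]) (use assms in auto)
qed

lemma opn_least:
  assumes "\<And>f. fs f \<Longrightarrow> n2 f \<le> 1 \<Longrightarrow> n2 (act x f) \<le> c"
  shows "opn x \<le> c"
  unfolding opn_def using zero_in_ball assms by (intro cSUP_least) auto

lemma opn_nonneg: "x \<in> fcar G \<Longrightarrow> 0 \<le> opn x"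
  using opn_upper[of x "\<lambda>_. 0"] zero_in_ball n2_nonneg order_trans by blast

lemma n2_eq_0: "fs f \<Longrightarrow> n2 f = 0 \<Longrightarrow> f = (\<lambda>\<xi>. 0)"
  using n2_ge[of f] by (auto simp: fun_eq_iff)

lemma n2_act_opn:
  assumes "x \<in> fcar G" "fs f"
  shows "n2 (act x f) \<le> opn x * n2 f"
proof (cases "n2 f = 0")
  case True
  then have "f = (\<lambda>\<xi>. 0)" using assms n2_eq_0 by blast
  then show ?thesis by (simp add: n2_def)
next
  case False
  then have pos: "n2 f > 0" using n2_nonneg[of f] by linarith
  let ?c = "complex_of_real (1 / n2 f)"
  have c: "cmod ?c = 1 / n2 f" using pos by (simp add: norm_divide)
  have "n2 (act x (\<lambda>\<xi>. ?c * f \<xi>)) \<le> opn x"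
    using assms pos c by (intro opn_upper fs_scale) (auto simp only: n2_scale, auto)
  then have "1 / n2 f * n2 (act x f) \<le> opn x"
    unfolding act_scale_right n2_scale c .
  then show ?thesis using pos by (simp add: field_simps)
qed

text \<open>For f in the unit ball the square of the norm of x f is the inner product of f with x^*x
  f, and the Cauchy-Schwarz inequality bounds it by the norm of x^*x.\<close>

lemma opn_star_mult_ge:
  assumes "x \<in> fcar G"
  shows "(opn x)\<^sup>2 \<le> opn (free_star x * x)"
proof -
  have sx: "free_star x * x \<in> fcar G" using assms by simp
  have "opn x \<le> sqrt (opn (free_star x * x))"
  proof (rule opn_least)
    fix f :: "'x \<Rightarrow> complex" assume f: "fs f" "n2 f \<le> 1"
    have "complex_of_real ((n2 (act x f))\<^sup>2) = ip f (act (free_star x * x) f)"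
      using ip_act[OF assms f(1), of "act x f"] by (simp add: ip_self act_mult)
    then have "(n2 (act x f))\<^sup>2 = cmod (ip f (act (free_star x * x) f))"
      by (metis norm_of_real abs_of_nonneg zero_le_power2)
    also have "\<dots> \<le> n2 f * n2 (act (free_star x * x) f)"
      by (intro ip_le f fs_act sx)
    also have "\<dots> \<le> 1 * opn (free_star x * x)"
      using f by (intro mult_mono opn_upper sx) auto
    finally show "n2 (act x f) \<le> sqrt (opn (free_star x * x))"
      by (simp add: real_le_rsqrt)
  qed
  then have "(opn x)\<^sup>2 \<le> (sqrt (opn (free_star x * x)))\<^sup>2"
    using opn_nonneg[OF assms] by (intro power_mono)
  then show ?thesis using opn_nonneg[OF sx] by simp
qed

lemma opn_mult:
  assumes "x \<in> fcar G" "y \<in> fcar G"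
  shows "opn (x * y) \<le> opn x * opn y"
proof (rule opn_least)
  fix f :: "'x \<Rightarrow> complex" assume f: "fs f" "n2 f \<le> 1"
  have "n2 (act (x * y) f) \<le> opn x * n2 (act y f)"
    unfolding act_mult by (intro n2_act_opn assms fs_act f)
  also have "\<dots> \<le> opn x * opn y" by (intro mult_left_mono opn_upper opn_nonneg assms f)
  finally show "n2 (act (x * y) f) \<le> opn x * opn y" .
qed

text \<open>In |x|^2 \<le> |x^*x| \<le> |x^*| |x| one factor cancels; the same argument applies to
  x^*.\<close>

lemma opn_star:
  assumes "x \<in> fcar G"
  shows "opn (free_star x) = opn x"
proof -
  have le: "opn y \<le> opn (free_star y)" if "y \<in> fcar G" for y
  proof (cases "opn y = 0")
    case False
    then have "opn y > 0" using opn_nonneg[OF that] by linarith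
    moreover have "opn y * opn y \<le> opn (free_star y) * opn y"
      using opn_star_mult_ge[OF that] opn_mult[of "free_star y" y] that
      by (simp add: power2_eq_square)
    ultimately show ?thesis by simp
  qed (use that opn_nonneg in simp)
  show ?thesis using le[OF assms] le[of "free_star x"] assms by (simp add: free_star_star)
qed

lemma opn_seminorm: "cstar_seminorm (free_star_algebra G) opn"
  unfolding cstar_seminorm_def free_star_algebra_simps
proof (intro conjI ballI allI)
  fix x y :: "('v, 'e, complex) free_elem" assume xy: "x \<in> fcar G" "y \<in> fcar G"
  show "opn (x + y) \<le> opn x + opn y"
  proof (rule opn_least)
    fix f :: "'x \<Rightarrow> complex" assume f: "fs f" "n2 f \<le> 1"
    have "n2 (act (x + y) f) \<le> n2 (act x f) + n2 (act y f)"
      unfolding act_add_left by (intro n2_add fs_act xy f)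
    then show "n2 (act (x + y) f) \<le> opn x + opn y"
      using opn_upper[OF xy(1) f] opn_upper[OF xy(2) f] by linarith
  qed
next
  fix c and x :: "('v, 'e, complex) free_elem" assume x: "x \<in> fcar G"
  have le: "opn (cst c * y) \<le> cmod c * opn y" if "y \<in> fcar G" for c y
    by (rule opn_least) (auto simp: act_scale_left n2_scale intro!: mult_left_mono opn_upper that)
  show "opn (cst c * x) = cmod c * opn x"
  proof (cases "c = 0")
    case True
    then show ?thesis using le[OF x, of c] opn_nonneg[of "cst c * x"] x by simp
  next
    case False
    then have "cst (inverse c) * (cst c * x) = x"
      by (simp add: cst_simps flip: mult.assoc)
    then have "opn x \<le> cmod (inverse c) * opn (cst c * x)"
      using le[of "cst c * x" "inverse c"] x by simp
    then have "cmod c * opn x \<le> cmod c * inverse (cmod c) * opn (cst c * x)"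
      unfolding norm_inverse mult.assoc by (rule mult_left_mono) simp
    also have "cmod c * inverse (cmod c) = 1" using False by simp
    finally show ?thesis using le[OF x, of c] by simp
  qed
next
  fix x :: "('v, 'e, complex) free_elem" assume x: "x \<in> fcar G"
  show "opn (free_star x * x) = (opn x)\<^sup>2"
    using opn_mult[of "free_star x" x] opn_star[OF x] opn_star_mult_ge[OF x] x
    by (simp add: power2_eq_square)
qed (auto intro: opn_nonneg opn_mult)

lemma opn_LI: "x \<in> LI G \<Longrightarrow> opn x = 0"
proof -
  assume "x \<in> LI G"
  moreover have "{f :: 'x \<Rightarrow> complex. fs f \<and> n2 f \<le> 1} \<noteq> {}" using zero_in_ball by blast
  moreover have "n2 (\<lambda>\<xi> :: 'x. 0) = 0" by (simp add: n2_def)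
  ultimately show ?thesis by (simp add: opn_def act_LI)
qed

text \<open>Matrix coefficients are dominated by the norm. This turns norm bounds into bounds on the
  coefficients of an expansion, and it makes matrix entries continuous in the universal
  norm.\<close>

lemma opn_coeff:
  assumes "x \<in> fcar G"
  shows "cmod (act x (\<lambda>\<xi>. if \<xi> = \<eta> then 1 else 0) \<zeta>) \<le> opn x"
proof -
  have "fs (\<lambda>\<xi>. if \<xi> = \<eta> then 1 else 0)" "n2 (\<lambda>\<xi>. if \<xi> = \<eta> then 1 else 0) \<le> 1"
    by (simp_all add: fs_def n2_def)
  then show ?thesis
    using n2_ge[OF fs_act[OF assms]] opn_upper[OF assms] order_trans by blast
qed

end

section \<open>Finite-dimensional representations force the graph conditions\<close>

interpretation pm: vector_space "\<lambda>c. Poly_Mapping.map ((*) c) :: (nat \<Rightarrow>\<^sub>0 'k::field) \<Rightarrow> _"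
  by unfold_locales
    (simp_all add: mult_map_scale_conv_mult algebra_simps single_add mult_single flip: mult.assoc)

lemma endomorphism_simps:
  assumes "is_endomorphism V T"
  shows "x \<in> V \<Longrightarrow> T x \<in> V" "x \<in> V \<Longrightarrow> y \<in> V \<Longrightarrow> T (x + y) = T x + T y"
    "x \<in> V \<Longrightarrow> T (Poly_Mapping.map ((*) c) x) = Poly_Mapping.map ((*) c) (T x)"
  using assms unfolding is_endomorphism_def by blast+

text \<open>Applying \<open>T m\<close> to a linear relation among the vectors leaves only the term
  with \<open>x m\<close>, so the vectors are linearly independent. Every obstruction below is
  brought into this form.\<close>

lemma no_infinite_biorthogonal_sequence:
  fixes V :: "(nat \<Rightarrow>\<^sub>0 'k::field) set"
  assumes "fin_dim_space V" "\<And>n :: nat. x n \<in> V" "\<And>n. is_endomorphism V (T n)"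
    and "\<And>n. T n (x n) \<noteq> 0" "\<And>m n. m \<noteq> n \<Longrightarrow> T m (x n) = 0"
  shows False
proof -
  obtain B where B: "finite B" "V = pm.span B" using assms(1) by (auto simp: fin_dim_space_def)
  have sub: "pm.subspace V" unfolding B by (rule pm.subspace_span)
  have inj: "inj x" by (rule injI) (metis assms(4,5))
  have "pm.independent (range x)"
    unfolding pm.independent_explicit_finite_subsets
  proof (intro allI impI ballI)
    fix S u y assume S: "S \<subseteq> range x" "finite S" "(\<Sum>v\<in>S. Poly_Mapping.map ((*) (u v)) v) = 0" "y \<in> S"
    then obtain m where m: "y = x m" by blast
    have "T m (\<Sum>v\<in>S'. Poly_Mapping.map ((*) (u v)) v) = (\<Sum>v\<in>S'. Poly_Mapping.map ((*) (u v)) (T m v)) \<and>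
        (\<Sum>v\<in>S'. Poly_Mapping.map ((*) (u v)) v) \<in> V" if "finite S'" "S' \<subseteq> S" for S'
      using that
    proof (induction S' rule: finite_induct)
      case empty
      have "0 \<in> V" using sub by (rule pm.subspace_0)
      then have "T m (0 + 0) = T m 0 + T m 0" using endomorphism_simps(2)[OF assms(3)[of m]] by blast
      then have "T m 0 = 0" by (metis add.right_neutral add_left_cancel)
      then show ?case using \<open>0 \<in> V\<close> by simp
    next
      case (insert v S')
      have "v \<in> V" using insert.prems S(1) assms(2) by blast
      then have "Poly_Mapping.map ((*) (u v)) v \<in> V" using sub pm.subspace_scale by blast
      then show ?case
        using insert \<open>v \<in> V\<close> endomorphism_simps(2,3)[OF assms(3)[of m]] pm.subspace_add[OF sub] by simp
    qed
    from this[OF S(2) subset_refl] have "T m 0 = (\<Sum>v\<in>S. Poly_Mapping.map ((*) (u v)) (T m v))"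
      using S(3) by simp
    also have "\<dots> = (\<Sum>v\<in>{y}. Poly_Mapping.map ((*) (u v)) (T m v))"
    proof (rule sum.mono_neutral_right)
      show "\<forall>v\<in>S - {y}. Poly_Mapping.map ((*) (u v)) (T m v) = 0"
      proof
        fix v assume "v \<in> S - {y}"
        then obtain n where "v = x n" "n \<noteq> m" using S(1) m by auto
        then show "Poly_Mapping.map ((*) (u v)) (T m v) = 0" using assms(5)[of m n] by simp
      qed
    qed (use S in auto)
    finally have "T m 0 = Poly_Mapping.map ((*) (u y)) (T m y)" by simp
    moreover have "T m 0 = 0"
    proof -
      have "0 \<in> V" using sub by (rule pm.subspace_0)
      then have "T m (0 + 0) = T m 0 + T m 0" using endomorphism_simps(2)[OF assms(3)[of m]] by blast
      then show ?thesis by (metis add.right_neutral add_left_cancel)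
    qed
    ultimately show "u y = 0" using assms(4)[of m] m pm.scale_eq_0_iff by metis
  qed
  moreover have "range x \<subseteq> pm.span B" using assms(2) B by blast
  ultimately have "finite (range x)" using pm.independent_span_bound[OF B(1)] by blast
  then show False using inj finite_imageD infinite_UNIV_nat by blast
qed

text \<open>Representations stay on the free algebra and only have to kill the ideal. Those of the
  Leavitt path algebra and those of the C*-algebra both restrict to this form, so the graph
  conditions are derived once for both.\<close>

definition leavitt_rep :: "('v, 'e) ultragraph \<Rightarrow> (nat \<Rightarrow>\<^sub>0 'k::field) set \<Rightarrow>
    (('v, 'e, 'k) free_elem \<Rightarrow> (nat \<Rightarrow>\<^sub>0 'k) \<Rightarrow> (nat \<Rightarrow>\<^sub>0 'k)) \<Rightarrow> bool" where
  "leavitt_rep G V \<phi> \<longleftrightarrow> fin_dim_space V \<and> algebra_rep (free_algebra G) V \<phi> \<and>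
    (\<forall>x\<in>LI G. \<forall>v\<in>V. \<phi> x v = 0)"

context
  fixes G :: "('v, 'e) ultragraph" and V :: "(nat \<Rightarrow>\<^sub>0 'k::field) set" and \<phi>
  assumes ug: "is_ultragraph G" and rep: "leavitt_rep G V \<phi>"
begin

lemma rep_fin_dim: "fin_dim_space V"
  using rep by (simp add: leavitt_rep_def)

lemma rep_endo: "x \<in> fcar G \<Longrightarrow> is_endomorphism V (\<phi> x)"
  using rep by (simp add: leavitt_rep_def algebra_rep_def)

lemma rep_in: "x \<in> fcar G \<Longrightarrow> v \<in> V \<Longrightarrow> \<phi> x v \<in> V"
  using rep_endo by (simp add: is_endomorphism_def)

lemma rep_add: "x \<in> fcar G \<Longrightarrow> y \<in> fcar G \<Longrightarrow> v \<in> V \<Longrightarrow> \<phi> (x + y) v = \<phi> x v + \<phi> y v"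
  using rep by (simp add: leavitt_rep_def algebra_rep_def)

lemma rep_mult: "x \<in> fcar G \<Longrightarrow> y \<in> fcar G \<Longrightarrow> v \<in> V \<Longrightarrow> \<phi> (x * y) v = \<phi> x (\<phi> y v)"
  using rep by (simp add: leavitt_rep_def algebra_rep_def)

lemma rep_0: "v \<in> V \<Longrightarrow> \<phi> 0 v = 0"
  using rep by (simp add: leavitt_rep_def)

lemma rep_zero: "x \<in> fcar G \<Longrightarrow> \<phi> x 0 = 0"
proof -
  assume x: "x \<in> fcar G"
  obtain B where "V = pm.span B" using rep_fin_dim by (auto simp: fin_dim_space_def)
  then have "0 \<in> V" by (simp add: pm.span_zero)
  then have "\<phi> x (0 + 0) = \<phi> x 0 + \<phi> x 0" using endomorphism_simps(2)[OF rep_endo[OF x]] by blast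
  then show ?thesis by (metis add.right_neutral add_left_cancel)
qed

lemma rep_lcong: "lcong G x y \<Longrightarrow> y \<in> fcar G \<Longrightarrow> v \<in> V \<Longrightarrow> \<phi> x v = \<phi> y v"
proof -
  assume *: "lcong G x y" "y \<in> fcar G" "v \<in> V"
  then have "x - y \<in> LI G" by (simp add: lcong_def)
  then have "\<phi> ((x - y) + y) v = 0 + \<phi> y v"
    using * rep rep_add[of "x - y" y v] LI_fcar[OF ug, of "x - y"] by (simp add: leavitt_rep_def)
  then show ?thesis by simp
qed

lemma rep_sum:
  assumes "finite S" "\<And>i. i \<in> S \<Longrightarrow> f i \<in> fcar G" "v \<in> V"
  shows "\<phi> (sum f S) v = (\<Sum>i\<in>S. \<phi> (f i) v)"
  using assms(1,2) by (induction S rule: finite_induct) (simp_all add: rep_0 rep_add assms(3))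

text \<open>The vectors s_{\<gamma>(n)} p_w v and the operators p_w s_{\<gamma>(m)}^* are
  biorthogonal, as p_w s_{\<gamma>(m)}^* s_{\<gamma>(m)} p_w = p_w p_{r(\<gamma>(m))} p_w = p_w.
  Orthogonality is asked only between two factors p_w; this weaker form is what a sink in the range
  of a cycle can provide.\<close>

lemma infinitely_many_orthogonal_paths:
  assumes w: "w \<in> verts G" and v: "v \<in> V" "\<phi> (PP {w}) v \<noteq> 0"
    and \<gamma>: "\<And>n :: nat. ug_path G (\<gamma> n)" "\<And>n. w \<in> rng G (last (\<gamma> n))"
    and orth: "\<And>m n. m \<noteq> n \<Longrightarrow> lcong G (PP {w} * (gp (\<gamma> m) * sp (\<gamma> n)) * PP {w} :: ('v, 'e, 'k) free_elem) 0"
  shows False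
proof (rule no_infinite_biorthogonal_sequence[OF rep_fin_dim])
  have s: "set (\<gamma> n) \<subseteq> edges G" for n using \<gamma>(1) ug_path_edges by blast
  have c: "(PP {w} * gp (\<gamma> n) :: ('v, 'e, 'k) free_elem) \<in> fcar G" "(sp (\<gamma> n) * PP {w} :: ('v, 'e, 'k) free_elem) \<in> fcar G"
    "(PP {w} :: ('v, 'e, 'k) free_elem) \<in> fcar G" "(PP {w} :: ('v, 'e, 'k) free_elem) \<in> fcar1 G" for n
    using s[of n] w by auto
  fix m n
  show "\<phi> (sp (\<gamma> n) * PP {w}) v \<in> V" "is_endomorphism V (\<phi> (PP {w} * gp (\<gamma> n)))"
    using c v rep_in rep_endo by blast+
  have eq: "\<phi> (PP {w} * gp (\<gamma> m)) (\<phi> (sp (\<gamma> n) * PP {w}) v) =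
      \<phi> (PP {w} * (gp (\<gamma> m) * sp (\<gamma> n)) * PP {w}) v"
    using rep_mult[OF c(1) c(2) v(1)] by (simp add: mult.assoc)
  {
    assume "m \<noteq> n"
    then have "lcong G (PP {w} * (gp (\<gamma> m) * sp (\<gamma> n)) * PP {w}) (0 :: ('v, 'e, 'k) free_elem)"
      by (rule orth)
    then show "\<phi> (PP {w} * gp (\<gamma> m)) (\<phi> (sp (\<gamma> n) * PP {w}) v) = 0"
      unfolding eq using rep_lcong[of _ 0] v rep_0 by auto
  }
  have "lcong G (PP {w} * (gp (\<gamma> m) * sp (\<gamma> m)) * PP {w} :: ('v, 'e, 'k) free_elem)
      (PP {w} * PP (rng G (last (\<gamma> m))) * PP {w})"
    by (intro lcong_multr lcong_multl lcong_gp_sp[OF ug \<gamma>(1)] c(4))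
  also have "lcong G (PP {w} * PP (rng G (last (\<gamma> m))) * PP {w} :: ('v, 'e, 'k) free_elem)
      ((if w \<in> rng G (last (\<gamma> m)) then PP {w} else 0) * PP {w})"
    using rng_gen_verts_last[OF ug _ s[of m]] \<gamma>(1)[of m]
    by (intro lcong_multr lcong_PP_PP_if(2) c(4) w) (auto simp: ug_path_def)
  also have "(if w \<in> rng G (last (\<gamma> m)) then PP {w} else 0 :: ('v, 'e, 'k) free_elem) * PP {w} = PP {w} * PP {w}"
    using \<gamma>(2) by simp
  also have "lcong G \<dots> (PP {w})"
    using lcong_PP_PP[of "{w}" G "{w}"] w by simp
  finally have "\<phi> (PP {w} * (gp (\<gamma> m) * sp (\<gamma> m)) * PP {w}) v = \<phi> (PP {w}) v"
    using c(3) v(1) by (rule rep_lcong)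
  then show "\<phi> (PP {w} * gp (\<gamma> m)) (\<phi> (sp (\<gamma> m) * PP {w}) v) \<noteq> 0"
    using v(2) rep_mult[OF c(1) c(2) v(1)] by (simp add: mult.assoc)
qed

end

text \<open>The rotation puts the i-th edge last, so that an exit at this edge becomes a
  continuation of the whole closed path.\<close>

lemma rotate_closed_path:
  assumes c: "ug_path G c" "src G (hd c) \<in> rng G (last c)" and i: "i < length c"
  defines "d \<equiv> drop (Suc i) c @ take (Suc i) c"
  shows "ug_path G d" "src G (hd d) \<in> rng G (last d)" "hd d = c ! (Suc i mod length c)" "last d = c ! i"
    "set d = set c"
proof -
  have tk: "take (Suc i) c \<noteq> []" "last (take (Suc i) c) = c ! i"
    using i by (auto simp: take_Suc_conv_app_nth)
  have "ug_path G d \<and> src G (hd d) \<in> rng G (last d) \<and> hd d = c ! (Suc i mod length c) \<and> last d = c ! i"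
  proof (cases "Suc i = length c")
    case True
    then show ?thesis using c tk i unfolding d_def by (auto simp: hd_conv_nth last_conv_nth)
  next
    case False
    then have dr: "drop (Suc i) c \<noteq> []" "Suc i < length c" using i by auto
    have "ug_path G (take (Suc i) c @ drop (Suc i) c)" using c by simp
    then have "ug_path G (take (Suc i) c)" "ug_path G (drop (Suc i) c)"
      "src G (hd (drop (Suc i) c)) \<in> rng G (c ! i)"
      using ug_path_append[OF tk(1) dr(1), of G] tk(2) by auto
    moreover have "hd (drop (Suc i) c) = c ! Suc i" using dr by (simp add: hd_drop_conv_nth)
    moreover have "hd (take (Suc i) c) = hd c" "last (drop (Suc i) c) = last c" using dr by (auto simp: hd_take)
    ultimately show ?thesis
      unfolding d_def using c tk dr ug_path_append[OF dr(1) tk(1), of G] by (simp add: last_append)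
  qed
  then show "ug_path G d" "src G (hd d) \<in> rng G (last d)" "hd d = c ! (Suc i mod length c)" "last d = c ! i"
    by blast+
  show "set d = set c" unfolding d_def by (metis Un_commute append_take_drop_id set_append)
qed

lemma closed_path_power:
  assumes "ug_path G d" "src G (hd d) \<in> rng G (last d)"
  shows "ug_path G (concat (replicate (Suc n) d)) \<and> hd (concat (replicate (Suc n) d)) = hd d \<and>
    last (concat (replicate (Suc n) d)) = last d"
proof (induction n)
  case (Suc n)
  have "d \<noteq> []" using assms(1) by auto
  moreover have "concat (replicate (Suc n) d) \<noteq> []" using Suc by auto
  ultimately show ?case
    using Suc assms ug_path_append[of d "concat (replicate (Suc n) d)" G] by simp
qed (use assms in simp)

lemma replicate_less_split:
  assumes "m < (n :: nat)"
  shows "concat (replicate (Suc n) d) = concat (replicate (Suc m) d) @ concat (replicate (Suc (n - Suc m)) d)"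
proof -
  have "Suc n = Suc m + Suc (n - Suc m)" using assms by simp
  then show ?thesis by (metis replicate_add concat_append)
qed

section \<open>The graph conditions from separation of the vertex projections\<close>

context
  fixes G :: "('v, 'e) ultragraph" and K :: "'k::field itself"
  assumes ug: "is_ultragraph G"
    and sep: "\<And>w. w \<in> verts G \<Longrightarrow> \<exists>V (\<phi> :: ('v, 'e, 'k) free_elem \<Rightarrow> _). leavitt_rep G V \<phi> \<and> (\<exists>v\<in>V. \<phi> (PP {w}) v \<noteq> 0)"
begin

lemma no_orthogonal_paths:
  assumes w: "w \<in> verts G" and \<gamma>: "\<And>n :: nat. ug_path G (\<gamma> n)" "\<And>n. w \<in> rng G (last (\<gamma> n))"
    and orth: "\<And>m n. m \<noteq> n \<Longrightarrow> lcong G (PP {w} * (gp (\<gamma> m) * sp (\<gamma> n)) * PP {w} :: ('v, 'e, 'k) free_elem) 0"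
  shows False
  using sep[OF w] infinitely_many_orthogonal_paths[OF ug _ w _ _ \<gamma> orth] by blast

lemma no_diverging_paths:
  assumes w: "w \<in> verts G" and \<gamma>: "\<And>n :: nat. ug_path G (\<gamma> n)" "\<And>n. w \<in> rng G (last (\<gamma> n))"
    and div: "\<And>m n. m < n \<Longrightarrow> \<exists>\<rho> e \<alpha> f \<beta>. \<gamma> m = \<rho> @ e # \<alpha> \<and> \<gamma> n = \<rho> @ f # \<beta> \<and> e \<noteq> f"
  shows False
proof (rule no_orthogonal_paths[OF w \<gamma>])
  fix m n :: nat assume "m \<noteq> n"
  then obtain \<rho> e \<alpha> f \<beta> where d: "\<gamma> m = \<rho> @ e # \<alpha>" "\<gamma> n = \<rho> @ f # \<beta>" "e \<noteq> f"
    using div[of m n] div[of n m] by (metis nat_neq_iff)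
  have "lcong G (gp (\<gamma> m) * sp (\<gamma> n) :: ('v, 'e, 'k) free_elem) 0"
    unfolding d using \<gamma>(1)[of m] \<gamma>(1)[of n] d by (intro lcong_gp_sp_diverging[OF ug]) auto
  then have "lcong G (PP {w} * (gp (\<gamma> m) * sp (\<gamma> n)) * PP {w}) (PP {w} * 0 * PP {w} :: ('v, 'e, 'k) free_elem)"
    using w by (intro lcong_multr lcong_multl) auto
  then show "lcong G (PP {w} * (gp (\<gamma> m) * sp (\<gamma> n)) * PP {w} :: ('v, 'e, 'k) free_elem) 0" by simp
qed

text \<open>The edges into v are paths of length one that differ in their first edge and all have v
  in their range.\<close>

lemma no_inf_receivers_of_reps: "no_inf_receivers G"
  unfolding no_inf_receivers_def
proof (rule ballI, rule ccontr)
  fix v assume v: "v \<in> verts G" and inf: "infinite {e \<in> edges G. v \<in> rng G e}"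
  obtain e :: "nat \<Rightarrow> 'e" where e: "inj e" "range e \<subseteq> {e \<in> edges G. v \<in> rng G e}"
    using infinite_countable_subset[OF inf] by blast
  have e': "e n \<in> edges G" "v \<in> rng G (e n)" for n using e(2) by blast+
  show False
    by (rule no_diverging_paths[OF v, of "\<lambda>n. [e n]"])
      (use e e' in \<open>auto simp: inj_def intro!: exI[of _ "[]"]\<close>)
qed

lemma no_inf_backward_chains_of_reps: "no_inf_backward_chains G"
  unfolding no_inf_backward_chains_def
proof
  assume "\<exists>e :: nat \<Rightarrow> 'e. inj e \<and> (\<forall>i. e i \<in> edges G) \<and> (\<forall>i. src G (e i) \<in> rng G (e (Suc i)))"
  then obtain e :: "nat \<Rightarrow> 'e" where e: "inj e" "\<And>i. e i \<in> edges G" "\<And>i. src G (e i) \<in> rng G (e (Suc i))"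
    by blast
  \<comment> \<open>The edge \<open>e 0\<close> is left out and only supplies its source, which lies
    in the range of \<open>e 1\<close>, the last edge of every \<open>\<gamma> n\<close>. With the
    bound n + 2 the path \<open>\<gamma> n\<close> runs from \<open>e (n + 1)\<close> to
    \<open>e 1\<close> and is never empty.\<close>
  define \<gamma> where "\<gamma> n = rev (map e [1..<n + 2])" for n
  have \<gamma>_Suc: "\<gamma> (Suc n) = e (n + 2) # \<gamma> n" for n by (simp add: \<gamma>_def)
  have p: "ug_path G (\<gamma> n) \<and> hd (\<gamma> n) = e (Suc n) \<and> last (\<gamma> n) = e 1" for n
  proof (induction n)
    case (Suc n)
    then have "\<gamma> n \<noteq> []" by auto
    then show ?case unfolding \<gamma>_Suc using Suc e(2,3) by (simp add: ug_path_Cons)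
  qed (use e in \<open>simp add: \<gamma>_def\<close>)
  show False
  proof (rule no_diverging_paths[of "src G (e 0)" \<gamma>])
    show "src G (e 0) \<in> verts G" using ug e by simp
    show "src G (e 0) \<in> rng G (last (\<gamma> n))" for n using p[of n] e(3)[of 0] by simp
    show "ug_path G (\<gamma> n)" for n using p by blast
    fix m n :: nat assume "m < n"
    have "\<gamma> m \<noteq> []" "\<gamma> n \<noteq> []" using p[of m] p[of n] by auto
    then have "\<gamma> m = [] @ e (Suc m) # tl (\<gamma> m)" "\<gamma> n = [] @ e (Suc n) # tl (\<gamma> n)"
      using p[of m] p[of n] by (metis append_Nil list.collapse)+
    moreover have "e (Suc m) \<noteq> e (Suc n)" using e(1) \<open>m < n\<close> by (auto simp: inj_def)
    ultimately show "\<exists>\<rho> e \<alpha> f \<beta>. \<gamma> m = \<rho> @ e # \<alpha> \<and> \<gamma> n = \<rho> @ f # \<beta> \<and> e \<noteq> f" by blast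
  qed
qed

text \<open>An exit edge f gives the paths d^{n+1} f, which diverge where f meets the first edge of
  d. A sink in the range gives only the powers of d, each of them a prefix of the next.\<close>

lemma no_cycle_exits_of_reps: "no_cycle_exits G"
  unfolding no_cycle_exits_def
proof (intro allI impI notI)
  fix c assume c: "ug_cycle G c" "has_exit G c"
  then obtain i where i: "i < length c"
    and ex: "(\<exists>f\<in>edges G. src G f \<in> rng G (c ! i) \<and> f \<noteq> c ! (Suc i mod length c)) \<or>
      (\<exists>w\<in>rng G (c ! i). is_sink G w)" unfolding has_exit_def by blast
  define d where "d = drop (Suc i) c @ take (Suc i) c"
  have cp: "ug_path G c" "src G (hd c) \<in> rng G (last c)"
    using c by (auto simp: ug_cycle_def path_src_def path_rng_def)
  have d: "ug_path G d \<and> src G (hd d) \<in> rng G (last d) \<and> hd d = c ! (Suc i mod length c) \<and> last d = c ! i"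
    unfolding d_def using rotate_closed_path[OF cp i] by blast
  then have dne: "d \<noteq> []" by auto
  define r where "r n = concat (replicate (Suc n) d)" for n
  have r: "ug_path G (r n)" "hd (r n) = hd d" "last (r n) = last d" "r n \<noteq> []" for n
    using closed_path_power[of G d n] d dne unfolding r_def by auto
  have rs: "r n = r m @ r (n - Suc m)" if "m < n" for m n
    using replicate_less_split[OF that] unfolding r_def by simp
  have last_edge: "c ! i \<in> edges G" using i cp(1) ug_path_edges nth_mem by blast
  have hd_edge: "hd d \<in> edges G" using d dne by (metis hd_edges ug_path_edges)
  show False using ex
  proof
    assume "\<exists>f\<in>edges G. src G f \<in> rng G (c ! i) \<and> f \<noteq> c ! (Suc i mod length c)"
    then obtain f where f: "f \<in> edges G" "src G f \<in> rng G (last d)" "f \<noteq> hd d" using d by auto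
    then obtain w where w: "w \<in> rng G f" using is_ultragraph_simps(3)[OF ug] by blast
    show False
    proof (rule no_diverging_paths[of w "\<lambda>n. r n @ [f]"])
      show "w \<in> verts G" using w f is_ultragraph_simps(2)[OF ug] by blast
      show "ug_path G (r n @ [f])" for n using r f by (simp add: ug_path_append)
      show "w \<in> rng G (last (r n @ [f]))" for n using w by simp
      fix m n :: nat assume mn: "m < n"
      have "r n @ [f] = r m @ hd d # (tl (r (n - Suc m)) @ [f])"
        using rs[OF mn] r(2)[of "n - Suc m"] r(4)[of "n - Suc m"] by (metis append.assoc append_Cons list.collapse)
      moreover have "r m @ [f] = r m @ f # []" by simp
      ultimately show "\<exists>\<rho> e \<alpha> g \<beta>. r m @ [f] = \<rho> @ e # \<alpha> \<and> r n @ [f] = \<rho> @ g # \<beta> \<and> e \<noteq> g"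
        using f(3) by blast
    qed
  next
    assume "\<exists>w\<in>rng G (c ! i). is_sink G w"
    then obtain w where w: "w \<in> rng G (last d)" "is_sink G w" using d by auto
    have wv: "w \<in> verts G" using w by (simp add: is_sink_def)
    \<comment> \<open>The product of two different powers reduces to a power of d or to its adjoint.
      It is the factor p_w that makes it vanish, because d starts at a vertex other than the sink
      w.\<close>
    have hw: "src G (hd d) \<noteq> w" using w(2) hd_edge by (auto simp: is_sink_def emits_def)
    show False
    proof (rule no_orthogonal_paths[OF wv, of r])
      show "w \<in> rng G (last (r n))" for n using w r by simp
      show "ug_path G (r n)" for n by (rule r)
      fix m n :: nat assume "m \<noteq> n"
      then consider "m < n" | "n < m" by linarith
      then show "lcong G (PP {w} * (gp (r m) * sp (r n)) * PP {w} :: ('v, 'e, 'k) free_elem) 0"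
      proof cases
        case 1
        have "lcong G (gp (r m) * sp (r n) :: ('v, 'e, 'k) free_elem) (sp (r (n - Suc m)))"
          unfolding rs[OF 1]
          by (rule lcong_gp_sp_prefix(1)[OF ug _ r(4) r(4)]) (use r(1)[of n] rs[OF 1] in simp)
        then have "lcong G (PP {w} * (gp (r m) * sp (r n)) * PP {w} :: ('v, 'e, 'k) free_elem)
            (PP {w} * sp (r (n - Suc m)) * PP {w})"
          using wv by (intro lcong_multr lcong_multl) auto
        also have "lcong G \<dots> (0 * PP {w})"
          by (rule lcong_multr) (use lcong_PP_sp[OF ug, of "{w}" "r (n - Suc m)"] wv hw r ug_path_edges[OF r(1)] in auto)
        finally show ?thesis by simp
      next
        case 2
        have "lcong G (gp (r m) * sp (r n) :: ('v, 'e, 'k) free_elem) (gp (r (m - Suc n)))"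
          unfolding rs[OF 2]
          by (rule lcong_gp_sp_prefix(2)[OF ug _ r(4) r(4)]) (use r(1)[of m] rs[OF 2] in simp)
        then have "lcong G (PP {w} * ((gp (r m) * sp (r n)) * PP {w}) :: ('v, 'e, 'k) free_elem)
            (PP {w} * (gp (r (m - Suc n)) * PP {w}))"
          using wv by (intro lcong_multr lcong_multl) auto
        also have "lcong G \<dots> (PP {w} * 0)"
          by (rule lcong_multl) (use lcong_gp_PP[OF ug, of "{w}" "r (m - Suc n)"] wv hw r ug_path_edges[OF r(1)] in auto)
        finally show ?thesis by (simp add: mult.assoc)
      qed
    qed
  qed
qed

text \<open>If v reached nothing, the relation p_w = \<Sum> s_e p_{w'} s_e^* would pass nonvanishing
  in a fixed representation from w to some vertex w' in the range of an edge from w. Iterating gives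
  an infinite path through distinct vertices, hence infinitely many nonzero orthogonal idempotents
  on one finite-dimensional space.\<close>

lemma reaches_of_reps:
  assumes "RFUM2 G" and v: "v \<in> verts G"
  shows "reaches_terminal_set G v \<or> reaches_cycle G v"
proof (rule ccontr)
  assume contra: "\<not> (reaches_terminal_set G v \<or> reaches_cycle G v)"
  obtain V and \<phi> :: "('v, 'e, 'k) free_elem \<Rightarrow> _" where rep: "leavitt_rep G V \<phi>" "\<exists>x\<in>V. \<phi> (PP {v}) x \<noteq> 0"
    using sep[OF v] by blast
  define bad where "bad w \<longleftrightarrow> w \<in> verts G \<and> \<not> reaches_terminal_set G w \<and> \<not> reaches_cycle G w \<and>
    (\<exists>x\<in>V. \<phi> (PP {w}) x \<noteq> 0)" for w
  have step: "\<exists>w' e. e \<in> edges G \<and> src G e = w \<and> w' \<in> rng G e \<and> bad w'" if bad: "bad w" for w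
  proof -
    have wv: "w \<in> verts G" using bad by (simp add: bad_def)
    have nt: "{w} \<notin> terminal_sets G" using bad by (auto simp: bad_def reaches_terminal_set_def)
    have reg: "is_regular G w"
    proof -
      have "emits G {w} \<noteq> {}" using nt wv by (auto simp: terminal_sets_def is_sink_def)
      moreover have "finite (emits G {w})"
      proof (rule ccontr)
        assume "infinite (emits G {w})"
        \<comment> \<open>A proper subset of a singleton is empty, so a single infinite emitter is
          automatically minimal.\<close>
        then have "min_inf_emitter G {w}"
          using wv by (auto simp: min_inf_emitter_def psubset_insert_iff emits_def)
        then show False using nt by (auto simp: terminal_sets_def)
      qed
      ultimately show ?thesis using wv by (simp add: is_regular_def)
    qed
    \<comment> \<open>(RFUM2) writes the range as a finite union. None of its members is a terminal
      set, since w would reach it, so all of them are singletons of regular vertices.\<close>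
    have fin: "finite (rng G e)" if e: "e \<in> emits G {w}" for e
    proof -
      have ee: "e \<in> edges G" "src G e = w" using e by (auto simp: emits_def)
      obtain \<F> where F: "finite \<F>" "rng G e = \<Union>\<F>" "\<And>A. A \<in> \<F> \<Longrightarrow> min_inf_emitter G A \<or> min_sink G A \<or>
          (\<exists>v. A = {v} \<and> (is_sink G v \<or> is_regular G v))"
        using assms(1) ee unfolding RFUM2_def by meson
      have "A \<notin> terminal_sets G" if "A \<in> \<F>" for A
      proof
        assume "A \<in> terminal_sets G"
        moreover have "ug_path G [e]" "path_src G [e] = w" "A \<subseteq> path_rng G [e]"
          using ee F(2) that by (auto simp: path_src_def path_rng_def)
        ultimately have "reaches_terminal_set G w" unfolding reaches_terminal_set_def by blast
        then show False using bad by (simp add: bad_def)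
      qed
      then have "finite A" if "A \<in> \<F>" for A
        using F(3)[OF that] that unfolding terminal_sets_def by auto
      then show ?thesis using F(1,2) by auto
    qed
    have sub: "rng G e \<subseteq> verts G" "e \<in> edges G" "src G e = w" if "e \<in> emits G {w}" for e
      using that ug by (auto simp: emits_def)
    have "\<exists>e\<in>emits G {w}. \<exists>w'\<in>rng G e. \<exists>x\<in>V. \<phi> (PP {w'}) x \<noteq> 0"
    proof (rule ccontr)
      assume no: "\<not> ?thesis"
      have "lcong G (PP {w} :: ('v, 'e, 'k) free_elem) (\<Sum>e\<in>emits G {w}. \<Sum>w'\<in>rng G e. sp [e] * (PP {w'} * gp [e]))"
      proof -
        have "lcong G (PP {w} :: ('v, 'e, 'k) free_elem) (\<Sum>e\<in>emits G {w}. sp [e] * gp [e])"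
          by (rule lcong_CK[OF reg])
        also have "lcong G \<dots> (\<Sum>e\<in>emits G {w}. sp [e] * ((\<Sum>w'\<in>rng G e. PP {w'}) * gp [e]))"
        proof (rule lcong_sum)
          fix e assume e: "e \<in> emits G {w}"
          have "lcong G (sp [e] * gp [e] :: ('v, 'e, 'k) free_elem) (sp [e] * (PP (rng G e) * gp [e]))"
            by (rule lcong_multl[OF _ lcong_sym[OF lcong_edge(3)]]) (use sub[OF e] in auto)
          also have "lcong G \<dots> (sp [e] * ((\<Sum>w'\<in>rng G e. PP {w'}) * gp [e]))"
            by (intro lcong_multl lcong_multr lcong_PP_finite[OF ug fin[OF e]]) (use sub[OF e] in auto)
          finally show "lcong G (sp [e] * gp [e] :: ('v, 'e, 'k) free_elem) (sp [e] * ((\<Sum>w'\<in>rng G e. PP {w'}) * gp [e]))" .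
        qed
        finally show ?thesis by (simp add: sum_distrib_left sum_distrib_right)
      qed
      moreover have in1: "(sp [e] * (PP {w'} * gp [e]) :: ('v, 'e, 'k) free_elem) \<in> fcar G"
        if "e \<in> emits G {w}" "w' \<in> rng G e" for e w'
        using sub[OF that(1)] that(2) by (intro fcar_mult1 fcar_mult2) auto
      ultimately have eq1: "\<phi> (PP {w}) x = \<phi> (\<Sum>e\<in>emits G {w}. \<Sum>w'\<in>rng G e. sp [e] * (PP {w'} * gp [e])) x" if "x \<in> V" for x
        using that by (intro rep_lcong[OF ug rep(1)]) auto
      have eq: "\<phi> (PP {w}) x = (\<Sum>e\<in>emits G {w}. \<Sum>w'\<in>rng G e. \<phi> (sp [e] * (PP {w'} * gp [e])) x)" if "x \<in> V" for x
        unfolding eq1[OF that] using reg that in1 fin by (simp add: rep_sum[OF ug rep(1)] is_regular_def)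
      have "\<phi> (sp [e] * (PP {w'} * gp [e])) x = 0" if "x \<in> V" "e \<in> emits G {w}" "w' \<in> rng G e" for x e w'
      proof -
        have c: "(sp [e] :: ('v, 'e, 'k) free_elem) \<in> fcar G" "(gp [e] :: ('v, 'e, 'k) free_elem) \<in> fcar G"
          "(PP {w'} :: ('v, 'e, 'k) free_elem) \<in> fcar G"
          using sub[OF that(2)] that(3) unfolding sp_def gp_def by auto
        then have "\<phi> (sp [e] * (PP {w'} * gp [e])) x = \<phi> (sp [e]) (\<phi> (PP {w'}) (\<phi> (gp [e]) x))"
          using rep_mult[OF ug rep(1)] that(1) rep_in[OF ug rep(1)] by simp
        also have "\<phi> (PP {w'}) (\<phi> (gp [e]) x) = 0"
          using no that c rep_in[OF ug rep(1)] by blast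
        finally show ?thesis using rep_zero[OF ug rep(1)] c by simp
      qed
      then have "\<phi> (PP {w}) x = 0" if "x \<in> V" for x using eq[OF that] that by simp
      then show False using bad by (auto simp: bad_def)
    qed
    then obtain e w' where e: "e \<in> emits G {w}" "w' \<in> rng G e" "\<exists>x\<in>V. \<phi> (PP {w'}) x \<noteq> 0" by blast
    note s = sub[OF e(1)]
    have cons: "ug_path G (e # \<alpha>) \<and> path_src G (e # \<alpha>) = w \<and> path_rng G (e # \<alpha>) = path_rng G \<alpha>"
      if "ug_path G \<alpha>" "path_src G \<alpha> = w'" for \<alpha>
      using that e(2) s by (auto simp: ug_path_Cons path_src_def path_rng_def)
    have one: "ug_path G [e]" "path_src G [e] = w" "path_rng G [e] = rng G e"
      using s by (auto simp: path_src_def path_rng_def)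
    have "\<not> reaches_terminal_set G w'"
    proof
      assume "reaches_terminal_set G w'"
      then have "reaches_terminal_set G w" unfolding reaches_terminal_set_def
        using cons one e(2) by (metis empty_subsetI insert_subset)
      then show False using bad by (simp add: bad_def)
    qed
    moreover have "\<not> reaches_cycle G w'"
    proof
      assume "reaches_cycle G w'"
      then have "reaches_cycle G w" unfolding reaches_cycle_def
        using cons one e(2) by metis
      then show False using bad by (simp add: bad_def)
    qed
    ultimately have "bad w'" using e s unfolding bad_def by blast
    then show ?thesis using s e by blast
  qed
  have "bad v" using contra rep v by (simp add: bad_def)
  obtain f where f: "\<And>n. bad (f n)" "\<And>n. \<exists>e. e \<in> edges G \<and> src G e = f n \<and> f (Suc n) \<in> rng G e"
    using dependent_nat_choice[of "\<lambda>_. bad" "\<lambda>_ w w'. \<exists>e. e \<in> edges G \<and> src G e = w \<and> w' \<in> rng G e"] \<open>bad v\<close> step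
    by metis
  obtain e where e: "\<And>n. e n \<in> edges G" "\<And>n. src G (e n) = f n" "\<And>n. f (Suc n) \<in> rng G (e n)"
    using f(2) by metis
  have path: "ug_path G (map e [i..<j])" if "i < j" for i j
    using that e by (auto simp: ug_path_def)
  \<comment> \<open>A repeated vertex would close up part of the path and put a cycle on it, but no
    vertex of the path lies on a cycle.\<close>
  have f_ne: "f i \<noteq> f j" if ij: "i < j" for i j
  proof
    assume eq: "f i = f j"
    have "src G (hd (map e [i..<j])) \<in> rng G (last (map e [i..<j]))"
      using ij e(2)[of i] e(3)[of "j - 1"] eq by (simp add: hd_map last_map)
    then obtain c where c: "ug_cycle G c" "set c \<subseteq> set (map e [i..<j])"
      using closed_path_imp_cycle[OF path[OF ij]] by blast
    then have "c \<noteq> []" by (auto simp: ug_cycle_def)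
    then obtain k where "e k \<in> set c" using c(2) by (cases c) auto
    then have "on_cycle G (f k)" using c(1) e(2)[of k] unfolding on_cycle_def by force
    then show False using f(1)[of k] by (simp add: bad_def reaches_cycle_def)
  qed
  have fv: "f n \<in> verts G" "PP {f n} \<in> fcar G" for n using f(1)[of n] by (auto simp: bad_def)
  have "\<forall>n. \<exists>x\<in>V. \<phi> (PP {f n}) x \<noteq> 0" using f(1) by (simp add: bad_def)
  then obtain x where x: "\<And>n. x n \<in> V" "\<And>n. \<phi> (PP {f n}) (x n) \<noteq> 0" by metis
  show False
  proof (rule no_infinite_biorthogonal_sequence[OF rep_fin_dim[OF ug rep(1)]])
    fix m n
    show "\<phi> (PP {f n}) (x n) \<in> V" "is_endomorphism V (\<phi> (PP {f n}))"
      using rep_in[OF ug rep(1) fv(2) x(1)] rep_endo[OF ug rep(1) fv(2)] by blast+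
    have "\<phi> (PP {f n}) (\<phi> (PP {f n}) (x n)) = \<phi> (PP {f n} * PP {f n}) (x n)"
      using rep_mult[OF ug rep(1) fv(2) fv(2) x(1)] by simp
    also have "\<dots> = \<phi> (PP {f n}) (x n)"
      using lcong_PP_PP[of "{f n}" G "{f n}"] fv(1) by (intro rep_lcong[OF ug rep(1) _ fv(2) x(1)]) auto
    finally show "\<phi> (PP {f n}) (\<phi> (PP {f n}) (x n)) \<noteq> 0" using x(2) by simp
    assume "m \<noteq> n"
    then have "f m \<noteq> f n" using f_ne[of m n] f_ne[of n m] by (metis nat_neq_iff)
    have "\<phi> (PP {f m}) (\<phi> (PP {f n}) (x n)) = \<phi> (PP {f m} * PP {f n}) (x n)"
      using rep_mult[OF ug rep(1) fv(2) fv(2) x(1)] by simp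
    also have "\<dots> = \<phi> 0 (x n)"
      using lcong_PP_PP_if(1)[of "{f m}" G "f n"] fv(1) \<open>f m \<noteq> f n\<close>
      by (intro rep_lcong[OF ug rep(1) _ _ x(1)]) auto
    finally show "\<phi> (PP {f m}) (\<phi> (PP {f n}) (x n)) = 0" using rep_0[OF ug rep(1) x(1)] by simp
  qed
qed

lemma graph_RFD_of_reps: "RFUM2 G \<Longrightarrow> graph_RFD G"
  unfolding graph_RFD_def
  using no_inf_receivers_of_reps no_cycle_exits_of_reps no_inf_backward_chains_of_reps reaches_of_reps
  by blast

end

section \<open>Paths acting by partial bijections\<close>

text \<open>Restriction to an invariant set is what makes the action finite in the applications. The
  second coordinate records degrees: an element of degree d shifts it by d modulo N.\<close>

lemma gset_restrict_cyclic:
  assumes gset: "gset G D R th sg" and N: "(N :: int) > 0"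
    and inv: "\<And>e \<xi>. e \<in> edges G \<Longrightarrow> \<xi> \<in> D (rng G e) \<Longrightarrow> th e \<xi> \<in> S \<longleftrightarrow> \<xi> \<in> S"
  shows "gset G (\<lambda>A. (D A \<inter> S) \<times> {0..<N}) (\<lambda>e. (R e \<inter> S) \<times> {0..<N})
    (\<lambda>e (\<xi>, j). (th e \<xi>, (j + 1) mod N)) (\<lambda>e (\<xi>, j). (sg e \<xi>, (j - 1) mod N))"
proof -
  interpret gset G D R th sg by (rule gset)
  have mods: "((j + 1) mod N - 1) mod N = j" "((j - 1) mod N + 1) mod N = j" if "j \<in> {0..<N}" for j
    using that by (auto simp: mod_simps)
  have sgS: "sg e \<xi> \<in> S \<longleftrightarrow> \<xi> \<in> S" if "e \<in> edges G" "\<xi> \<in> R e" for e \<xi>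
    using inv[OF that(1) sg_D[OF that]] th_sg[OF that] by simp
  show ?thesis
  proof
    fix e and \<xi> :: "'c \<times> int" assume e: "e \<in> edges G" and \<xi>: "\<xi> \<in> (D (rng G e) \<inter> S) \<times> {0..<N}"
    then show "(case \<xi> of (\<xi>, j) \<Rightarrow> (th e \<xi>, (j + 1) mod N)) \<in> (R e \<inter> S) \<times> {0..<N}"
      using N th_R inv by auto
    show "(case case \<xi> of (\<xi>, j) \<Rightarrow> (th e \<xi>, (j + 1) mod N) of (\<xi>, j) \<Rightarrow> (sg e \<xi>, (j - 1) mod N)) = \<xi>"
      using e \<xi> sg_th mods by auto
  next
    fix e and \<xi> :: "'c \<times> int" assume e: "e \<in> edges G" and \<xi>: "\<xi> \<in> (R e \<inter> S) \<times> {0..<N}"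
    then show "(case \<xi> of (\<xi>, j) \<Rightarrow> (sg e \<xi>, (j - 1) mod N)) \<in> (D (rng G e) \<inter> S) \<times> {0..<N}"
      using N sg_D sgS by auto
    show "(case case \<xi> of (\<xi>, j) \<Rightarrow> (sg e \<xi>, (j - 1) mod N) of (\<xi>, j) \<Rightarrow> (th e \<xi>, (j + 1) mod N)) = \<xi>"
      using e \<xi> th_sg mods by auto
    show "\<xi> \<in> (D {src G e} \<inter> S) \<times> {0..<N}" using e \<xi> R_src by auto
  next
    fix v and \<xi> :: "'c \<times> int" assume "is_regular G v" "\<xi> \<in> (D {v} \<inter> S) \<times> {0..<N}"
    then show "\<exists>e\<in>emits G {v}. \<xi> \<in> (R e \<inter> S) \<times> {0..<N}" using D_regular[of v "fst \<xi>"] by auto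
  qed (use D_empty D_Int D_Un R_disj in auto)
qed

context gset
begin

definition pt :: "'e list \<Rightarrow> 'x \<Rightarrow> 'x" where "pt \<alpha> \<xi> = foldr th \<alpha> \<xi>"

lemma pt_simps [simp]: "pt [] \<xi> = \<xi>" "pt (e # \<alpha>) \<xi> = th e (pt \<alpha> \<xi>)"
  "pt (\<alpha> @ \<beta>) \<xi> = pt \<alpha> (pt \<beta> \<xi>)"
  by (simp_all add: pt_def)

lemma D_mono: "A \<in> gen_verts G \<Longrightarrow> B \<in> gen_verts G \<Longrightarrow> A \<subseteq> B \<Longrightarrow> \<xi> \<in> D A \<Longrightarrow> \<xi> \<in> D B"
  using D_Int[of A B] by (auto simp: Int_absorb2)

lemma pt_R:
  assumes ug: "is_ultragraph G" and \<alpha>: "ug_path G \<alpha>" "\<xi> \<in> D (rng G (last \<alpha>))"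
  shows "pt \<alpha> \<xi> \<in> R (hd \<alpha>)"
  using \<alpha>
proof (induction \<alpha>)
  case (Cons e \<alpha>)
  have e: "e \<in> edges G" using Cons.prems by (simp add: ug_path_Cons)
  show ?case
  proof (cases "\<alpha> = []")
    case True
    then show ?thesis using Cons.prems th_R e by simp
  next
    case False
    then have p: "ug_path G \<alpha>" "src G (hd \<alpha>) \<in> rng G e" using Cons.prems by (auto simp: ug_path_Cons)
    have h: "hd \<alpha> \<in> edges G" using p(1) False hd_edges ug_path_edges by metis
    have "pt \<alpha> \<xi> \<in> R (hd \<alpha>)" using Cons p False by simp
    then have "pt \<alpha> \<xi> \<in> D {src G (hd \<alpha>)}" using R_src h by blast
    then have "pt \<alpha> \<xi> \<in> D (rng G e)"
      using D_mono[of "{src G (hd \<alpha>)}" "rng G e"] p(2) e is_ultragraph_simps(1)[OF ug h] by auto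
    then show ?thesis using th_R e by simp
  qed
qed simp

lemma act_one: "act 1 f = f"
  using act_wd[of "[]" f] by (simp add: wd_Nil)

lemma act_sp_pt:
  assumes ug: "is_ultragraph G" and \<alpha>: "ug_path G \<alpha>" "\<eta> \<in> D (rng G (last \<alpha>))"
  shows "act (sp \<alpha>) f (pt \<alpha> \<eta>) = f \<eta>" "act (gp \<alpha>) f \<eta> = f (pt \<alpha> \<eta>)"
proof -
  have "act (sp \<alpha>) f (pt \<alpha> \<eta>) = f \<eta> \<and> act (gp \<alpha>) f \<eta> = f (pt \<alpha> \<eta>)" using \<alpha>
  proof (induction \<alpha> arbitrary: f)
    case (Cons e \<alpha>)
    have e: "e \<in> edges G" using Cons.prems by (simp add: ug_path_Cons)
    have D: "pt \<alpha> \<eta> \<in> D (rng G e)"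
    proof (cases "\<alpha> = []")
      case False
      then have p: "ug_path G \<alpha>" "src G (hd \<alpha>) \<in> rng G e" using Cons.prems by (auto simp: ug_path_Cons)
      have h: "hd \<alpha> \<in> edges G" using p(1) False hd_edges ug_path_edges by metis
      have "pt \<alpha> \<eta> \<in> D {src G (hd \<alpha>)}" using pt_R[OF ug p(1), of \<eta>] False Cons.prems R_src h by auto
      then show ?thesis
        using D_mono[of "{src G (hd \<alpha>)}" "rng G e"] p(2) e is_ultragraph_simps(1)[OF ug h] by auto
    qed (use Cons.prems in simp)
    have IH: "act (sp \<alpha>) f (pt \<alpha> \<eta>) = f \<eta>" "act (gp \<alpha>) f \<eta> = f (pt \<alpha> \<eta>)" for f :: "'x \<Rightarrow> 'a"
    proof -
      have "act (sp \<alpha>) f (pt \<alpha> \<eta>) = f \<eta> \<and> act (gp \<alpha>) f \<eta> = f (pt \<alpha> \<eta>)"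
      proof (cases "\<alpha> = []")
        case False
        then show ?thesis using Cons by (intro Cons.IH) (auto simp: ug_path_Cons)
      qed (simp add: sp_simps gp_simps act_one)
      then show "act (sp \<alpha>) f (pt \<alpha> \<eta>) = f \<eta>" "act (gp \<alpha>) f \<eta> = f (pt \<alpha> \<eta>)" by blast+
    qed
    show ?case
      using D e IH th_R[OF e D] sg_th[OF e D]
      by (simp add: sp_Cons[of e \<alpha>] gp_Cons[of e \<alpha>] act_mult)
        (simp add: sp_def gp_def act_gens)
  qed simp
  then show "act (sp \<alpha>) f (pt \<alpha> \<eta>) = f \<eta>" "act (gp \<alpha>) f \<eta> = f (pt \<alpha> \<eta>)" by blast+
qed

lemma act_sp_outside:
  assumes "ug_path G \<alpha>" "\<And>\<eta>. \<eta> \<in> D (rng G (last \<alpha>)) \<Longrightarrow> \<xi> \<noteq> pt \<alpha> \<eta>"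
  shows "act (sp \<alpha>) f \<xi> = 0"
  using assms
proof (induction \<alpha> arbitrary: \<xi>)
  case (Cons e \<alpha>)
  have e: "e \<in> edges G" using Cons.prems by (simp add: ug_path_Cons)
  have "act (sp \<alpha>) f (sg e \<xi>) = 0" if \<xi>: "\<xi> \<in> R e"
  proof (cases "\<alpha> = []")
    case True
    have False using Cons.prems(2)[of "sg e \<xi>"] sg_D[OF e \<xi>] th_sg[OF e \<xi>] True by simp
    then show ?thesis by blast
  next
    case False
    have "sg e \<xi> \<noteq> pt \<alpha> \<eta>" if "\<eta> \<in> D (rng G (last \<alpha>))" for \<eta>
      using Cons.prems(2)[of \<eta>] that False th_sg[OF e \<xi>] by auto
    then show ?thesis using Cons.IH[of "sg e \<xi>"] Cons.prems False by (simp add: ug_path_Cons)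
  qed
  then show ?case by (simp add: sp_Cons[of e \<alpha>] act_mult) (simp add: sp_def act_gens)
qed simp

text \<open>The unit moves \<open>pt \<beta> \<eta>\<close> to \<open>pt \<alpha> \<eta>\<close> for
  \<eta> in Q. Its matrix coefficients are therefore 0 or 1, which makes them usable as
  coordinates.\<close>

lemma act_path_unit:
  assumes ug: "is_ultragraph G"
    and \<alpha>: "\<alpha> \<noteq> [] \<Longrightarrow> ug_path G \<alpha> \<and> Q \<subseteq> D (rng G (last \<alpha>))"
    and \<beta>: "\<beta> \<noteq> [] \<Longrightarrow> ug_path G \<beta> \<and> Q \<subseteq> D (rng G (last \<beta>))"
    and q: "\<And>f. act q f = (\<lambda>\<eta>. if \<eta> \<in> Q then f \<eta> else 0)"
  shows "act (sp \<alpha> * q * gp \<beta>) (\<lambda>\<xi>. if \<xi> = y then 1 else 0) x =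
    (if \<exists>\<eta>\<in>Q. x = pt \<alpha> \<eta> \<and> y = pt \<beta> \<eta> then 1 else 0)"
proof -
  let ?\<delta> = "\<lambda>\<xi>. if \<xi> = y then 1 else 0"
  have g: "act (q * gp \<beta>) ?\<delta> \<eta> = (if \<eta> \<in> Q \<and> y = pt \<beta> \<eta> then 1 else 0)" for \<eta>
  proof (cases "\<beta> = []")
    case False
    then show ?thesis using \<beta> act_sp_pt(2)[OF ug, of \<beta> \<eta> ?\<delta>] by (auto simp: act_mult q)
  qed (auto simp: gp_simps q act_one)
  show ?thesis
  proof (cases "\<alpha> = []")
    case True
    then show ?thesis using g by (simp add: sp_simps mult.assoc)
  next
    case False
    then have p: "ug_path G \<alpha>" "Q \<subseteq> D (rng G (last \<alpha>))" using \<alpha> by blast+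
    show ?thesis
    proof (cases "\<exists>\<eta>\<in>D (rng G (last \<alpha>)). x = pt \<alpha> \<eta>")
      case True
      then obtain \<eta> where \<eta>: "\<eta> \<in> D (rng G (last \<alpha>))" "x = pt \<alpha> \<eta>" by blast
      \<comment> \<open>Injectivity of \<open>pt \<alpha>\<close> is read off from the action of
        \<open>sp \<alpha>\<close> on the unit function at \<eta>.\<close>
      have inj: "\<eta>' = \<eta>" if "\<eta>' \<in> D (rng G (last \<alpha>))" "x = pt \<alpha> \<eta>'" for \<eta>'
      proof -
        let ?h = "\<lambda>\<xi>. if \<xi> = \<eta> then 1 else (0 :: 'a)"
        have "?h \<eta>' = ?h \<eta>"
          using act_sp_pt(1)[OF ug p(1) that(1), of ?h] act_sp_pt(1)[OF ug p(1) \<eta>(1), of ?h] that(2) \<eta>(2)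
          by simp
        then show ?thesis by (auto split: if_splits)
      qed
      have "act (sp \<alpha> * q * gp \<beta>) ?\<delta> x = act (q * gp \<beta>) ?\<delta> \<eta>"
        using act_sp_pt(1)[OF ug p(1) \<eta>(1)] \<eta>(2) by (simp add: mult.assoc act_mult[of "sp \<alpha>"])
      moreover have "(\<exists>\<eta>'\<in>Q. x = pt \<alpha> \<eta>' \<and> y = pt \<beta> \<eta>') \<longleftrightarrow> \<eta> \<in> Q \<and> y = pt \<beta> \<eta>"
        using inj \<eta> p(2) by blast
      ultimately show ?thesis using g by simp
    next
      case False
      then have "act (sp \<alpha> * q * gp \<beta>) ?\<delta> x = 0"
        unfolding mult.assoc act_mult[of "sp \<alpha>"] using act_sp_outside[OF p(1)] by blast
      then show ?thesis using False p(2) by auto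
    qed
  qed
qed

end

section \<open>Minimal sets\<close>

text \<open>Only the infinite terminal sets. The finite ones are singletons and are treated as
  vertices.\<close>

definition minset :: "('v, 'e) ultragraph \<Rightarrow> 'v set \<Rightarrow> bool" where
  "minset G T \<longleftrightarrow> infinite T \<and> (min_inf_emitter G T \<or> min_sink G T)"

lemma minset_gen_verts: "minset G T \<Longrightarrow> T \<in> gen_verts G"
  by (auto simp: minset_def min_inf_emitter_def min_sink_def)

lemma minset_psubset: "minset G T \<Longrightarrow> B \<in> gen_verts G \<Longrightarrow> B \<subset> T \<Longrightarrow> finite B"
  unfolding minset_def min_inf_emitter_def min_sink_def by blast

text \<open>Proper subsets of a minimal set are finite, and the intersection of two different sets
  is a proper subset of at least one of them.\<close>

lemma minset_Int:
  assumes "minset G T" "minset G T'" "T \<noteq> T'"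
  shows "finite (T \<inter> T')"
  using assms minset_gen_verts[OF assms(1)] minset_gen_verts[OF assms(2)]
    minset_psubset[OF assms(1), of "T \<inter> T'"] minset_psubset[OF assms(2), of "T \<inter> T'"] by blast

text \<open>If neither set contained T, both traces on T would be proper, hence finite, and T would
  be finite. So inclusion of T behaves like membership of a point, which lets T serve as the end of
  a boundary point.\<close>

lemma minset_prime:
  assumes "minset G T" "A \<in> gen_verts G" "B \<in> gen_verts G" "T \<subseteq> A \<union> B"
  shows "T \<subseteq> A \<or> T \<subseteq> B"
proof (rule ccontr)
  assume "\<not> ?thesis"
  then have "T \<inter> A \<subset> T" "T \<inter> B \<subset> T" by auto
  then have "finite (T \<inter> A)" "finite (T \<inter> B)"
    using minset_psubset[OF assms(1)] minset_gen_verts[OF assms(1)] assms(2,3) by auto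
  moreover have "T = (T \<inter> A) \<union> (T \<inter> B)" using assms(4) by blast
  ultimately show False using assms(1) by (metis finite_Un minset_def)
qed

lemma min_inf_emitter_cases:
  assumes "is_ultragraph G" "min_inf_emitter G A"
  shows "minset G A \<or> (\<exists>v\<in>verts G. A = {v} \<and> infinite (emits G {v}))"
proof (cases "finite A")
  case True
  have "emits G A = (\<Union>v\<in>A. emits G {v})" by (auto simp: emits_def)
  moreover have inf: "infinite (emits G A)" and A: "A \<in> gen_verts G"
    using assms(2) by (auto simp: min_inf_emitter_def)
  ultimately obtain v where v: "v \<in> A" "infinite (emits G {v})" using True by auto
  have vv: "v \<in> verts G" using gen_verts_subset[OF assms(1) A] v by blast
  then have "\<not> {v} \<subset> A" using assms(2) v(2) unfolding min_inf_emitter_def by blast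
  then show ?thesis using v vv by auto
qed (use assms in \<open>simp add: minset_def\<close>)

text \<open>Intersections carry the content: two different minimal sets meet in a finite set, which
  goes into U together with the traces on the finite parts.\<close>

lemma gen_verts_decomposition:
  assumes ug: "is_ultragraph G" and rfum: "RFUM2 G" and A: "A \<in> gen_verts G"
  shows "\<exists>\<T> U. finite \<T> \<and> finite U \<and> (\<forall>T\<in>\<T>. minset G T) \<and> U \<subseteq> verts G \<and> A = \<Union>\<T> \<union> U"
  using A
proof (induction rule: gen_verts.induct)
  case empty
  then show ?case by (intro exI[of _ "{}"]) auto
next
  case (vertex v)
  then show ?case by (intro exI[of _ "{}"] exI[of _ "{v}"]) auto
next
  case (rng e)
  then obtain \<F> where F: "finite \<F>" "ultragraph.rng G e = \<Union>\<F>" "\<And>A. A \<in> \<F> \<Longrightarrow> min_inf_emitter G A \<or> min_sink G A \<or>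
      (\<exists>v. A = {v} \<and> (is_sink G v \<or> is_regular G v))"
    using rfum unfolding RFUM2_def by meson
  have "minset G A" if "A \<in> \<F>" "infinite A" for A
    using F(3)[OF that(1)] that(2) by (auto simp: minset_def)
  moreover have "\<Union>{A \<in> \<F>. finite A} \<subseteq> verts G" using is_ultragraph_simps(2)[OF ug rng] F(2) by auto
  moreover have "ultragraph.rng G e = \<Union>{A \<in> \<F>. infinite A} \<union> \<Union>{A \<in> \<F>. finite A}" using F(2) by auto
  ultimately show ?case
    using F(1) by (intro exI[of _ "{A \<in> \<F>. infinite A}"] exI[of _ "\<Union>{A \<in> \<F>. finite A}"]) auto
next
  case (union A B)
  then obtain \<T> U \<T>' U' where "finite \<T>" "finite U" "\<forall>T\<in>\<T>. minset G T" "U \<subseteq> verts G" "A = \<Union>\<T> \<union> U"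
    "finite \<T>'" "finite U'" "\<forall>T\<in>\<T>'. minset G T" "U' \<subseteq> verts G" "B = \<Union>\<T>' \<union> U'" by blast
  then show ?case by (intro exI[of _ "\<T> \<union> \<T>'"] exI[of _ "U \<union> U'"]) auto
next
  case (inter A B)
  then obtain \<T> U \<T>' U' where *: "finite \<T>" "finite U" "\<forall>T\<in>\<T>. minset G T" "U \<subseteq> verts G" "A = \<Union>\<T> \<union> U"
    "finite \<T>'" "finite U'" "\<forall>T\<in>\<T>'. minset G T" "U' \<subseteq> verts G" "B = \<Union>\<T>' \<union> U'" by blast
  let ?P = "{(T, T') \<in> \<T> \<times> \<T>'. T \<noteq> T'}"
  let ?V = "(\<Union>(T, T')\<in>?P. T \<inter> T') \<union> (U \<inter> B) \<union> (A \<inter> U')"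
  have "finite ?P" by (rule finite_subset[of _ "\<T> \<times> \<T>'"]) (use * in auto)
  moreover have "finite (T \<inter> T')" if "(T, T') \<in> ?P" for T T'
    using that * minset_Int[of G T T'] by blast
  ultimately have "finite ?V" using * by (intro finite_UnI finite_UN_I) auto
  moreover have "?V \<subseteq> verts G"
    using gen_verts_subset[OF ug inter.hyps(1)] gen_verts_subset[OF ug inter.hyps(2)] * by blast
  moreover have "A \<inter> B = \<Union>(\<T> \<inter> \<T>') \<union> ?V" unfolding *(5,10) by blast
  ultimately show ?case using * by (intro exI[of _ "\<T> \<inter> \<T>'"] exI[of _ ?V]) auto
qed

section \<open>Boundary points under the graph conditions\<close>

locale rfd_ultragraph =
  fixes G :: "('v, 'e) ultragraph"
  assumes ug: "is_ultragraph G" and rfum: "RFUM2 G" and grfd: "graph_RFD G"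
begin

definition cyc_edges :: "'e set" where
  "cyc_edges = {e \<in> edges G. on_cycle G (src G e)}"

section \<open>Rigidity of cycles without exits\<close>

lemma cycle_closed: "ug_cycle G c \<Longrightarrow> ug_path G c \<and> src G (hd c) \<in> rng G (last c)"
  by (simp add: ug_cycle_def path_src_def path_rng_def)

lemma cycle_src_in_rng:
  assumes "ug_cycle G c" "i < length c"
  shows "src G (c ! (Suc i mod length c)) \<in> rng G (c ! i)"
proof (cases "Suc i = length c")
  case True
  then have "last c = c ! i" "hd c = c ! 0" using assms(2) by (cases c; auto simp: last_conv_nth hd_conv_nth)+
  then show ?thesis using cycle_closed[OF assms(1)] True by simp
next
  case False
  then show ?thesis using assms by (simp add: ug_cycle_def ug_path_def)
qed

lemma cycle_next:
  assumes "ug_cycle G c" "i < length c" "f \<in> edges G" "src G f \<in> rng G (c ! i)"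
  shows "f = c ! (Suc i mod length c)"
  using grfd assms unfolding graph_RFD_def no_cycle_exits_def has_exit_def by blast

text \<open>A vertex in the range of an edge on the cycle is not a sink, so it emits an edge, and
  that edge would be an exit unless it were the next one. This leaves a single vertex.\<close>

lemma cycle_rng:
  assumes "ug_cycle G c" "i < length c"
  shows "rng G (c ! i) = {src G (c ! (Suc i mod length c))}"
proof -
  have ci: "c ! i \<in> edges G" using assms by (auto simp: ug_cycle_def ug_path_def)
  have "w = src G (c ! (Suc i mod length c))" if w: "w \<in> rng G (c ! i)" for w
  proof -
    have "w \<in> verts G" using is_ultragraph_simps(2)[OF ug ci] w by blast
    moreover have "\<not> is_sink G w"
      using grfd assms w unfolding graph_RFD_def no_cycle_exits_def has_exit_def by blast
    ultimately obtain f where "f \<in> edges G" "src G f = w" by (auto simp: is_sink_def emits_def)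
    then show ?thesis using cycle_next[OF assms, of f] w by blast
  qed
  then show ?thesis using cycle_src_in_rng[OF assms] by blast
qed

text \<open>An edge from a vertex on the cycle continues the preceding edge of the cycle, so absence
  of exits leaves only one.\<close>

lemma cycle_unique_edge:
  assumes c: "ug_cycle G c" "e \<in> set c" and f: "f \<in> edges G" "src G f = src G e"
  shows "f = e"
proof -
  obtain k where k: "k < length c" "c ! k = e" using c(2) by (auto simp: in_set_conv_nth)
  obtain i where i: "i < length c" "Suc i mod length c = k"
  proof (cases k)
    case 0
    then show ?thesis using that[of "length c - 1"] k by simp
  next
    case (Suc m)
    then show ?thesis using that[of m] k by simp
  qed
  have "src G f \<in> rng G (c ! i)" using cycle_src_in_rng[OF c(1) i(1)] i k f by simp
  then show ?thesis using cycle_next[OF c(1) i(1) f(1)] i k by simp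
qed

lemma cyc_edge_cycle:
  assumes "e \<in> cyc_edges"
  obtains c where "ug_cycle G c" "e \<in> set c"
proof -
  obtain c f where "ug_cycle G c" "f \<in> set c" "src G e = src G f"
    using assms by (auto simp: cyc_edges_def on_cycle_def)
  then show ?thesis using that[of c] cycle_unique_edge[of c f e] assms by (auto simp: cyc_edges_def)
qed

lemma cycle_edges_cyc: "ug_cycle G c \<Longrightarrow> set c \<subseteq> cyc_edges"
  by (auto simp: cyc_edges_def on_cycle_def ug_cycle_def ug_path_def)

lemma cyc_unique: "e \<in> cyc_edges \<Longrightarrow> f \<in> edges G \<Longrightarrow> src G f = src G e \<Longrightarrow> f = e"
  using cyc_edge_cycle cycle_unique_edge by metis

lemma cyc_edges_edges: "e \<in> cyc_edges \<Longrightarrow> e \<in> edges G"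
  by (simp add: cyc_edges_def)

lemma cycle_edge_rng:
  assumes "ug_cycle G c" "e \<in> set c"
  shows "\<exists>f\<in>set c. rng G e = {src G f}"
proof -
  obtain i where "i < length c" "c ! i = e" using assms(2) by (auto simp: in_set_conv_nth)
  then show ?thesis using cycle_rng[OF assms(1)] by (metis mod_less_divisor nth_mem zero_less_iff_neq_zero not_less_zero)
qed

lemma cyc_rng:
  assumes "e \<in> cyc_edges"
  obtains w where "rng G e = {w}" "on_cycle G w" "w \<in> verts G"
proof -
  obtain c where c: "ug_cycle G c" "e \<in> set c" using assms by (rule cyc_edge_cycle)
  obtain f where f: "f \<in> set c" "rng G e = {src G f}" using cycle_edge_rng[OF c] by blast
  have "on_cycle G (src G f)" using c(1) f(1) by (auto simp: on_cycle_def)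
  moreover have "src G f \<in> verts G" using is_ultragraph_simps(2)[OF ug, of e] f(2) assms by (auto simp: cyc_edges_def)
  ultimately show ?thesis using that f(2) by blast
qed

lemma on_cycle_edge:
  assumes "on_cycle G v"
  obtains e where "e \<in> cyc_edges" "src G e = v"
proof -
  obtain c e where "ug_cycle G c" "e \<in> set c" "v = src G e" using assms by (auto simp: on_cycle_def)
  then show ?thesis using that cycle_edges_cyc by blast
qed

lemma on_cycle_emits:
  assumes "e \<in> cyc_edges"
  shows "emits G {src G e} = {e}"
  using cyc_unique[OF assms] cyc_edges_edges[OF assms] by (auto simp: emits_def)

lemma on_cycle_regular: "on_cycle G v \<Longrightarrow> is_regular G v"
  by (erule on_cycle_edge) (use ug in \<open>auto simp: is_regular_def on_cycle_emits dest: cyc_edges_edges\<close>)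

lemma cyc_edge_iff: "e \<in> edges G \<Longrightarrow> on_cycle G (src G e) \<longleftrightarrow> e \<in> cyc_edges"
  by (simp add: cyc_edges_def)

lemma path_in_cycle:
  assumes "ug_cycle G c" "ug_path G \<alpha>" "src G (hd \<alpha>) \<in> src G ` set c"
  shows "set \<alpha> \<subseteq> set c"
  using assms(2,3)
proof (induction \<alpha>)
  case (Cons e \<alpha>)
  have e: "e \<in> set c"
    using Cons.prems cycle_unique_edge[OF assms(1), of _ e] by (auto simp: ug_path_Cons)
  have "set \<alpha> \<subseteq> set c" if "\<alpha> \<noteq> []"
  proof -
    have "ug_path G \<alpha>" "src G (hd \<alpha>) \<in> rng G e" using Cons.prems that by (auto simp: ug_path_Cons)
    then show ?thesis using Cons.IH cycle_edge_rng[OF assms(1) e] by auto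
  qed
  then show ?case using e by (cases "\<alpha> = []") auto
qed simp

text \<open>Rotate a cycle through e so that e comes last: it then starts at a vertex of c and
  cannot leave c. With this backward statement the vertices of a cycle form a set that is invariant
  in both directions.\<close>

lemma cycle_pred:
  assumes c: "ug_cycle G c" and e: "e \<in> cyc_edges" "rng G e \<subseteq> src G ` set c"
  shows "e \<in> set c"
proof -
  obtain d where d: "ug_cycle G d" "e \<in> set d" using e(1) by (rule cyc_edge_cycle)
  obtain i where i: "i < length d" "d ! i = e" using d(2) by (auto simp: in_set_conv_nth)
  note rot = rotate_closed_path[OF _ _ i(1), of G]
  have dd: "ug_path G d" "src G (hd d) \<in> rng G (last d)" using cycle_closed[OF d(1)] by blast+
  have "src G (d ! (Suc i mod length d)) \<in> src G ` set c"
    using cycle_src_in_rng[OF d(1) i(1)] e(2) i(2) by blast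
  then have "set (drop (Suc i) d @ take (Suc i) d) \<subseteq> set c"
    using rot[OF dd] by (intro path_in_cycle[OF c]) auto
  then show ?thesis using rot(5)[OF dd] d(2) by blast
qed

section \<open>Finiteness of the part off the cycles\<close>

lemma nonC_not_closed:
  assumes "ug_path G \<alpha>" "set \<alpha> \<inter> cyc_edges = {}"
  shows "src G (hd \<alpha>) \<notin> rng G (last \<alpha>)"
proof
  assume "src G (hd \<alpha>) \<in> rng G (last \<alpha>)"
  then obtain c where c: "ug_cycle G c" "set c \<subseteq> set \<alpha>" using closed_path_imp_cycle assms(1) by blast
  have "c \<noteq> []" using c(1) by (auto simp: ug_cycle_def)
  then show False using cycle_edges_cyc[OF c(1)] c(2) assms(2) by (metis Int_iff empty_iff hd_in_set subset_iff)
qed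

definition precedes :: "('e \<times> 'e) set" where
  "precedes = {(e', e). e' \<in> edges G - cyc_edges \<and> e \<in> edges G - cyc_edges \<and> src G e \<in> rng G e'}"

text \<open>(B3) forbids only chains of distinct edges. A backward chain with a repetition contains
  a closed path, and that path would contain a cycle although its edges avoid all cycles.\<close>

lemma wf_precedes: "wf precedes"
  unfolding wf_iff_no_infinite_down_chain
proof
  assume "\<exists>f. \<forall>i. (f (Suc i), f i) \<in> precedes"
  then obtain f where f: "\<And>i. f i \<in> edges G - cyc_edges" "\<And>i. src G (f i) \<in> rng G (f (Suc i))"
    unfolding precedes_def by auto
  have "\<not> inj f" using grfd f unfolding graph_RFD_def no_inf_backward_chains_def by blast
  then obtain i j where ij: "f i = f j" "i < j" unfolding inj_def by (metis linorder_neqE_nat)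
  \<comment> \<open>The edges from \<open>f j\<close> down to \<open>f (Suc i)\<close> form a path,
    because the sequence runs against the direction of paths; it closes up since
    \<open>f i = f j\<close>.\<close>
  let ?\<alpha> = "rev (map f [Suc i..<Suc j])"
  have ne: "[Suc i..<Suc j] \<noteq> []" using ij by simp
  have "src G (f (j - Suc k)) \<in> rng G (f (j - k))" if "Suc k < j - i" for k
    using f(2)[of "j - Suc k"] that Suc_diff_Suc[of k j] by simp
  then have "ug_path G ?\<alpha>"
    using f ij(2) by (auto simp: ug_path_def rev_nth Suc_diff_Suc simp del: upt_Suc)
  moreover have "set ?\<alpha> \<inter> cyc_edges = {}" using f(1) by auto
  moreover have "hd ?\<alpha> = f j" "last ?\<alpha> = f (Suc i)"
    using ij(2) ne by (simp_all add: hd_rev last_rev last_map hd_map del: upt_Suc)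
  ultimately show False using nonC_not_closed[of ?\<alpha>] f(2)[of i] ij(1) by metis
qed

definition acyclic_paths :: "'v \<Rightarrow> 'e list set" where
  "acyclic_paths v = {\<alpha>. ug_path G \<alpha> \<and> set \<alpha> \<inter> cyc_edges = {} \<and> v \<in> rng G (last \<alpha>)}"

lemma acyclic_paths_subset:
  "acyclic_paths v \<subseteq> (\<Union>e\<in>{e \<in> edges G - cyc_edges. v \<in> rng G e}.
     {[e]} \<union> (\<lambda>\<alpha>. \<alpha> @ [e]) ` acyclic_paths (src G e))"
proof
  fix \<alpha> assume \<alpha>: "\<alpha> \<in> acyclic_paths v"
  then obtain \<beta> e where \<beta>: "\<alpha> = \<beta> @ [e]" by (cases \<alpha> rule: rev_cases) (auto simp: acyclic_paths_def)
  have "\<beta> \<in> acyclic_paths (src G e)" if "\<beta> \<noteq> []"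
    using \<alpha> that unfolding \<beta> acyclic_paths_def by (auto simp: ug_path_append)
  moreover have "e \<in> {e \<in> edges G - cyc_edges. v \<in> rng G e}"
    using \<alpha> unfolding \<beta> acyclic_paths_def by (auto simp: ug_path_def)
  ultimately show "\<alpha> \<in> (\<Union>e\<in>{e \<in> edges G - cyc_edges. v \<in> rng G e}.
     {[e]} \<union> (\<lambda>\<alpha>. \<alpha> @ [e]) ` acyclic_paths (src G e))"
    unfolding \<beta> by (cases "\<beta> = []") auto
qed

lemma finite_receivers: "v \<in> verts G \<Longrightarrow> finite {e \<in> edges G - cyc_edges. v \<in> rng G e}"
  using grfd unfolding graph_RFD_def no_inf_receivers_def by (elim conjE) (erule (1) ballE[THEN finite_subset[rotated]], auto)

text \<open>A backward form of Koenig's lemma: each vertex has finitely many incoming edges by (B1),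
  and going backwards terminates by (B3).\<close>

lemma finite_acyclic_paths_src: "e \<in> edges G - cyc_edges \<Longrightarrow> finite (acyclic_paths (src G e))"
proof (induction e rule: wf_induct_rule[OF wf_precedes])
  case (1 e)
  have sv: "src G e \<in> verts G" using ug 1(2) by simp
  have "finite (acyclic_paths (src G e'))" if "e' \<in> edges G - cyc_edges" "src G e \<in> rng G e'" for e'
    using 1 that by (auto simp: precedes_def)
  then show ?case
    by (intro finite_subset[OF acyclic_paths_subset] finite_UN_I finite_receivers[OF sv]) auto
qed

lemma finite_acyclic_paths: "v \<in> verts G \<Longrightarrow> finite (acyclic_paths v)"
  using finite_acyclic_paths_src
  by (intro finite_subset[OF acyclic_paths_subset] finite_UN_I finite_receivers) auto

text \<open>A cycle is collapsed: since it has no exit, the only continuation of a path that has reached the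
  cycle vertex \<open>v\<close> is winding, so the point is \<open>(\<alpha>, {v})\<close> with \<open>\<alpha>\<close> avoiding the edges on cycles.\<close>

definition is_root :: "'v set \<Rightarrow> bool" where
  "is_root t \<longleftrightarrow> minset G t \<or> (\<exists>v\<in>verts G. t = {v} \<and> (\<not> is_regular G v \<or> on_cycle G v))"

lemma is_root_gen_verts: "is_root t \<Longrightarrow> t \<in> gen_verts G"
  using minset_gen_verts by (auto simp: is_root_def)

lemma is_root_nonempty: "is_root t \<Longrightarrow> t \<noteq> {}"
  by (auto simp: is_root_def minset_def)

lemma is_root_prime:
  assumes "is_root t" "A \<in> gen_verts G" "B \<in> gen_verts G"
  shows "t \<subseteq> A \<union> B \<longleftrightarrow> t \<subseteq> A \<or> t \<subseteq> B"
  using assms minset_prime[of G t A B] by (auto simp: is_root_def)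

lemma is_root_terminal: "A \<in> terminal_sets G \<Longrightarrow> is_root A"
  using min_inf_emitter_cases[OF ug, of A]
  by (auto simp: terminal_sets_def is_root_def minset_def min_sink_def is_sink_def is_regular_def)

lemma is_root_cyc:
  assumes "e \<in> cyc_edges"
  shows "is_root {src G e}" "is_root (rng G e)"
proof -
  show "is_root {src G e}" using assms ug by (auto simp: is_root_def cyc_edges_def)
  show "is_root (rng G e)" by (rule cyc_rng[OF assms]) (auto simp: is_root_def)
qed

text \<open>Finite paths off the cycles together with the place where they stop. Inclusion of t in
  the range replaces membership of a vertex, so a minimal infinite set counts as a single end
  point.\<close>

definition points :: "('e list \<times> 'v set) set" where
  "points = {(a, t). is_root t \<and> (a = [] \<or> ug_path G a \<and> set a \<inter> cyc_edges = {} \<and> t \<subseteq> rng G (last a))}"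

definition D0 :: "'v set \<Rightarrow> ('e list \<times> 'v set) set" where
  "D0 A = {(a, t) \<in> points. if a = [] then t \<subseteq> A else src G (hd a) \<in> A}"

definition R0 :: "'e \<Rightarrow> ('e list \<times> 'v set) set" where
  "R0 e = {(a, t) \<in> points. if e \<in> cyc_edges then a = [] \<and> t = {src G e} else a \<noteq> [] \<and> hd a = e}"

definition th0 :: "'e \<Rightarrow> 'e list \<times> 'v set \<Rightarrow> 'e list \<times> 'v set" where
  "th0 e = (\<lambda>(a, t). if e \<in> cyc_edges then ([], {src G e}) else (e # a, t))"

definition sg0 :: "'e \<Rightarrow> 'e list \<times> 'v set \<Rightarrow> 'e list \<times> 'v set" where
  "sg0 e = (\<lambda>(a, t). if e \<in> cyc_edges then ([], rng G e) else (tl a, t))"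

lemma hd_point_not_cyc: "(a, t) \<in> points \<Longrightarrow> a \<noteq> [] \<Longrightarrow> hd a \<in> edges G \<and> hd a \<notin> cyc_edges"
  by (cases a) (auto simp: points_def ug_path_Cons)

lemma D0_on_cycle:
  assumes "on_cycle G v" "(a, t) \<in> D0 {v}"
  shows "a = [] \<and> t = {v}"
  using assms hd_point_not_cyc[of a t] is_root_nonempty[of t]
  by (cases "a = []") (auto simp: D0_def points_def cyc_edges_def)

text \<open>Additivity of \<open>D0\<close> on unions is primality of the roots. Exhaustion at a
  regular vertex holds because a point with empty path over it can only be a vertex on a cycle,
  whose one edge covers it.\<close>

lemma gset0: "gset G D0 R0 th0 sg0"
proof
  show "D0 {} = {}" using is_root_nonempty by (auto simp: D0_def points_def)
  fix A B assume AB: "A \<in> gen_verts G" "B \<in> gen_verts G"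
  show "D0 (A \<inter> B) = D0 A \<inter> D0 B" by (auto simp: D0_def)
  show "D0 (A \<union> B) = D0 A \<union> D0 B"
    using is_root_prime[OF _ AB] by (auto simp: D0_def points_def)
next
  fix e \<xi> assume e: "e \<in> edges G" and \<xi>: "\<xi> \<in> D0 (rng G e)"
  obtain a t where at: "\<xi> = (a, t)" by fastforce
  show "th0 e \<xi> \<in> R0 e"
  proof (cases "e \<in> cyc_edges")
    case True
    then show ?thesis using is_root_cyc by (auto simp: at th0_def R0_def points_def)
  next
    case False
    then show ?thesis using \<xi> e by (auto simp: at th0_def R0_def D0_def points_def ug_path_Cons)
  qed
  show "sg0 e (th0 e \<xi>) = \<xi>"
  proof (cases "e \<in> cyc_edges")
    case True
    \<comment> \<open>For e on a cycle \<open>th0 e\<close> forgets its argument. It can be inverted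
      nevertheless, because only one point lies over a vertex on a cycle.\<close>
    then obtain w where "rng G e = {w}" "on_cycle G w" by (rule cyc_rng)
    then have "a = [] \<and> t = rng G e" using D0_on_cycle[of w a t] \<xi> at by auto
    then show ?thesis using True by (simp add: at th0_def sg0_def)
  qed (simp add: at th0_def sg0_def)
next
  fix e \<xi> assume e: "e \<in> edges G" and \<xi>: "\<xi> \<in> R0 e"
  obtain a t where at: "\<xi> = (a, t)" by fastforce
  have p: "(a, t) \<in> points" using \<xi> at by (simp add: R0_def)
  show "sg0 e \<xi> \<in> D0 (rng G e)"
  proof (cases "e \<in> cyc_edges")
    case True
    then show ?thesis using is_root_cyc by (auto simp: at sg0_def D0_def points_def)
  next
    case False
    then obtain b where b: "a = e # b" using \<xi> by (cases a) (auto simp: at R0_def)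
    show ?thesis using p False unfolding b at
      by (auto simp: sg0_def D0_def points_def ug_path_Cons)
  qed
  show "th0 e (sg0 e \<xi>) = \<xi>"
    using \<xi> by (cases a) (auto simp: at th0_def sg0_def R0_def split: if_splits)
  show "\<xi> \<in> D0 {src G e}"
    using \<xi> by (auto simp: at D0_def R0_def split: if_splits)
next
  fix e f \<xi> assume ef: "e \<in> edges G" "f \<in> edges G" "\<xi> \<in> R0 e" "\<xi> \<in> R0 f"
  show "e = f"
    using ef(3,4) cyc_unique[OF _ ef(1), of f] by (auto simp: R0_def split: if_splits)
next
  fix v \<xi> assume v: "is_regular G v" and \<xi>: "\<xi> \<in> D0 {v}"
  obtain a t where at: "\<xi> = (a, t)" by fastforce
  have p: "(a, t) \<in> points" using \<xi> at by (simp add: D0_def)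
  show "\<exists>e\<in>emits G {v}. \<xi> \<in> R0 e"
  proof (cases "a = []")
    case True
    then have t: "is_root t" "t \<subseteq> {v}" using \<xi> by (auto simp: at D0_def points_def)
    then have "t = {v}" using is_root_nonempty by blast
    then have "on_cycle G v" using t v by (auto simp: is_root_def minset_def)
    then obtain e where e: "e \<in> cyc_edges" "src G e = v" by (rule on_cycle_edge)
    then have "\<xi> \<in> R0 e" using p True \<open>t = {v}\<close> by (simp add: at R0_def)
    moreover have "e \<in> emits G {v}" using e cyc_edges_edges by (auto simp: emits_def)
    ultimately show ?thesis by blast
  next
    case False
    then have "hd a \<in> edges G" "hd a \<notin> cyc_edges" "src G (hd a) = v"
      using hd_point_not_cyc[OF p] \<xi> by (auto simp: at D0_def)
    then show ?thesis using False p by (intro bexI[of _ "hd a"]) (auto simp: at R0_def emits_def)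
  qed
qed

sublocale b: gset G D0 R0 th0 sg0
  by (rule gset0)

lemma D0_path:
  assumes "ug_path G \<alpha>" "\<xi> \<in> D0 (rng G (last \<alpha>))"
  shows "b.pt \<alpha> \<xi> \<in> D0 {path_src G \<alpha>}"
proof -
  have "hd \<alpha> \<in> edges G" using assms(1) by (intro hd_edges ug_path_edges) auto
  then show ?thesis using b.R_src[OF _ b.pt_R[OF ug assms]] by (simp add: path_src_def)
qed

lemma root_in_D0: "is_root t \<Longrightarrow> t \<subseteq> A \<Longrightarrow> ([], t) \<in> D0 A"
  by (simp add: D0_def points_def)

lemma root_on_cycle: "on_cycle G v \<Longrightarrow> is_root {v}"
  by (auto simp: is_root_def dest: on_cycle_regular simp: is_regular_def)

text \<open>This is where (B4) enters: a terminal set or cycle reached from v is the end of a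
  boundary point over v, so p_v acts nontrivially.\<close>

lemma D0_vertex_nonempty:
  assumes "v \<in> verts G"
  shows "D0 {v} \<noteq> {}"
proof -
  have "reaches_terminal_set G v \<or> reaches_cycle G v" using grfd assms by (simp add: graph_RFD_def)
  then show ?thesis
  proof
    assume "reaches_terminal_set G v"
    then consider "is_root {v}" | \<alpha> A where "ug_path G \<alpha>" "path_src G \<alpha> = v" "is_root A" "A \<subseteq> rng G (last \<alpha>)"
      unfolding reaches_terminal_set_def path_rng_def using is_root_terminal by blast
    then show ?thesis
    proof cases
      case 1
      then show ?thesis using root_in_D0 by blast
    next
      case 2
      then show ?thesis using D0_path[of \<alpha>] root_in_D0 by blast
    qed
  next
    assume "reaches_cycle G v"
    then consider "on_cycle G v" | \<alpha> w where "ug_path G \<alpha>" "path_src G \<alpha> = v" "on_cycle G w" "w \<in> rng G (last \<alpha>)"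
      unfolding reaches_cycle_def path_rng_def by blast
    then show ?thesis
    proof cases
      case 1
      then show ?thesis using root_in_D0 root_on_cycle by blast
    next
      case 2
      then have "{w} \<subseteq> rng G (last \<alpha>)" by simp
      then show ?thesis using D0_path[of \<alpha>] root_in_D0 root_on_cycle 2 by blast
    qed
  qed
qed

lemma D0_nonempty: "A \<in> gen_verts G \<Longrightarrow> A \<noteq> {} \<Longrightarrow> D0 A \<noteq> {}"
  using gen_verts_subset[OF ug, of A] D0_vertex_nonempty b.D_mono[of "{_}" A] by (metis (no_types, lifting)
      all_not_in_conv empty_subsetI gen_verts.vertex insert_subset subset_iff)

text \<open>Edges change the end of a point only along cycles. These are therefore the sets S for
  which the points ending in S form a finite invariant piece of the action.\<close>

definition closed_roots :: "'v set set \<Rightarrow> bool" where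
  "closed_roots S \<longleftrightarrow> finite {p \<in> points. snd p \<in> S} \<and>
    (\<forall>e\<in>cyc_edges. {src G e} \<in> S \<longleftrightarrow> rng G e \<in> S)"

text \<open>Every nonempty path that stops at t has any chosen vertex of t in its range, so
  finiteness of the acyclic paths into that one vertex suffices even when t is infinite.\<close>

lemma finite_points:
  assumes "finite S"
  shows "finite {p \<in> points. snd p \<in> S}"
proof -
  have "{p \<in> points. snd p \<in> S} \<subseteq> (\<Union>t\<in>{t \<in> S. is_root t}. insert [] (acyclic_paths (SOME v. v \<in> t)) \<times> {t})"
  proof clarify
    fix a t assume at: "(a, t) \<in> points" "snd (a, t) \<in> S"
    then have t: "is_root t" "t \<in> S" by (auto simp: points_def)
    have "(SOME v. v \<in> t) \<in> t" using is_root_nonempty[OF t(1)] by (meson all_not_in_conv someI)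
    then have "a \<in> insert [] (acyclic_paths (SOME v. v \<in> t))"
      using at by (auto simp: points_def acyclic_paths_def)
    then show "(a, t) \<in> (\<Union>t\<in>{t \<in> S. is_root t}. insert [] (acyclic_paths (SOME v. v \<in> t)) \<times> {t})"
      using t by blast
  qed
  moreover have "finite (acyclic_paths (SOME v. v \<in> t))" if "is_root t" for t
  proof (rule finite_acyclic_paths)
    have "(SOME v. v \<in> t) \<in> t" using is_root_nonempty[OF that] by (meson all_not_in_conv someI)
    then show "(SOME v. v \<in> t) \<in> verts G" using gen_verts_subset[OF ug is_root_gen_verts[OF that]] by blast
  qed
  ultimately show ?thesis
    using assms by (elim finite_subset) (intro finite_UN_I finite_cartesian_product; simp)
qed

text \<open>For a vertex on a cycle take all vertices of that cycle; any other root is never changed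
  by an edge and forms a set by itself.\<close>

lemma ex_closed_roots:
  assumes "is_root t"
  shows "\<exists>S. t \<in> S \<and> closed_roots S"
proof (cases "\<exists>v. t = {v} \<and> on_cycle G v")
  case True
  then obtain v c where v: "t = {v}" "ug_cycle G c" "v \<in> src G ` set c" by (auto simp: on_cycle_def)
  let ?S = "(\<lambda>e. {src G e}) ` set c"
  have "{src G e} \<in> ?S \<longleftrightarrow> rng G e \<in> ?S" if e: "e \<in> cyc_edges" for e
  proof
    assume "{src G e} \<in> ?S"
    then have "e \<in> set c" using cycle_unique_edge[OF v(2)] cyc_edges_edges[OF e] by auto
    then show "rng G e \<in> ?S" using cycle_edge_rng[OF v(2)] by blast
  next
    assume "rng G e \<in> ?S"
    then have "e \<in> set c" using cycle_pred[OF v(2) e] by auto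
    then show "{src G e} \<in> ?S" by blast
  qed
  then show ?thesis using v finite_points[of ?S] unfolding closed_roots_def by (intro exI[of _ ?S]) auto
next
  case False
  have "{src G e} \<noteq> t" "rng G e \<noteq> t" if "e \<in> cyc_edges" for e
    using False that cyc_rng[OF that] by (auto simp: cyc_edges_def)
  then show ?thesis using finite_points[of "{t}"] unfolding closed_roots_def by (intro exI[of _ "{t}"]) auto
qed

lemma th0_root:
  assumes "closed_roots S" "e \<in> edges G" "\<xi> \<in> D0 (rng G e)"
  shows "snd (th0 e \<xi>) \<in> S \<longleftrightarrow> snd \<xi> \<in> S"
proof (cases "e \<in> cyc_edges")
  case True
  then obtain w where w: "rng G e = {w}" "on_cycle G w" by (rule cyc_rng)
  obtain a t where at: "\<xi> = (a, t)" by fastforce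
  have "t = rng G e" using D0_on_cycle[OF w(2), of a t] assms(3) w(1) at by auto
  then show ?thesis using assms(1) True by (auto simp: at th0_def closed_roots_def)
qed (auto simp: th0_def split: prod.splits)

lemma gset_cover:
  assumes "closed_roots S" "(N :: int) > 0"
  shows "gset G (\<lambda>A. (D0 A \<inter> {p. snd p \<in> S}) \<times> {0..<N}) (\<lambda>e. (R0 e \<inter> {p. snd p \<in> S}) \<times> {0..<N})
    (\<lambda>e (\<xi>, j). (th0 e \<xi>, (j + 1) mod N)) (\<lambda>e (\<xi>, j). (sg0 e \<xi>, (j - 1) mod N))"
  using th0_root[OF assms(1)] by (intro gset_restrict_cyclic gset0 assms(2)) auto

end

section \<open>Spanning by path units\<close>

text \<open>A finite part of the ultragraph that supports a given element: edges \<open>F\<close>, and the sets \<open>T0\<close> and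
  vertices \<open>V0\<close> out of which the ranges of the edges in \<open>F\<close> are made.  A cell projection \<open>q t\<close> is what
  remains of \<open>p\<^sub>t\<close> after removing the smaller cells and the ranges of the \<open>s\<^sub>e\<close> with \<open>e\<close> in \<open>F\<close>; edges
  on cycles are exempt, as \<open>s\<^sub>e s\<^sub>e\<^sup>* = p\<^bsub>s(e)\<^esub>\<close> for them.\<close>

locale rfd_data = rfd_ultragraph G for G :: "('v, 'e) ultragraph" +
  fixes F :: "'e set" and V0 :: "'v set" and T0 :: "'v set set"
  assumes fin: "finite F" "finite V0" "finite T0"
    and F_edges: "F \<subseteq> edges G" and V0_verts: "V0 \<subseteq> verts G" and F_src: "\<And>e. e \<in> F \<Longrightarrow> src G e \<in> V0"
    and T0_minset: "\<And>T. T \<in> T0 \<Longrightarrow> minset G T"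
    and T0_Int: "\<And>T T'. T \<in> T0 \<Longrightarrow> T' \<in> T0 \<Longrightarrow> T \<noteq> T' \<Longrightarrow> T \<inter> T' \<subseteq> V0"
    and F_rng: "\<And>e. e \<in> F \<Longrightarrow> rng G e = \<Union>{T \<in> T0. T \<subseteq> rng G e} \<union> (V0 \<inter> rng G e)"
begin

text \<open>The members of \<open>gen_verts G\<close> that the chosen pieces can resolve: their
  projections are sums of cell projections up to terms s_e p_{r(e)} s_e^* with e in
  \<open>F'\<close>.\<close>

definition fam :: "'v set \<Rightarrow> bool" where
  "fam A \<longleftrightarrow> A \<in> gen_verts G \<and> A = \<Union>{T \<in> T0. T \<subseteq> A} \<union> (V0 \<inter> A)"

definition F' :: "'e set" where "F' = F - cyc_edges"

definition q :: "'v set \<Rightarrow> ('v, 'e, 'k::field) free_elem" where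
  "q t = PP t - (\<Sum>v\<in>{v \<in> V0 \<inter> t. {v} \<noteq> t}. PP {v}) - (\<Sum>e\<in>{e \<in> F'. {src G e} = t}. sp [e] * gp [e])"

text \<open>The boundary points that \<open>q t\<close> fixes; it kills all others.\<close>

definition Dq :: "'v set \<Rightarrow> ('e list \<times> 'v set) set" where
  "Dq t = {p \<in> D0 t. (\<forall>v\<in>V0 \<inter> t. {v} \<noteq> t \<longrightarrow> p \<notin> D0 {v}) \<and> (\<forall>e\<in>F'. {src G e} = t \<longrightarrow> p \<notin> R0 e)}"

definition cells :: "'v set set" where "cells = T0 \<union> (\<lambda>v. {v}) ` V0"

lemma F'_F: "e \<in> F' \<Longrightarrow> e \<in> F" "e \<in> F' \<Longrightarrow> e \<notin> cyc_edges" "e \<in> F' \<Longrightarrow> e \<in> edges G"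
  using F_edges by (auto simp: F'_def)

lemma F_edge: "e \<in> F \<Longrightarrow> e \<in> edges G"
  using F_edges by blast

lemma fin_sums: "finite {v \<in> V0 \<inter> t. {v} \<noteq> t}" "finite {e \<in> F'. {src G e} = t}" "finite F'"
  using fin by (auto simp: F'_def)

lemma fam_gen_verts: "fam A \<Longrightarrow> A \<in> gen_verts G"
  by (simp add: fam_def)

lemma fam_rng: "e \<in> F \<Longrightarrow> fam (rng G e)"
  using F_rng F_edge by (auto simp: fam_def)

lemma fam_singleton: "v \<in> V0 \<Longrightarrow> fam {v}"
  using V0_verts T0_minset by (auto simp: fam_def)

lemma cells_gen_verts: "t \<in> cells \<Longrightarrow> t \<in> gen_verts G"
  using T0_minset minset_gen_verts V0_verts by (auto simp: cells_def)

lemma T0_infinite: "T \<in> T0 \<Longrightarrow> infinite T"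
  using T0_minset by (simp add: minset_def)

lemma cells_nonempty: "t \<in> cells \<Longrightarrow> t \<noteq> {}"
  using T0_infinite by (auto simp: cells_def)

lemma q_T0: "T \<in> T0 \<Longrightarrow> q T = PP T - (\<Sum>v\<in>V0 \<inter> T. PP {v})"
proof -
  assume "T \<in> T0"
  then have "infinite T" by (rule T0_infinite)
  then have "{v \<in> V0 \<inter> T. {v} \<noteq> T} = V0 \<inter> T" and E: "{e \<in> F'. {src G e} = T} = {}" by auto
  then show ?thesis unfolding q_def E by simp
qed

lemma q_singleton: "q {v} = PP {v} - (\<Sum>e\<in>{e \<in> F'. src G e = v}. sp [e] * gp [e])"
proof -
  have "{v' \<in> V0 \<inter> {v}. {v'} \<noteq> {v}} = {}" by auto
  then show ?thesis by (simp add: q_def)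
qed

lemma q_cyc: "on_cycle G w \<Longrightarrow> q {w} = PP {w}"
proof -
  assume "on_cycle G w"
  then have E: "{e \<in> F'. src G e = w} = {}" using F'_F cyc_edge_iff by blast
  show ?thesis unfolding q_singleton E by simp
qed

lemma q_fcar [simp]:
  assumes t: "t \<in> cells"
  shows "q t \<in> fcar G"
  unfolding q_def sp_def gp_def
  using cells_gen_verts[OF t] V0_verts F'_F(3) by (intro fcar_diff fcar_sum fcar_mult1) auto

lemma lcong_PP_edge:
  "A \<in> gen_verts G \<Longrightarrow> e \<in> edges G \<Longrightarrow> lcong G (PP A * sp [e]) (if src G e \<in> A then sp [e] else 0)"
  using lcong_PP_sp[OF ug, of A "[e]"] by simp

lemma lcong_edge_PP:
  "A \<in> gen_verts G \<Longrightarrow> e \<in> edges G \<Longrightarrow> lcong G (gp [e] * PP A) (if src G e \<in> A then gp [e] else 0)"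
  using lcong_gp_PP[OF ug, of A "[e]"] by simp

lemma fam_Int_T0: "fam A \<Longrightarrow> T \<in> T0 \<Longrightarrow> \<not> T \<subseteq> A \<Longrightarrow> A \<inter> T \<subseteq> V0"
proof
  fix x assume *: "fam A" "T \<in> T0" "\<not> T \<subseteq> A" "x \<in> A \<inter> T"
  then have "x \<in> \<Union>{T \<in> T0. T \<subseteq> A} \<union> (V0 \<inter> A)" unfolding fam_def by blast
  then show "x \<in> V0" using T0_Int[of _ T] * by blast
qed

text \<open>Cells are atoms relative to \<open>fam\<close>: a set in \<open>fam\<close> that does
  not contain an infinite cell meets it inside \<open>V0\<close> only, and the vertices of
  \<open>V0\<close> have been removed from \<open>q t\<close>.\<close>

lemma lcong_PP_q:
  assumes A: "fam A" and t: "t \<in> cells"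
  shows "lcong G (PP A * q t :: ('v, 'e, 'k::field) free_elem) (if t \<subseteq> A then q t else 0)"
proof -
  have Ag: "A \<in> gen_verts G" and tg: "t \<in> gen_verts G" using A t fam_gen_verts cells_gen_verts by auto
  let ?V = "{v \<in> V0 \<inter> t. {v} \<noteq> t}" and ?E = "{e \<in> F'. {src G e} = t}"
  have eq: "PP A * q t = PP A * PP t - (\<Sum>v\<in>?V. PP A * PP {v}) - (\<Sum>e\<in>?E. PP A * sp [e] * gp [e])"
    by (simp add: q_def right_diff_distrib sum_distrib_left mult.assoc)
  have E: "lcong G (\<Sum>e\<in>?E. PP A * sp [e] * gp [e]) (\<Sum>e\<in>?E. (if src G e \<in> A then sp [e] else 0) * gp [e])"
    using F'_F(3) Ag by (intro lcong_sum lcong_multr lcong_PP_edge) auto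
  have V: "lcong G (\<Sum>v\<in>?V. PP A * PP {v}) (\<Sum>v\<in>?V. if v \<in> A then PP {v} else 0)"
    using V0_verts Ag by (intro lcong_sum lcong_PP_PP_if(1)) auto
  have P: "lcong G (PP A * PP t) (PP (A \<inter> t))" by (rule lcong_PP_PP[OF Ag tg])
  have all: "lcong G (PP A * q t :: ('v, 'e, 'k) free_elem) (PP (A \<inter> t) - (\<Sum>v\<in>?V. if v \<in> A then PP {v} else 0) -
      (\<Sum>e\<in>?E. (if src G e \<in> A then sp [e] else 0) * gp [e]))"
    unfolding eq by (intro lcong_diff P V E)
  show ?thesis
  proof (cases "t \<subseteq> A")
    case True
    have "(\<Sum>v\<in>?V. if v \<in> A then PP {v} else 0 :: ('v, 'e, 'k) free_elem) = (\<Sum>v\<in>?V. PP {v})"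
      "(\<Sum>e\<in>?E. (if src G e \<in> A then sp [e] else 0 :: ('v, 'e, 'k) free_elem) * gp [e]) = (\<Sum>e\<in>?E. sp [e] * gp [e])"
      using True by (auto intro!: sum.cong)
    moreover have "A \<inter> t = t" using True by blast
    ultimately show ?thesis using all True unfolding q_def by simp
  next
    case False
    show ?thesis
    proof (cases "t \<in> T0")
      case True
      then have "infinite t" by (rule T0_infinite)
      then have E0: "?E = {}" and V0': "?V = V0 \<inter> t" by auto
      have sub: "A \<inter> t \<subseteq> V0" by (rule fam_Int_T0[OF A True False])
      then have "lcong G (PP (A \<inter> t) :: ('v, 'e, 'k) free_elem) (\<Sum>v\<in>A \<inter> t. PP {v})"
        using fin V0_verts finite_subset by (intro lcong_PP_finite[OF ug]) auto
      moreover have "(\<Sum>v\<in>V0 \<inter> t. if v \<in> A then PP {v} else 0 :: ('v, 'e, 'k) free_elem) = (\<Sum>v\<in>A \<inter> t. PP {v})"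
        using sub fin by (intro sum.mono_neutral_cong_right) auto
      ultimately have "lcong G (PP (A \<inter> t) - (\<Sum>v\<in>V0 \<inter> t. if v \<in> A then PP {v} else 0) - 0 :: ('v, 'e, 'k) free_elem)
          ((\<Sum>v\<in>A \<inter> t. PP {v}) - (\<Sum>v\<in>A \<inter> t. PP {v}) - 0)"
        by (intro lcong_diff) auto
      then show ?thesis using all False unfolding E0 V0' by (auto intro: lcong_trans)
    next
      case F: False
      then obtain v where v: "t = {v}" using t by (auto simp: cells_def)
      then have "v \<notin> A" "?V = {}" "A \<inter> t = {}" using False by auto
      then show ?thesis using all False v lcong_PP_empty[of G] by (auto intro: lcong_trans)
    qed
  qed
qed

lemma lcong_q_PP:
  assumes A: "fam A" and t: "t \<in> cells"
  shows "lcong G (q t * PP A :: ('v, 'e, 'k::field) free_elem) (if t \<subseteq> A then q t else 0)"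
proof -
  have Ag: "A \<in> gen_verts G" and tg: "t \<in> gen_verts G" using A t fam_gen_verts cells_gen_verts by auto
  let ?V = "{v \<in> V0 \<inter> t. {v} \<noteq> t}" and ?E = "{e \<in> F'. {src G e} = t}"
  have eq: "q t * PP A = PP t * PP A - (\<Sum>v\<in>?V. PP {v} * PP A) - (\<Sum>e\<in>?E. sp [e] * (gp [e] * PP A))"
    by (simp add: q_def left_diff_distrib sum_distrib_right mult.assoc)
  have E: "lcong G (\<Sum>e\<in>?E. sp [e] * (gp [e] * PP A)) (\<Sum>e\<in>?E. sp [e] * (if src G e \<in> A then gp [e] else 0))"
    using F'_F(3) Ag by (intro lcong_sum lcong_multl lcong_edge_PP) auto
  have V: "lcong G (\<Sum>v\<in>?V. PP {v} * PP A) (\<Sum>v\<in>?V. if v \<in> A then PP {v} else 0)"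
    using V0_verts Ag by (intro lcong_sum lcong_PP_PP_if(2)) auto
  have P: "lcong G (PP t * PP A) (PP (t \<inter> A))" by (rule lcong_PP_PP[OF tg Ag])
  have all: "lcong G (q t * PP A :: ('v, 'e, 'k) free_elem) (PP (t \<inter> A) - (\<Sum>v\<in>?V. if v \<in> A then PP {v} else 0) -
      (\<Sum>e\<in>?E. sp [e] * (if src G e \<in> A then gp [e] else 0)))"
    unfolding eq by (intro lcong_diff P V E)
  show ?thesis
  proof (cases "t \<subseteq> A")
    case True
    have "(\<Sum>v\<in>?V. if v \<in> A then PP {v} else 0 :: ('v, 'e, 'k) free_elem) = (\<Sum>v\<in>?V. PP {v})"
      "(\<Sum>e\<in>?E. sp [e] * (if src G e \<in> A then gp [e] else 0 :: ('v, 'e, 'k) free_elem)) = (\<Sum>e\<in>?E. sp [e] * gp [e])"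
      using True by (auto intro!: sum.cong)
    moreover have "t \<inter> A = t" using True by blast
    ultimately show ?thesis using all True unfolding q_def by simp
  next
    case False
    show ?thesis
    proof (cases "t \<in> T0")
      case True
      then have "infinite t" by (rule T0_infinite)
      then have E0: "?E = {}" and V0': "?V = V0 \<inter> t" by auto
      have sub: "t \<inter> A \<subseteq> V0" using fam_Int_T0[OF A True False] by blast
      then have "lcong G (PP (t \<inter> A) :: ('v, 'e, 'k) free_elem) (\<Sum>v\<in>t \<inter> A. PP {v})"
        using fin V0_verts finite_subset by (intro lcong_PP_finite[OF ug]) auto
      moreover have "(\<Sum>v\<in>V0 \<inter> t. if v \<in> A then PP {v} else 0 :: ('v, 'e, 'k) free_elem) = (\<Sum>v\<in>t \<inter> A. PP {v})"
        using sub fin by (intro sum.mono_neutral_cong_right) auto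
      ultimately have "lcong G (PP (t \<inter> A) - (\<Sum>v\<in>V0 \<inter> t. if v \<in> A then PP {v} else 0) - 0 :: ('v, 'e, 'k) free_elem)
          ((\<Sum>v\<in>t \<inter> A. PP {v}) - (\<Sum>v\<in>t \<inter> A. PP {v}) - 0)"
        by (intro lcong_diff) auto
      then show ?thesis using all False unfolding E0 V0' by (auto intro: lcong_trans)
    next
      case F: False
      then obtain v where v: "t = {v}" using t by (auto simp: cells_def)
      then have "v \<notin> A" "?V = {}" "t \<inter> A = {}" using False by auto
      then show ?thesis using all False v lcong_PP_empty[of G] by (auto intro: lcong_trans)
    qed
  qed
qed

text \<open>For e in \<open>F'\<close> the term s_e s_e^* was subtracted from the cell of its
  source, so s_e^* annihilates that cell. For an edge on a cycle nothing was subtracted, and s_e^*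
  survives.\<close>

lemma lcong_gp_q:
  assumes e: "e \<in> F" and t: "t \<in> cells"
  shows "lcong G (gp [e] * q t :: ('v, 'e, 'k::field) free_elem) (if {src G e} = t \<and> e \<in> cyc_edges then gp [e] else 0)"
proof (cases "{src G e} = t")
  case False
  have s: "fam {src G e}" using fam_singleton F_src e by blast
  have "lcong G (gp [e] * q t) ((gp [e] * PP {src G e}) * q t)"
    using lcong_sym[OF lcong_edge(4)[OF F_edge[OF e]]] t by (intro lcong_multr) auto
  also have "(gp [e] * PP {src G e}) * q t = gp [e] * (PP {src G e} * q t)" by (simp add: mult.assoc)
  also have "lcong G \<dots> (gp [e] * (if t \<subseteq> {src G e} then q t else 0))"
    using F_edge[OF e] by (intro lcong_multl lcong_PP_q s t) auto
  finally have "lcong G (gp [e] * q t) (gp [e] * (if t \<subseteq> {src G e} then q t else 0))" .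
  moreover have "\<not> t \<subseteq> {src G e}" using False cells_nonempty[OF t] by blast
  ultimately show ?thesis using False by simp
next
  case True
  let ?E = "{f \<in> F'. src G f = src G e}"
  have E: "e \<in> edges G" using F_edge e .
  have eq: "gp [e] * q t = gp [e] * PP {src G e} - (\<Sum>f\<in>?E. (gp [e] * sp [f]) * gp [f])"
    unfolding True[symmetric] q_singleton by (simp add: right_diff_distrib sum_distrib_left mult.assoc)
  have "lcong G (\<Sum>f\<in>?E. (gp [e] * sp [f]) * gp [f]) (\<Sum>f\<in>?E. (if e = f then PP (rng G e) else 0) * gp [f])"
    using F'_F(3) E by (intro lcong_sum lcong_multr lcong_ghost_edge) auto
  also have "(\<Sum>f\<in>?E. (if e = f then PP (rng G e) else 0) * gp [f]) = (\<Sum>f\<in>?E. if f = e then PP (rng G e) * gp [e] else 0)"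
    by (intro sum.cong) auto
  also have "\<dots> = (if e \<in> cyc_edges then 0 else PP (rng G e) * gp [e])"
  proof -
    have "finite ?E" using fin_sums(3) by simp
    moreover have "e \<in> ?E \<longleftrightarrow> e \<notin> cyc_edges" using e by (simp add: F'_def)
    ultimately show ?thesis by (simp only: sum.delta if_not_P split: if_split) simp
  qed
  also have "lcong G \<dots> (if e \<in> cyc_edges then 0 else gp [e])"
    by (simp add: lcong_edge(3)[OF E])
  finally have "lcong G (gp [e] * q t) (gp [e] - (if e \<in> cyc_edges then 0 else gp [e]))"
    unfolding eq by (intro lcong_diff lcong_edge(4)[OF E])
  then show ?thesis using True by (auto split: if_splits)
qed

text \<open>A cell without boundary points is not a root, so it is a regular vertex off the cycles.
  All points over it are covered by edges of \<open>F'\<close>; these are then all its edges, and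
  the Cuntz-Krieger relation makes \<open>q t\<close> vanish. So the boundary action overlooks no
  cell.\<close>

lemma q_LI:
  assumes t: "t \<in> cells" "Dq t = {}"
  shows "q t \<in> LI G"
proof -
  have not_root: "\<not> (is_root t \<and> (\<forall>e\<in>F'. {src G e} = t \<longrightarrow> ([], t) \<notin> R0 e))"
  proof
    assume r: "is_root t \<and> (\<forall>e\<in>F'. {src G e} = t \<longrightarrow> ([], t) \<notin> R0 e)"
    then have "([], t) \<in> Dq t" using cells_nonempty[OF t(1)]
      by (auto simp: Dq_def D0_def points_def)
    then show False using t(2) by blast
  qed
  have R0: "([], s) \<notin> R0 e" if "e \<in> F'" for e s using that F'_F(2) by (auto simp: R0_def)
  have "\<not> is_root t" using not_root R0 by blast
  then obtain v where v: "t = {v}" "v \<in> V0" "v \<in> verts G" "is_regular G v" "\<not> on_cycle G v"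
    using t(1) T0_minset V0_verts by (auto simp: cells_def is_root_def)
  have "emits G {v} = {e \<in> F'. src G e = v}"
  proof
    show "{e \<in> F'. src G e = v} \<subseteq> emits G {v}" using F'_F(3) by (auto simp: emits_def)
    show "emits G {v} \<subseteq> {e \<in> F'. src G e = v}"
    proof
      fix e assume "e \<in> emits G {v}"
      then have e: "e \<in> edges G" "src G e = v" by (auto simp: emits_def)
      have nc: "e \<notin> cyc_edges" using v(5) e by (auto simp: cyc_edges_def)
      \<comment> \<open>The range of e is nonempty, so e carries a boundary point. That point must
        be covered by some edge of \<open>F'\<close>, which can only be e.\<close>
      obtain p where p: "p \<in> D0 (rng G e)" using D0_nonempty[of "rng G e"] is_ultragraph_simps(3)[OF ug] e by blast
      have "th0 e p \<in> R0 e" using b.th_R e p by blast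
      then have thD: "th0 e p \<in> D0 {v}" using b.R_src e by blast
      have "th0 e p \<notin> Dq {v}" using t(2) v(1) by simp
      then obtain f where f: "f \<in> F'" "src G f = v" "th0 e p \<in> R0 f"
        using thD unfolding Dq_def by blast
      then have "f = e" using b.R_disj[of f e] e F'_F(3) \<open>th0 e p \<in> R0 e\<close> by blast
      then show "e \<in> {e \<in> F'. src G e = v}" using f by blast
    qed
  qed
  then show ?thesis using lcong_CK[OF v(4)] unfolding v(1) q_singleton lcong_def by simp
qed

section \<open>The graded span of the units\<close>

definition live :: "'v set set" where "live = {t \<in> cells. Dq t \<noteq> {}}"

lemma live_cells: "t \<in> live \<Longrightarrow> t \<in> cells"
  by (simp add: live_def)

definition fpath :: "'e list \<Rightarrow> 'v set \<Rightarrow> bool" where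
  "fpath \<alpha> t \<longleftrightarrow> set \<alpha> \<subseteq> F \<and> (\<alpha> \<noteq> [] \<longrightarrow> ug_path G \<alpha> \<and> t \<subseteq> rng G (last \<alpha>))"

definition elt :: "'e list \<Rightarrow> 'v set \<Rightarrow> 'e list \<Rightarrow> ('v, 'e, 'k::field) free_elem" where
  "elt \<alpha> t \<beta> = sp \<alpha> * q t * gp \<beta>"

text \<open>Degrees are kept because the action with the factor Z/N sees a unit only through two
  points and its degree; they also limit how many units can occur in a combination of short
  words.\<close>

inductive_set span :: "int \<Rightarrow> ('v, 'e, 'k::field) free_elem set" for d where
  LI: "x \<in> LI G \<Longrightarrow> x \<in> span d"
| elt: "t \<in> live \<Longrightarrow> fpath \<alpha> t \<Longrightarrow> fpath \<beta> t \<Longrightarrow> int (length \<alpha>) - int (length \<beta>) = d \<Longrightarrow> elt \<alpha> t \<beta> \<in> span d"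
| add: "x \<in> span d \<Longrightarrow> y \<in> span d \<Longrightarrow> x + y \<in> span d"
| scale: "x \<in> span d \<Longrightarrow> cst c * x \<in> span d"

lemma span_lcong: "lcong G y x \<Longrightarrow> x \<in> span d \<Longrightarrow> y \<in> span d"
  using span.add[of x d "y - x"] span.LI[of "y - x" d] by (simp add: lcong_def)

lemma span_sum: "(\<And>i. i \<in> S \<Longrightarrow> f i \<in> span d) \<Longrightarrow> sum f S \<in> span d"
  by (induction S rule: infinite_finite_induct) (auto intro: span.add span.LI)

lemma fpath_Nil [simp]: "fpath [] t"
  by (simp add: fpath_def)

lemma fpath_edges: "fpath \<alpha> t \<Longrightarrow> set \<alpha> \<subseteq> edges G"
  using F_edges by (auto simp: fpath_def)

lemma fpath_Cons: "fpath (e # \<alpha>) t \<longleftrightarrow> e \<in> F \<and>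
    (if \<alpha> = [] then t \<subseteq> rng G e else fpath \<alpha> t \<and> src G (hd \<alpha>) \<in> rng G e)"
  using F_edge by (auto simp: fpath_def ug_path_Cons)

lemma fpath_snoc: "\<alpha> \<noteq> [] \<Longrightarrow> fpath (\<alpha> @ [e]) t \<longleftrightarrow> set \<alpha> \<subseteq> F \<and> ug_path G \<alpha> \<and> e \<in> F \<and> src G e \<in> rng G (last \<alpha>) \<and> t \<subseteq> rng G e"
  using F_edge by (auto simp: fpath_def ug_path_append)

lemma elt_span: "t \<in> live \<Longrightarrow> fpath \<alpha> t \<Longrightarrow> fpath \<beta> t \<Longrightarrow> elt \<alpha> t \<beta> \<in> span (int (length \<alpha>) - int (length \<beta>))"
  by (rule span.elt) auto

lemma elt_fcar1: "t \<in> cells \<Longrightarrow> fpath \<alpha> t \<Longrightarrow> fpath \<beta> t \<Longrightarrow> elt \<alpha> t \<beta> \<in> fcar G"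
  unfolding elt_def using fpath_edges by (intro fcar_mult2 fcar_mult1) auto

lemma PP_elt_span:
  assumes A: "fam A" and t: "t \<in> live" "fpath \<alpha> t" "fpath \<beta> t"
  shows "(PP A * elt \<alpha> t \<beta> :: ('v, 'e, 'k::field) free_elem) \<in> span (int (length \<alpha>) - int (length \<beta>))"
proof -
  note e = fpath_edges[OF t(2)] fpath_edges[OF t(3)]
  have "lcong G (PP A * sp \<alpha> * q t :: ('v, 'e, 'k) free_elem) (sp \<alpha> * q t) \<or> lcong G (PP A * sp \<alpha> * q t) (0 :: ('v, 'e, 'k) free_elem)"
  proof (cases "\<alpha> = []")
    case True
    have "lcong G (PP A * q t :: ('v, 'e, 'k) free_elem) (if t \<subseteq> A then q t else 0)"
      by (rule lcong_PP_q[OF A live_cells[OF t(1)]])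
    then show ?thesis using True by (auto simp: sp_simps split: if_splits)
  next
    case False
    have "lcong G (PP A * sp \<alpha> * q t) ((if src G (hd \<alpha>) \<in> A then sp \<alpha> else 0) * q t :: ('v, 'e, 'k) free_elem)"
      using lcong_PP_sp[OF ug fam_gen_verts[OF A] False e(1)] live_cells[OF t(1)] by (intro lcong_multr) auto
    then show ?thesis by (auto split: if_splits)
  qed
  then have "lcong G (PP A * sp \<alpha> * q t * gp \<beta> :: ('v, 'e, 'k) free_elem) (sp \<alpha> * q t * gp \<beta>) \<or> lcong G (PP A * sp \<alpha> * q t * gp \<beta>) (0 * gp \<beta> :: ('v, 'e, 'k) free_elem)"
  proof (elim disjE, goal_cases)
    case 1
    then show ?case by (intro disjI1 lcong_multr[OF gp_fcar1[OF e(2)]])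
  next
    case 2
    then show ?case by (intro disjI2 lcong_multr[OF gp_fcar1[OF e(2)]])
  qed
  then show ?thesis
    using span_lcong elt_span[OF t] span.LI[OF LI_0] by (auto simp: elt_def mult.assoc)
qed

text \<open>If \<alpha> does not continue f, the projection p_{r(f)} kills the unit; otherwise f is
  put in front of \<alpha>.\<close>

lemma sp_elt_span:
  assumes f: "f \<in> F" and t: "t \<in> live" "fpath \<alpha> t" "fpath \<beta> t"
  shows "(sp [f] * elt \<alpha> t \<beta> :: ('v, 'e, 'k::field) free_elem) \<in> span (int (length \<alpha>) - int (length \<beta>) + 1)"
proof -
  note e = fpath_edges[OF t(2)] fpath_edges[OF t(3)] F_edge[OF f] live_cells[OF t(1)]
  have eq: "sp [f] * elt \<alpha> t \<beta> = sp (f # \<alpha>) * q t * gp \<beta>" for \<beta>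
    by (simp add: elt_def sp_Cons[of f \<alpha>] mult.assoc)
  show ?thesis
  proof (cases "fpath (f # \<alpha>) t")
    case True
    then show ?thesis unfolding eq elt_def[symmetric] by (intro span.elt t True) simp
  next
    case False
    have "lcong G (PP (rng G f) * (sp \<alpha> * q t)) (0 :: ('v, 'e, 'k) free_elem)"
    proof (cases "\<alpha> = []")
      case True
      have "lcong G (PP (rng G f) * q t :: ('v, 'e, 'k) free_elem) (if t \<subseteq> rng G f then q t else 0)"
        by (rule lcong_PP_q[OF fam_rng[OF f] e(4)])
      then show ?thesis using True False f by (auto simp: fpath_Cons sp_simps)
    next
      case ne: False
      then have "lcong G (PP (rng G f) * sp \<alpha> * q t) (0 * q t :: ('v, 'e, 'k) free_elem)"
        using False f t e lcong_PP_sp[OF ug gen_verts.rng[OF e(3)] ne e(1)]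
        by (intro lcong_multr) (auto simp: fpath_Cons)
      then show ?thesis by (simp add: mult.assoc)
    qed
    then have "lcong G (sp [f] * (PP (rng G f) * (sp \<alpha> * q t)) * gp \<beta>) (sp [f] * 0 * gp \<beta> :: ('v, 'e, 'k) free_elem)"
      using e by (intro lcong_multr lcong_multl) auto
    moreover have "lcong G ((sp [f] * PP (rng G f)) * (sp \<alpha> * q t * gp \<beta>)) (sp [f] * (sp \<alpha> * q t * gp \<beta>) :: ('v, 'e, 'k) free_elem)"
      using e by (intro lcong_multr lcong_edge(2)) auto
    ultimately have "lcong G (sp [f] * elt \<alpha> t \<beta>) (0 :: ('v, 'e, 'k) free_elem)"
      using lcong_trans lcong_sym by (fastforce simp: elt_def mult.assoc)
    then show ?thesis using span_lcong span.LI[OF LI_0] by blast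
  qed
qed

lemma cell_cyc_rng:
  assumes "f \<in> F" "f \<in> cyc_edges"
  shows "rng G f \<in> live" "q (rng G f) = PP (rng G f)"
proof -
  obtain w where w: "rng G f = {w}" "on_cycle G w" using assms(2) by (rule cyc_rng)
  have "finite (rng G f)" using w by simp
  then have "\<Union>{T \<in> T0. T \<subseteq> rng G f} = {}" using T0_infinite finite_subset cells_nonempty by blast
  then have "w \<in> V0" using F_rng[OF assms(1)] w by blast
  moreover have "([], {w}) \<in> Dq {w}"
    using root_on_cycle[OF w(2)] F'_F(2) by (auto simp: Dq_def D0_def points_def R0_def)
  ultimately show "rng G f \<in> live" using w by (auto simp: live_def cells_def)
  show "q (rng G f) = PP (rng G f)" using q_cyc w by simp
qed

lemma gp_elt_span:
  assumes f: "f \<in> F" and t: "t \<in> live" "fpath \<alpha> t" "fpath \<beta> t"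
  shows "(gp [f] * elt \<alpha> t \<beta> :: ('v, 'e, 'k::field) free_elem) \<in> span (int (length \<alpha>) - int (length \<beta>) - 1)"
proof (cases \<alpha>)
  case (Cons g \<alpha>')
  note e = fpath_edges[OF t(2)] fpath_edges[OF t(3)] F_edge[OF f] live_cells[OF t(1)]
  have s: "set \<alpha>' \<subseteq> edges G" "g \<in> edges G" "g \<in> F" using e(1) Cons t(2) by (auto simp: fpath_Cons)
  have "lcong G ((gp [f] * sp [g]) * (sp \<alpha>' * q t * gp \<beta>)) ((if f = g then PP (rng G f) else 0) * (sp \<alpha>' * q t * gp \<beta>) :: ('v, 'e, 'k) free_elem)"
    using e s by (intro lcong_multr lcong_ghost_edge) auto
  then have *: "lcong G (gp [f] * elt \<alpha> t \<beta>) ((if f = g then PP (rng G f) else 0) * elt \<alpha>' t \<beta> :: ('v, 'e, 'k) free_elem)"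
    by (simp add: elt_def Cons sp_Cons[of g \<alpha>'] mult.assoc)
  have "fpath \<alpha>' t" using t(2) Cons by (cases "\<alpha>' = []") (auto simp: fpath_Cons)
  then have "PP (rng G f) * elt \<alpha>' t \<beta> \<in> span (int (length \<alpha>') - int (length \<beta>))"
    using fam_rng[OF f] t by (intro PP_elt_span) auto
  then show ?thesis using * Cons span.LI[OF LI_0] by (intro span_lcong[OF *]) (auto split: if_splits)
next
  case Nil
  note e = fpath_edges[OF t(3)] F_edge[OF f] live_cells[OF t(1)]
  have *: "lcong G (gp [f] * elt \<alpha> t \<beta>) ((if {src G f} = t \<and> f \<in> cyc_edges then gp [f] else 0) * gp \<beta> :: ('v, 'e, 'k) free_elem)"
    using e lcong_gp_q[OF f e(3)] unfolding elt_def Nil sp_simps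
    by (simp only: mult_1_left mult.assoc[symmetric]) (intro lcong_multr; auto)
  show ?thesis
  proof (cases "{src G f} = t \<and> f \<in> cyc_edges")
    case False
    then show ?thesis using * span.LI[OF LI_0] by (intro span_lcong[OF *]) auto
  next
    \<comment> \<open>Here s_f^* does not cancel. As s_f^* = p_{r(f)} s_f^*, it passes to the right
      and joins the ghost path, with the next vertex of the cycle as the new cell.\<close>
    case True
    have fp: "fpath (\<beta> @ [f]) (rng G f)"
    proof (cases "\<beta> = []")
      case False
      then show ?thesis using t(3) True f by (subst fpath_snoc) (auto simp: fpath_def)
    qed (use f in \<open>simp add: fpath_Cons\<close>)
    have "lcong G (gp [f] * gp \<beta>) ((PP (rng G f) * gp [f]) * gp \<beta> :: ('v, 'e, 'k) free_elem)"
      using e by (intro lcong_multr lcong_sym[OF lcong_edge(3)]) auto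
    also have "(PP (rng G f) * gp [f]) * gp \<beta> = (elt [] (rng G f) (\<beta> @ [f]) :: ('v, 'e, 'k) free_elem)"
      by (simp add: elt_def cell_cyc_rng(2)[OF f] True gp_simps sp_simps mult.assoc)
    finally have "lcong G (gp [f] * elt \<alpha> t \<beta>) (elt [] (rng G f) (\<beta> @ [f]) :: ('v, 'e, 'k) free_elem)"
      using * True lcong_trans by simp blast
    moreover have "elt [] (rng G f) (\<beta> @ [f]) \<in> span (int (length \<alpha>) - int (length \<beta>) - 1)"
      using cell_cyc_rng(1)[OF f] True fp Nil by (intro span.elt) auto
    ultimately show ?thesis using span_lcong by blast
  qed
qed

lemma elt_gp_span:
  assumes f: "f \<in> F" and t: "t \<in> live" "fpath \<alpha> t" "fpath \<beta> t"
  shows "(elt \<alpha> t \<beta> * gp [f] :: ('v, 'e, 'k::field) free_elem) \<in> span (int (length \<alpha>) - int (length \<beta>) - 1)"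
proof -
  note e = fpath_edges[OF t(2)] fpath_edges[OF t(3)] F_edge[OF f] live_cells[OF t(1)]
  show ?thesis
  proof (cases "fpath (f # \<beta>) t")
    case True
    have "(elt \<alpha> t \<beta> * gp [f] :: ('v, 'e, 'k) free_elem) = elt \<alpha> t (f # \<beta>)"
      by (simp add: elt_def gp_Cons[of f \<beta>] mult.assoc)
    then show ?thesis using span.elt[OF t(1,2) True, where 'k = 'k] by (simp add: algebra_simps)
  next
    case False
    have "lcong G (q t * gp \<beta> * PP (rng G f)) (0 :: ('v, 'e, 'k) free_elem)"
    proof (cases "\<beta> = []")
      case True
      have "lcong G (q t * PP (rng G f) :: ('v, 'e, 'k) free_elem) (if t \<subseteq> rng G f then q t else 0)"
        by (rule lcong_q_PP[OF fam_rng[OF f] e(4)])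
      then show ?thesis using True False f by (auto simp: fpath_Cons gp_simps)
    next
      case ne: False
      then have "lcong G (q t * (gp \<beta> * PP (rng G f))) (q t * 0 :: ('v, 'e, 'k) free_elem)"
        using False f t e lcong_gp_PP[OF ug gen_verts.rng[OF e(3)] ne e(2)]
        by (intro lcong_multl) (auto simp: fpath_Cons)
      then show ?thesis by (simp add: mult.assoc)
    qed
    then have "lcong G (sp \<alpha> * (q t * gp \<beta> * PP (rng G f)) * gp [f]) (sp \<alpha> * 0 * gp [f] :: ('v, 'e, 'k) free_elem)"
      using e by (intro lcong_multr lcong_multl) auto
    moreover have "lcong G ((sp \<alpha> * q t * gp \<beta>) * (PP (rng G f) * gp [f])) ((sp \<alpha> * q t * gp \<beta>) * gp [f] :: ('v, 'e, 'k) free_elem)"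
      using e by (intro lcong_multl lcong_edge(3)) auto
    ultimately have "lcong G (elt \<alpha> t \<beta> * gp [f]) (0 :: ('v, 'e, 'k) free_elem)"
      using lcong_trans lcong_sym by (fastforce simp: elt_def mult.assoc)
    then show ?thesis using span_lcong span.LI[OF LI_0] by blast
  qed
qed

lemma span_left:
  assumes "x \<in> span d"
  shows "fam A \<Longrightarrow> PP A * x \<in> span d" "f \<in> F \<Longrightarrow> sp [f] * x \<in> span (d + 1)"
    "f \<in> F \<Longrightarrow> gp [f] * x \<in> span (d - 1)" "f \<in> F \<Longrightarrow> x * gp [f] \<in> span (d - 1)"
proof -
  note int = span.LI span.add span.scale
  show "fam A \<Longrightarrow> PP A * x \<in> span d"
    using assms by induction
      (auto simp: distrib_left cst_mult_left fam_gen_verts intro: int PP_elt_span)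
  show "f \<in> F \<Longrightarrow> sp [f] * x \<in> span (d + 1)"
    using assms by induction
      (auto simp: distrib_left cst_mult_left F_edge intro: int sp_elt_span)
  show "f \<in> F \<Longrightarrow> gp [f] * x \<in> span (d - 1)"
    using assms by induction
      (auto simp: distrib_left cst_mult_left F_edge intro: int gp_elt_span)
  show "f \<in> F \<Longrightarrow> x * gp [f] \<in> span (d - 1)"
    using assms by induction
      (auto simp: distrib_right mult.assoc F_edge intro: int elt_gp_span)
qed

lemma q_span: "t \<in> cells \<Longrightarrow> q t \<in> span 0"
  using q_LI[of t] span.LI[of "q t"] elt_span[of t "[]" "[]"]
  by (cases "Dq t = {}") (auto simp: live_def elt_def sp_simps gp_simps)

text \<open>Inclusion-exclusion: the sets T overlap only in \<open>V0\<close>, whose vertices are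
  removed from each \<open>q T\<close> and counted once in the second sum.\<close>

lemma lcong_PP_cells:
  assumes "finite \<T>" "\<T> \<subseteq> T0" "U \<subseteq> V0"
  shows "lcong G (PP (\<Union>\<T> \<union> U) :: ('v, 'e, 'k::field) free_elem) ((\<Sum>T\<in>\<T>. q T) + (\<Sum>v\<in>V0 \<inter> (\<Union>\<T> \<union> U). PP {v}))"
  using assms(1,2)
proof (induction \<T> rule: finite_induct)
  case empty
  have "V0 \<inter> U = U" using assms(3) by blast
  moreover have "finite U" "U \<subseteq> verts G" using assms(3) fin V0_verts finite_subset by auto
  ultimately show ?case by (simp add: lcong_PP_finite[OF ug])
next
  case (insert T \<T>)
  let ?B = "\<Union>\<T> \<union> U"
  have TB: "T \<inter> ?B \<subseteq> V0" using T0_Int[of T] insert.prems insert.hyps(2) assms(3) by blast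
  have T: "T \<in> gen_verts G" using insert.prems T0_minset minset_gen_verts by auto
  have U: "U \<in> gen_verts G" using assms(3) fin V0_verts finite_subset by (intro finite_gen_verts[OF ug]) auto
  have "\<Union>\<T> \<in> gen_verts G" using insert.hyps(1) insert.prems
    by (induction \<T> rule: finite_induct) (use T0_minset minset_gen_verts in auto)
  then have B: "?B \<in> gen_verts G" using U by simp
  have eq: "V0 \<inter> (T \<union> ?B) = (V0 \<inter> T) \<union> (V0 \<inter> ?B)" "(V0 \<inter> T) \<inter> (V0 \<inter> ?B) = T \<inter> ?B" using TB by blast+
  have "lcong G (PP (T \<union> ?B)) (PP T + PP ?B - PP (T \<inter> ?B) :: ('v, 'e, 'k::field) free_elem)"
    by (rule lcong_PP_union[OF T B])
  also have "lcong G \<dots> (PP T + ((\<Sum>T\<in>\<T>. q T) + (\<Sum>v\<in>V0 \<inter> ?B. PP {v})) - (\<Sum>v\<in>T \<inter> ?B. PP {v}))"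
    using insert TB fin V0_verts finite_subset by (intro lcong_diff lcong_add lcong_PP_finite[OF ug]) auto
  also have "PP T + ((\<Sum>T\<in>\<T>. q T) + (\<Sum>v\<in>V0 \<inter> ?B. PP {v})) - (\<Sum>v\<in>T \<inter> ?B. PP {v}) =
      ((\<Sum>T\<in>insert T \<T>. q T) + (\<Sum>v\<in>V0 \<inter> (T \<union> ?B). PP {v}) :: ('v, 'e, 'k::field) free_elem)"
    using insert.hyps sum.union_inter[of "V0 \<inter> T" "V0 \<inter> ?B" "\<lambda>v. PP {v} :: ('v, 'e, 'k) free_elem"] fin insert.prems
    unfolding eq by (simp add: q_T0 algebra_simps)
  finally show ?case by (simp add: Un_assoc)
qed

text \<open>For v in \<open>V0\<close>, p_v is \<open>q {v}\<close> plus the terms s_e s_e^* with e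
  in \<open>F'\<close>, and each of these hides a p_{r(e)} in the middle. The assumption thus
  concerns ranges one step further along the graph.\<close>

lemma PP_span_step:
  assumes A: "fam A" and IH: "\<And>e. e \<in> F' \<Longrightarrow> src G e \<in> A \<Longrightarrow> (sp [e] * PP (rng G e) * gp [e] :: ('v, 'e, 'k::field) free_elem) \<in> span 0"
  shows "(PP A :: ('v, 'e, 'k) free_elem) \<in> span 0"
proof -
  have v: "(PP {v} :: ('v, 'e, 'k) free_elem) \<in> span 0" if "v \<in> V0 \<inter> A" for v
  proof -
    have "lcong G (PP {v} :: ('v, 'e, 'k) free_elem) (q {v} + (\<Sum>e\<in>{e \<in> F'. src G e = v}. sp [e] * PP (rng G e) * gp [e]))"
    proof -
      have "lcong G (q {v} + (\<Sum>e\<in>{e \<in> F'. src G e = v}. sp [e] * gp [e]) :: ('v, 'e, 'k) free_elem)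
          (q {v} + (\<Sum>e\<in>{e \<in> F'. src G e = v}. sp [e] * PP (rng G e) * gp [e]))"
        using F'_F(3) by (intro lcong_add lcong_refl lcong_sum lcong_multr lcong_sym[OF lcong_edge(2)]) auto
      then show ?thesis by (simp add: q_singleton)
    qed
    moreover have "(q {v} + (\<Sum>e\<in>{e \<in> F'. src G e = v}. sp [e] * PP (rng G e) * gp [e]) :: ('v, 'e, 'k) free_elem) \<in> span 0"
      using that IH by (intro span.add span_sum q_span) (auto simp: cells_def)
    ultimately show ?thesis using span_lcong by blast
  qed
  have "lcong G (PP A :: ('v, 'e, 'k) free_elem) ((\<Sum>T\<in>{T \<in> T0. T \<subseteq> A}. q T) + (\<Sum>v\<in>V0 \<inter> A. PP {v}))"
  proof -
    have "A = \<Union>{T \<in> T0. T \<subseteq> A} \<union> (V0 \<inter> A)" using A by (simp add: fam_def)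
    moreover have "finite {T \<in> T0. T \<subseteq> A}" using fin by simp
    ultimately show ?thesis
      using lcong_PP_cells[of "{T \<in> T0. T \<subseteq> A}" "V0 \<inter> A", where 'k = 'k] by auto
  qed
  moreover have "((\<Sum>T\<in>{T \<in> T0. T \<subseteq> A}. q T) + (\<Sum>v\<in>V0 \<inter> A. PP {v}) :: ('v, 'e, 'k) free_elem) \<in> span 0"
    using v by (intro span.add span_sum q_span) (auto simp: cells_def)
  ultimately show ?thesis using span_lcong by blast
qed

text \<open>Well-foundedness was obtained for going backwards. It makes the relation acyclic, and on
  the finite set \<open>F'\<close> acyclicity gives termination forwards too, so the expansion of a
  projection ends.\<close>

lemma wf_forward: "wf {(e', e). e \<in> F' \<and> e' \<in> F' \<and> src G e' \<in> rng G e}"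
proof -
  let ?W = "{(e, e'). e \<in> F' \<and> e' \<in> F' \<and> src G e' \<in> rng G e}"
  have "?W \<subseteq> precedes" using F'_F by (auto simp: precedes_def)
  then have "acyclic ?W" using wf_precedes wf_acyclic acyclic_subset by blast
  moreover have "finite ?W" by (rule finite_subset[of _ "F' \<times> F'"]) (use fin_sums in auto)
  ultimately have "wf (?W\<inverse>)" using finite_acyclic_wf_converse by blast
  moreover have "?W\<inverse> = {(e', e). e \<in> F' \<and> e' \<in> F' \<and> src G e' \<in> rng G e}" by auto
  ultimately show ?thesis by simp
qed

lemma edge_PP_span: "e \<in> F' \<Longrightarrow> (sp [e] * PP (rng G e) * gp [e] :: ('v, 'e, 'k::field) free_elem) \<in> span 0"
proof (induction e rule: wf_induct_rule[OF wf_forward])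
  case (1 e)
  have "(PP (rng G e) :: ('v, 'e, 'k) free_elem) \<in> span 0"
    using 1 F'_F by (intro PP_span_step fam_rng) auto
  then have "(sp [e] * PP (rng G e) * gp [e] :: ('v, 'e, 'k) free_elem) \<in> span (0 + 1 - 1)"
    using F'_F(1)[OF 1(2)] by (intro span_left(2,4))
  then show ?case by simp
qed

lemma PP_span: "fam A \<Longrightarrow> PP A \<in> span 0"
  by (rule PP_span_step[OF _ edge_PP_span])

fun gdeg :: "('v, 'e) generator \<Rightarrow> int" where
  "gdeg (Proj A) = 0" | "gdeg (Edge e) = 1" | "gdeg (Ghost e) = -1"

definition gens0 :: "('v, 'e) generator set" where
  "gens0 = Proj ` {A. fam A} \<union> Edge ` F \<union> Ghost ` F"

lemma gen_span: "g \<in> gens0 \<Longrightarrow> wd [g] \<in> span (gdeg g)"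
proof (cases g)
  case (Proj A)
  moreover assume "g \<in> gens0"
  ultimately show ?thesis using PP_span by (auto simp: gens0_def)
next
  case (Edge e)
  moreover assume "g \<in> gens0"
  ultimately have e: "e \<in> F" by (auto simp: gens0_def)
  have "sp [e] * PP (rng G e) \<in> span (0 + 1)" by (intro span_left(2) PP_span fam_rng e)
  then show ?thesis
    using span_lcong[OF lcong_sym[OF lcong_edge(2)[OF F_edge[OF e]]]] by (simp add: Edge sp_simps)
next
  case (Ghost e)
  moreover assume "g \<in> gens0"
  ultimately have e: "e \<in> F" by (auto simp: gens0_def)
  have "gp [e] * PP {src G e} \<in> span (0 - 1)" by (intro span_left(3) PP_span fam_singleton F_src e)
  then show ?thesis
    using span_lcong[OF lcong_sym[OF lcong_edge(4)[OF F_edge[OF e]]]] by (simp add: Ghost gp_simps)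
qed

lemma word_span: "u \<noteq> [] \<Longrightarrow> set u \<subseteq> gens0 \<Longrightarrow> (wd u :: ('v, 'e, 'k::field) free_elem) \<in> span (sum_list (map gdeg u))"
proof (induction u)
  case (Cons g u)
  show ?case
  proof (cases "u = []")
    case True
    then show ?thesis using Cons.prems by (simp add: gen_span)
  next
    case False
      then have IH: "(wd u :: ('v, 'e, 'k) free_elem) \<in> span (sum_list (map gdeg u))" using Cons by simp
    have "(wd [g] * wd u :: ('v, 'e, 'k) free_elem) \<in> span (gdeg g + sum_list (map gdeg u))"
    proof (cases g)
      case (Proj A)
      then show ?thesis using span_left(1)[OF IH] Cons.prems by (auto simp: gens0_def)
    next
      case (Edge e)
      then show ?thesis using span_left(2)[OF IH] Cons.prems by (auto simp: gens0_def sp_simps add.commute)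
    next
      case (Ghost e)
      then show ?thesis using span_left(3)[OF IH] Cons.prems by (auto simp: gens0_def gp_simps)
    qed
    then show ?thesis by (simp add: wd_Cons[of g u])
  qed
qed simp

lemma sum_gdeg_le: "\<bar>sum_list (map gdeg u)\<bar> \<le> int (length u)"
proof (induction u)
  case (Cons g u)
  have "\<bar>gdeg g\<bar> \<le> 1" by (cases g) auto
  then show ?case using Cons by simp
qed simp

end

section \<open>Separating path units by matrix coefficients\<close>

lemma sum_disjoint_if:
  assumes "finite I" "\<And>i j. i \<in> I \<Longrightarrow> j \<in> I \<Longrightarrow> P i \<Longrightarrow> P j \<Longrightarrow> i = j"
  shows "(\<Sum>i\<in>I. if P i then c else 0) = (if \<exists>i\<in>I. P i then c else (0 :: 'a::comm_monoid_add))"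
proof (cases "\<exists>i\<in>I. P i")
  case True
  then obtain k where k: "k \<in> I" "P k" by blast
  then have "(\<Sum>i\<in>I. if P i then c else 0) = (\<Sum>i\<in>I. if i = k then c else 0)"
    using assms(2) by (intro sum.cong) auto
  then show ?thesis using True k assms(1) by simp
qed simp

text \<open>With V or E empty no point is subtracted twice. Cells have this property, since edges
  are removed only from singletons.\<close>

lemma (in gset) act_cell:
  assumes ug: "is_ultragraph G" and V: "finite V" "V \<subseteq> t" "V \<subseteq> verts G" and t: "t \<in> gen_verts G"
    and E: "finite E" "E \<subseteq> edges G" "\<And>e. e \<in> E \<Longrightarrow> src G e \<in> t" and VE: "V = {} \<or> E = {}"
  shows "act (PP t - (\<Sum>v\<in>V. PP {v}) - (\<Sum>e\<in>E. sp [e] * gp [e])) f =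
    (\<lambda>\<eta>. if \<eta> \<in> {\<eta> \<in> D t. (\<forall>v\<in>V. \<eta> \<notin> D {v}) \<and> (\<forall>e\<in>E. \<eta> \<notin> R e)} then f \<eta> else 0)"
proof
  fix \<eta>
  have PP: "act (PP A) f = (\<lambda>\<eta>. if \<eta> \<in> D A then f \<eta> else 0)" for A by (simp add: act_gens fun_eq_iff)
  have Ee: "act (sp [e] * gp [e]) f \<eta> = (if \<eta> \<in> R e then f \<eta> else 0)" if "e \<in> E" for e
    using that E(2) sg_D th_sg by (auto simp: act_mult sp_def gp_def act_gens)
  have Dv: "v = w" if "v \<in> V" "w \<in> V" "\<eta> \<in> D {v}" "\<eta> \<in> D {w}" for v w
  proof (rule ccontr)
    assume "v \<noteq> w"
    then have "{v} \<inter> {w} = {}" by auto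
    then show False using that V(3) D_Int[of "{v}" "{w}"] D_empty by auto
  qed
  have sub: "\<eta> \<in> D t" if "v \<in> V" "\<eta> \<in> D {v}" for v
    using that V t D_mono[of "{v}" t] by auto
  have subE: "\<eta> \<in> D t" if "e \<in> E" "\<eta> \<in> R e" for e
    using that E t D_mono[of "{src G e}" t] R_src is_ultragraph_simps(1)[OF ug, of e] by blast
  have "act (PP t - (\<Sum>v\<in>V. PP {v}) - (\<Sum>e\<in>E. sp [e] * gp [e])) f \<eta> =
     (if \<eta> \<in> D t then f \<eta> else 0) - (\<Sum>v\<in>V. if \<eta> \<in> D {v} then f \<eta> else 0) - (\<Sum>e\<in>E. if \<eta> \<in> R e then f \<eta> else 0)"
    by (simp add: act_diff_left act_sum_left PP Ee)
  also have "(\<Sum>v\<in>V. if \<eta> \<in> D {v} then f \<eta> else 0) = (if \<exists>v\<in>V. \<eta> \<in> D {v} then f \<eta> else 0)"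
    by (rule sum_disjoint_if[OF V(1) Dv])
  also have "(\<Sum>e\<in>E. if \<eta> \<in> R e then f \<eta> else 0) = (if \<exists>e\<in>E. \<eta> \<in> R e then f \<eta> else 0)"
    using R_disj E(2) by (intro sum_disjoint_if[OF E(1)]) blast
  finally show "act (PP t - (\<Sum>v\<in>V. PP {v}) - (\<Sum>e\<in>E. sp [e] * gp [e])) f \<eta> =
      (if \<eta> \<in> {\<eta> \<in> D t. (\<forall>v\<in>V. \<eta> \<notin> D {v}) \<and> (\<forall>e\<in>E. \<eta> \<notin> R e)} then f \<eta> else 0)"
    using VE sub subE by auto
qed

context rfd_ultragraph
begin

text \<open>Stretches of winding around a cycle. Start and length determine such a stretch, so two
  of them from the same vertex are comparable as prefixes.\<close>

primrec cp :: "'v \<Rightarrow> 'e list \<Rightarrow> 'v \<Rightarrow> bool" where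
  "cp u [] w \<longleftrightarrow> u = w"
| "cp u (e # \<delta>) w \<longleftrightarrow> e \<in> cyc_edges \<and> src G e = u \<and> (\<exists>u'. rng G e = {u'} \<and> cp u' \<delta> w)"

lemma cp_edges: "cp u \<delta> w \<Longrightarrow> set \<delta> \<subseteq> edges G"
  by (induction \<delta> arbitrary: u) (auto dest: cyc_edges_edges)

lemma cp_on_cycle: "cp u \<delta> w \<Longrightarrow> on_cycle G w \<Longrightarrow> on_cycle G u"
  by (cases \<delta>) (auto simp: cyc_edges_def)

lemma cp_pt: "cp u \<delta> w \<Longrightarrow> b.pt \<delta> ([], {w}) = ([], {u})"
  by (induction \<delta> arbitrary: u) (auto simp: th0_def split: prod.splits)

lemma cp_det:
  assumes "cp u \<delta> w" "cp u \<delta>' w'" "length \<delta> \<le> length \<delta>'"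
  shows "\<exists>\<mu>. \<delta>' = \<delta> @ \<mu> \<and> cp w \<mu> w'"
  using assms
proof (induction \<delta> arbitrary: u \<delta>')
  case (Cons e \<delta>)
  then obtain e' \<delta>'' where \<delta>': "\<delta>' = e' # \<delta>''" by (cases \<delta>') auto
  have "e' = e" using Cons.prems cyc_unique[of e e'] cyc_edges_edges[of e'] unfolding \<delta>' by auto
  then show ?case using Cons.IH Cons.prems unfolding \<delta>' by auto
qed simp

text \<open>On a cycle the Cuntz-Krieger sum has the single term s_e s_e^*; applied from the inside
  outwards it removes the whole winding.\<close>

lemma cp_collapse:
  assumes "on_cycle G w" "cp u \<mu> w"
  shows "lcong G (sp \<mu> * PP {w} * gp \<mu> :: ('v, 'e, 'k::field) free_elem) (PP {u})"
  using assms(2)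
proof (induction \<mu> arbitrary: u)
  case (Cons e \<mu>)
  then obtain u' where u': "e \<in> cyc_edges" "src G e = u" "rng G e = {u'}" "cp u' \<mu> w" by auto
  have e: "e \<in> edges G" using u' cyc_edges_edges by blast
  have reg: "is_regular G u" using on_cycle_regular cp_on_cycle[OF Cons.prems assms(1)] by blast
  have em: "emits G {u} = {e}" using on_cycle_emits[OF u'(1)] u'(2) by simp
  have "sp (e # \<mu>) * PP {w} * gp (e # \<mu>) = (sp [e] * (sp \<mu> * PP {w} * gp \<mu>) * gp [e] :: ('v, 'e, 'k) free_elem)"
    by (simp add: sp_Cons[of e \<mu>] gp_Cons[of e \<mu>] mult.assoc)
  also have "lcong G \<dots> (sp [e] * PP (rng G e) * gp [e])"
    unfolding u'(3) using e by (intro lcong_multr lcong_multl Cons.IH u') auto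
  also have "lcong G \<dots> (sp [e] * gp [e])" using e by (intro lcong_multr lcong_edge(2)) auto
  also have "lcong G \<dots> (PP {u})" using lcong_sym[OF lcong_CK[OF reg]] unfolding em by simp
  finally show ?case .
qed (simp add: sp_simps gp_simps)

text \<open>Both stretches are prolonged by the same path: the lengths added on the two sides agree,
  and a continuation is determined by its length. \<open>cp_collapse\<close> then removes
  it.\<close>

lemma cp_units_le:
  assumes "on_cycle G w" "on_cycle G w'" "cp u \<delta> w" "cp u \<delta>' w'" "cp u2 \<epsilon> w" "cp u2 \<epsilon>' w'"
    "length \<delta> \<le> length \<delta>'" "length \<delta> + length \<epsilon>' = length \<delta>' + length \<epsilon>"
    "set \<alpha> \<subseteq> edges G" "set \<beta> \<subseteq> edges G"
  shows "lcong G (sp (\<alpha> @ \<delta>') * PP {w'} * gp (\<beta> @ \<epsilon>') :: ('v, 'e, 'k::field) free_elem)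
    (sp (\<alpha> @ \<delta>) * PP {w} * gp (\<beta> @ \<epsilon>))"
proof -
  obtain \<mu> where \<mu>: "\<delta>' = \<delta> @ \<mu>" "cp w \<mu> w'" using cp_det[OF assms(3,4,7)] by blast
  have "length \<epsilon> \<le> length \<epsilon>'" using assms(7,8) by linarith
  then obtain \<nu> where \<nu>: "\<epsilon>' = \<epsilon> @ \<nu>" "cp w \<nu> w'" using cp_det[OF assms(5,6)] by blast
  have "length \<mu> = length \<nu>" using assms(8) \<mu> \<nu> by simp
  then have "\<mu> = \<nu>" using cp_det[OF \<mu>(2) \<nu>(2)] by auto
  have "sp (\<alpha> @ \<delta>') * PP {w'} * gp (\<beta> @ \<epsilon>') =
      (sp (\<alpha> @ \<delta>) * (sp \<mu> * PP {w'} * gp \<mu>) * gp (\<beta> @ \<epsilon>) :: ('v, 'e, 'k) free_elem)"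
    by (simp add: \<mu>(1) \<nu>(1) \<open>\<mu> = \<nu>\<close> sp_simps gp_simps mult.assoc)
  also have "lcong G \<dots> (sp (\<alpha> @ \<delta>) * PP {w} * gp (\<beta> @ \<epsilon>))"
    using assms(9,10) cp_edges[OF assms(3)] cp_edges[OF assms(5)]
    by (intro lcong_multr lcong_multl cp_collapse[OF assms(2) \<mu>(2)]) auto
  finally show ?thesis .
qed

lemma cp_units:
  assumes "on_cycle G w" "on_cycle G w'" "cp u \<delta> w" "cp u \<delta>' w'" "cp u2 \<epsilon> w" "cp u2 \<epsilon>' w'"
    "length \<delta> + length \<epsilon>' = length \<delta>' + length \<epsilon>" "set \<alpha> \<subseteq> edges G" "set \<beta> \<subseteq> edges G"
  shows "lcong G (sp (\<alpha> @ \<delta>) * PP {w} * gp (\<beta> @ \<epsilon>) :: ('v, 'e, 'k::field) free_elem)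
    (sp (\<alpha> @ \<delta>') * PP {w'} * gp (\<beta> @ \<epsilon>'))"
proof (cases "length \<delta> \<le> length \<delta>'")
  case True
  show ?thesis by (rule lcong_sym, rule cp_units_le) (use assms True in auto)
next
  case False
  show ?thesis by (rule cp_units_le) (use assms False in auto)
qed

lemma pt_acyclic: "set \<alpha> \<inter> cyc_edges = {} \<Longrightarrow> b.pt \<alpha> (a, t) = (\<alpha> @ a, t)"
  by (induction \<alpha>) (auto simp: th0_def)

lemma path_last_cyc: "ug_path G \<alpha> \<Longrightarrow> set \<alpha> \<inter> cyc_edges \<noteq> {} \<Longrightarrow> last \<alpha> \<in> cyc_edges"
proof (induction \<alpha>)
  case (Cons e \<alpha>)
  show ?case
  proof (cases "\<alpha> = []")
    case False
    then have p: "ug_path G \<alpha>" "src G (hd \<alpha>) \<in> rng G e" using Cons.prems by (auto simp: ug_path_Cons)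
    have "set \<alpha> \<inter> cyc_edges \<noteq> {}"
    proof
      assume no: "set \<alpha> \<inter> cyc_edges = {}"
      then have "e \<in> cyc_edges" using Cons.prems by auto
      then obtain w where "rng G e = {w}" "on_cycle G w" by (rule cyc_rng)
      then have "hd \<alpha> \<in> cyc_edges" using p False ug_path_edges[OF p(1)] hd_edges[of \<alpha>] by (simp add: cyc_edges_def)
      then show False using no False hd_in_set[of \<alpha>] by blast
    qed
    then show ?thesis using Cons.IH p False by simp
  qed (use Cons.prems in auto)
qed simp

text \<open>A path that has entered a cycle cannot leave it, so its edges on cycles form a final
  stretch.\<close>

lemma cp_decompose:
  assumes "on_cycle G w" "\<alpha> \<noteq> [] \<Longrightarrow> ug_path G \<alpha> \<and> {w} \<subseteq> rng G (last \<alpha>)"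
  shows "\<exists>\<alpha>0 \<delta> u. \<alpha> = \<alpha>0 @ \<delta> \<and> set \<alpha>0 \<inter> cyc_edges = {} \<and> cp u \<delta> w"
  using assms(2)
proof (induction \<alpha>)
  case (Cons e \<alpha>)
  show ?case
  proof (cases "\<alpha> = []")
    case True
    show ?thesis
    proof (cases "e \<in> cyc_edges")
      case C: True
      then obtain w' where "rng G e = {w'}" by (rule cyc_rng)
      then have "cp (src G e) [e] w" using C Cons.prems True by auto
      then show ?thesis using True by (intro exI[of _ "[]"] exI[of _ "[e]"] exI[of _ "src G e"]) auto
    next
      case False
      then show ?thesis using True by (intro exI[of _ "[e]"] exI[of _ "[]"] exI[of _ w]) auto
    qed
  next
    case False
    then have p: "ug_path G \<alpha>" "src G (hd \<alpha>) \<in> rng G e" using Cons.prems by (auto simp: ug_path_Cons)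
    obtain \<alpha>0 \<delta> u where IH: "\<alpha> = \<alpha>0 @ \<delta>" "set \<alpha>0 \<inter> cyc_edges = {}" "cp u \<delta> w"
      using Cons False p by auto
    show ?thesis
    proof (cases "e \<in> cyc_edges")
      case C: True
      then obtain w' where w': "rng G e = {w'}" "on_cycle G w'" by (rule cyc_rng)
      then have "hd \<alpha> \<in> cyc_edges" using p False ug_path_edges[OF p(1)] hd_edges[of \<alpha>] by (simp add: cyc_edges_def)
      then have "\<alpha>0 = []" using IH(1,2) by (cases \<alpha>0) auto
      then have "\<delta> \<noteq> []" "src G (hd \<delta>) = u" using IH False by (cases \<delta>; auto)+
      then have "cp (src G e) (e # \<delta>) w" using C w' p(2) IH \<open>\<alpha>0 = []\<close> by auto
      then show ?thesis using IH(1) \<open>\<alpha>0 = []\<close> by (intro exI[of _ "[]"] exI[of _ "e # \<delta>"] exI[of _ "src G e"]) auto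
    next
      case C: False
      then show ?thesis using IH by (intro exI[of _ "e # \<alpha>0"] exI[of _ \<delta>] exI[of _ u]) auto
    qed
  qed
qed (auto intro: exI[of _ "[]"])

end

context rfd_data
begin

section \<open>Recovering a unit from a matrix coefficient\<close>

lemma Dq_D0: "p \<in> Dq t \<Longrightarrow> p \<in> D0 t"
  by (simp add: Dq_def)

lemma Dq_points: "p \<in> Dq t \<Longrightarrow> p \<in> points"
  by (auto simp: Dq_def D0_def)

text \<open>Points that begin with an edge of \<open>F'\<close> were cut out of the cell. Hence in a
  point composed of a path \<alpha> in \<open>F'\<close> and a point of a cell, \<alpha> is the
  longest initial stretch inside \<open>F'\<close>.\<close>

lemma Dq_first_edge:
  assumes "(a, r) \<in> Dq t" "a \<noteq> []"
  shows "hd a \<notin> F'"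
proof
  assume e: "hd a \<in> F'"
  have p: "(a, r) \<in> points" by (rule Dq_points[OF assms(1)])
  have s: "src G (hd a) \<in> V0 \<inter> t" using F_src F'_F(1)[OF e] Dq_D0[OF assms(1)] assms(2) by (auto simp: D0_def)
  show False
  proof (cases "{src G (hd a)} = t")
    case True
    then have "(a, r) \<notin> R0 (hd a)" using assms(1) e by (auto simp: Dq_def)
    then show False using p assms(2) F'_F(2)[OF e] by (auto simp: R0_def)
  next
    case False
    then have "(a, r) \<notin> D0 {src G (hd a)}" using assms(1) s by (auto simp: Dq_def)
    then show False using p assms(2) by (auto simp: D0_def)
  qed
qed

lemma Dq_root:
  assumes "([], {u}) \<in> Dq t" "u \<in> V0"
  shows "t = {u}"
proof (rule ccontr)
  assume ne: "t \<noteq> {u}"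
  have "u \<in> t" using Dq_D0[OF assms(1)] by (simp add: D0_def)
  then have "([], {u}) \<notin> D0 {u}" using assms ne by (auto simp: Dq_def)
  then show False using Dq_points[OF assms(1)] by (simp add: D0_def)
qed

text \<open>Different cells meet inside \<open>V0\<close> only, and a point over a vertex of
  \<open>V0\<close> in both cells would have been removed from any cell but that of the vertex
  itself.\<close>

lemma Dq_disjoint:
  assumes t: "t \<in> cells" "t' \<in> cells" and p: "p \<in> Dq t" "p \<in> Dq t'"
  shows "t = t'"
proof (rule ccontr)
  assume ne: "t \<noteq> t'"
  obtain a r where ar: "p = (a, r)" by fastforce
  have D: "(a, r) \<in> D0 t" "(a, r) \<in> D0 t'" using p Dq_D0 ar by auto
  have root: "is_root r" using D(1) by (simp add: D0_def points_def)
  have single: False if v: "v \<in> V0" "p \<in> D0 {v}" "v \<in> t \<inter> t'" for v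
    using p v ne unfolding Dq_def by blast
  have x: "\<exists>v. v \<in> t \<inter> t' \<and> p \<in> D0 {v}" if "t \<inter> t' \<subseteq> V0"
  proof (cases "a = []")
    case True
    then have r: "r \<subseteq> t \<inter> t'" using D by (auto simp: D0_def)
    have "finite r" by (rule finite_subset[OF r finite_subset[OF that fin(2)]])
    with root obtain v where "r = {v}" by (auto simp: is_root_def minset_def)
    then show ?thesis using r D(1) True by (auto simp: ar D0_def)
  next
    case False
    then show ?thesis using D by (auto simp: ar D0_def)
  qed
  have "t \<inter> t' \<subseteq> V0"
    using t ne T0_Int by (auto simp: cells_def)
  then show False using x single by blast
qed

lemma Dq_cyc: "on_cycle G w \<Longrightarrow> p \<in> Dq {w} \<Longrightarrow> p = ([], {w})"
  using D0_on_cycle Dq_D0 by (cases p) blast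

lemma fpath_acyclic:
  assumes "fpath \<alpha> t" "t \<noteq> {}" "\<nexists>w. t = {w} \<and> on_cycle G w"
  shows "set \<alpha> \<inter> cyc_edges = {}"
proof (rule ccontr)
  assume c: "set \<alpha> \<inter> cyc_edges \<noteq> {}"
  then have p: "ug_path G \<alpha>" "t \<subseteq> rng G (last \<alpha>)" using assms(1) by (auto simp: fpath_def)
  obtain w where "rng G (last \<alpha>) = {w}" "on_cycle G w" using path_last_cyc[OF p(1) c] by (rule cyc_rng)
  then show False using p(2) assms(2,3) by auto
qed

lemma fpath_cyc:
  assumes "fpath \<alpha> {w}" "on_cycle G w" "{w} \<in> cells"
  obtains \<alpha>0 \<delta> u where "\<alpha> = \<alpha>0 @ \<delta>" "set \<alpha>0 \<subseteq> F'" "cp u \<delta> w" "u \<in> V0" "on_cycle G u"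
    "b.pt \<alpha> ([], {w}) = (\<alpha>0, {u})"
proof -
  obtain \<alpha>0 \<delta> u where d: "\<alpha> = \<alpha>0 @ \<delta>" "set \<alpha>0 \<inter> cyc_edges = {}" "cp u \<delta> w"
    using cp_decompose[OF assms(2), of \<alpha>] assms(1) by (auto simp: fpath_def)
  have s: "set \<alpha> \<subseteq> F" using assms(1) by (simp add: fpath_def)
  have "u \<in> V0"
  proof (cases \<delta>)
    case Nil
    have "w \<in> V0" using assms(3) T0_infinite by (force simp: cells_def)
    then show ?thesis using d(3) Nil by simp
  next
    case (Cons e \<delta>')
    then show ?thesis using d(1,3) s F_src by auto
  qed
  then show ?thesis
    using that[of \<alpha>0 \<delta> u] d s cp_pt[OF d(3)] pt_acyclic[OF d(2)] cp_on_cycle[OF d(3) assms(2)]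
    by (auto simp: F'_def)
qed

definition base :: "'v set \<Rightarrow> 'e list \<times> 'v set" where "base t = (SOME p. p \<in> Dq t)"

lemma base: "t \<in> live \<Longrightarrow> base t \<in> Dq t"
  unfolding base_def live_def using some_in_eq by blast

definition good :: "'e list \<times> 'v set \<times> 'e list \<Rightarrow> bool" where
  "good = (\<lambda>(\<alpha>, t, \<beta>). t \<in> live \<and> fpath \<alpha> t \<and> fpath \<beta> t)"

lemma mixed_separation:
  assumes t: "t \<in> live" "fpath \<alpha> t" "\<nexists>w. t = {w} \<and> on_cycle G w"
    and t': "{w} \<in> live" "fpath \<alpha>' {w}" "on_cycle G w"
    and \<eta>: "\<eta> \<in> Dq t" "b.pt \<alpha> \<eta> = b.pt \<alpha>' ([], {w})"
  shows False
proof -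
  obtain \<alpha>0 \<delta> u where d: "\<alpha>' = \<alpha>0 @ \<delta>" "set \<alpha>0 \<subseteq> F'" "cp u \<delta> w" "u \<in> V0" "on_cycle G u"
    "b.pt \<alpha>' ([], {w}) = (\<alpha>0, {u})" using t'(2,3) live_cells[OF t'(1)] by (rule fpath_cyc)
  obtain a r where ar: "\<eta> = (a, r)" by fastforce
  have "set \<alpha> \<inter> cyc_edges = {}" using t cells_nonempty[OF live_cells] by (intro fpath_acyclic) auto
  then have eq: "\<alpha> @ a = \<alpha>0" "r = {u}" using \<eta>(2) d(6) by (auto simp: ar pt_acyclic)
  have "a = []"
  proof (rule ccontr)
    assume "a \<noteq> []"
    then have "hd a \<in> F'" using eq(1) d(2) by (cases a) auto
    then show False using Dq_first_edge \<eta>(1) \<open>a \<noteq> []\<close> ar by blast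
  qed
  then have "t = {u}" using \<eta>(1) eq(2) d(4) Dq_root ar by blast
  then show False using t(3) d(5) by blast
qed

text \<open>Off the cycles the two points determine both paths and the cell, because the stretch of
  edges in \<open>F'\<close> ends where the point of the cell begins. Over a cycle the points forget
  the windings, and equality of the degrees makes up for it.\<close>

lemma separation:
  assumes t: "t \<in> live" "fpath \<alpha> t" "fpath \<beta> t" and t': "t' \<in> live" "fpath \<alpha>' t'" "fpath \<beta>' t'"
    and \<eta>: "\<eta> \<in> Dq t" "b.pt \<alpha> \<eta> = b.pt \<alpha>' (base t')" "b.pt \<beta> \<eta> = b.pt \<beta>' (base t')"
    and len: "int (length \<alpha>) - int (length \<beta>) = int (length \<alpha>') - int (length \<beta>')"
  shows "lcong G (elt \<alpha> t \<beta> :: ('v, 'e, 'k::field) free_elem) (elt \<alpha>' t' \<beta>') \<and>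
    b.pt \<alpha> (base t) = b.pt \<alpha>' (base t') \<and> b.pt \<beta> (base t) = b.pt \<beta>' (base t')"
proof (cases "\<exists>w. t = {w} \<and> on_cycle G w")
  case True
  then obtain w where w: "t = {w}" "on_cycle G w" by blast
  have \<eta>w: "\<eta> = ([], {w})" "base t = ([], {w})" using Dq_cyc[OF w(2), of \<eta>] Dq_cyc[OF w(2), of "base t"] w(1) \<eta>(1) base[OF t(1)] by auto
  show ?thesis
  proof (cases "\<exists>w. t' = {w} \<and> on_cycle G w")
    case False
    have "b.pt \<alpha>' (base t') = b.pt \<alpha> ([], {w})" using \<eta>(2) \<eta>w by simp
    then show ?thesis
      using mixed_separation[OF t'(1,2) False _ _ w(2) base[OF t'(1)], of \<alpha>] t w by simp
  next
    case True
    then obtain w' where w': "t' = {w'}" "on_cycle G w'" by blast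
    have b': "base t' = ([], {w'})" using Dq_cyc[OF w'(2), of "base t'"] w'(1) base[OF t'(1)] by auto
    obtain \<alpha>0 \<delta> u where a: "\<alpha> = \<alpha>0 @ \<delta>" "set \<alpha>0 \<subseteq> F'" "cp u \<delta> w" "b.pt \<alpha> ([], {w}) = (\<alpha>0, {u})"
      using fpath_cyc[OF t(2)[unfolded w] w(2)] live_cells[OF t(1)] w by metis
    obtain \<beta>0 \<epsilon> u2 where b: "\<beta> = \<beta>0 @ \<epsilon>" "set \<beta>0 \<subseteq> F'" "cp u2 \<epsilon> w" "b.pt \<beta> ([], {w}) = (\<beta>0, {u2})"
      using fpath_cyc[OF t(3)[unfolded w] w(2)] live_cells[OF t(1)] w by metis
    obtain \<alpha>0' \<delta>' u' where a': "\<alpha>' = \<alpha>0' @ \<delta>'" "cp u' \<delta>' w'" "b.pt \<alpha>' ([], {w'}) = (\<alpha>0', {u'})"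
      using fpath_cyc[OF t'(2)[unfolded w'] w'(2)] live_cells[OF t'(1)] w' by metis
    obtain \<beta>0' \<epsilon>' u2' where b2: "\<beta>' = \<beta>0' @ \<epsilon>'" "cp u2' \<epsilon>' w'" "b.pt \<beta>' ([], {w'}) = (\<beta>0', {u2'})"
      using fpath_cyc[OF t'(3)[unfolded w'] w'(2)] live_cells[OF t'(1)] w' by metis
    have eq: "\<alpha>0' = \<alpha>0" "u' = u" "\<beta>0' = \<beta>0" "u2' = u2"
      using \<eta>(2,3) \<eta>w b' a(4) a'(3) b(4) b2(3) by auto
    have "lcong G (sp (\<alpha>0 @ \<delta>) * PP {w} * gp (\<beta>0 @ \<epsilon>) :: ('v, 'e, 'k::field) free_elem)
        (sp (\<alpha>0 @ \<delta>') * PP {w'} * gp (\<beta>0 @ \<epsilon>'))"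
      by (rule cp_units[OF w(2) w'(2) a(3) a'(2)[unfolded eq] b(3) b2(2)[unfolded eq]])
        (use len a b a' b2 eq F'_F(3) in auto)
    then show ?thesis using w w' \<eta> \<eta>w b' by (simp add: elt_def q_cyc a(1) b(1) a'(1) b2(1) eq)
  qed
next
  case nc: False
  show ?thesis
  proof (cases "\<exists>w. t' = {w} \<and> on_cycle G w")
    case True
    then obtain w' where w': "t' = {w'}" "on_cycle G w'" by blast
    have "base t' = ([], {w'})" using Dq_cyc[OF w'(2), of "base t'"] w'(1) base[OF t'(1)] by auto
    then show ?thesis using mixed_separation[OF t(1,2) nc _ _ w'(2) \<eta>(1)] t' \<eta>(2) w' by auto
  next
    case nc': False
    obtain a r where ar: "\<eta> = (a, r)" by fastforce
    obtain a' r' where ar': "base t' = (a', r')" by fastforce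
    note ne = cells_nonempty[OF live_cells[OF t(1)]] cells_nonempty[OF live_cells[OF t'(1)]]
    have ac: "set \<alpha> \<inter> cyc_edges = {}" "set \<beta> \<inter> cyc_edges = {}" "set \<alpha>' \<inter> cyc_edges = {}" "set \<beta>' \<inter> cyc_edges = {}"
      using fpath_acyclic[OF t(2) ne(1) nc] fpath_acyclic[OF t(3) ne(1) nc]
        fpath_acyclic[OF t'(2) ne(2) nc'] fpath_acyclic[OF t'(3) ne(2) nc'] by blast+
    have eq: "\<alpha> @ a = \<alpha>' @ a'" "r = r'" "\<beta> @ a = \<beta>' @ a'"
      using \<eta>(2,3) ac by (auto simp: ar ar' pt_acyclic)
    have aF: "set \<alpha> \<subseteq> F'" "set \<alpha>' \<subseteq> F'" using t(2) t'(2) ac by (auto simp: fpath_def F'_def)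
    have "a = a'"
    proof -
      obtain us where us: "\<alpha> = \<alpha>' @ us \<and> us @ a = a' \<or> \<alpha> @ us = \<alpha>' \<and> a = us @ a'"
        using eq(1) by (auto simp: append_eq_append_conv2)
      \<comment> \<open>If one path were longer, its first surplus edge would lie in
        \<open>F'\<close> and also be the first edge of a point of a cell.\<close>
      have "us = []"
      proof (rule ccontr)
        assume usne: "us \<noteq> []"
        from us have "hd us \<in> F'" using aF usne by (cases us) auto
        moreover from us have "hd us \<notin> F'"
          using Dq_first_edge[of a r t] Dq_first_edge[of a' r' t'] \<eta>(1) base[OF t'(1)] ar ar' usne by auto
        ultimately show False by blast
      qed
      then show ?thesis using us by auto
    qed
    then have "\<eta> = base t'" "\<alpha> = \<alpha>'" "\<beta> = \<beta>'" using eq ar ar' by auto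
    moreover have "t = t'"
      using Dq_disjoint[OF live_cells[OF t(1)] live_cells[OF t'(1)] \<eta>(1)] base[OF t'(1)] \<open>\<eta> = base t'\<close> by simp
    ultimately show ?thesis by simp
  qed
qed

end

section \<open>The expansion in path units\<close>

context rfd_ultragraph
begin

text \<open>N and S vary with the coefficient to be computed, so the action is named as a function
  of them and not interpreted once and for all.\<close>

definition cact :: "int \<Rightarrow> 'v set set \<Rightarrow> ('v, 'e, 'k::field) free_elem \<Rightarrow>
    (('e list \<times> 'v set) \<times> int \<Rightarrow> 'k) \<Rightarrow> ('e list \<times> 'v set) \<times> int \<Rightarrow> 'k" where
  "cact N S = gset.act G (\<lambda>A. (D0 A \<inter> {p. snd p \<in> S}) \<times> {0..<N})
    (\<lambda>e. (R0 e \<inter> {p. snd p \<in> S}) \<times> {0..<N})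
    (\<lambda>e (\<xi>, j). (th0 e \<xi>, (j + 1) mod N)) (\<lambda>e (\<xi>, j). (sg0 e \<xi>, (j - 1) mod N))"

lemma pt_root:
  assumes "closed_roots S" "ug_path G \<alpha>" "\<xi> \<in> D0 (rng G (last \<alpha>))"
  shows "snd (b.pt \<alpha> \<xi>) \<in> S \<longleftrightarrow> snd \<xi> \<in> S"
  using assms(2,3)
proof (induction \<alpha>)
  case (Cons e \<alpha>)
  have e: "e \<in> edges G" using Cons.prems by (simp add: ug_path_Cons)
  show ?case
  proof (cases "\<alpha> = []")
    case True
    then show ?thesis using th0_root[OF assms(1) e] Cons.prems by simp
  next
    case False
    then have p: "ug_path G \<alpha>" "src G (hd \<alpha>) \<in> rng G e" using Cons.prems by (auto simp: ug_path_Cons)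
    have h: "hd \<alpha> \<in> edges G" by (rule hd_edges[OF False ug_path_edges[OF p(1)]])
    have "b.pt \<alpha> \<xi> \<in> D0 {src G (hd \<alpha>)}"
      using b.R_src[OF h] b.pt_R[OF ug p(1)] Cons.prems False by auto
    then have "b.pt \<alpha> \<xi> \<in> D0 (rng G e)"
      using b.D_mono[of "{src G (hd \<alpha>)}" "rng G e"] p(2) e is_ultragraph_simps(1)[OF ug h] by auto
    then have "snd (th0 e (b.pt \<alpha> \<xi>)) \<in> S \<longleftrightarrow> snd (b.pt \<alpha> \<xi>) \<in> S" by (rule th0_root[OF assms(1) e])
    then show ?thesis using Cons.IH p(1) Cons.prems(2) False by simp
  qed
qed simp

lemma cover_pt:
  assumes "closed_roots S" "(N :: int) > 0" "j \<in> {0..<N}"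
  shows "gset.pt (\<lambda>e (\<xi>, j). (th0 e \<xi>, (j + 1) mod N)) \<alpha> (p, j) = (b.pt \<alpha> p, (j + int (length \<alpha>)) mod N)"
proof -
  interpret c: gset G "\<lambda>A. (D0 A \<inter> {p. snd p \<in> S}) \<times> {0..<N}" "\<lambda>e. (R0 e \<inter> {p. snd p \<in> S}) \<times> {0..<N}"
    "\<lambda>e (\<xi>, j). (th0 e \<xi>, (j + 1) mod N)" "\<lambda>e (\<xi>, j). (sg0 e \<xi>, (j - 1) mod N)"
    by (rule gset_cover[OF assms(1,2)])
  show ?thesis
  proof (induction \<alpha>)
    case (Cons e \<alpha>)
    then show ?case by (simp add: mod_simps algebra_simps)
  qed (use assms(3) in simp)
qed

end

context rfd_data
begin

lemma elt_coeff:
  assumes S: "closed_roots S" and N: "(N :: int) > 0" and t: "t \<in> cells" "fpath \<alpha> t" "fpath \<beta> t"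
  shows "cact N S (elt \<alpha> t \<beta>) (\<lambda>\<xi>. if \<xi> = (Q, j') then 1 else 0) (P, i) =
    (if \<exists>\<eta>\<in>Dq t. snd \<eta> \<in> S \<and> (\<exists>j\<in>{0..<N}. P = b.pt \<alpha> \<eta> \<and> i = (j + int (length \<alpha>)) mod N \<and>
       Q = b.pt \<beta> \<eta> \<and> j' = (j + int (length \<beta>)) mod N) then 1 else 0)"
proof -
  interpret c: gset G "\<lambda>A. (D0 A \<inter> {p. snd p \<in> S}) \<times> {0..<N}" "\<lambda>e. (R0 e \<inter> {p. snd p \<in> S}) \<times> {0..<N}"
    "\<lambda>e (\<xi>, j). (th0 e \<xi>, (j + 1) mod N)" "\<lambda>e (\<xi>, j). (sg0 e \<xi>, (j - 1) mod N)"
    by (rule gset_cover[OF S N])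
  let ?Q = "(Dq t \<inter> {p. snd p \<in> S}) \<times> {0..<N}"
  have tg: "t \<in> gen_verts G" by (rule cells_gen_verts[OF t(1)])
  have VE: "{v \<in> V0 \<inter> t. {v} \<noteq> t} = {} \<or> {e \<in> F'. {src G e} = t} = {}" by auto
  have q: "c.act (q t) f = (\<lambda>\<eta>. if \<eta> \<in> ?Q then f \<eta> else 0)" for f :: "_ \<Rightarrow> 'a"
  proof -
    have "?Q = {\<eta> \<in> (D0 t \<inter> {p. snd p \<in> S}) \<times> {0..<N}.
        (\<forall>v\<in>{v \<in> V0 \<inter> t. {v} \<noteq> t}. \<eta> \<notin> (D0 {v} \<inter> {p. snd p \<in> S}) \<times> {0..<N}) \<and>
        (\<forall>e\<in>{e \<in> F'. {src G e} = t}. \<eta> \<notin> (R0 e \<inter> {p. snd p \<in> S}) \<times> {0..<N})}"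
      by (auto simp: Dq_def)
    moreover have "c.act (q t) f = (\<lambda>\<eta>. if \<eta> \<in> {\<eta> \<in> (D0 t \<inter> {p. snd p \<in> S}) \<times> {0..<N}.
        (\<forall>v\<in>{v \<in> V0 \<inter> t. {v} \<noteq> t}. \<eta> \<notin> (D0 {v} \<inter> {p. snd p \<in> S}) \<times> {0..<N}) \<and>
        (\<forall>e\<in>{e \<in> F'. {src G e} = t}. \<eta> \<notin> (R0 e \<inter> {p. snd p \<in> S}) \<times> {0..<N})} then f \<eta> else 0)"
      unfolding q_def
    proof (rule c.act_cell[OF ug fin_sums(1) _ _ tg fin_sums(2) _ _ VE])
      show "{v \<in> V0 \<inter> t. {v} \<noteq> t} \<subseteq> t" "{v \<in> V0 \<inter> t. {v} \<noteq> t} \<subseteq> verts G" using V0_verts by auto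
      show "{e \<in> F'. {src G e} = t} \<subseteq> edges G" using F'_F(3) by auto
      show "\<And>e. e \<in> {e \<in> F'. {src G e} = t} \<Longrightarrow> src G e \<in> t" by auto
    qed
    ultimately show ?thesis by (simp only:)
  qed
  have sub: "?Q \<subseteq> (D0 (rng G (last \<gamma>)) \<inter> {p. snd p \<in> S}) \<times> {0..<N}" if "fpath \<gamma> t" "\<gamma> \<noteq> []" for \<gamma>
  proof -
    have "rng G (last \<gamma>) \<in> gen_verts G" "t \<subseteq> rng G (last \<gamma>)"
      using that rng_gen_verts_last[OF ug that(2) fpath_edges[OF that(1)]] by (auto simp: fpath_def)
    then show ?thesis using b.D_mono[OF tg] Dq_D0 by auto
  qed
  have "cact N S (elt \<alpha> t \<beta>) (\<lambda>\<xi>. if \<xi> = (Q, j') then 1 else 0) (P, i) =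
      (if \<exists>\<eta>\<in>?Q. (P, i) = c.pt \<alpha> \<eta> \<and> (Q, j') = c.pt \<beta> \<eta> then 1 else 0 :: 'a)"
    unfolding cact_def elt_def
    by (rule c.act_path_unit[OF ug _ _ q]) (use t sub in \<open>auto simp: fpath_def\<close>)
  also have "(\<exists>\<eta>\<in>?Q. (P, i) = c.pt \<alpha> \<eta> \<and> (Q, j') = c.pt \<beta> \<eta>) \<longleftrightarrow>
     (\<exists>\<eta>\<in>Dq t. snd \<eta> \<in> S \<and> (\<exists>j\<in>{0..<N}. (P, i) = c.pt \<alpha> (\<eta>, j) \<and> (Q, j') = c.pt \<beta> (\<eta>, j)))"
    by blast
  also have "\<dots> \<longleftrightarrow> (\<exists>\<eta>\<in>Dq t. snd \<eta> \<in> S \<and> (\<exists>j\<in>{0..<N}. P = b.pt \<alpha> \<eta> \<and> i = (j + int (length \<alpha>)) mod N \<and>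
       Q = b.pt \<beta> \<eta> \<and> j' = (j + int (length \<beta>)) mod N))"
    by (rule bex_cong[OF refl], rule conj_cong[OF refl], rule bex_cong[OF refl])
      (simp add: cover_pt[OF S N])
  finally show ?thesis .
qed

section \<open>Coefficient functionals biorthogonal to the units\<close>

definition degr :: "'e list \<times> 'v set \<times> 'e list \<Rightarrow> int" where
  "degr = (\<lambda>(\<alpha>, t, \<beta>). int (length \<alpha>) - int (length \<beta>))"

text \<open>Different triples may give the same unit modulo the relations, as paths can wind around a cycle;
  the key of a triple identifies the unit.\<close>

definition key :: "'e list \<times> 'v set \<times> 'e list \<Rightarrow> ('e list \<times> 'v set) \<times> ('e list \<times> 'v set) \<times> int" where
  "key = (\<lambda>(\<alpha>, t, \<beta>). (b.pt \<alpha> (base t), b.pt \<beta> (base t), int (length \<alpha>) - int (length \<beta>)))"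

definition keys_upto :: "nat \<Rightarrow> (('e list \<times> 'v set) \<times> ('e list \<times> 'v set) \<times> int) set" where
  "keys_upto L = {key \<tau> |\<tau>. good \<tau> \<and> \<bar>degr \<tau>\<bar> \<le> int L}"

text \<open>Triples with equal keys give congruent units, so the choice does not matter modulo the
  relations.\<close>

definition unit_of :: "('e list \<times> 'v set) \<times> ('e list \<times> 'v set) \<times> int \<Rightarrow> ('v, 'e, 'k::field) free_elem" where
  "unit_of \<kappa> = (let (\<alpha>, t, \<beta>) = (SOME \<tau>. good \<tau> \<and> key \<tau> = \<kappa>) in elt \<alpha> t \<beta>)"

definition orbit_of :: "('e list \<times> 'v set) \<times> ('e list \<times> 'v set) \<times> int \<Rightarrow> 'v set set" where
  "orbit_of = (\<lambda>(P, Q, d). SOME S. snd Q \<in> S \<and> closed_roots S)"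

text \<open>The matrix entry from (Q, 0) to (P, d mod N) with N = 2L + 1. Degrees from -L to L are
  distinct modulo this N, so the entry sees d itself.\<close>

definition coeff :: "nat \<Rightarrow> ('e list \<times> 'v set) \<times> ('e list \<times> 'v set) \<times> int \<Rightarrow> ('v, 'e, 'k::field) free_elem \<Rightarrow> 'k" where
  "coeff L \<kappa> x = (case \<kappa> of (P, Q, d) \<Rightarrow>
    cact (2 * int L + 1) (orbit_of \<kappa>) x (\<lambda>\<xi>. if \<xi> = (Q, 0) then 1 else 0) (P, d mod (2 * int L + 1)))"

lemma fpath_pt:
  assumes "t \<in> live" "fpath \<alpha> t"
  shows "b.pt \<alpha> (base t) \<in> points" "closed_roots S \<Longrightarrow> snd (b.pt \<alpha> (base t)) \<in> S \<longleftrightarrow> snd (base t) \<in> S"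
proof -
  have tg: "t \<in> gen_verts G" by (rule cells_gen_verts[OF live_cells[OF assms(1)]])
  have D: "base t \<in> D0 (rng G (last \<alpha>))" if "\<alpha> \<noteq> []"
    using b.D_mono[OF tg _ _ Dq_D0[OF base[OF assms(1)]], of "rng G (last \<alpha>)"] that
      rng_gen_verts_last[OF ug that fpath_edges[OF assms(2)]] assms(2) by (auto simp: fpath_def)
  show "b.pt \<alpha> (base t) \<in> points"
  proof (cases "\<alpha> = []")
    case True
    then show ?thesis using Dq_points[OF base[OF assms(1)]] by simp
  next
    case False
    then have "b.pt \<alpha> (base t) \<in> D0 {path_src G \<alpha>}" using D assms(2) by (intro D0_path) (auto simp: fpath_def)
    then show ?thesis by (auto simp: D0_def)
  qed
  show "snd (b.pt \<alpha> (base t)) \<in> S \<longleftrightarrow> snd (base t) \<in> S" if "closed_roots S"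
    using pt_root[OF that] D assms(2) by (cases "\<alpha> = []") (auto simp: fpath_def)
qed

lemma orbit_of:
  assumes "t \<in> live" "fpath \<alpha> t" "fpath \<beta> t"
  shows "closed_roots (orbit_of (key (\<alpha>, t, \<beta>)))" "snd (base t) \<in> orbit_of (key (\<alpha>, t, \<beta>))"
proof -
  have "is_root (snd (b.pt \<beta> (base t)))" using fpath_pt(1)[OF assms(1,3)] by (auto simp: points_def)
  then have *: "snd (b.pt \<beta> (base t)) \<in> orbit_of (key (\<alpha>, t, \<beta>)) \<and> closed_roots (orbit_of (key (\<alpha>, t, \<beta>)))"
    unfolding orbit_of_def key_def prod.case using someI_ex[OF ex_closed_roots] by blast
  then show "closed_roots (orbit_of (key (\<alpha>, t, \<beta>)))" by blast
  then show "snd (base t) \<in> orbit_of (key (\<alpha>, t, \<beta>))" using * fpath_pt(2)[OF assms(1,3)] by blast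
qed

lemma mod_eq_small:
  assumes "\<bar>a\<bar> \<le> int L" "\<bar>c\<bar> \<le> int L" "a mod (2 * int L + 1) = c mod (2 * int L + 1)"
  shows "a = c"
proof -
  have "(2 * int L + 1) dvd (a - c)" using assms(3) by (simp add: mod_eq_dvd_iff)
  then obtain k where k: "a - c = (2 * int L + 1) * k" by blast
  have "\<bar>a - c\<bar> < 2 * int L + 1" using assms(1,2) by linarith
  have "k = 0"
  proof (rule ccontr)
    assume "k \<noteq> 0"
    then have "(2 * int L + 1) * 1 \<le> (2 * int L + 1) * \<bar>k\<bar>" by (intro mult_left_mono) auto
    moreover have "\<bar>(2 * int L + 1) * k\<bar> = (2 * int L + 1) * \<bar>k\<bar>" by (simp add: abs_mult)
    ultimately have "\<not> \<bar>a - c\<bar> < 2 * int L + 1" unfolding k by (simp only: not_less mult_1_right)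
    then show False using \<open>\<bar>a - c\<bar> < 2 * int L + 1\<close> by blast
  qed
  then show ?thesis using k by simp
qed

text \<open>A nonzero entry supplies a point of the cell and a position j in Z/N. Subtracting the
  two congruences for j gives equal degrees, and \<open>separation\<close> applies. Conversely, the
  base point of the cell at the position -|\<beta>| modulo N realizes the entry.\<close>

lemma coeff_unit:
  assumes t: "t \<in> live" "fpath \<alpha> t" "fpath \<beta> t" "\<bar>degr (\<alpha>, t, \<beta>)\<bar> \<le> int L"
    and t': "t' \<in> live" "fpath \<alpha>' t'" "fpath \<beta>' t'" "\<bar>degr (\<alpha>', t', \<beta>')\<bar> \<le> int L"
  shows "coeff L (key (\<alpha>', t', \<beta>')) (elt \<alpha> t \<beta>) =
      (if key (\<alpha>', t', \<beta>') = key (\<alpha>, t, \<beta>) then 1 else 0 :: 'k::field)"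
    and "key (\<alpha>', t', \<beta>') = key (\<alpha>, t, \<beta>) \<Longrightarrow>
      lcong G (elt \<alpha> t \<beta> :: ('v, 'e, 'k) free_elem) (elt \<alpha>' t' \<beta>')"
proof -
  let ?N = "2 * int L + 1" and ?\<kappa> = "key (\<alpha>', t', \<beta>')"
  let ?d = "int (length \<alpha>') - int (length \<beta>')"
  have N: "?N > 0" by simp
  let ?ex = "\<exists>\<eta>\<in>Dq t. snd \<eta> \<in> orbit_of ?\<kappa> \<and> (\<exists>j\<in>{0..<?N}. b.pt \<alpha>' (base t') = b.pt \<alpha> \<eta> \<and>
      ?d mod ?N = (j + int (length \<alpha>)) mod ?N \<and> b.pt \<beta>' (base t') = b.pt \<beta> \<eta> \<and> 0 = (j + int (length \<beta>)) mod ?N)"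
  have c: "coeff L ?\<kappa> (elt \<alpha> t \<beta>) = (if ?ex then 1 else 0 :: 'k)"
  proof -
    have "coeff L ?\<kappa> (elt \<alpha> t \<beta>) = (cact ?N (orbit_of ?\<kappa>) (elt \<alpha> t \<beta>)
        (\<lambda>\<xi>. if \<xi> = (b.pt \<beta>' (base t'), 0) then 1 else 0) (b.pt \<alpha>' (base t'), ?d mod ?N) :: 'k)"
      by (simp add: coeff_def key_def)
    then show ?thesis unfolding elt_coeff[OF orbit_of(1)[OF t'(1-3)] N live_cells[OF t(1)] t(2,3)] .
  qed
  have sep: "lcong G (elt \<alpha> t \<beta> :: ('v, 'e, 'k) free_elem) (elt \<alpha>' t' \<beta>') \<and> ?\<kappa> = key (\<alpha>, t, \<beta>)" if ex: ?ex
  proof -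
    obtain \<eta> j where \<eta>: "\<eta> \<in> Dq t" "b.pt \<alpha>' (base t') = b.pt \<alpha> \<eta>" "b.pt \<beta>' (base t') = b.pt \<beta> \<eta>"
      "?d mod ?N = (j + int (length \<alpha>)) mod ?N" "0 = (j + int (length \<beta>)) mod ?N" using ex by blast
    have "?d mod ?N = ((j + int (length \<alpha>)) mod ?N - (j + int (length \<beta>)) mod ?N) mod ?N"
      using \<eta>(4,5) by simp
    also have "\<dots> = (int (length \<alpha>) - int (length \<beta>)) mod ?N" by (simp add: mod_simps)
    finally have len: "int (length \<alpha>) - int (length \<beta>) = ?d"
      using mod_eq_small[of ?d L "int (length \<alpha>) - int (length \<beta>)"] t(4) t'(4) by (simp add: degr_def)
    have "lcong G (elt \<alpha> t \<beta> :: ('v, 'e, 'k) free_elem) (elt \<alpha>' t' \<beta>') \<and>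
      b.pt \<alpha> (base t) = b.pt \<alpha>' (base t') \<and> b.pt \<beta> (base t) = b.pt \<beta>' (base t')"
      by (rule separation[OF t(1-3) t'(1-3) \<eta>(1) \<eta>(2,3)[symmetric] len])
    then show ?thesis using len by (simp add: key_def)
  qed
  have ex: ?ex if eq: "?\<kappa> = key (\<alpha>, t, \<beta>)"
  proof -
    have e: "b.pt \<alpha>' (base t') = b.pt \<alpha> (base t)" "b.pt \<beta>' (base t') = b.pt \<beta> (base t)"
      "?d = int (length \<alpha>) - int (length \<beta>)" using eq by (auto simp: key_def)
    let ?j = "(- int (length \<beta>)) mod ?N"
    have "?j \<in> {0..<?N}"
      unfolding atLeastLessThan_iff using pos_mod_bound[OF N] pos_mod_sign[OF N] by blast
    moreover have "?d mod ?N = (?j + int (length \<alpha>)) mod ?N" unfolding e(3) by (simp add: mod_simps)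
    moreover have "0 = (?j + int (length \<beta>)) mod ?N" by (simp add: mod_simps)
    moreover have "snd (base t) \<in> orbit_of ?\<kappa>" unfolding eq by (rule orbit_of(2)[OF t(1-3)])
    ultimately show ?thesis using e base[OF t(1)] by blast
  qed
  have iff: "?ex \<longleftrightarrow> ?\<kappa> = key (\<alpha>, t, \<beta>)" using sep ex by blast
  show "coeff L ?\<kappa> (elt \<alpha> t \<beta>) = (if ?\<kappa> = key (\<alpha>, t, \<beta>) then 1 else 0 :: 'k)"
    unfolding c by (rule arg_cong[OF iff, of "\<lambda>b. if b then 1 else 0"])
  show "?\<kappa> = key (\<alpha>, t, \<beta>) \<Longrightarrow> lcong G (elt \<alpha> t \<beta> :: ('v, 'e, 'k) free_elem) (elt \<alpha>' t' \<beta>')"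
    using sep ex by blast
qed

text \<open>The points that occur in keys. There are finitely many of them although \<alpha> may
  wind arbitrarily often, because windings leave no trace in the point.\<close>

definition frame :: "('e list \<times> 'v set) set" where
  "frame = {b.pt \<alpha> (base t) |\<alpha> t. t \<in> live \<and> fpath \<alpha> t}"

text \<open>A nonempty path in \<open>F'\<close> is an acyclic path into a vertex chosen from the
  range of its last edge, and there are finitely many such edges.\<close>

lemma finite_F'_paths: "finite {\<alpha>. set \<alpha> \<subseteq> F' \<and> (\<alpha> = [] \<or> ug_path G \<alpha>)}"
proof -
  have sm: "(SOME v. v \<in> rng G e) \<in> rng G e" if "e \<in> F'" for e
    using is_ultragraph_simps(3)[OF ug F'_F(3)[OF that]] some_in_eq by blast
  have "{\<alpha>. set \<alpha> \<subseteq> F' \<and> (\<alpha> = [] \<or> ug_path G \<alpha>)} \<subseteq> insert [] (\<Union>e\<in>F'. acyclic_paths (SOME v. v \<in> rng G e))"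
  proof
    fix \<alpha> assume \<alpha>: "\<alpha> \<in> {\<alpha>. set \<alpha> \<subseteq> F' \<and> (\<alpha> = [] \<or> ug_path G \<alpha>)}"
    show "\<alpha> \<in> insert [] (\<Union>e\<in>F'. acyclic_paths (SOME v. v \<in> rng G e))"
    proof (cases "\<alpha> = []")
      case False
      then have "last \<alpha> \<in> F'" using \<alpha> last_in_set by blast
      moreover have "\<alpha> \<in> acyclic_paths (SOME v. v \<in> rng G (last \<alpha>))"
        using \<alpha> False sm[OF \<open>last \<alpha> \<in> F'\<close>] F'_F(2) by (auto simp: acyclic_paths_def)
      ultimately show ?thesis by blast
    qed simp
  qed
  moreover have "finite (acyclic_paths (SOME v. v \<in> rng G e))" if "e \<in> F'" for e
    using sm[OF that] is_ultragraph_simps(2)[OF ug F'_F(3)[OF that]] by (intro finite_acyclic_paths) blast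
  ultimately show ?thesis using fin_sums(3) by (elim finite_subset) auto
qed

lemma finite_frame: "finite frame"
proof -
  let ?AP = "{\<alpha>. set \<alpha> \<subseteq> F' \<and> (\<alpha> = [] \<or> ug_path G \<alpha>)}"
  let ?B = "base ` cells \<union> (\<lambda>u. ([], {u})) ` V0"
  have "frame \<subseteq> (\<lambda>(\<alpha>, a, r). (\<alpha> @ a, r)) ` (?AP \<times> ?B)"
  proof
    fix p assume "p \<in> frame"
    then obtain \<alpha> t where p: "p = b.pt \<alpha> (base t)" "t \<in> live" "fpath \<alpha> t" by (auto simp: frame_def)
    have tc: "t \<in> cells" "t \<noteq> {}" using p live_cells cells_nonempty by auto
    show "p \<in> (\<lambda>(\<alpha>, a, r). (\<alpha> @ a, r)) ` (?AP \<times> ?B)"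
    proof (cases "\<exists>w. t = {w} \<and> on_cycle G w")
      case True
      then obtain w where w: "t = {w}" "on_cycle G w" by blast
      obtain \<alpha>0 \<delta> u where d: "\<alpha> = \<alpha>0 @ \<delta>" "set \<alpha>0 \<subseteq> F'" "u \<in> V0" "b.pt \<alpha> ([], {w}) = (\<alpha>0, {u})"
        using fpath_cyc[OF p(3)[unfolded w] w(2)] tc w by metis
      have "base t = ([], {w})" using Dq_cyc[OF w(2)] base[OF p(2)] w by blast
      then have "p = (\<alpha>0 @ [], {u})" using d p by simp
      moreover have "\<alpha>0 \<in> ?AP"
      proof (cases "\<alpha>0 = [] \<or> \<delta> = []")
        case True
        then show ?thesis using d p(3) by (auto simp: fpath_def)
      next
        case False
        then show ?thesis using d p(3) ug_path_append[of \<alpha>0 \<delta> G] by (auto simp: fpath_def)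
      qed
      ultimately show ?thesis using d(3) by (intro image_eqI[of _ _ "(\<alpha>0, [], {u})"]) auto
    next
      case False
      have ac: "set \<alpha> \<inter> cyc_edges = {}" by (rule fpath_acyclic[OF p(3) tc(2) False])
      obtain a r where ar: "base t = (a, r)" by fastforce
      have "p = (\<alpha> @ a, r)" using p(1) ac by (simp add: ar pt_acyclic)
      moreover have "\<alpha> \<in> ?AP" using p(3) ac by (auto simp: fpath_def F'_def)
      moreover have "(a, r) \<in> ?B" using tc(1) ar by (metis UnI1 image_eqI)
      ultimately show ?thesis by (intro image_eqI[of _ _ "(\<alpha>, a, r)"]) auto
    qed
  qed
  moreover have "finite cells" using fin by (simp add: cells_def)
  ultimately show ?thesis using finite_F'_paths fin by (elim finite_subset) auto
qed

lemma keys_upto_subset: "keys_upto L \<subseteq> frame \<times> frame \<times> {- int L..int L}"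
  by (auto simp: keys_upto_def key_def good_def frame_def degr_def)

lemma finite_keys_upto: "finite (keys_upto L)"
  by (rule finite_subset[OF keys_upto_subset]) (use finite_frame in auto)

text \<open>Linear in L: the two points range over a fixed finite set and only the degree moves. The
  norm estimate for high powers rests on this.\<close>

lemma card_keys_upto: "card (keys_upto L) \<le> (card frame)\<^sup>2 * (2 * L + 1)"
proof -
  have "card (keys_upto L) \<le> card (frame \<times> frame \<times> {- int L..int L})"
    by (rule card_mono[OF _ keys_upto_subset]) (use finite_frame in auto)
  also have "\<dots> = (card frame)\<^sup>2 * (2 * L + 1)"
    by (simp add: card_cartesian_product power2_eq_square nat_add_distrib nat_mult_distrib
        algebra_simps)
  finally show ?thesis .
qed

lemma coeff_add: "coeff L \<kappa> (x + y) = coeff L \<kappa> x + coeff L \<kappa> y"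
  and coeff_scale: "coeff L \<kappa> (cst c * x) = c * coeff L \<kappa> x"
  and coeff_LI: "x \<in> LI G \<Longrightarrow> coeff L \<kappa> x = 0"
  if "\<kappa> \<in> keys_upto L"
proof -
  obtain P Q d where k: "\<kappa> = (P, Q, d)" by (rule prod_cases3)
  have S: "closed_roots (orbit_of \<kappa>)" using that orbit_of(1) by (auto simp: keys_upto_def good_def)
  interpret c: gset G "\<lambda>A. (D0 A \<inter> {p. snd p \<in> orbit_of \<kappa>}) \<times> {0..<2 * int L + 1}"
    "\<lambda>e. (R0 e \<inter> {p. snd p \<in> orbit_of \<kappa>}) \<times> {0..<2 * int L + 1}"
    "\<lambda>e (\<xi>, j). (th0 e \<xi>, (j + 1) mod (2 * int L + 1))" "\<lambda>e (\<xi>, j). (sg0 e \<xi>, (j - 1) mod (2 * int L + 1))"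
    by (rule gset_cover[OF S]) simp
  show "coeff L \<kappa> (x + y) = coeff L \<kappa> x + coeff L \<kappa> y"
    by (simp add: coeff_def k[symmetric] cact_def c.act_add_left split: prod.splits)
  show "coeff L \<kappa> (cst c * x) = c * coeff L \<kappa> x"
    by (simp add: coeff_def cact_def c.act_scale_left split: prod.splits)
  show "x \<in> LI G \<Longrightarrow> coeff L \<kappa> x = 0"
    by (simp add: coeff_def cact_def c.act_LI split: prod.splits)
qed

definition expands :: "nat \<Rightarrow> ('v, 'e, 'k::field) free_elem \<Rightarrow> bool" where
  "expands L x \<longleftrightarrow> lcong G x (\<Sum>\<kappa>\<in>keys_upto L. cst (coeff L \<kappa> x) * unit_of \<kappa>)"

lemma expands_add:
  assumes "expands L x" "expands L y"
  shows "expands L (x + y)"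
proof -
  have *: "(\<Sum>\<kappa>\<in>keys_upto L. cst (coeff L \<kappa> (x + y)) * unit_of \<kappa>) =
      (\<Sum>\<kappa>\<in>keys_upto L. cst (coeff L \<kappa> x) * unit_of \<kappa>) + (\<Sum>\<kappa>\<in>keys_upto L. cst (coeff L \<kappa> y) * unit_of \<kappa>)"
    by (simp add: coeff_add single_add distrib_right sum.distrib)
  show ?thesis unfolding expands_def * by (intro lcong_add assms[unfolded expands_def])
qed

lemma expands_scale:
  assumes "expands L x"
  shows "expands L (cst c * x)"
proof -
  have *: "(\<Sum>\<kappa>\<in>keys_upto L. cst (coeff L \<kappa> (cst c * x)) * unit_of \<kappa>) =
      cst c * (\<Sum>\<kappa>\<in>keys_upto L. cst (coeff L \<kappa> x) * unit_of \<kappa>)"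
    by (simp add: coeff_scale sum_distrib_left cst_simps(1)[symmetric] mult.assoc)
  show ?thesis unfolding expands_def * by (intro lcong_cst assms[unfolded expands_def])
qed

lemma expands_LI: "x \<in> LI G \<Longrightarrow> expands L x"
  by (simp add: expands_def coeff_LI lcong_0_iff)

lemma unit_of_key:
  assumes "t \<in> live" "fpath \<alpha> t" "fpath \<beta> t"
  obtains \<alpha>' t' \<beta>' where "t' \<in> live" "fpath \<alpha>' t'" "fpath \<beta>' t'" "key (\<alpha>', t', \<beta>') = key (\<alpha>, t, \<beta>)"
    "unit_of (key (\<alpha>, t, \<beta>)) = (elt \<alpha>' t' \<beta>' :: ('v, 'e, 'k::field) free_elem)"
proof -
  obtain \<alpha>' t' \<beta>' where *: "(SOME \<tau>. good \<tau> \<and> key \<tau> = key (\<alpha>, t, \<beta>)) = (\<alpha>', t', \<beta>')" by (rule prod_cases3)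
  have "good (\<alpha>', t', \<beta>') \<and> key (\<alpha>', t', \<beta>') = key (\<alpha>, t, \<beta>)"
    unfolding *[symmetric] by (rule someI[of _ "(\<alpha>, t, \<beta>)"]) (use assms in \<open>simp add: good_def\<close>)
  then show ?thesis using that[of t' \<alpha>' \<beta>'] * by (simp add: unit_of_def good_def)
qed

text \<open>By biorthogonality only the key of the unit itself contributes, and the chosen
  representative for that key is congruent to the unit.\<close>

lemma expands_elt:
  assumes t: "t \<in> live" "fpath \<alpha> t" "fpath \<beta> t" "\<bar>int (length \<alpha>) - int (length \<beta>)\<bar> \<le> int L"
  shows "expands L (elt \<alpha> t \<beta> :: ('v, 'e, 'k::field) free_elem)"
proof -
  let ?k = "key (\<alpha>, t, \<beta>)"
  have d: "\<bar>degr (\<alpha>, t, \<beta>)\<bar> \<le> int L" using t(4) by (simp add: degr_def)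
  have k: "?k \<in> keys_upto L" using t d by (auto simp: keys_upto_def good_def)
  have "coeff L \<kappa> (elt \<alpha> t \<beta>) = (if \<kappa> = ?k then 1 else 0 :: 'k)" if "\<kappa> \<in> keys_upto L" for \<kappa>
  proof -
    obtain \<alpha>' t' \<beta>' where t': "\<kappa> = key (\<alpha>', t', \<beta>')" "t' \<in> live" "fpath \<alpha>' t'" "fpath \<beta>' t'"
      "\<bar>degr (\<alpha>', t', \<beta>')\<bar> \<le> int L"
    proof -
      obtain \<tau> where \<tau>: "\<kappa> = key \<tau>" "good \<tau>" "\<bar>degr \<tau>\<bar> \<le> int L" using \<open>\<kappa> \<in> keys_upto L\<close> by (auto simp: keys_upto_def)
      obtain \<alpha>' t' \<beta>' where "\<tau> = (\<alpha>', t', \<beta>')" by (rule prod_cases3)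
      then show ?thesis using that[of \<alpha>' t' \<beta>'] \<tau> by (simp add: good_def)
    qed
    show ?thesis unfolding t'(1) by (rule coeff_unit(1)[OF t(1-3) d t'(2-5)])
  qed
  then have "(\<Sum>\<kappa>\<in>keys_upto L. cst (coeff L \<kappa> (elt \<alpha> t \<beta>)) * unit_of \<kappa>) =
      (\<Sum>\<kappa>\<in>keys_upto L. if \<kappa> = ?k then unit_of ?k else 0 :: ('v, 'e, 'k) free_elem)"
    by (intro sum.cong) auto
  also have "\<dots> = unit_of ?k" using k finite_keys_upto by simp
  finally have s: "(\<Sum>\<kappa>\<in>keys_upto L. cst (coeff L \<kappa> (elt \<alpha> t \<beta>)) * unit_of \<kappa>) = (unit_of ?k :: ('v, 'e, 'k) free_elem)" .
  obtain \<alpha>' t' \<beta>' where t': "t' \<in> live" "fpath \<alpha>' t'" "fpath \<beta>' t'" "key (\<alpha>', t', \<beta>') = ?k"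
    "unit_of ?k = (elt \<alpha>' t' \<beta>' :: ('v, 'e, 'k) free_elem)" using unit_of_key[OF t(1-3)] by metis
  have "\<bar>degr (\<alpha>', t', \<beta>')\<bar> \<le> int L" using t'(4) d by (simp add: key_def degr_def)
  then show ?thesis unfolding expands_def s t'(5)
    by (rule coeff_unit(2)[OF t(1-3) d t'(1-3) _ t'(4)])
qed

lemma expands_span: "x \<in> span d \<Longrightarrow> \<bar>d\<bar> \<le> int L \<Longrightarrow> expands L x"
  by (induction rule: span.induct) (auto intro: expands_LI expands_elt expands_add expands_scale)

lemma expansion:
  assumes "\<And>w. w \<in> Poly_Mapping.keys x \<Longrightarrow> letters w \<noteq> [] \<and> set (letters w) \<subseteq> gens0 \<and> length (letters w) \<le> L"
  shows "expands L x"
proof (rule poly_mapping_span_induct[of x "expands L"])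
  fix w c assume w: "w \<in> Poly_Mapping.keys x"
  have "expands L (wd (letters w))"
    using assms[OF w] sum_gdeg_le[of "letters w"] by (intro expands_span[OF word_span]) auto
  then show "expands L (Poly_Mapping.single w c)" by (subst single_eq_cst) (rule expands_scale)
qed (auto intro: expands_LI expands_add)

end

section \<open>The universal C*-seminorm\<close>

definition adm :: "('v, 'e) ultragraph \<Rightarrow> (('v, 'e, complex) free_elem \<Rightarrow> real) \<Rightarrow> bool" where
  "adm G \<rho> \<longleftrightarrow> cstar_seminorm (free_star_algebra G) \<rho> \<and> (\<forall>r\<in>cstar_relators G. \<rho> r = 0)"

context
  fixes G :: "('v, 'e) ultragraph" and \<rho>
  assumes ug: "is_ultragraph G" and adm: "adm G \<rho>"
begin

lemma adm_nonneg: "x \<in> fcar G \<Longrightarrow> 0 \<le> \<rho> x"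
  and adm_add: "x \<in> fcar G \<Longrightarrow> y \<in> fcar G \<Longrightarrow> \<rho> (x + y) \<le> \<rho> x + \<rho> y"
  and adm_scale: "x \<in> fcar G \<Longrightarrow> \<rho> (cst c * x) = cmod c * \<rho> x"
  and adm_mult: "x \<in> fcar G \<Longrightarrow> y \<in> fcar G \<Longrightarrow> \<rho> (x * y) \<le> \<rho> x * \<rho> y"
  and adm_cstar: "x \<in> fcar G \<Longrightarrow> \<rho> (free_star x * x) = (\<rho> x)\<^sup>2"
  and adm_relator: "x \<in> cstar_relators G \<Longrightarrow> \<rho> x = 0"
  using adm unfolding adm_def cstar_seminorm_def free_star_algebra_simps by blast+

lemma adm_0: "\<rho> 0 = 0"
  using adm_scale[of 0 0] by (simp add: cst_simps)

lemma adm_uminus: "x \<in> fcar G \<Longrightarrow> \<rho> (- x) = \<rho> x"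
  using adm_scale[of x "-1"] by (simp add: cst_simps)

lemma adm_star: "x \<in> fcar G \<Longrightarrow> \<rho> (free_star x) = \<rho> x"
proof -
  have le: "\<rho> y \<le> \<rho> (free_star y)" if "y \<in> fcar G" for y
  proof (cases "\<rho> y = 0")
    case False
    then have "\<rho> y > 0" using adm_nonneg[OF that] by linarith
    moreover have "\<rho> y * \<rho> y \<le> \<rho> (free_star y) * \<rho> y"
      using adm_cstar[OF that] adm_mult[of "free_star y" y] that by (simp add: power2_eq_square)
    ultimately show ?thesis by simp
  qed (use that adm_nonneg in simp)
  assume "x \<in> fcar G"
  then show ?thesis using le[of x] le[of "free_star x"] by (simp add: free_star_star)
qed

text \<open>The kernel of an admissible seminorm. It is an ideal closed under the involution, so
  algebraic consequences of the C*-relations can be derived inside it.\<close>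

definition kr :: "('v, 'e, complex) free_elem set" where "kr = {x \<in> fcar G. \<rho> x = 0}"

lemma kr_add: "x \<in> kr \<Longrightarrow> y \<in> kr \<Longrightarrow> x + y \<in> kr"
  using adm_add[of x y] adm_nonneg[of "x + y"] by (auto simp: kr_def)

lemma kr_scale: "x \<in> kr \<Longrightarrow> cst c * x \<in> kr"
  by (auto simp: kr_def adm_scale)

lemma kr_uminus: "x \<in> kr \<Longrightarrow> - x \<in> kr"
  by (auto simp: kr_def adm_uminus)

lemma kr_diff: "x \<in> kr \<Longrightarrow> y \<in> kr \<Longrightarrow> x - y \<in> kr"
  using kr_add[of x "-y"] kr_uminus by auto

lemma kr_mult: "x \<in> kr \<Longrightarrow> y \<in> fcar G \<Longrightarrow> x * y \<in> kr" "x \<in> kr \<Longrightarrow> y \<in> fcar G \<Longrightarrow> y * x \<in> kr"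
  using adm_mult[of x y] adm_nonneg[of "x * y"] adm_mult[of y x] adm_nonneg[of "y * x"]
  by (auto simp: kr_def)

lemma kr_star: "x \<in> kr \<Longrightarrow> free_star x \<in> kr"
  by (auto simp: kr_def adm_star)

lemma adm_cong: "x \<in> fcar G \<Longrightarrow> y \<in> fcar G \<Longrightarrow> x - y \<in> kr \<Longrightarrow> \<rho> x = \<rho> y"
  using adm_add[of "x - y" y] adm_add[of "y - x" x] adm_uminus[of "x - y"]
  by (simp add: kr_def)

lemma gens_fcar [simp]:
  "A \<in> gen_verts G \<Longrightarrow> PP A \<in> fcar G" "e \<in> edges G \<Longrightarrow> sp [e] \<in> fcar G" "e \<in> edges G \<Longrightarrow> gp [e] \<in> fcar G"
  by (auto simp: sp_def gp_def)

lemma lattice_kr: "x \<in> lattice_relators G \<Longrightarrow> x \<in> kr"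
  using adm_relator[of x] subsetD[OF leavitt_relators_fcar[OF ug], of x]
  by (auto simp: kr_def cstar_relators_def leavitt_relators_def)

lemma edge_kr:
  assumes e: "e \<in> edges G"
  shows "sp [e] * gp [e] * sp [e] - sp [e] \<in> kr" "gp [e] * sp [e] - PP (rng G e) \<in> kr"
    "PP {src G e} * (sp [e] * gp [e]) - sp [e] * gp [e] \<in> kr"
proof -
  have s: "src G e \<in> verts G" using ug e by simp
  have "sp [e] * gp [e] * sp [e] - sp [e] \<in> cstar_relators G" "gp [e] * sp [e] - PP (rng G e) \<in> cstar_relators G"
    "PP {src G e} * (sp [e] * gp [e]) - sp [e] * gp [e] \<in> cstar_relators G"
    unfolding cstar_relators_def gen_eq_wd sp_simps(3) gp_simps(3) using e by blast+
  from this[THEN adm_relator] show "sp [e] * gp [e] * sp [e] - sp [e] \<in> kr" "gp [e] * sp [e] - PP (rng G e) \<in> kr"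
    "PP {src G e} * (sp [e] * gp [e]) - sp [e] * gp [e] \<in> kr"
    unfolding kr_def using s e by auto
qed

lemma edge_kr_left: "e \<in> edges G \<Longrightarrow> PP {src G e} * sp [e] - sp [e] \<in> kr"
proof -
  assume e: "e \<in> edges G"
  note k = edge_kr[OF e]
  have s: "(PP {src G e} :: ('v, 'e, complex) free_elem) \<in> fcar G" using ug e by simp
  \<comment> \<open>An exact identity in the free algebra: s_e is replaced by s_e s_e^* s_e, the
    projection p_{s(e)} is absorbed, and s_e is restored; each correction lies in the
    kernel.\<close>
  have "PP {src G e} * sp [e] - sp [e] =
      (PP {src G e} * (sp [e] * gp [e]) - sp [e] * gp [e]) * sp [e] + (sp [e] * gp [e] * sp [e] - sp [e]) -
      PP {src G e} * (sp [e] * gp [e] * sp [e] - sp [e] :: ('v, 'e, complex) free_elem)"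
    by (simp add: algebra_simps)
  also have "\<dots> \<in> kr"
    by (rule kr_diff[OF kr_add[OF kr_mult(1)[OF k(3)] k(1)] kr_mult(2)[OF k(1)]]) (use e s in simp_all)
  finally show ?thesis .
qed

lemma edge_kr_right: "e \<in> edges G \<Longrightarrow> sp [e] * PP (rng G e) - sp [e] \<in> kr"
proof -
  assume e: "e \<in> edges G"
  note k = edge_kr[OF e]
  have "sp [e] * PP (rng G e) - sp [e] =
      (sp [e] * gp [e] * sp [e] - sp [e]) - sp [e] * (gp [e] * sp [e] - PP (rng G e) :: ('v, 'e, complex) free_elem)"
    by (simp add: algebra_simps)
  also have "\<dots> \<in> kr" by (rule kr_diff[OF k(1) kr_mult(2)[OF k(2)]]) (use e in simp)
  finally show ?thesis .
qed

lemma free_star_diff: "free_star (x - y) = free_star x - free_star y"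
  using free_star_add[of x "-y"] by (simp add: free_star_uminus)

text \<open>The relations only say that the product of the two range projections vanishes.
  Multiplying by s_e^* on the left and by s_f on the right recovers s_e^* s_f, as both are partial
  isometries.\<close>

lemma orth_kr:
  assumes "e \<in> edges G" "f \<in> edges G" "e \<noteq> f"
  shows "gp [e] * sp [f] \<in> kr"
proof -
  have "(sp [e] * gp [e]) * (sp [f] * gp [f]) \<in> cstar_relators G"
    unfolding cstar_relators_def gen_eq_wd sp_simps(3) gp_simps(3) using assms by blast
  then have y: "(sp [e] * gp [e]) * (sp [f] * gp [f]) \<in> kr"
    unfolding kr_def using adm_relator assms by auto
  have "free_star (sp [e] * gp [e] * sp [e] - sp [e]) \<in> kr" by (intro kr_star edge_kr assms)
  then have g: "gp [e] * sp [e] * gp [e] - gp [e] \<in> kr"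
    by (simp add: free_star_diff free_star_mult free_star_gens mult.assoc)
  have "gp [e] * sp [f] = gp [e] * ((sp [e] * gp [e]) * (sp [f] * gp [f])) * sp [f] -
      (gp [e] * sp [e] * gp [e] - gp [e]) * sp [f] -
      (gp [e] * sp [e] * gp [e]) * (sp [f] * gp [f] * sp [f] - sp [f] :: ('v, 'e, complex) free_elem)"
    by (simp add: algebra_simps)
  also have "\<dots> \<in> kr"
    by (rule kr_diff[OF kr_diff[OF kr_mult(1)[OF kr_mult(2)[OF y]] kr_mult(1)[OF g]] kr_mult(2)[OF edge_kr(1)[OF assms(2)]]])
      (use assms in simp_all)
  finally show ?thesis .
qed

text \<open>The relations for ghosts are not among the C*-relations, but they are adjoints of
  relations for edges. With them the expansion in units, which holds modulo the Leavitt relations,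
  is available in every admissible seminorm.\<close>

lemma leavitt_relators_kr:
  assumes "x \<in> leavitt_relators G"
  shows "x \<in> kr"
proof -
  consider "x \<in> lattice_relators G"
    | e where "e \<in> edges G" "x \<in> {PP {src G e} * sp [e] - sp [e],
       sp [e] * PP (rng G e) - sp [e], PP (rng G e) * gp [e] - gp [e], gp [e] * PP {src G e} - gp [e]}"
    | e f where "e \<in> edges G" "f \<in> edges G" "x = gp [e] * sp [f] - (if e = f then PP (rng G e) else 0)"
    | "x \<in> cuntz_krieger_relators G"
    using assms unfolding leavitt_relators_def gen_eq_wd sp_simps(3) gp_simps(3) by blast
  then show ?thesis
  proof cases
    case 2
    have "free_star (sp [e] * PP (rng G e) - sp [e]) \<in> kr" "free_star (PP {src G e} * sp [e] - sp [e]) \<in> kr"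
      using 2(1) by (intro kr_star edge_kr_left edge_kr_right; assumption)+
    then show ?thesis using 2 edge_kr_left edge_kr_right
      by (auto simp: free_star_diff free_star_mult free_star_gens)
  next
    case 3
    then show ?thesis using edge_kr(2) orth_kr by (cases "e = f") auto
  next
    case 4
    then show ?thesis
      using subsetD[OF leavitt_relators_fcar[OF ug] assms] adm_relator[of x] by (auto simp: kr_def cstar_relators_def)
  qed (rule lattice_kr)
qed

lemma LI_kr: "x \<in> LI G \<Longrightarrow> x \<in> kr"
proof (induction rule: ideal_generated.induct)
  case (relator r)
  then show ?case by (rule leavitt_relators_kr)
next
  case zero
  show ?case by (simp add: kr_def adm_0)
qed (auto intro: kr_add kr_scale kr_mult)

lemma adm_lcong: "lcong G x y \<Longrightarrow> x \<in> fcar G \<Longrightarrow> y \<in> fcar G \<Longrightarrow> \<rho> x = \<rho> y"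
  by (rule adm_cong) (auto simp: lcong_def LI_kr)

lemma adm_LI: "x \<in> LI G \<Longrightarrow> \<rho> x = 0"
  using LI_kr by (simp add: kr_def)

text \<open>For a projection p the C*-identity says that the seminorm of p equals its own square,
  and s_e^* s_e is the projection p_{r(e)} up to the kernel.\<close>

lemma adm_gen_le: "g \<in> generators G \<Longrightarrow> \<rho> (wd [g]) \<le> 1"
proof -
  assume g: "g \<in> generators G"
  have PP: "\<rho> (PP A) \<le> 1" if A: "A \<in> gen_verts G" for A
  proof -
    have "(\<rho> (PP A))\<^sup>2 = \<rho> (PP A * PP A)"
      using adm_cstar[of "PP A"] A by (simp add: free_star_gens)
    also have "\<dots> = \<rho> (PP A)"
      using lcong_PP_PP[OF A A] A by (intro adm_lcong) auto
    finally have "\<rho> (PP A) = 0 \<or> \<rho> (PP A) = 1" by (simp add: power2_eq_square)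
    then show ?thesis by auto
  qed
  have sp: "\<rho> (sp [e]) \<le> 1" if e: "e \<in> edges G" for e
  proof -
    have "(\<rho> (sp [e]))\<^sup>2 = \<rho> (gp [e] * sp [e])"
      using adm_cstar[of "sp [e]"] e by (simp add: free_star_gens)
    also have "\<dots> = \<rho> (PP (rng G e))"
      using edge_kr(2)[OF e] e by (intro adm_cong fcar_mult1) auto
    also have "\<dots> \<le> 1" using PP e by blast
    finally show ?thesis using adm_nonneg[OF gens_fcar(2)[OF e]] by (simp add: power_le_one_iff)
  qed
  have gp: "\<rho> (gp [e]) \<le> 1" if e: "e \<in> edges G" for e
    using sp[OF e] adm_star[OF gens_fcar(2)[OF e]] by (simp add: free_star_gens)
  show ?thesis using g PP sp gp by (auto simp: generators_def sp_simps gp_simps)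
qed

lemma adm_word_le: "u \<noteq> [] \<Longrightarrow> set u \<subseteq> generators G \<Longrightarrow> \<rho> (wd u) \<le> 1"
proof (induction u)
  case (Cons g u)
  show ?case
  proof (cases "u = []")
    case True
    then show ?thesis using Cons.prems adm_gen_le by simp
  next
    case False
    then have "\<rho> (wd [g] * wd u) \<le> \<rho> (wd [g]) * \<rho> (wd u)" using Cons.prems by (intro adm_mult) auto
    also have "\<dots> \<le> 1 * 1"
      using Cons False adm_gen_le adm_nonneg[of "wd u"] by (intro mult_mono) auto
    finally show ?thesis by (simp add: wd_Cons[of g u])
  qed
qed simp

lemma adm_sum: "(\<And>i. i \<in> S \<Longrightarrow> f i \<in> fcar G) \<Longrightarrow> \<rho> (sum f S) \<le> (\<Sum>i\<in>S. \<rho> (f i))"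
proof (induction S rule: infinite_finite_induct)
  case (insert i S)
  then have "\<rho> (f i + sum f S) \<le> \<rho> (f i) + \<rho> (sum f S)" by (intro adm_add fcar_sum) auto
  then show ?case using insert by fastforce
qed (auto simp: adm_0)

text \<open>The bound is independent of \<rho>, so the supremum that defines the universal seminorm
  is finite.\<close>

lemma adm_le_word_norm:
  assumes "x \<in> fcar G"
  shows "\<rho> x \<le> word_norm x"
proof -
  have w: "(wd (letters w) :: ('v, 'e, complex) free_elem) \<in> fcar G" "\<rho> (wd (letters w)) \<le> 1" if "w \<in> Poly_Mapping.keys x" for w
  proof -
    have "letters w \<noteq> []" "set (letters w) \<subseteq> generators G" using that assms by (auto simp: fcar_def)
    then show "(wd (letters w) :: ('v, 'e, complex) free_elem) \<in> fcar G" "\<rho> (wd (letters w)) \<le> 1"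
      by (auto intro: adm_word_le)
  qed
  have "\<rho> x = \<rho> (\<Sum>w\<in>Poly_Mapping.keys x. cst (Poly_Mapping.lookup x w) * wd (letters w))"
    by (subst poly_mapping_sum_single[of x], subst single_eq_cst) simp
  also have "\<dots> \<le> (\<Sum>w\<in>Poly_Mapping.keys x. \<rho> (cst (Poly_Mapping.lookup x w) * wd (letters w)))"
    by (rule adm_sum) (use w in simp)
  also have "\<dots> \<le> (\<Sum>w\<in>Poly_Mapping.keys x. cmod (Poly_Mapping.lookup x w))"
    by (rule sum_mono) (use w in \<open>auto simp: adm_scale mult_left_le\<close>)
  finally show ?thesis by (simp add: word_norm_def)
qed

end

lemma adm_zero: "adm G (\<lambda>x. 0)"
  by (simp add: adm_def cstar_seminorm_def)

text \<open>The C*-relators lie in the ideal of the Leavitt relations, on which every action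
  vanishes. So each action by partial bijections yields an admissible seminorm.\<close>

lemma (in gset) adm_opn:
  assumes ug: "is_ultragraph G"
  shows "adm G opn"
proof -
  have "x \<in> LI G" if x: "x \<in> cstar_relators G" for x
  proof -
    consider "x \<in> lattice_relators G \<union> cuntz_krieger_relators G"
      | e where "e \<in> edges G" "x = sp [e] * gp [e] * sp [e] - sp [e]"
      | e where "e \<in> edges G" "x = gp [e] * sp [e] - PP (rng G e)"
      | e where "e \<in> edges G" "x = PP {src G e} * (sp [e] * gp [e]) - sp [e] * gp [e]"
      | e f where "e \<in> edges G" "f \<in> edges G" "e \<noteq> f" "x = (sp [e] * gp [e]) * (sp [f] * gp [f])"
      using x unfolding cstar_relators_def gen_eq_wd sp_simps(3) gp_simps(3) by blast
    then show ?thesis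
    proof cases
      case 1
      then have "x \<in> leavitt_relators G" by (auto simp: leavitt_relators_def)
      then show ?thesis by (rule ideal_generated.relator)
    next
      case 2
      have "lcong G (sp [e] * (gp [e] * sp [e])) (sp [e] * PP (rng G e) :: ('v, 'e, complex) free_elem)"
        using lcong_ghost_edge[OF 2(1) 2(1)] 2(1) by (intro lcong_multl) auto
      also have "lcong G \<dots> (sp [e])" by (rule lcong_edge(2)[OF 2(1)])
      finally show ?thesis using 2(2) by (simp add: lcong_def mult.assoc)
    next
      case 3
      have "lcong G (gp [e] * sp [e]) (PP (rng G e) :: ('v, 'e, complex) free_elem)"
        using lcong_ghost_edge[OF 3(1) 3(1)] by simp
      then show ?thesis using 3(2) by (simp add: lcong_def)
    next
      case 4
      have "lcong G ((PP {src G e} * sp [e]) * gp [e]) (sp [e] * gp [e] :: ('v, 'e, complex) free_elem)"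
        using 4(1) by (intro lcong_multr lcong_edge(1)) auto
      then show ?thesis using 4(2) by (simp add: lcong_def mult.assoc)
    next
      case 5
      have "lcong G (gp [e] * sp [f]) (0 :: ('v, 'e, complex) free_elem)"
        using lcong_ghost_edge[OF 5(1) 5(2)] 5(3) by simp
      then have "lcong G (sp [e] * (gp [e] * sp [f]) * gp [f]) (sp [e] * 0 * gp [f] :: ('v, 'e, complex) free_elem)"
        using 5(1,2) by (intro lcong_multr lcong_multl) auto
      then show ?thesis using 5(4) by (simp add: lcong_0_iff mult.assoc)
    qed
  qed
  then show ?thesis using opn_seminorm opn_LI by (auto simp: adm_def)
qed

section \<open>The supremum of the admissible seminorms\<close>

abbreviation U :: "('v, 'e) ultragraph \<Rightarrow> ('v, 'e, complex) free_elem \<Rightarrow> real" where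
  "U G \<equiv> universal_seminorm (free_star_algebra G) (cstar_relators G)"

lemma U_eq: "U G x = (SUP \<rho>\<in>{\<rho>. adm G \<rho>}. \<rho> x)"
  by (simp add: universal_seminorm_def adm_def)

lemma U_least: "(\<And>\<rho>. adm G \<rho> \<Longrightarrow> \<rho> x \<le> c) \<Longrightarrow> U G x \<le> c"
  unfolding U_eq using adm_zero by (intro cSUP_least) blast+

context
  fixes G :: "('v, 'e) ultragraph"
  assumes ug: "is_ultragraph G"
begin

lemma U_upper:
  assumes "adm G \<rho>" "x \<in> fcar G"
  shows "\<rho> x \<le> U G x"
proof -
  have "bdd_above ((\<lambda>\<rho>. \<rho> x) ` {\<rho>. adm G \<rho>})"
    by (rule bdd_aboveI2[of _ _ "word_norm x"]) (use adm_le_word_norm[OF ug _ assms(2)] in blast)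
  then show ?thesis unfolding U_eq using assms(1) by (intro cSUP_upper) auto
qed

lemma U_nonneg: "x \<in> fcar G \<Longrightarrow> 0 \<le> U G x"
  using U_upper[OF adm_zero] by blast

lemma U_add: "x \<in> fcar G \<Longrightarrow> y \<in> fcar G \<Longrightarrow> U G (x + y) \<le> U G x + U G y"
  by (rule U_least) (rule order_trans[OF adm_add[OF ug]], auto intro!: add_mono U_upper)

lemma U_scale_le: "x \<in> fcar G \<Longrightarrow> U G (cst c * x) \<le> cmod c * U G x"
  by (rule U_least) (auto simp: adm_scale[OF ug] intro!: mult_left_mono U_upper)

lemma U_mult: "x \<in> fcar G \<Longrightarrow> y \<in> fcar G \<Longrightarrow> U G (x * y) \<le> U G x * U G y"
  by (rule U_least) (rule order_trans[OF adm_mult[OF ug]], auto intro!: mult_mono U_upper U_nonneg adm_nonneg[OF ug])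

lemma U_star_le: "x \<in> fcar G \<Longrightarrow> U G (free_star x) \<le> U G x"
  by (rule U_least) (auto simp: adm_star[OF ug] intro!: U_upper)

lemma U_LI: "x \<in> LI G \<Longrightarrow> U G x = 0"
  using U_least[of G x 0] adm_LI[OF ug] U_nonneg[OF LI_fcar[OF ug]] by force

lemma U_0: "U G 0 = 0"
  by (rule U_LI) simp

lemma U_uminus_le: "x \<in> fcar G \<Longrightarrow> U G (- x) \<le> U G x"
  using U_scale_le[of x "-1"] by (simp add: cst_simps)

text \<open>The faithful action gives an admissible seminorm with value at least 1 on p_v, so p_v
  survives in the C*-algebra.\<close>

lemma U_PP_pos:
  assumes "v \<in> verts G"
  shows "U G (PP {v}) \<noteq> 0"
proof -
  obtain R th sg where "gset G (\<lambda>A. A \<times> (UNIV :: ('v + 'e + nat) list set)) R th sg"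
    using ex_faithful_gset[OF ug] by blast
  then interpret gset G "\<lambda>A. A \<times> (UNIV :: ('v + 'e + nat) list set)" R th sg .
  have "cmod (act (PP {v}) (\<lambda>\<xi>. if \<xi> = (v, []) then 1 else 0) (v, [])) \<le> opn (PP {v})"
    using assms by (intro opn_coeff) auto
  also have "\<dots> \<le> U G (PP {v})" using assms by (intro U_upper adm_opn ug) auto
  finally show ?thesis by (simp add: act_gens)
qed

end

text \<open>With a = \<epsilon>(1 + s) the assumption lets (1 + s)^{2m} grow at most linearly along
  m = 2^k, while the Bernoulli inequality forces it above (m s)^2.\<close>

lemma growth_bound:
  fixes a \<epsilon> K l :: real
  assumes nn: "0 \<le> a" "0 \<le> \<epsilon>" "0 \<le> K" "0 \<le> l"
    and le: "\<And>k :: nat. a ^ (2 * 2 ^ k) \<le> K * (l * 2 ^ k + 1) * \<epsilon> ^ (2 * 2 ^ k)"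
  shows "a \<le> \<epsilon>"
proof (rule ccontr)
  assume "\<not> a \<le> \<epsilon>"
  then have a: "a > \<epsilon>" by simp
  show False
  proof (cases "\<epsilon> = 0")
    case True
    then show ?thesis using le[of 0] a by simp
  next
    case False
    then have e: "\<epsilon> > 0" using nn by simp
    define s where "s = a / \<epsilon> - 1"
    have s: "s > 0" using a e by (simp add: s_def field_simps)
    have as: "a = \<epsilon> * (1 + s)" using e by (simp add: s_def)
    have bound: "(2 :: real) ^ k * s\<^sup>2 \<le> K * (l + 1)" for k
    proof -
      define m :: nat where "m = 2 ^ k"
      have m1: "(1 :: real) \<le> real m" by (simp add: m_def)
      have "\<epsilon> ^ (2 * m) * (1 + s) ^ (2 * m) \<le> \<epsilon> ^ (2 * m) * (K * (l * real m + 1))"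
        using le[of k] unfolding as power_mult_distrib m_def[symmetric] by (simp add: m_def mult_ac)
      then have "(1 + s) ^ (2 * m) \<le> K * (l * real m + 1)" using e by simp
      moreover have "(real m * s)\<^sup>2 \<le> (1 + s) ^ (2 * m)"
      proof -
        have "real m * s \<le> (1 + s) ^ m" using Bernoulli_inequality[of s m] s by simp
        then have "(real m * s)\<^sup>2 \<le> ((1 + s) ^ m)\<^sup>2" using s by (intro power_mono) auto
        then show ?thesis by (simp add: power_mult[symmetric] mult.commute)
      qed
      ultimately have "real m * (real m * s\<^sup>2) \<le> K * (l * real m + 1)" by (simp add: power2_eq_square mult_ac)
      also have "\<dots> \<le> real m * (K * (l + 1))"
        using nn m1 mult_left_mono[of 1 "real m" K] by (simp add: algebra_simps)
      finally show ?thesis using m1 by (simp add: m_def)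
    qed
    obtain k :: nat where "K * (l + 1) / s\<^sup>2 < 2 ^ k" using real_arch_pow[of 2] by auto
    then show False using bound[of k] s by (simp add: field_simps not_le)
  qed
qed

section \<open>Quotients and matrix representations\<close>

text \<open>The records have no subtraction, so \<open>neg\<close> asks for inverses inside the
  ideal, which is what comparing cosets takes. The quotient by the relations and the quotient by the
  null sequences are both instances.\<close>

locale alg_ideal =
  fixes A :: "('k, 'a, 'm) algebra_str_scheme" and I :: "'a set"
  assumes assoc: "\<And>x y z. alg_add A (alg_add A x y) z = alg_add A x (alg_add A y z)"
    and comm: "\<And>x y. alg_add A x y = alg_add A y x"
    and zero: "\<And>x. alg_add A (alg_zero A) x = x"
    and neg: "\<And>x. x \<in> I \<Longrightarrow> \<exists>y\<in>I. alg_add A x y = alg_zero A"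
    and I_carrier: "I \<subseteq> alg_carrier A"
    and I_zero: "alg_zero A \<in> I"
    and I_add: "\<And>x y. x \<in> I \<Longrightarrow> y \<in> I \<Longrightarrow> alg_add A x y \<in> I"
    and distl: "\<And>x y z. alg_mult A x (alg_add A y z) = alg_add A (alg_mult A x y) (alg_mult A x z)"
    and distr: "\<And>x y z. alg_mult A (alg_add A x y) z = alg_add A (alg_mult A x z) (alg_mult A y z)"
    and scale_add: "\<And>c x y. alg_scale A c (alg_add A x y) = alg_add A (alg_scale A c x) (alg_scale A c y)"
    and I_mult: "\<And>a x. a \<in> alg_carrier A \<Longrightarrow> x \<in> I \<Longrightarrow> alg_mult A a x \<in> I"
      "\<And>a x. a \<in> alg_carrier A \<Longrightarrow> x \<in> I \<Longrightarrow> alg_mult A x a \<in> I"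
    and I_scale: "\<And>c x. x \<in> I \<Longrightarrow> alg_scale A c x \<in> I"
begin

lemma mem_coset: "y \<in> alg_coset A I x \<longleftrightarrow> (\<exists>i\<in>I. y = alg_add A x i)"
  by (auto simp: alg_coset_def)

lemma self_coset: "x \<in> alg_coset A I x"
  using I_zero zero comm mem_coset by metis

lemma coset_shift:
  assumes "i \<in> I"
  shows "alg_coset A I (alg_add A x i) = alg_coset A I x"
proof (intro equalityI subsetI)
  fix y
  obtain j where j: "j \<in> I" "alg_add A i j = alg_zero A" using neg assms by blast
  assume "y \<in> alg_coset A I x"
  then obtain k where k: "k \<in> I" "y = alg_add A x k" using mem_coset by blast
  have "y = alg_add A (alg_add A x i) (alg_add A j k)"
    using k(2) j(2) assoc zero by metis
  then show "y \<in> alg_coset A I (alg_add A x i)" using mem_coset I_add j k by blast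
next
  fix y
  assume "y \<in> alg_coset A I (alg_add A x i)"
  then show "y \<in> alg_coset A I x" using mem_coset I_add assms assoc by metis
qed

lemma coset_eqD: "alg_coset A I x = alg_coset A I y \<Longrightarrow> \<exists>i\<in>I. x = alg_add A y i"
  using self_coset[of x] mem_coset by simp

lemma UN_const:
  assumes "x \<in> S" "\<And>y. y \<in> S \<Longrightarrow> f y = c"
  shows "(\<Union>y\<in>S. f y) = c"
  using assms by blast

lemma quot_add: "alg_add (quotient_algebra A I) (alg_coset A I x) (alg_coset A I y) = alg_coset A I (alg_add A x y)"
proof -
  have "alg_coset A I (alg_add A x' y') = alg_coset A I (alg_add A x y)"
    if x': "x' \<in> alg_coset A I x" and y': "y' \<in> alg_coset A I y" for x' y'
  proof -
    obtain i j where ij: "i \<in> I" "j \<in> I" "x' = alg_add A x i" "y' = alg_add A y j"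
      using x' y' mem_coset by metis
    have "alg_add A x' y' = alg_add A (alg_add A x y) (alg_add A i j)"
      unfolding ij using assoc comm by metis
    then show ?thesis using coset_shift I_add ij by simp
  qed
  then show ?thesis unfolding quotient_algebra_def algebra_str.simps
    by (intro UN_const[OF self_coset]) auto
qed

lemma quot_scale: "alg_scale (quotient_algebra A I) c (alg_coset A I x) = alg_coset A I (alg_scale A c x)"
proof -
  have "alg_coset A I (alg_scale A c x') = alg_coset A I (alg_scale A c x)" if "x' \<in> alg_coset A I x" for x'
    using that mem_coset scale_add coset_shift I_scale by metis
  then show ?thesis unfolding quotient_algebra_def algebra_str.simps
    by (intro UN_const[OF self_coset]) auto
qed

lemma quot_mult:
  assumes "x \<in> alg_carrier A" "y \<in> alg_carrier A"
  shows "alg_mult (quotient_algebra A I) (alg_coset A I x) (alg_coset A I y) = alg_coset A I (alg_mult A x y)"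
proof -
  have "alg_coset A I (alg_mult A x' y') = alg_coset A I (alg_mult A x y)"
    if x': "x' \<in> alg_coset A I x" and y': "y' \<in> alg_coset A I y" for x' y'
  proof -
    obtain i j where ij: "i \<in> I" "j \<in> I" "x' = alg_add A x i" "y' = alg_add A y j"
      using x' y' mem_coset by metis
    have "alg_mult A x' y' = alg_add A (alg_mult A x y)
        (alg_add A (alg_mult A x j) (alg_add A (alg_mult A i y) (alg_mult A i j)))"
      unfolding ij distl distr using assoc comm by metis
    moreover have "alg_add A (alg_mult A x j) (alg_add A (alg_mult A i y) (alg_mult A i j)) \<in> I"
      using ij assms I_carrier by (intro I_add I_mult) auto
    ultimately show ?thesis using coset_shift by simp
  qed
  then show ?thesis unfolding quotient_algebra_def algebra_str.simps
    by (intro UN_const[OF self_coset]) auto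
qed

lemma quot_carrier: "alg_carrier (quotient_algebra A I) = alg_coset A I ` alg_carrier A"
  "alg_zero (quotient_algebra A I) = alg_coset A I (alg_zero A)"
  by (simp_all add: quotient_algebra_def)

end

lemma quotient_star_simps:
  "alg_carrier (quotient_star_algebra A I) = alg_carrier (quotient_algebra A I)"
  "alg_zero (quotient_star_algebra A I) = alg_zero (quotient_algebra A I)"
  "alg_add (quotient_star_algebra A I) = alg_add (quotient_algebra A I)"
  "alg_mult (quotient_star_algebra A I) = alg_mult (quotient_algebra A I)"
  "alg_scale (quotient_star_algebra A I) = alg_scale (quotient_algebra A I)"
  "alg_star (quotient_star_algebra A I) X = (\<Union>x\<in>X. alg_coset A I (alg_star A x))"
  by (simp_all add: quotient_star_algebra_def algebra_str.extend_def star_algebra_str.fields_def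
      quotient_algebra_def)

lemma alg_ideal_LI:
  assumes "is_ultragraph G"
  shows "alg_ideal (free_algebra G) (LI G)"
proof
  fix x :: "('a, 'b, 'k::field) free_elem" assume "x \<in> LI G"
  then show "\<exists>y\<in>LI G. alg_add (free_algebra G) x y = alg_zero (free_algebra G)"
    by (intro bexI[of _ "-x"]) auto
qed (auto simp: algebra_simps LI_fcar[OF assms])

text \<open>Star representations consist of matrices, algebra representations act on spaces of
  finitely supported sequences; this turns the former into the latter.\<close>

definition mat_act :: "nat \<Rightarrow> 'k::field mat \<Rightarrow> (nat \<Rightarrow>\<^sub>0 'k) \<Rightarrow> (nat \<Rightarrow>\<^sub>0 'k)" where
  "mat_act n M f = (\<Sum>i<n. Poly_Mapping.single i (\<Sum>j<n. M $$ (i, j) * Poly_Mapping.lookup f j))"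

definition Vn :: "nat \<Rightarrow> (nat \<Rightarrow>\<^sub>0 'k::field) set" where
  "Vn n = pm.span ((\<lambda>i. Poly_Mapping.single i 1) ` {..<n})"

lemma lookup_mat_act: "Poly_Mapping.lookup (mat_act n M f) k =
    (if k < n then \<Sum>j<n. M $$ (k, j) * Poly_Mapping.lookup f j else 0)"
  by (auto simp: mat_act_def lookup_sum lookup_single when_def)

lemma fin_dim_Vn: "fin_dim_space (Vn n)"
  unfolding fin_dim_space_def Vn_def by blast

lemma mat_act_Vn: "mat_act n M f \<in> Vn n"
  unfolding mat_act_def Vn_def
proof (rule pm.span_sum)
  fix i assume "i \<in> {..<n}"
  then have "Poly_Mapping.map ((*) (\<Sum>j<n. M $$ (i, j) * Poly_Mapping.lookup f j)) (Poly_Mapping.single i 1)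
      \<in> pm.span ((\<lambda>i. Poly_Mapping.single i 1) ` {..<n})"
    by (intro pm.span_scale pm.span_base) auto
  then show "Poly_Mapping.single i (\<Sum>j<n. M $$ (i, j) * Poly_Mapping.lookup f j)
      \<in> pm.span ((\<lambda>i. Poly_Mapping.single i 1) ` {..<n})" by simp
qed

lemma lookup_scale: "Poly_Mapping.lookup (Poly_Mapping.map ((*) c) f) k = c * Poly_Mapping.lookup (f :: nat \<Rightarrow>\<^sub>0 'k::field) k"
  by (simp add: Poly_Mapping.map.rep_eq when_def)

lemma mat_rep_algebra_rep:
  fixes A :: "('k::field, 'a) algebra_str"
  assumes car: "\<And>a. a \<in> alg_carrier A \<Longrightarrow> \<pi> a \<in> carrier_mat n n"
    and add: "\<And>a b. a \<in> alg_carrier A \<Longrightarrow> b \<in> alg_carrier A \<Longrightarrow> \<pi> (alg_add A a b) = \<pi> a + \<pi> b"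
    and scale: "\<And>c a. a \<in> alg_carrier A \<Longrightarrow> \<pi> (alg_scale A c a) = c \<cdot>\<^sub>m \<pi> a"
    and mult: "\<And>a b. a \<in> alg_carrier A \<Longrightarrow> b \<in> alg_carrier A \<Longrightarrow> \<pi> (alg_mult A a b) = \<pi> a * \<pi> b"
  shows "algebra_rep A (Vn n) (\<lambda>a. mat_act n (\<pi> a))"
  unfolding algebra_rep_def is_endomorphism_def
proof (intro conjI ballI allI)
  fix a x assume "a \<in> alg_carrier A"
  show "mat_act n (\<pi> a) x \<in> Vn n" by (rule mat_act_Vn)
  fix y show "mat_act n (\<pi> a) (x + y) = mat_act n (\<pi> a) x + mat_act n (\<pi> a) y"
    by (rule poly_mapping_eqI) (simp add: lookup_mat_act lookup_add algebra_simps sum.distrib)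
next
  fix a x c
  show "mat_act n (\<pi> a) (Poly_Mapping.map ((*) c) x) = Poly_Mapping.map ((*) c) (mat_act n (\<pi> a) x)"
    by (rule poly_mapping_eqI) (simp add: lookup_mat_act lookup_scale sum_distrib_left mult_ac)
next
  fix a b x assume ab: "a \<in> alg_carrier A" "b \<in> alg_carrier A"
  note c = car[OF ab(1)] car[OF ab(2)]
  show "mat_act n (\<pi> (alg_add A a b)) x = mat_act n (\<pi> a) x + mat_act n (\<pi> b) x"
    unfolding add[OF ab] using c
    by (intro poly_mapping_eqI) (auto simp: lookup_mat_act lookup_add algebra_simps sum.distrib)
  show "mat_act n (\<pi> (alg_mult A a b)) x = mat_act n (\<pi> a) (mat_act n (\<pi> b) x)"
  proof (rule poly_mapping_eqI)
    fix k
    have "(\<Sum>j<n. (\<pi> a * \<pi> b) $$ (k, j) * Poly_Mapping.lookup x j) =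
        (\<Sum>l<n. \<pi> a $$ (k, l) * (\<Sum>j<n. \<pi> b $$ (l, j) * Poly_Mapping.lookup x j))" if k: "k < n"
    proof -
      have "(\<pi> a * \<pi> b) $$ (k, j) = (\<Sum>l<n. \<pi> a $$ (k, l) * \<pi> b $$ (l, j))" if "j < n" for j
        using c k that by (simp add: scalar_prod_def atLeast0LessThan)
      then have "(\<Sum>j<n. (\<pi> a * \<pi> b) $$ (k, j) * Poly_Mapping.lookup x j) =
          (\<Sum>j<n. \<Sum>l<n. \<pi> a $$ (k, l) * \<pi> b $$ (l, j) * Poly_Mapping.lookup x j)"
        by (simp add: sum_distrib_right)
      also have "\<dots> = (\<Sum>l<n. \<Sum>j<n. \<pi> a $$ (k, l) * \<pi> b $$ (l, j) * Poly_Mapping.lookup x j)"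
        by (rule sum.swap)
      finally show ?thesis by (simp add: sum_distrib_left mult.assoc)
    qed
    then show "Poly_Mapping.lookup (mat_act n (\<pi> (alg_mult A a b)) x) k =
        Poly_Mapping.lookup (mat_act n (\<pi> a) (mat_act n (\<pi> b) x)) k"
      unfolding mult[OF ab] by (simp add: lookup_mat_act)
  qed
next
  fix c a x assume a: "a \<in> alg_carrier A"
  show "mat_act n (\<pi> (alg_scale A c a)) x = Poly_Mapping.map ((*) c) (mat_act n (\<pi> a) x)"
    unfolding scale[OF a] using car[OF a]
    by (intro poly_mapping_eqI) (auto simp: lookup_mat_act lookup_scale sum_distrib_left mult_ac)
qed

lemma mat_act_nonzero:
  assumes "i < n" "j < n" "M $$ (i, j) \<noteq> 0"
  shows "\<exists>x\<in>Vn n. mat_act n M x \<noteq> 0"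
proof -
  have "Poly_Mapping.lookup (mat_act n M (Poly_Mapping.single j 1)) i = M $$ (i, j)"
  proof -
    have "(\<Sum>l<n. M $$ (i, l) * Poly_Mapping.lookup (Poly_Mapping.single j 1) l) = (\<Sum>l<n. if l = j then M $$ (i, j) else 0)"
      by (intro sum.cong) (auto simp: lookup_single when_def)
    then show ?thesis using assms by (simp add: lookup_mat_act)
  qed
  then have "mat_act n M (Poly_Mapping.single j 1) \<noteq> 0" using assms(3) by auto
  moreover have "Poly_Mapping.single j 1 \<in> Vn n"
    unfolding Vn_def by (rule pm.span_base) (use assms in auto)
  ultimately show ?thesis by blast
qed

section \<open>Matrices of an action on finitely many points\<close>

context gset
begin

definition fincar :: "'x list \<Rightarrow> bool" where
  "fincar xs \<longleftrightarrow> distinct xs \<and> (\<forall>A. D A \<subseteq> set xs) \<and> (\<forall>e. R e \<subseteq> set xs)"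

definition unit_fun :: "'x \<Rightarrow> 'x \<Rightarrow> 'k::field" where
  "unit_fun \<eta> = (\<lambda>\<xi>. if \<xi> = \<eta> then 1 else 0)"

definition mrep :: "'x list \<Rightarrow> ('v, 'e, 'k::field) free_elem \<Rightarrow> 'k mat" where
  "mrep xs x = mat (length xs) (length xs) (\<lambda>(i, j). act x (unit_fun (xs ! j)) (xs ! i))"

lemma act_outside:
  assumes "fincar xs" "x \<in> fcar G" "\<xi> \<notin> set xs"
  shows "act x f \<xi> = 0"
proof -
  have "opw u f \<xi> = 0" if "u \<noteq> []" for u :: "('v, 'e) generator list"
  proof (cases u)
    case (Cons g v)
    then show ?thesis using assms(1,3) by (cases g) (auto simp: fincar_def)
  qed (use that in simp)
  then show ?thesis using assms(2) by (simp add: act_def fcar_def)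
qed

text \<open>The last letter of a word already ignores the values of f outside the finite set, and
  elements of the carrier contain no empty word.\<close>

lemma act_restrict:
  assumes "fincar xs" "x \<in> fcar G"
  shows "act x f = act x (\<lambda>\<xi>. if \<xi> \<in> set xs then f \<xi> else 0)"
  using assms(2)
proof (induction rule: fcar_induct)
  case (word u c)
  obtain v g where u: "u = v @ [g]" using word(1) by (cases u rule: rev_cases) auto
  have "g \<in> generators G" using word(2) u by simp
  then have "gop g f = gop g (\<lambda>\<xi>. if \<xi> \<in> set xs then f \<xi> else 0)"
    using assms(1) sg_D th_R
    by (cases g) (fastforce simp: fincar_def fun_eq_iff generators_def)+
  then show ?case by (simp add: act_scale_left act_wd u)
qed (simp_all add: act_add_left)

lemma act_expand:
  assumes "fincar xs" "x \<in> fcar G"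
  shows "act x f \<xi> = (\<Sum>j<length xs. act x (unit_fun (xs ! j)) \<xi> * f (xs ! j))"
proof -
  have d: "distinct xs" using assms(1) by (simp add: fincar_def)
  have eq: "(\<lambda>\<xi>. if \<xi> \<in> set xs then f \<xi> else 0) = (\<lambda>\<xi>. \<Sum>j<length xs. f (xs ! j) * unit_fun (xs ! j) \<xi>)"
  proof
    fix \<xi>
    show "(if \<xi> \<in> set xs then f \<xi> else 0) = (\<Sum>j<length xs. f (xs ! j) * unit_fun (xs ! j) \<xi>)"
    proof (cases "\<xi> \<in> set xs")
      case True
      then obtain k where k: "k < length xs" "xs ! k = \<xi>" by (auto simp: in_set_conv_nth)
      have "(\<Sum>j<length xs. f (xs ! j) * unit_fun (xs ! j) \<xi>) = (\<Sum>j<length xs. if j = k then f \<xi> else 0)"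
        using k nth_eq_iff_index_eq[OF d] by (intro sum.cong) (auto simp: unit_fun_def)
      then show ?thesis using True k by simp
    next
      case False
      then have "unit_fun (xs ! j) \<xi> = (0 :: 'a)" if "j < length xs" for j
        using nth_mem[OF that] by (auto simp: unit_fun_def)
      then show ?thesis using False by simp
    qed
  qed
  then have "act x f = act x (\<lambda>\<xi>. \<Sum>j<length xs. f (xs ! j) * unit_fun (xs ! j) \<xi>)"
    by (subst act_restrict[OF assms]) (simp only: eq)
  then show ?thesis by (simp add: act_sum_right act_scale_right mult.commute)
qed

lemma mrep_carrier: "mrep xs x \<in> carrier_mat (length xs) (length xs)"
  by (simp add: mrep_def)

lemma mrep_add: "mrep xs (x + y) = mrep xs x + mrep xs y"
  by (rule eq_matI) (auto simp: mrep_def act_add_left)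

lemma mrep_scale: "mrep xs (cst c * x) = c \<cdot>\<^sub>m mrep xs x"
  by (rule eq_matI) (auto simp: mrep_def act_scale_left)

lemma mrep_mult:
  assumes "fincar xs" "x \<in> fcar G"
  shows "mrep xs (x * y) = mrep xs x * mrep xs y"
proof (rule eq_matI)
  fix i j assume ij: "i < dim_row (mrep xs x * mrep xs y)" "j < dim_col (mrep xs x * mrep xs y)"
  then show "mrep xs (x * y) $$ (i, j) = (mrep xs x * mrep xs y) $$ (i, j)"
    using act_expand[OF assms, of "act y (unit_fun (xs ! j))" "xs ! i"]
    by (simp add: mrep_def act_mult scalar_prod_def atLeast0LessThan)
qed (auto simp: mrep_def)

lemma mrep_LI: "x \<in> LI G \<Longrightarrow> mrep xs x = 0\<^sub>m (length xs) (length xs)"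
  by (rule eq_matI) (auto simp: mrep_def act_LI)

lemma fs_unit_fun: "fs (unit_fun \<eta>)"
  by (simp add: fs_def unit_fun_def)

lemma ip_unit_fun: "fs f \<Longrightarrow> ip f (unit_fun \<eta>) = f \<eta>" "ip (unit_fun \<eta>) f = cnj (f \<eta>)"
proof -
  assume f: "fs f"
  have "ip f (unit_fun \<eta>) = (\<Sum>\<xi>\<in>{\<xi>. f \<xi> \<noteq> 0}. if \<xi> = \<eta> then f \<eta> else 0)"
    unfolding ip_def unit_fun_def by (intro sum.cong) auto
  then show "ip f (unit_fun \<eta>) = f \<eta>" using f by (simp add: fs_def)
next
  show "ip (unit_fun \<eta>) f = cnj (f \<eta>)"
    by (subst ip_superset[of "{\<eta>}"]) (auto simp: unit_fun_def)
qed

lemma mrep_star: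
  assumes "x \<in> fcar G"
  shows "mrep xs (free_star x) = mat_adjoint (mrep xs x)"
proof (rule eq_matI)
  fix i j assume "i < dim_row (mat_adjoint (mrep xs x))" "j < dim_col (mat_adjoint (mrep xs x))"
  then have ij: "i < length xs" "j < length xs" by (auto simp: mat_adjoint_def mrep_def)
  have "act x (unit_fun (xs ! i)) (xs ! j) = cnj (act (free_star x) (unit_fun (xs ! j)) (xs ! i))"
    using ip_act[OF assms fs_unit_fun, of "xs ! i" "unit_fun (xs ! j)"]
      ip_unit_fun(1)[OF fs_act[OF assms fs_unit_fun]] ip_unit_fun(2) by metis
  then have "act (free_star x) (unit_fun (xs ! j)) (xs ! i) = cnj (act x (unit_fun (xs ! i)) (xs ! j))"
    by simp
  moreover have "mat_adjoint (mrep xs x) $$ (i, j) = cnj (mrep xs x $$ (j, i))"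
    using ij by (simp add: mat_adjoint_def mat_of_rows_index mrep_def)
  ultimately show "mrep xs (free_star x) $$ (i, j) = mat_adjoint (mrep xs x) $$ (i, j)"
    using ij by (simp add: mrep_def)
qed (auto simp: mrep_def mat_adjoint_def)

lemma mrep_entry_le:
  assumes "x \<in> fcar G" "i < length xs" "j < length xs"
  shows "cmod (mrep xs x $$ (i, j)) \<le> opn x"
  using opn_coeff[OF assms(1), of "xs ! j" "xs ! i"] assms(2,3) by (simp add: mrep_def unit_fun_def)

text \<open>Crude, but enough to turn entrywise convergence to 0 into convergence of the operator
  norm.\<close>

lemma opn_le_entries:
  assumes "fincar xs" "x \<in> fcar G"
  shows "opn x \<le> (\<Sum>i<length xs. \<Sum>j<length xs. cmod (mrep xs x $$ (i, j)))"
proof (rule opn_least)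
  fix f :: "'x \<Rightarrow> complex" assume f: "fs f" "n2 f \<le> 1"
  have d: "distinct xs" using assms(1) by (simp add: fincar_def)
  have f1: "cmod (f \<eta>) \<le> 1" for \<eta> using n2_ge[OF f(1), of \<eta>] f(2) by linarith
  have "n2 (act x f) = L2_set (\<lambda>\<xi>. cmod (act x f \<xi>)) (set xs)"
    using act_outside[OF assms] by (intro n2_superset) auto
  also have "\<dots> \<le> (\<Sum>\<xi>\<in>set xs. cmod (act x f \<xi>))" by (rule L2_set_le_sum) simp
  also have "\<dots> = (\<Sum>i<length xs. cmod (act x f (xs ! i)))"
    using d by (simp add: sum.distinct_set_conv_list sum_list_sum_nth atLeast0LessThan)
  also have "\<dots> \<le> (\<Sum>i<length xs. \<Sum>j<length xs. cmod (mrep xs x $$ (i, j)))"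
  proof (rule sum_mono)
    fix i assume i: "i \<in> {..<length xs}"
    have "cmod (act x f (xs ! i)) \<le> (\<Sum>j<length xs. cmod (act x (unit_fun (xs ! j)) (xs ! i) * f (xs ! j)))"
      unfolding act_expand[OF assms, of f] by (rule norm_sum)
    also have "\<dots> \<le> (\<Sum>j<length xs. cmod (mrep xs x $$ (i, j)))"
      using i f1 by (intro sum_mono) (auto simp: mrep_def norm_mult mult_left_le)
    finally show "cmod (act x f (xs ! i)) \<le> (\<Sum>j<length xs. cmod (mrep xs x $$ (i, j)))" .
  qed
  finally show "n2 (act x f) \<le> (\<Sum>i<length xs. \<Sum>j<length xs. cmod (mrep xs x $$ (i, j)))" .
qed

end

section \<open>The ultragraph C*-algebra as a completion\<close>

abbreviation Cau :: "('v, 'e) ultragraph \<Rightarrow> (complex, nat \<Rightarrow> ('v, 'e, complex) free_elem) star_algebra_str" where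
  "Cau G \<equiv> cauchy_algebra (free_star_algebra G) (U G)"

abbreviation Nul :: "('v, 'e) ultragraph \<Rightarrow> (nat \<Rightarrow> ('v, 'e, complex) free_elem) set" where
  "Nul G \<equiv> null_sequences (free_star_algebra G) (U G)"

lemma Cau_simps:
  "X \<in> alg_carrier (Cau G) \<longleftrightarrow> (\<forall>n. X n \<in> fcar G) \<and>
     (\<forall>\<epsilon>>0. \<exists>N. \<forall>m\<ge>N. \<forall>n\<ge>N. U G (X m - X n) < \<epsilon>)"
  "alg_zero (Cau G) = (\<lambda>n. 0)" "alg_add (Cau G) = (\<lambda>X Y n. X n + Y n)"
  "alg_scale (Cau G) = (\<lambda>c X n. cst c * X n)" "alg_mult (Cau G) = (\<lambda>X Y n. X n * Y n)"
  "alg_star (Cau G) = (\<lambda>X n. free_star (X n))"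
  by (simp_all add: cauchy_algebra_def fun_eq_iff cst_simps)

lemma Nul_iff: "X \<in> Nul G \<longleftrightarrow> (\<forall>n. X n \<in> fcar G) \<and> (\<lambda>n. U G (X n)) \<longlonglongrightarrow> 0"
  by (simp add: null_sequences_def)

context
  fixes G :: "('v, 'e) ultragraph"
  assumes ug: "is_ultragraph G"
begin

lemma U_diff: "x \<in> fcar G \<Longrightarrow> y \<in> fcar G \<Longrightarrow> U G (x - y) \<le> U G x + U G y"
  using U_add[OF ug, of x "-y"] U_uminus_le[OF ug, of y] by simp

lemma Cau_bounded:
  assumes "X \<in> alg_carrier (Cau G)"
  shows "\<exists>B. \<forall>n. U G (X n) \<le> B"
proof -
  have X: "\<And>n. X n \<in> fcar G" and "\<exists>N. \<forall>m\<ge>N. \<forall>n\<ge>N. U G (X m - X n) < 1"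
    using assms by (auto simp: Cau_simps dest!: spec[of _ "1 :: real"])
  then obtain N where N: "\<And>m n. m \<ge> N \<Longrightarrow> n \<ge> N \<Longrightarrow> U G (X m - X n) < 1" by blast
  have "U G (X n) \<le> (\<Sum>k\<le>N. U G (X k)) + 1" for n
  proof (cases "n \<le> N")
    case True
    have "U G (X n) \<le> (\<Sum>k\<le>N. U G (X k))"
      by (rule member_le_sum) (use True U_nonneg[OF ug X] in auto)
    then show ?thesis by simp
  next
    case False
    have "U G (X n) \<le> U G (X n - X N) + U G (X N)" using U_add[OF ug, of "X n - X N" "X N"] X by simp
    moreover have "U G (X N) \<le> (\<Sum>k\<le>N. U G (X k))"
      by (rule member_le_sum) (use U_nonneg[OF ug X] in auto)
    ultimately show ?thesis using N[of n N] False by simp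
  qed
  then show ?thesis by blast
qed

lemma Nul_Cau: "X \<in> Nul G \<Longrightarrow> X \<in> alg_carrier (Cau G)"
proof -
  assume X: "X \<in> Nul G"
  have "\<exists>N. \<forall>m\<ge>N. \<forall>n\<ge>N. U G (X m - X n) < \<epsilon>" if "\<epsilon> > 0" for \<epsilon>
  proof -
    have "eventually (\<lambda>n. U G (X n) < \<epsilon> / 2) sequentially"
      using X that by (intro order_tendstoD(2)[of _ 0]) (auto simp: Nul_iff)
    then obtain N where N: "\<And>n. n \<ge> N \<Longrightarrow> U G (X n) < \<epsilon> / 2" by (auto simp: eventually_sequentially)
    have "U G (X m - X n) < \<epsilon>" if "m \<ge> N" "n \<ge> N" for m n
      using U_diff[of "X m" "X n"] X N[OF that(1)] N[OF that(2)] by (fastforce simp: Nul_iff)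
    then show ?thesis by blast
  qed
  then show ?thesis using X by (simp add: Cau_simps Nul_iff)
qed

lemma Nul_dominated:
  assumes "\<And>n. X n \<in> fcar G" "\<And>n. U G (X n) \<le> f n" "f \<longlonglongrightarrow> 0"
  shows "X \<in> Nul G"
  unfolding Nul_iff
  using assms(1) tendsto_sandwich[of "\<lambda>_. 0" "\<lambda>n. U G (X n)" sequentially f 0] U_nonneg[OF ug assms(1)] assms(2,3)
  by auto

lemma alg_ideal_Nul: "alg_ideal (Cau G) (Nul G)"
proof
  fix X Y assume X: "X \<in> Nul G"
  show "\<exists>Y\<in>Nul G. alg_add (Cau G) X Y = alg_zero (Cau G)"
  proof (rule bexI[of _ "\<lambda>n. - X n"])
    show "(\<lambda>n. - X n) \<in> Nul G"
      by (rule Nul_dominated[of _ "\<lambda>n. U G (X n)"]) (use X U_uminus_le[OF ug] in \<open>auto simp: Nul_iff\<close>)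
  qed (simp add: Cau_simps)
  assume Y: "Y \<in> Nul G"
  show "alg_add (Cau G) X Y \<in> Nul G"
    unfolding Cau_simps
    by (rule Nul_dominated[of _ "\<lambda>n. U G (X n) + U G (Y n)"])
      (use X Y U_add[OF ug] in \<open>auto simp: Nul_iff intro: tendsto_add_zero\<close>)
next
  fix a X assume a: "a \<in> alg_carrier (Cau G)" and X: "X \<in> Nul G"
  obtain B where B: "\<And>n. U G (a n) \<le> B" using Cau_bounded[OF a] by blast
  have c: "a n \<in> fcar G" "X n \<in> fcar G" for n using a X by (auto simp: Cau_simps Nul_iff)
  have lim: "(\<lambda>n. B * U G (X n)) \<longlonglongrightarrow> 0" using X by (auto simp: Nul_iff intro: tendsto_mult_right_zero)
  have "U G (a n * X n) \<le> B * U G (X n)" "U G (X n * a n) \<le> B * U G (X n)" for n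
    using U_mult[OF ug c(1) c(2), of n n] U_mult[OF ug c(2) c(1), of n n]
      mult_right_mono[OF B[of n] U_nonneg[OF ug c(2)[of n]]] by (auto simp: mult.commute)
  then show "alg_mult (Cau G) a X \<in> Nul G" "alg_mult (Cau G) X a \<in> Nul G"
    unfolding Cau_simps using c lim by (auto intro!: Nul_dominated[of _ "\<lambda>n. B * U G (X n)"])
next
  fix c X assume X: "X \<in> Nul G"
  show "alg_scale (Cau G) c X \<in> Nul G"
    unfolding Cau_simps
    by (rule Nul_dominated[of _ "\<lambda>n. cmod c * U G (X n)"])
      (use X U_scale_le[OF ug] in \<open>auto simp: Nul_iff intro: tendsto_mult_right_zero\<close>)
next
  show "alg_zero (Cau G) \<in> Nul G" by (simp add: Cau_simps Nul_iff U_0[OF ug])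
qed (auto simp: Cau_simps(2-) algebra_simps fun_eq_iff dest: Nul_Cau)

lemma Nul_star: "X \<in> Nul G \<Longrightarrow> (\<lambda>n. free_star (X n)) \<in> Nul G"
  by (rule Nul_dominated[of _ "\<lambda>n. U G (X n)"]) (use U_star_le[OF ug] in \<open>auto simp: Nul_iff\<close>)

lemma const_Cau: "x \<in> fcar G \<Longrightarrow> (\<lambda>n. x) \<in> alg_carrier (Cau G)"
  by (simp add: Cau_simps U_0[OF ug])

text \<open>Constant sequences map the free algebra to the completion. A star representation
  composed with this map kills the ideal, because the universal seminorm vanishes there.\<close>

lemma leavitt_rep_of_star_rep:
  assumes "cstar_RFD (ultragraph_cstar_algebra G)" and w: "w \<in> verts G"
  shows "\<exists>V (\<phi> :: ('v, 'e, complex) free_elem \<Rightarrow> _). leavitt_rep G V \<phi> \<and> (\<exists>v\<in>V. \<phi> (PP {w}) v \<noteq> 0)"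
proof -
  interpret I: alg_ideal "Cau G" "Nul G" by (rule alg_ideal_Nul)
  let ?Q = "ultragraph_cstar_algebra G"
  let ?c = "\<lambda>x. alg_coset (Cau G) (Nul G) (\<lambda>n. x)"
  have Q: "?Q = quotient_star_algebra (Cau G) (Nul G)"
    by (simp add: ultragraph_cstar_algebra_def universal_cstar_algebra_def)
  have car: "?c x \<in> alg_carrier ?Q" if "x \<in> fcar G" for x
    unfolding Q quotient_star_simps I.quot_carrier using const_Cau[OF that] by blast
  have pw: "(PP {w} :: ('v, 'e, complex) free_elem) \<in> fcar G" using w by simp
  have "?c (PP {w}) \<noteq> ?c 0"
  proof
    assume "?c (PP {w}) = ?c 0"
    then obtain i where i: "i \<in> Nul G" "(\<lambda>n. PP {w}) = alg_add (Cau G) (\<lambda>n. 0) i" using I.coset_eqD by blast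
    then have "(\<lambda>n. PP {w}) \<in> Nul G" by (simp add: Cau_simps)
    then have "(\<lambda>n :: nat. U G (PP {w})) \<longlonglongrightarrow> 0" by (simp add: Nul_iff)
    then show False using U_PP_pos[OF ug w] LIMSEQ_unique tendsto_const by blast
  qed
  then obtain n \<pi> where \<pi>: "star_rep ?Q n \<pi>" "\<pi> (?c (PP {w})) \<noteq> \<pi> (?c 0)"
    using assms(1) car[OF pw] car[OF fcar_0] unfolding cstar_RFD_def by blast
  have p_car: "\<pi> (?c x) \<in> carrier_mat n n" if "x \<in> fcar G" for x
    using \<pi>(1) car[OF that] by (simp add: star_rep_def)
  have p_add: "\<pi> (?c (x + y)) = \<pi> (?c x) + \<pi> (?c y)" if "x \<in> fcar G" "y \<in> fcar G" for x y
  proof -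
    have "?c (x + y) = alg_add ?Q (?c x) (?c y)"
      unfolding Q quotient_star_simps I.quot_add by (simp add: Cau_simps)
    then show ?thesis using \<pi>(1) car that by (simp add: star_rep_def)
  qed
  have p_scale: "\<pi> (?c (cst c * x)) = c \<cdot>\<^sub>m \<pi> (?c x)" if "x \<in> fcar G" for c x
  proof -
    have "?c (cst c * x) = alg_scale ?Q c (?c x)"
      unfolding Q quotient_star_simps I.quot_scale by (simp add: Cau_simps)
    then show ?thesis using \<pi>(1) car that by (simp add: star_rep_def)
  qed
  have p_mult: "\<pi> (?c (x * y)) = \<pi> (?c x) * \<pi> (?c y)" if "x \<in> fcar G" "y \<in> fcar G" for x y
  proof -
    have "?c (x * y) = alg_mult ?Q (?c x) (?c y)"
      unfolding Q quotient_star_simps I.quot_mult[OF const_Cau[OF that(1)] const_Cau[OF that(2)]]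
      by (simp add: Cau_simps)
    then show ?thesis using \<pi>(1) car that by (simp add: star_rep_def)
  qed
  have p_0: "\<pi> (?c 0) = 0\<^sub>m n n"
  proof -
    have eq: "\<pi> (?c 0) = 0 \<cdot>\<^sub>m \<pi> (?c 0)" using p_scale[OF fcar_0, of 0] by simp
    have "\<pi> (?c 0) $$ (i, j) = 0" if "i < n" "j < n" for i j
      using arg_cong[OF eq, of "\<lambda>M. M $$ (i, j)"] p_car[OF fcar_0] that by auto
    then show ?thesis using p_car[OF fcar_0] by (intro eq_matI) auto
  qed
  have p_LI: "\<pi> (?c x) = 0\<^sub>m n n" if "x \<in> LI G" for x
  proof -
    have "(\<lambda>n. x) \<in> Nul G" using U_LI[OF ug that] LI_fcar[OF ug that] by (simp add: Nul_iff)
    then have "alg_coset (Cau G) (Nul G) (alg_add (Cau G) (\<lambda>n. 0) (\<lambda>n. x)) = ?c 0"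
      by (rule I.coset_shift)
    then have "?c x = ?c 0" by (simp add: Cau_simps)
    then show ?thesis using p_0 by simp
  qed
  have "algebra_rep (free_algebra G) (Vn n) (\<lambda>x. mat_act n (\<pi> (?c x)))"
    by (rule mat_rep_algebra_rep) (use p_car p_add p_scale p_mult in simp_all)
  moreover have "mat_act n (\<pi> (?c x)) v = 0" if "x \<in> LI G" for x v
    unfolding p_LI[OF that] by (rule poly_mapping_eqI) (simp add: lookup_mat_act)
  ultimately have "leavitt_rep G (Vn n) (\<lambda>x. mat_act n (\<pi> (?c x)))"
    by (simp add: leavitt_rep_def fin_dim_Vn)
  moreover have "\<exists>v\<in>Vn n. mat_act n (\<pi> (?c (PP {w}))) v \<noteq> 0"
  proof -
    have "\<exists>i<n. \<exists>j<n. \<pi> (?c (PP {w})) $$ (i, j) \<noteq> 0"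
    proof (rule ccontr)
      assume "\<not> ?thesis"
      then have "\<pi> (?c (PP {w})) = 0\<^sub>m n n" using p_car[OF pw] by (intro eq_matI) auto
      then show False using \<pi>(2) p_0 by simp
    qed
    then show ?thesis using mat_act_nonzero by blast
  qed
  ultimately show ?thesis by blast
qed

lemma leavitt_rep_of_algebra_rep:
  fixes K :: "'k::field itself"
  assumes "algebra_RFD (leavitt_algebra K G)" and w: "w \<in> verts G"
  shows "\<exists>V (\<phi> :: ('v, 'e, 'k) free_elem \<Rightarrow> _). leavitt_rep G V \<phi> \<and> (\<exists>v\<in>V. \<phi> (PP {w}) v \<noteq> 0)"
proof -
  interpret I: alg_ideal "free_algebra G" "LI G :: ('v, 'e, 'k) free_elem set" by (rule alg_ideal_LI[OF ug])
  let ?Q = "leavitt_algebra K G"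
  let ?c = "\<lambda>x :: ('v, 'e, 'k) free_elem. alg_coset (free_algebra G) (LI G) x"
  have Q: "?Q = quotient_algebra (free_algebra G) (LI G)" by (simp add: leavitt_algebra_def)
  have car: "?c x \<in> alg_carrier ?Q" if "x \<in> fcar G" for x
    unfolding Q I.quot_carrier using that by simp
  have pw: "(PP {w} :: ('v, 'e, 'k) free_elem) \<in> fcar G" using w by simp
  have ne: "?c (PP {w}) \<noteq> alg_zero ?Q"
  proof
    assume "?c (PP {w}) = alg_zero ?Q"
    then have "?c (PP {w}) = ?c 0" unfolding Q I.quot_carrier by simp
    then have "(PP {w} :: ('v, 'e, 'k) free_elem) \<in> LI G" using I.coset_eqD[of "PP {w}" 0] by auto
    then show False by (rule PP_notin_LI[OF ug w, THEN notE])
  qed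
  obtain V \<pi> where \<pi>: "fin_dim_space V" "algebra_rep ?Q V \<pi>" "\<exists>x\<in>V. \<pi> (?c (PP {w})) x \<noteq> 0"
    using bspec[OF assms(1)[unfolded algebra_RFD_def] car[OF pw], THEN mp, OF ne]
    by (elim exE conjE) (rule that)
  have ops: "?c (x + y) = alg_add ?Q (?c x) (?c y)" "?c (cst c * x) = alg_scale ?Q c (?c x)"
    "x \<in> fcar G \<Longrightarrow> y \<in> fcar G \<Longrightarrow> ?c (x * y) = alg_mult ?Q (?c x) (?c y)" for x y c
    unfolding Q using I.quot_add I.quot_scale I.quot_mult by simp_all
  have rep: "algebra_rep (free_algebra G) V (\<lambda>x. \<pi> (?c x))"
    using \<pi>(2) car unfolding algebra_rep_def free_algebra_simps by (simp add: ops)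
  have "\<pi> (?c x) v = 0" if x: "x \<in> LI G" and v: "v \<in> V" for x v
  proof -
    have "?c x = ?c 0" using I.coset_shift[OF x, of 0] by simp
    moreover have "\<pi> (?c (0 + 0)) v = \<pi> (?c 0) v + \<pi> (?c 0) v"
      unfolding ops(1) using \<pi>(2) car[OF fcar_0] v by (simp add: algebra_rep_def)
    ultimately show ?thesis by (metis add.right_neutral add_left_cancel)
  qed
  then have "leavitt_rep G V (\<lambda>x. \<pi> (?c x))" using rep \<pi>(1) by (simp add: leavitt_rep_def)
  then show ?thesis using \<pi>(3) by blast
qed

end

section \<open>Residual finite-dimensionality from the graph conditions\<close>

text \<open>Repeated squaring of a self-adjoint element, so that the C*-identity computes every
  C*-seminorm of the power exactly.\<close>

definition powseq :: "('v, 'e, complex) free_elem \<Rightarrow> nat \<Rightarrow> ('v, 'e, complex) free_elem" where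
  "powseq x k = (free_star x * x) ^ (2 ^ k)"

lemma powseq_Suc: "powseq x (Suc k) = powseq x k * powseq x k"
  by (simp add: powseq_def power_add[symmetric] mult_2)

lemma powseq_0: "powseq x 0 = free_star x * x"
  by (simp add: powseq_def)

lemma powseq_fcar: "x \<in> fcar G \<Longrightarrow> powseq x k \<in> fcar G"
  by (induction k) (auto simp: powseq_0 powseq_Suc)

lemma powseq_star: "free_star (powseq x k) = powseq x k"
  by (induction k) (auto simp: powseq_0 powseq_Suc free_star_mult free_star_star)

lemma adm_powseq:
  assumes "is_ultragraph G" "adm G \<rho>" "x \<in> fcar G"
  shows "\<rho> (powseq x k) = \<rho> x ^ (2 * 2 ^ k)"
proof (induction k)
  case 0
  then show ?case using adm_cstar[OF assms] by (simp add: powseq_0)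
next
  case (Suc k)
  have "\<rho> (powseq x (Suc k)) = (\<rho> (powseq x k))\<^sup>2"
    using adm_cstar[OF assms(1,2) powseq_fcar[OF assms(3)]] by (simp add: powseq_Suc powseq_star)
  then show ?case by (simp add: Suc power_mult[symmetric] mult.commute)
qed

definition words_in :: "'g set \<Rightarrow> nat \<Rightarrow> ('g gen_word \<Rightarrow>\<^sub>0 'k::zero) \<Rightarrow> bool" where
  "words_in S L x \<longleftrightarrow> (\<forall>w\<in>Poly_Mapping.keys x. letters w \<noteq> [] \<and> set (letters w) \<subseteq> S \<and> length (letters w) \<le> L)"

lemma words_in_mult:
  fixes x y :: "('v, 'e, 'k::field) free_elem"
  assumes "words_in S L x" "words_in S M y"
  shows "words_in S (L + M) (x * y)"
  unfolding words_in_def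
proof
  fix w assume "w \<in> Poly_Mapping.keys (x * y)"
  then obtain u v where uv: "u \<in> Poly_Mapping.keys x" "v \<in> Poly_Mapping.keys y" "letters w = letters u @ letters v"
    by (rule keys_multE)
  then have "letters u \<noteq> [] \<and> set (letters u) \<subseteq> S \<and> length (letters u) \<le> L"
    "letters v \<noteq> [] \<and> set (letters v) \<subseteq> S \<and> length (letters v) \<le> M"
    using assms by (auto simp: words_in_def)
  then show "letters w \<noteq> [] \<and> set (letters w) \<subseteq> S \<and> length (letters w) \<le> L + M" unfolding uv(3) by auto
qed

lemma words_in_star:
  assumes "words_in S L x" "generator_star ` S \<subseteq> S"
  shows "words_in S L (free_star x)"
  unfolding words_in_def
proof
  fix w assume "w \<in> Poly_Mapping.keys (free_star x)"
  then have "w \<in> (\<Union>u\<in>Poly_Mapping.keys x. Poly_Mapping.keys (Poly_Mapping.single (word_star u) (cnj (Poly_Mapping.lookup x u))))"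
    unfolding free_star_def by (rule subsetD[OF keys_sum])
  then obtain u where u: "u \<in> Poly_Mapping.keys x"
    "w \<in> Poly_Mapping.keys (Poly_Mapping.single (word_star u) (cnj (Poly_Mapping.lookup x u)))" by blast
  then have w: "w = word_star u" by (auto split: if_splits)
  then have "letters u \<noteq> [] \<and> set (letters u) \<subseteq> S \<and> length (letters u) \<le> L"
    using assms(1) u(1) unfolding words_in_def by blast
  then show "letters w \<noteq> [] \<and> set (letters w) \<subseteq> S \<and> length (letters w) \<le> L"
    using assms(2) unfolding w word_star_def by (auto simp: image_subset_iff subset_iff)
qed

text \<open>Word lengths are linear in the exponent 2^k, and therefore so is the number of
  keys.\<close>

lemma words_in_powseq:
  assumes "words_in S L x" "generator_star ` S \<subseteq> S"
  shows "words_in S (2 ^ k * (2 * L)) (powseq x k)"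
proof (induction k)
  case 0
  then show ?case using words_in_mult[OF words_in_star[OF assms] assms(1)] by (simp add: powseq_0 mult_2)
next
  case (Suc k)
  then show ?case using words_in_mult[OF Suc Suc] by (simp add: powseq_Suc mult_2 distrib_right)
qed

context rfd_data
begin

text \<open>Expanding \<open>q t\<close> turns the unit into at most 1 + |V0| + |F| signed words of
  seminorm at most 1. The bound is uniform in the paths and in \<rho>.\<close>

lemma elt_adm_le:
  assumes adm: "adm G \<rho>" and t: "t \<in> cells" "fpath \<alpha> t" "fpath \<beta> t"
  shows "\<rho> (elt \<alpha> t \<beta>) \<le> 1 + real (card V0) + real (card F)"
proof -
  let ?V = "{v \<in> V0 \<inter> t. {v} \<noteq> t}" and ?E = "{e \<in> F'. {src G e} = t}"
  have s: "set \<alpha> \<subseteq> edges G" "set \<beta> \<subseteq> edges G" using fpath_edges t by auto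
  have w: "(sp \<alpha> * wd u * gp \<beta> :: ('v, 'e, complex) free_elem) \<in> fcar G \<and> \<rho> (sp \<alpha> * wd u * gp \<beta>) \<le> 1"
    if "set u \<subseteq> generators G" "u \<noteq> []" for u
  proof -
    have eq: "sp \<alpha> * wd u * gp \<beta> = (wd (map Edge \<alpha> @ u @ map Ghost (rev \<beta>)) :: ('v, 'e, complex) free_elem)"
      by (simp add: sp_def gp_def wd_append mult.assoc)
    have "set (map Edge \<alpha> @ u @ map Ghost (rev \<beta>)) \<subseteq> generators G" using s that by auto
    then show ?thesis unfolding eq using that(2) adm_word_le[OF ug adm] by auto
  qed
  have wP: "(sp \<alpha> * PP A * gp \<beta> :: ('v, 'e, complex) free_elem) \<in> fcar G" "\<rho> (sp \<alpha> * PP A * gp \<beta>) \<le> 1" if "A \<in> gen_verts G" for A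
    using w[of "[Proj A]"] that by auto
  have wE: "(sp \<alpha> * (sp [e] * gp [e]) * gp \<beta> :: ('v, 'e, complex) free_elem) \<in> fcar G" "\<rho> (sp \<alpha> * (sp [e] * gp [e]) * gp \<beta>) \<le> 1" if "e \<in> F'" for e
  proof -
    have "sp [e] * gp [e] = (wd [Edge e, Ghost e] :: ('v, 'e, complex) free_elem)"
      by (simp add: sp_def gp_def flip: wd_append)
    then show "(sp \<alpha> * (sp [e] * gp [e]) * gp \<beta> :: ('v, 'e, complex) free_elem) \<in> fcar G" "\<rho> (sp \<alpha> * (sp [e] * gp [e]) * gp \<beta>) \<le> 1"
      using w[of "[Edge e, Ghost e]"] F'_F(3)[OF that] by auto
  qed
  have vg: "{v} \<in> gen_verts G" if "v \<in> ?V" for v using that V0_verts by auto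
  let ?x = "sp \<alpha> * PP t * gp \<beta> :: ('v, 'e, complex) free_elem"
  let ?y = "\<Sum>v\<in>?V. sp \<alpha> * PP {v} * gp \<beta> :: ('v, 'e, complex) free_elem"
  let ?z = "\<Sum>e\<in>?E. sp \<alpha> * (sp [e] * gp [e]) * gp \<beta> :: ('v, 'e, complex) free_elem"
  have c: "?x \<in> fcar G" "?y \<in> fcar G" "?z \<in> fcar G"
    using wP(1)[OF cells_gen_verts[OF t(1)]] wP(1)[OF vg] wE(1) by (auto intro!: fcar_sum)
  have "elt \<alpha> t \<beta> = ?x + - ?y + - ?z"
    by (simp add: elt_def q_def right_diff_distrib left_diff_distrib sum_distrib_left sum_distrib_right)
  also have "\<rho> (?x + - ?y + - ?z) \<le> \<rho> ?x + \<rho> ?y + \<rho> ?z"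
    using adm_add[OF ug adm, of "?x + - ?y" "- ?z"] adm_add[OF ug adm, of ?x "- ?y"] c
    by (simp add: adm_uminus[OF ug adm])
  also have "\<rho> ?x \<le> 1" by (rule wP(2)[OF cells_gen_verts[OF t(1)]])
  also have "\<rho> ?y \<le> real (card V0)"
  proof -
    have "\<rho> ?y \<le> (\<Sum>v\<in>?V. \<rho> (sp \<alpha> * PP {v} * gp \<beta>))" by (rule adm_sum[OF ug adm wP(1)[OF vg]])
    also have "\<dots> \<le> (\<Sum>v\<in>?V. 1)" by (rule sum_mono[OF wP(2)[OF vg]])
    also have "\<dots> \<le> real (card V0)" using card_mono[OF fin(2), of ?V] by auto
    finally show ?thesis .
  qed
  also have "\<rho> ?z \<le> real (card F)"
  proof -
    have "\<rho> ?z \<le> (\<Sum>e\<in>?E. \<rho> (sp \<alpha> * (sp [e] * gp [e]) * gp \<beta>))" by (rule adm_sum[OF ug adm]) (use wE in auto)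
    also have "\<dots> \<le> (\<Sum>e\<in>?E. 1)" by (rule sum_mono) (use wE in auto)
    also have "\<dots> \<le> real (card F)" using card_mono[OF fin(1), of ?E] F'_F(1) by auto
    finally show ?thesis .
  qed
  finally show ?thesis by simp
qed

lemma unit_of_adm_le:
  assumes adm: "adm G \<rho>" and k: "\<kappa> \<in> keys_upto L"
  shows "unit_of \<kappa> \<in> fcar G" "\<rho> (unit_of \<kappa>) \<le> 1 + real (card V0) + real (card F)"
proof -
  obtain \<tau> where \<tau>: "\<kappa> = key \<tau>" "good \<tau>" using k by (auto simp: keys_upto_def)
  obtain \<alpha> t \<beta> where "\<tau> = (\<alpha>, t, \<beta>)" by (rule prod_cases3)
  then have t: "\<kappa> = key (\<alpha>, t, \<beta>)" "t \<in> live" "fpath \<alpha> t" "fpath \<beta> t" using \<tau> by (auto simp: good_def)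
  obtain \<alpha>' t' \<beta>' where t': "t' \<in> live" "fpath \<alpha>' t'" "fpath \<beta>' t'"
    "unit_of \<kappa> = (elt \<alpha>' t' \<beta>' :: ('v, 'e, complex) free_elem)"
    using unit_of_key[OF t(2-4)] unfolding t(1) by metis
  show "\<rho> (unit_of \<kappa>) \<le> 1 + real (card V0) + real (card F)"
    unfolding t'(4) by (rule elt_adm_le[OF adm live_cells[OF t'(1)] t'(2,3)])
  obtain \<alpha>' t' \<beta>' where t': "t' \<in> live" "fpath \<alpha>' t'" "fpath \<beta>' t'"
    "unit_of \<kappa> = (elt \<alpha>' t' \<beta>' :: ('v, 'e, 'b::field) free_elem)"
    using unit_of_key[OF t(2-4)] unfolding t(1) by metis
  show "(unit_of \<kappa> :: ('v, 'e, 'b::field) free_elem) \<in> fcar G"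
    unfolding t'(4) by (rule elt_fcar1[OF live_cells[OF t'(1)] t'(2,3)])
qed

lemma closed_orbit_of: "\<kappa> \<in> keys_upto L \<Longrightarrow> closed_roots (orbit_of \<kappa>)"
  using orbit_of(1) by (auto simp: keys_upto_def good_def)

lemma gens0_star: "generator_star ` gens0 \<subseteq> gens0"
  unfolding gens0_def by (auto 4 3)

end

context rfd_ultragraph
begin

text \<open>Decompose the given sets and the ranges of the given edges, then enlarge
  \<open>V0\<close> by the sources of the edges and by the finite overlaps, so that different
  minimal sets meet only inside \<open>V0\<close>.\<close>

lemma ex_rfd_data:
  assumes E: "finite E" "E \<subseteq> edges G" and W: "finite \<W>" "\<W> \<subseteq> gen_verts G"
  shows "\<exists>V0 T0. rfd_data G E V0 T0 \<and> (\<forall>A\<in>\<W>. A = \<Union>{T \<in> T0. T \<subseteq> A} \<union> (V0 \<inter> A))"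
proof -
  have "\<forall>A\<in>gen_verts G. \<exists>\<T> U. finite \<T> \<and> finite U \<and> (\<forall>T\<in>\<T>. minset G T) \<and> U \<subseteq> verts G \<and> A = \<Union>\<T> \<union> U"
    using gen_verts_decomposition[OF ug rfum] by blast
  then obtain \<T> \<U> where dec: "\<And>A. A \<in> gen_verts G \<Longrightarrow> finite (\<T> A) \<and> finite (\<U> A) \<and>
      (\<forall>T\<in>\<T> A. minset G T) \<and> \<U> A \<subseteq> verts G \<and> A = \<Union>(\<T> A) \<union> \<U> A"
    by metis
  define \<A> where "\<A> = \<W> \<union> rng G ` E"
  have A: "finite \<A>" "\<A> \<subseteq> gen_verts G" using assms by (auto simp: \<A>_def)
  define T0 where "T0 = (\<Union>A\<in>\<A>. \<T> A)"
  define P where "P = {(T, T') \<in> T0 \<times> T0. T \<noteq> T'}"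
  define V0 where "V0 = (\<Union>A\<in>\<A>. \<U> A) \<union> src G ` E \<union> (\<Union>(T, T')\<in>P. T \<inter> T')"
  have T0: "finite T0" "\<And>T. T \<in> T0 \<Longrightarrow> minset G T" using A dec by (auto simp: T0_def)
  have "finite P" by (rule finite_subset[of _ "T0 \<times> T0"]) (use T0 in \<open>auto simp: P_def\<close>)
  moreover have PT: "finite (T \<inter> T')" "T \<inter> T' \<subseteq> verts G" if "(T, T') \<in> P" for T T'
    using that T0(2) minset_Int[of G T T'] gen_verts_subset[OF ug minset_gen_verts[of G T]] by (auto simp: P_def)
  ultimately have "finite (\<Union>(T, T')\<in>P. T \<inter> T')" by auto
  moreover have "finite (\<Union>A\<in>\<A>. \<U> A)" "(\<Union>A\<in>\<A>. \<U> A) \<subseteq> verts G" using A dec by blast+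
  moreover have "(\<Union>(T, T')\<in>P. T \<inter> T') \<subseteq> verts G" using PT(2) by blast
  moreover have "src G ` E \<subseteq> verts G" using E(2) is_ultragraph_simps(1)[OF ug] by blast
  ultimately have V0: "finite V0" "V0 \<subseteq> verts G" using E(1) unfolding V0_def by simp_all
  have cov: "A = \<Union>{T \<in> T0. T \<subseteq> A} \<union> (V0 \<inter> A)" if "A \<in> \<A>" for A
  proof -
    have d: "A = \<Union>(\<T> A) \<union> \<U> A" using dec A that by blast
    then have "\<T> A \<subseteq> {T \<in> T0. T \<subseteq> A}" "\<U> A \<subseteq> V0 \<inter> A"
      using that unfolding T0_def V0_def by blast+
    then show ?thesis using d by blast
  qed
  have "rfd_data G E V0 T0"
  proof (unfold_locales)
    show "T \<inter> T' \<subseteq> V0" if "T \<in> T0" "T' \<in> T0" "T \<noteq> T'" for T T'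
      using that unfolding V0_def P_def by blast
    show "src G e \<in> V0" if "e \<in> E" for e using that by (auto simp: V0_def)
    show "rng G e = \<Union>{T \<in> T0. T \<subseteq> rng G e} \<union> (V0 \<inter> rng G e)" if "e \<in> E" for e
      using that by (intro cov) (auto simp: \<A>_def)
  qed (use E V0 T0 in auto)
  moreover have "\<forall>A\<in>\<W>. A = \<Union>{T \<in> T0. T \<subseteq> A} \<union> (V0 \<inter> A)" using cov by (auto simp: \<A>_def)
  ultimately show ?thesis by blast
qed

lemma ex_rfd_data_words:
  assumes "x \<in> fcar G"
  shows "\<exists>F V0 T0 L. rfd_data G F V0 T0 \<and> words_in (rfd_data.gens0 G F V0 T0) L x"
proof -
  define S where "S = (\<Union>w\<in>Poly_Mapping.keys x. set (letters w))"
  have S: "finite S" "S \<subseteq> generators G" using assms by (auto simp: S_def fcar_def)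
  let ?E = "{e. Edge e \<in> S \<or> Ghost e \<in> S}" and ?W = "{A. Proj A \<in> S}"
  have "finite {e. Edge e \<in> S}" "finite {e. Ghost e \<in> S}" "finite ?W"
    using finite_vimageI[OF S(1), of Edge] finite_vimageI[OF S(1), of Ghost] finite_vimageI[OF S(1), of Proj]
    by (auto simp: vimage_def inj_def)
  then have f: "finite ?E" "finite ?W" by (auto simp: Collect_disj_eq)
  have sub: "?E \<subseteq> edges G" "?W \<subseteq> gen_verts G" using S(2) by (auto simp: generators_def)
  obtain V0 T0 where d: "rfd_data G ?E V0 T0" "\<forall>A\<in>?W. A = \<Union>{T \<in> T0. T \<subseteq> A} \<union> (V0 \<inter> A)"
    using ex_rfd_data[OF f(1) sub(1) f(2) sub(2)] by blast
  interpret d: rfd_data G ?E V0 T0 by (rule d(1))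
  have "S \<subseteq> d.gens0"
  proof
    fix g assume g: "g \<in> S"
    show "g \<in> d.gens0"
    proof (cases g)
      case (Proj A)
      then have "d.fam A" using g d(2) sub unfolding d.fam_def by blast
      then show ?thesis using Proj by (simp add: d.gens0_def)
    qed (use g in \<open>auto simp: d.gens0_def\<close>)
  qed
  then have "words_in d.gens0 (\<Sum>w\<in>Poly_Mapping.keys x. length (letters w)) x"
    using assms by (auto simp: words_in_def S_def fcar_def intro!: member_le_sum)
  then show ?thesis using d(1) by blast
qed

definition copn :: "int \<Rightarrow> 'v set set \<Rightarrow> ('v, 'e, complex) free_elem \<Rightarrow> real" where
  "copn N S = gset.opn G (\<lambda>A. (D0 A \<inter> {p. snd p \<in> S}) \<times> {0..<N})
    (\<lambda>e. (R0 e \<inter> {p. snd p \<in> S}) \<times> {0..<N})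
    (\<lambda>e (\<xi>, j). (th0 e \<xi>, (j + 1) mod N)) (\<lambda>e (\<xi>, j). (sg0 e \<xi>, (j - 1) mod N))"

lemma adm_copn: "closed_roots S \<Longrightarrow> N > 0 \<Longrightarrow> adm G (copn N S)"
  unfolding copn_def by (rule gset.adm_opn[OF gset_cover ug])

text \<open>All coefficients of the expansion are matrix entries of finite actions; once these
  vanish, x is congruent to 0.\<close>

lemma LI_of_cact:
  fixes x :: "('v, 'e, 'k::field) free_elem"
  assumes x: "x \<in> fcar G"
    and z: "\<And>S N f \<xi>. closed_roots S \<Longrightarrow> N > 0 \<Longrightarrow> cact N S x f \<xi> = 0"
  shows "x \<in> LI G"
proof -
  obtain F V0 T0 L where d: "rfd_data G F V0 T0" "words_in (rfd_data.gens0 G F V0 T0) L x"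
    using ex_rfd_data_words[OF x] by blast
  interpret d: rfd_data G F V0 T0 by (rule d(1))
  have "d.coeff L \<kappa> x = 0" if "\<kappa> \<in> d.keys_upto L" for \<kappa>
    using z[OF d.closed_orbit_of[OF that]] by (simp add: d.coeff_def split: prod.splits)
  moreover have "d.expands L x" using d(2) by (intro d.expansion) (simp add: words_in_def)
  ultimately show ?thesis by (simp add: d.expands_def lcong_0_iff)
qed

lemma adm_le_of_copn:
  assumes adm: "adm G \<rho>" and x: "x \<in> fcar G" and e: "0 \<le> \<epsilon>"
    and le: "\<And>S N. closed_roots S \<Longrightarrow> N > 0 \<Longrightarrow> copn N S x \<le> \<epsilon>"
  shows "\<rho> x \<le> \<epsilon>"
proof -
  obtain F V0 T0 l where d: "rfd_data G F V0 T0" "words_in (rfd_data.gens0 G F V0 T0) l x"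
    using ex_rfd_data_words[OF x] by blast
  interpret d: rfd_data G F V0 T0 by (rule d(1))
  let ?C = "1 + real (card V0) + real (card F)"
  show ?thesis
  proof (rule growth_bound[OF adm_nonneg[OF ug adm x] e])
    \<comment> \<open>The first constant counts pairs of points and bounds the units; the second
      comes from 2L + 1 with L = 2^k * 2l.\<close>
    show "0 \<le> (real (card d.frame))\<^sup>2 * ?C" "0 \<le> 4 * real l" by simp_all
    fix k :: nat
    let ?y = "powseq x k" and ?L = "2 ^ k * (2 * l)" and ?n = "2 * 2 ^ k :: nat"
    have y: "?y \<in> fcar G" by (rule powseq_fcar[OF x])
    have ex: "d.expands ?L ?y"
      using words_in_powseq[OF d(2) d.gens0_star] by (intro d.expansion) (auto simp: words_in_def)
    \<comment> \<open>The coefficient is an entry of a finite action, so it is at most the norm of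
      the power there, and by the C*-identity that is the power of the norm of x.\<close>
    have cf: "cmod (d.coeff ?L \<kappa> ?y) \<le> \<epsilon> ^ ?n" if k: "\<kappa> \<in> d.keys_upto ?L" for \<kappa>
    proof -
      obtain P Q e where \<kappa>: "\<kappa> = (P, Q, e)" by (rule prod_cases3)
      let ?N = "2 * int ?L + 1" and ?S = "d.orbit_of \<kappa>"
      have S: "closed_roots ?S" "?N > 0" using d.closed_orbit_of[OF k] by auto
      have "cmod (d.coeff ?L \<kappa> ?y) \<le> copn ?N ?S ?y"
        unfolding d.coeff_def copn_def cact_def \<kappa> prod.case
        by (rule gset.opn_coeff[OF gset_cover[OF S[unfolded \<kappa>]] y])
      also have "\<dots> = copn ?N ?S x ^ ?n" by (rule adm_powseq[OF ug adm_copn[OF S] x])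
      also have "\<dots> \<le> \<epsilon> ^ ?n"
        by (rule power_mono[OF le[OF S] adm_nonneg[OF ug adm_copn[OF S] x]])
      finally show ?thesis .
    qed
    have uf: "(d.unit_of \<kappa> :: ('v, 'e, complex) free_elem) \<in> fcar G" "\<rho> (d.unit_of \<kappa>) \<le> ?C"
      if "\<kappa> \<in> d.keys_upto ?L" for \<kappa> using d.unit_of_adm_le[OF adm that] by auto
    have "\<rho> x ^ ?n = \<rho> ?y" by (rule adm_powseq[OF ug adm x, symmetric])
    also have "\<dots> = \<rho> (\<Sum>\<kappa>\<in>d.keys_upto ?L. cst (d.coeff ?L \<kappa> ?y) * d.unit_of \<kappa>)"
      using uf(1) by (intro adm_lcong[OF ug adm ex[unfolded d.expands_def] y] fcar_sum fcar_mult1) auto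
    also have "\<dots> \<le> (\<Sum>\<kappa>\<in>d.keys_upto ?L. \<rho> (cst (d.coeff ?L \<kappa> ?y) * d.unit_of \<kappa>))"
      using uf(1) by (intro adm_sum[OF ug adm]) auto
    also have "\<dots> \<le> (\<Sum>\<kappa>\<in>d.keys_upto ?L. \<epsilon> ^ ?n * ?C)"
    proof (rule sum_mono)
      fix \<kappa> assume k: "\<kappa> \<in> d.keys_upto ?L"
      show "\<rho> (cst (d.coeff ?L \<kappa> ?y) * d.unit_of \<kappa>) \<le> \<epsilon> ^ ?n * ?C"
        unfolding adm_scale[OF ug adm uf(1)[OF k]]
        using e by (intro mult_mono cf[OF k] uf(2)[OF k] adm_nonneg[OF ug adm uf(1)[OF k]]) simp
    qed
    also have "\<dots> = real (card (d.keys_upto ?L)) * (\<epsilon> ^ ?n * ?C)" by simp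
    also have "\<dots> \<le> real ((card d.frame)\<^sup>2 * (2 * ?L + 1)) * (\<epsilon> ^ ?n * ?C)"
      using d.card_keys_upto[of ?L] e by (intro mult_right_mono) (simp_all only: of_nat_le_iff, simp)
    also have "\<dots> = (real (card d.frame))\<^sup>2 * ?C * (4 * real l * 2 ^ k + 1) * \<epsilon> ^ ?n"
      by (simp add: algebra_simps)
    finally show "\<rho> x ^ ?n \<le> (real (card d.frame))\<^sup>2 * ?C * (4 * real l * 2 ^ k + 1) * \<epsilon> ^ ?n" .
  qed
qed

lemma cover_fincar:
  assumes S: "closed_roots S" and N: "N > 0"
  obtains xs where "gset.fincar (\<lambda>A. (D0 A \<inter> {p. snd p \<in> S}) \<times> {0..<N})
    (\<lambda>e. (R0 e \<inter> {p. snd p \<in> S}) \<times> {0..<N :: int}) xs"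
proof -
  have "finite ({p \<in> points. snd p \<in> S} \<times> {0..<N})" using S by (simp add: closed_roots_def)
  then obtain xs where xs: "set xs = {p \<in> points. snd p \<in> S} \<times> {0..<N}" "distinct xs"
    using finite_distinct_list by blast
  interpret c: gset G "\<lambda>A. (D0 A \<inter> {p. snd p \<in> S}) \<times> {0..<N}" "\<lambda>e. (R0 e \<inter> {p. snd p \<in> S}) \<times> {0..<N}"
    "\<lambda>e (\<xi>, j). (th0 e \<xi>, (j + 1) mod N)" "\<lambda>e (\<xi>, j). (sg0 e \<xi>, (j - 1) mod N)"
    by (rule gset_cover[OF S N])
  have "c.fincar xs" unfolding c.fincar_def using xs by (auto simp: D0_def R0_def)
  then show ?thesis by (rule that)
qed

end

section \<open>Extension of the finite actions to the completion\<close>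

context gset
begin

definition conv :: "'x list \<Rightarrow> (nat \<Rightarrow> ('v, 'e, complex) free_elem) \<Rightarrow> complex mat \<Rightarrow> bool" where
  "conv xs X M \<longleftrightarrow> M \<in> carrier_mat (length xs) (length xs) \<and>
    (\<forall>i<length xs. \<forall>j<length xs. (\<lambda>n. mrep xs (X n) $$ (i, j)) \<longlonglongrightarrow> M $$ (i, j))"

text \<open>Entrywise limits along representatives. Quantifying over all representatives makes the
  limit a function of the coset.\<close>

definition limrep :: "'x list \<Rightarrow> (nat \<Rightarrow> ('v, 'e, complex) free_elem) set \<Rightarrow> complex mat" where
  "limrep xs A = (THE M. \<forall>X. A = alg_coset (Cau G) (Nul G) X \<longrightarrow> conv xs X M)"

lemma conv_add:
  assumes "conv xs X M" "conv xs Y M'"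
  shows "conv xs (\<lambda>n. X n + Y n) (M + M')"
  unfolding conv_def
proof (intro conjI allI impI)
  show "M + M' \<in> carrier_mat (length xs) (length xs)" using assms by (simp add: conv_def)
  fix i j assume ij: "i < length xs" "j < length xs"
  have "(M + M') $$ (i, j) = M $$ (i, j) + M' $$ (i, j)" using ij assms(2) by (auto simp: conv_def)
  then show "(\<lambda>n. mrep xs (X n + Y n) $$ (i, j)) \<longlonglongrightarrow> (M + M') $$ (i, j)"
    using assms ij by (simp add: conv_def mrep_add tendsto_add carrier_matD[OF mrep_carrier])
qed

lemma conv_scale:
  assumes "conv xs X M"
  shows "conv xs (\<lambda>n. cst c * X n) (c \<cdot>\<^sub>m M)"
  unfolding conv_def
proof (intro conjI allI impI)
  show "c \<cdot>\<^sub>m M \<in> carrier_mat (length xs) (length xs)" using assms by (simp add: conv_def)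
  fix i j assume ij: "i < length xs" "j < length xs"
  have "(c \<cdot>\<^sub>m M) $$ (i, j) = c * M $$ (i, j)" using ij assms by (auto simp: conv_def)
  then show "(\<lambda>n. mrep xs (cst c * X n) $$ (i, j)) \<longlonglongrightarrow> (c \<cdot>\<^sub>m M) $$ (i, j)"
    using assms ij by (simp add: conv_def mrep_scale tendsto_mult carrier_matD[OF mrep_carrier])
qed

lemma conv_mult:
  assumes "fincar xs" "\<And>n. X n \<in> fcar G" "conv xs X M" "conv xs Y M'"
  shows "conv xs (\<lambda>n. X n * Y n) (M * M')"
  unfolding conv_def
proof (intro conjI allI impI)
  show "M * M' \<in> carrier_mat (length xs) (length xs)" using assms(3,4) by (auto simp: conv_def)
  fix i j assume ij: "i < length xs" "j < length xs"
  have "mrep xs (X n * Y n) $$ (i, j) = (\<Sum>k<length xs. mrep xs (X n) $$ (i, k) * mrep xs (Y n) $$ (k, j))" for n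
    unfolding mrep_mult[OF assms(1,2)] using ij mrep_carrier[of xs "X n"] mrep_carrier[of xs "Y n"]
    by (simp add: scalar_prod_def atLeast0LessThan)
  moreover have "(M * M') $$ (i, j) = (\<Sum>k<length xs. M $$ (i, k) * M' $$ (k, j))"
    using ij assms(3,4) by (auto simp: conv_def scalar_prod_def atLeast0LessThan)
  ultimately show "(\<lambda>n. mrep xs (X n * Y n) $$ (i, j)) \<longlonglongrightarrow> (M * M') $$ (i, j)"
    using assms(3,4) ij by (auto simp: conv_def intro!: tendsto_sum tendsto_mult)
qed

lemma mat_adjoint_index:
  "M \<in> carrier_mat n n \<Longrightarrow> i < n \<Longrightarrow> j < n \<Longrightarrow> mat_adjoint (M :: complex mat) $$ (i, j) = cnj (M $$ (j, i))"
  by (auto simp: mat_adjoint_def mat_of_rows_index)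

lemma conv_star:
  assumes "\<And>n. X n \<in> fcar G" "conv xs X M"
  shows "conv xs (\<lambda>n. free_star (X n)) (mat_adjoint M)"
  unfolding conv_def
proof (intro conjI allI impI)
  show "mat_adjoint M \<in> carrier_mat (length xs) (length xs)"
    using assms(2) by (auto simp: conv_def mat_adjoint_def)
  fix i j assume ij: "i < length xs" "j < length xs"
  have "(\<lambda>n. cnj (mrep xs (X n) $$ (j, i))) \<longlonglongrightarrow> cnj (M $$ (j, i))"
    using assms(2) ij by (auto simp: conv_def intro!: tendsto_cnj)
  then show "(\<lambda>n. mrep xs (free_star (X n)) $$ (i, j)) \<longlonglongrightarrow> mat_adjoint M $$ (i, j)"
    using mat_adjoint_index[of M "length xs" i j] mat_adjoint_index[OF mrep_carrier ij] assms(2) ij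
    by (simp add: mrep_star[OF assms(1)] conv_def)
qed

lemma conv_unique:
  assumes "conv xs X M" "conv xs X M'"
  shows "M = M'"
proof (rule eq_matI)
  fix i j assume "i < dim_row M'" "j < dim_col M'"
  then have "i < length xs" "j < length xs" using assms(2) by (auto simp: conv_def)
  then show "M $$ (i, j) = M' $$ (i, j)"
    using assms by (intro LIMSEQ_unique[of "\<lambda>n. mrep xs (X n) $$ (i, j)"]) (simp_all add: conv_def)
qed (use assms in \<open>auto simp: conv_def\<close>)

text \<open>Hence Cauchy sequences have entrywise limits and null sequences have limit 0.\<close>

lemma entry_le_U:
  assumes "is_ultragraph G" "x \<in> fcar G" "i < length xs" "j < length xs"
  shows "cmod (mrep xs x $$ (i, j)) \<le> U G x"
  using mrep_entry_le[OF assms(2-4)] U_upper[OF assms(1) adm_opn[OF assms(1)] assms(2)] by linarith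

lemma conv_Nul:
  assumes "is_ultragraph G" "X \<in> Nul G"
  shows "conv xs X (0\<^sub>m (length xs) (length xs))"
  unfolding conv_def
proof (intro conjI allI impI)
  fix i j assume ij: "i < length xs" "j < length xs"
  have "(\<lambda>n. mrep xs (X n) $$ (i, j)) \<longlonglongrightarrow> 0"
    by (rule metric_tendsto_imp_tendsto[of "\<lambda>n. U G (X n)" 0])
      (use entry_le_U[OF assms(1) _ ij] assms(2) in \<open>auto simp: Nul_iff dist_norm intro!: always_eventually order_trans[OF _ abs_ge_self]\<close>)
  then show "(\<lambda>n. mrep xs (X n) $$ (i, j)) \<longlonglongrightarrow> 0\<^sub>m (length xs) (length xs) $$ (i, j)" using ij by simp
qed simp

lemma ex_conv:
  assumes "is_ultragraph G" "X \<in> alg_carrier (Cau G)"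
  shows "\<exists>M. conv xs X M"
proof -
  have X: "X n \<in> fcar G" for n using assms(2) by (simp add: Cau_simps)
  have "convergent (\<lambda>n. mrep xs (X n) $$ (i, j))" if ij: "i < length xs" "j < length xs" for i j
  proof -
    have "Cauchy (\<lambda>n. mrep xs (X n) $$ (i, j))"
    proof (rule CauchyI)
      fix e :: real assume "0 < e"
      then obtain N where N: "\<And>m n. m \<ge> N \<Longrightarrow> n \<ge> N \<Longrightarrow> U G (X m - X n) < e"
        using assms(2) unfolding Cau_simps by blast
      have "cmod (mrep xs (X m) $$ (i, j) - mrep xs (X n) $$ (i, j)) < e" if "m \<ge> N" "n \<ge> N" for m n
      proof -
        have "mrep xs (X m) $$ (i, j) - mrep xs (X n) $$ (i, j) = mrep xs (X m - X n) $$ (i, j)"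
          using ij by (simp add: mrep_def act_diff_left)
        then show ?thesis using entry_le_U[OF assms(1) _ ij, of "X m - X n"] X N[OF that] by simp
      qed
      then show "\<exists>M. \<forall>m\<ge>M. \<forall>n\<ge>M. cmod (mrep xs (X m) $$ (i, j) - mrep xs (X n) $$ (i, j)) < e" by blast
    qed
    then show ?thesis by (rule Cauchy_convergent)
  qed
  then have "conv xs X (mat (length xs) (length xs) (\<lambda>(i, j). lim (\<lambda>n. mrep xs (X n) $$ (i, j))))"
    by (auto simp: conv_def convergent_LIMSEQ_iff)
  then show ?thesis by blast
qed

lemma limrep:
  assumes ug: "is_ultragraph G" and X: "conv xs X M"
  shows "limrep xs (alg_coset (Cau G) (Nul G) X) = M"
  unfolding limrep_def
proof (rule the_equality)
  interpret I: alg_ideal "Cau G" "Nul G" by (rule alg_ideal_Nul[OF ug])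
  show "\<forall>Y. alg_coset (Cau G) (Nul G) X = alg_coset (Cau G) (Nul G) Y \<longrightarrow> conv xs Y M"
  proof (intro allI impI)
    fix Y assume "alg_coset (Cau G) (Nul G) X = alg_coset (Cau G) (Nul G) Y"
    from I.coset_eqD[OF this[symmetric]] obtain i where
      i: "i \<in> Nul G" "Y = alg_add (Cau G) X i" by blast
    have Y: "Y = (\<lambda>n. X n + i n)" unfolding i(2) by (simp add: Cau_simps)
    have "M + 0\<^sub>m (length xs) (length xs) = M" using X by (simp add: conv_def)
    then show "conv xs Y M" using conv_add[OF X conv_Nul[OF ug i(1)]] unfolding Y by simp
  qed
  fix M' assume "\<forall>Y. alg_coset (Cau G) (Nul G) X = alg_coset (Cau G) (Nul G) Y \<longrightarrow> conv xs Y M'"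
  then have "conv xs X M'" by (elim allE[of _ X] mp) (rule refl)
  then show "M' = M" by (rule conv_unique[OF _ X])
qed

lemma limrep_star_rep:
  assumes ug: "is_ultragraph G" and xs: "fincar xs"
  shows "star_rep (ultragraph_cstar_algebra G) (length xs) (limrep xs)"
proof -
  interpret I: alg_ideal "Cau G" "Nul G" by (rule alg_ideal_Nul[OF ug])
  let ?Q = "ultragraph_cstar_algebra G" and ?c = "alg_coset (Cau G) (Nul G)"
  have Q: "?Q = quotient_star_algebra (Cau G) (Nul G)"
    by (simp add: ultragraph_cstar_algebra_def universal_cstar_algebra_def)
  have car: "\<exists>X M. a = ?c X \<and> X \<in> alg_carrier (Cau G) \<and> conv xs X M" if "a \<in> alg_carrier ?Q" for a
    using that ex_conv[OF ug] unfolding Q quotient_star_simps I.quot_carrier by blast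
  have f: "X n \<in> fcar G" if "X \<in> alg_carrier (Cau G)" for X n using that by (simp add: Cau_simps)
  show ?thesis unfolding star_rep_def
  proof (intro conjI ballI allI)
    fix a assume "a \<in> alg_carrier ?Q"
    then obtain X M where a: "a = ?c X" "X \<in> alg_carrier (Cau G)" "conv xs X M" using car by blast
    note l = limrep[OF ug a(3)]
    show "limrep xs a \<in> carrier_mat (length xs) (length xs)" using a(1,3) l by (simp add: conv_def)
    show "limrep xs (alg_scale ?Q c a) = c \<cdot>\<^sub>m limrep xs a" for c
      unfolding Q quotient_star_simps a(1) I.quot_scale l
      by (rule limrep[OF ug]) (use conv_scale[OF a(3)] in \<open>simp add: Cau_simps\<close>)
    have st: "?c (\<lambda>n. free_star (Y n)) = ?c (\<lambda>n. free_star (X n))" if "Y \<in> ?c X" for Y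
    proof -
      from that[unfolded alg_coset_def] obtain i where
        i: "i \<in> Nul G" "Y = alg_add (Cau G) X i" by (elim imageE) iprover
      have "(\<lambda>n. free_star (Y n)) = alg_add (Cau G) (\<lambda>n. free_star (X n)) (\<lambda>n. free_star (i n))"
        unfolding i(2) by (simp add: Cau_simps free_star_add)
      then show ?thesis using I.coset_shift[OF Nul_star[OF ug i(1)]] by simp
    qed
    have "alg_star ?Q a = ?c (\<lambda>n. free_star (X n))"
      unfolding Q quotient_star_simps a(1) using st by (intro I.UN_const[OF I.self_coset]) (simp add: Cau_simps)
    then show "limrep xs (alg_star ?Q a) = mat_adjoint (limrep xs a)"
      unfolding a(1) l using limrep[OF ug conv_star[OF f[OF a(2)] a(3)]] by (simp add: a(1))
    fix b assume "b \<in> alg_carrier ?Q"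
    then obtain Y M' where b: "b = ?c Y" "Y \<in> alg_carrier (Cau G)" "conv xs Y M'" using car by blast
    note l' = limrep[OF ug b(3)]
    show "limrep xs (alg_add ?Q a b) = limrep xs a + limrep xs b"
      unfolding Q quotient_star_simps a(1) b(1) I.quot_add l l'
      by (rule limrep[OF ug]) (use conv_add[OF a(3) b(3)] in \<open>simp add: Cau_simps\<close>)
    show "limrep xs (alg_mult ?Q a b) = limrep xs a * limrep xs b"
      unfolding Q quotient_star_simps a(1) b(1) I.quot_mult[OF a(2) b(2)] l l'
      by (rule limrep[OF ug]) (use conv_mult[OF xs f[OF a(2)] a(3) b(3)] in \<open>simp add: Cau_simps\<close>)
  qed
qed

lemma opn_tendsto_0:
  assumes "fincar xs" "\<And>n. X n \<in> fcar G" "conv xs X (0\<^sub>m (length xs) (length xs))"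
  shows "(\<lambda>n. opn (X n)) \<longlonglongrightarrow> 0"
proof (rule tendsto_sandwich[of "\<lambda>_. 0"])
  show "(\<lambda>n. \<Sum>i<length xs. \<Sum>j<length xs. cmod (mrep xs (X n) $$ (i, j))) \<longlonglongrightarrow> 0"
  proof (intro tendsto_null_sum)
    fix i j assume "i \<in> {..<length xs}" "j \<in> {..<length xs}"
    then show "(\<lambda>n. cmod (mrep xs (X n) $$ (i, j))) \<longlonglongrightarrow> 0"
      using assms(3) by (auto simp: conv_def intro: tendsto_norm_zero)
  qed
qed (use assms opn_le_entries opn_nonneg in \<open>auto intro!: always_eventually\<close>)

end

section \<open>Both algebras under the graph conditions\<close>

context rfd_ultragraph
begin

lemma leavitt_RFD: "algebra_RFD (leavitt_algebra (K :: 'k::field itself) G)"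
  unfolding algebra_RFD_def
proof (intro ballI impI)
  interpret I: alg_ideal "free_algebra G" "LI G :: ('v, 'e, 'k) free_elem set" by (rule alg_ideal_LI[OF ug])
  let ?Q = "leavitt_algebra K G"
  let ?c = "\<lambda>x :: ('v, 'e, 'k) free_elem. alg_coset (free_algebra G) (LI G) x"
  have Q: "?Q = quotient_algebra (free_algebra G) (LI G)" by (simp add: leavitt_algebra_def)
  have car: "\<exists>x\<in>fcar G. a = ?c x" if "a \<in> alg_carrier ?Q" for a
    using that unfolding Q I.quot_carrier by auto
  fix a assume a: "a \<in> alg_carrier ?Q" "a \<noteq> alg_zero ?Q"
  then obtain x where x: "x \<in> fcar G" "a = ?c x" using car by blast
  have "x \<notin> LI G"
  proof
    assume "x \<in> LI G"
    then have "?c x = ?c 0" using I.coset_shift[of x 0] by simp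
    then show False using a(2) x(2) unfolding Q I.quot_carrier by simp
  qed
  then obtain S N f \<xi> where S: "closed_roots S" "N > 0" "cact N S x f \<xi> \<noteq> 0"
    using LI_of_cact[OF x(1)] by blast
  interpret c: gset G "\<lambda>A. (D0 A \<inter> {p. snd p \<in> S}) \<times> {0..<N}" "\<lambda>e. (R0 e \<inter> {p. snd p \<in> S}) \<times> {0..<N}"
    "\<lambda>e (\<xi>, j). (th0 e \<xi>, (j + 1) mod N)" "\<lambda>e (\<xi>, j). (sg0 e \<xi>, (j - 1) mod N)"
    by (rule gset_cover[OF S(1,2)])
  obtain xs where xs: "c.fincar xs" using cover_fincar[OF S(1,2)] by blast
  \<comment> \<open>Any representative of the coset gives the same matrix, since \<open>mrep\<close>
    vanishes on the ideal.\<close>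
  define \<pi> where "\<pi> b = c.mrep xs (SOME y. y \<in> fcar G \<and> b = ?c y)" for b
  have \<pi>: "\<pi> (?c y) = c.mrep xs y" if y: "y \<in> fcar G" for y
  proof -
    let ?z = "SOME z. z \<in> fcar G \<and> ?c y = ?c z"
    have z: "?z \<in> fcar G \<and> ?c y = ?c ?z" by (rule someI[of _ y]) (use y in simp)
    then obtain i where i: "i \<in> LI G" "y = ?z + i" using I.coset_eqD[of y ?z] by auto
    have "c.mrep xs y = c.mrep xs ?z + c.mrep xs i" by (subst i(2)) (rule c.mrep_add)
    also have "\<dots> = c.mrep xs ?z" unfolding c.mrep_LI[OF i(1)] using c.mrep_carrier[of xs ?z] by simp
    finally show ?thesis by (simp add: \<pi>_def)
  qed
  have rep: "algebra_rep ?Q (Vn (length xs)) (\<lambda>b. mat_act (length xs) (\<pi> b))"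
  proof (rule mat_rep_algebra_rep)
    fix b assume "b \<in> alg_carrier ?Q"
    then obtain y where y: "y \<in> fcar G" "b = ?c y" using car by blast
    show "\<pi> b \<in> carrier_mat (length xs) (length xs)" unfolding y(2) \<pi>[OF y(1)] by (rule c.mrep_carrier)
    show "\<pi> (alg_scale ?Q k b) = k \<cdot>\<^sub>m \<pi> b" for k
      unfolding y(2) Q I.quot_scale free_algebra_simps using y(1) by (simp add: \<pi> c.mrep_scale)
    fix d assume "d \<in> alg_carrier ?Q"
    then obtain z where z: "z \<in> fcar G" "d = ?c z" using car by blast
    show "\<pi> (alg_add ?Q b d) = \<pi> b + \<pi> d"
      unfolding y(2) z(2) Q I.quot_add free_algebra_simps using y(1) z(1) by (simp add: \<pi> c.mrep_add)
    have "alg_mult ?Q b d = ?c (y * z)"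
      unfolding y(2) z(2) Q using I.quot_mult[of y z] y(1) z(1) by simp
    then show "\<pi> (alg_mult ?Q b d) = \<pi> b * \<pi> d"
      unfolding y(2) z(2) using y(1) z(1) by (simp add: \<pi> c.mrep_mult[OF xs])
  qed
  have act: "c.act x f \<xi> \<noteq> 0" using S(3) by (simp add: cact_def)
  then have "\<xi> \<in> set xs" using c.act_outside[OF xs x(1)] by blast
  then obtain i where i: "i < length xs" "\<xi> = xs ! i" by (metis in_set_conv_nth)
  obtain j where j: "j < length xs" "c.act x (c.unit_fun (xs ! j)) \<xi> \<noteq> 0"
    \<comment> \<open>A nonzero value on f forces a nonzero value on some unit function, that is, a
      nonzero matrix entry.\<close>
    using act c.act_expand[OF xs x(1), of f \<xi>] by (metis (no_types, lifting) lessThan_iff mult_zero_left sum.neutral)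
  have "c.mrep xs x $$ (i, j) \<noteq> 0" using i j by (simp add: c.mrep_def)
  then have "\<exists>v\<in>Vn (length xs). mat_act (length xs) (\<pi> a) v \<noteq> 0"
    unfolding x(2) \<pi>[OF x(1)] by (rule mat_act_nonzero[OF i(1) j(1)])
  then show "\<exists>V \<pi>. fin_dim_space V \<and> algebra_rep ?Q V \<pi> \<and> (\<exists>x\<in>V. \<pi> a x \<noteq> 0)"
    using rep fin_dim_Vn by (intro exI[of _ "Vn (length xs)"] exI[of _ "\<lambda>b. mat_act (length xs) (\<pi> b)"]) blast
qed

text \<open>If nothing separates a and b, the difference of their representatives tends to 0 in
  every finite action. This convergence need not be uniform over the actions. The Cauchy property
  supplies the uniformity, and \<open>adm_le_of_copn\<close> carries the bound over to the universal
  norm.\<close>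

lemma cstar_RFD: "cstar_RFD (ultragraph_cstar_algebra G)"
  unfolding cstar_RFD_def
proof (intro ballI impI, rule ccontr)
  interpret I: alg_ideal "Cau G" "Nul G" by (rule alg_ideal_Nul[OF ug])
  let ?Q = "ultragraph_cstar_algebra G" and ?c = "alg_coset (Cau G) (Nul G)"
  fix a b assume a: "a \<in> alg_carrier ?Q" and b: "b \<in> alg_carrier ?Q" and ne: "a \<noteq> b"
    and no: "\<not> (\<exists>n \<pi>. star_rep ?Q n \<pi> \<and> \<pi> a \<noteq> \<pi> b)"
  have Q: "?Q = quotient_star_algebra (Cau G) (Nul G)"
    by (simp add: ultragraph_cstar_algebra_def universal_cstar_algebra_def)
  obtain X where X: "X \<in> alg_carrier (Cau G)" "a = ?c X"
    using a unfolding Q quotient_star_simps I.quot_carrier by blast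
  obtain Y where Y: "Y \<in> alg_carrier (Cau G)" "b = ?c Y"
    using b unfolding Q quotient_star_simps I.quot_carrier by blast
  define Z where "Z n = X n - Y n" for n
  have f: "X n \<in> fcar G" "Y n \<in> fcar G" "Z n \<in> fcar G" for n using X Y by (auto simp: Z_def Cau_simps)
  have lim: "(\<lambda>n. copn N S (Z n)) \<longlonglongrightarrow> 0" if S: "closed_roots S" "N > 0" for S N
  proof -
    interpret c: gset G "\<lambda>A. (D0 A \<inter> {p. snd p \<in> S}) \<times> {0..<N}" "\<lambda>e. (R0 e \<inter> {p. snd p \<in> S}) \<times> {0..<N}"
      "\<lambda>e (\<xi>, j). (th0 e \<xi>, (j + 1) mod N)" "\<lambda>e (\<xi>, j). (sg0 e \<xi>, (j - 1) mod N)"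
      by (rule gset_cover[OF S])
    obtain xs where xs: "c.fincar xs" using cover_fincar[OF S] by blast
    obtain M where M: "c.conv xs X M" using c.ex_conv[OF ug X(1)] by blast
    obtain M' where M': "c.conv xs Y M'" using c.ex_conv[OF ug Y(1)] by blast
    have "c.limrep xs a = c.limrep xs b" using no c.limrep_star_rep[OF ug xs] by blast
    then have "M = M'" unfolding X(2) Y(2) c.limrep[OF ug M] c.limrep[OF ug M'] .
    have "c.conv xs (\<lambda>n. X n + cst (-1) * Y n) (M + (-1) \<cdot>\<^sub>m M)"
      by (intro c.conv_add M c.conv_scale) (simp add: M' \<open>M = M'\<close>)
    moreover have "M + (-1) \<cdot>\<^sub>m M = 0\<^sub>m (length xs) (length xs)"
      using M by (intro eq_matI) (auto simp: c.conv_def)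
    moreover have "(\<lambda>n. X n + cst (-1) * Y n) = Z" by (simp add: Z_def fun_eq_iff cst_simps)
    ultimately have "c.conv xs Z (0\<^sub>m (length xs) (length xs))" by simp
    then show ?thesis unfolding copn_def by (rule c.opn_tendsto_0[OF xs f(3)])
  qed
  have "Z \<in> Nul G"
    unfolding Nul_iff
  proof (intro conjI allI f LIMSEQ_I)
    fix e :: real assume e: "0 < e"
    then have e3: "0 < e / 3" by simp
    obtain N1 where N1: "\<And>m n. m \<ge> N1 \<Longrightarrow> n \<ge> N1 \<Longrightarrow> U G (X m - X n) < e / 3"
      using X(1) e3 unfolding Cau_simps by blast
    obtain N2 where N2: "\<And>m n. m \<ge> N2 \<Longrightarrow> n \<ge> N2 \<Longrightarrow> U G (Y m - Y n) < e / 3"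
      using Y(1) e3 unfolding Cau_simps by blast
    have "norm (U G (Z n) - 0) < e" if n: "n \<ge> max N1 N2" for n
    proof -
      \<comment> \<open>The index bound depends on e alone: X and Y contribute e/3 each, while the
        auxiliary index m is sent to infinity separately in each finite action.\<close>
      have "U G (Z n) \<le> 2 * e / 3"
      proof (rule U_least)
        fix \<rho> assume adm: "adm G \<rho>"
        show "\<rho> (Z n) \<le> 2 * e / 3"
        proof (rule adm_le_of_copn[OF adm f(3)])
          fix S N assume S: "closed_roots S" "(N :: int) > 0"
          note ad = adm_copn[OF S]
          have "copn N S (Z n) \<le> 2 * e / 3 + copn N S (Z m)" if m: "m \<ge> max N1 N2" for m
          proof -
            have d: "Z n - Z m = (X n - X m) - (Y n - Y m)" by (simp add: Z_def)
            have "copn N S (Z n) \<le> copn N S (Z n - Z m) + copn N S (Z m)"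
              using adm_add[OF ug ad, of "Z n - Z m" "Z m"] f by simp
            moreover have "copn N S (Z n - Z m) \<le> U G (Z n - Z m)" using f by (intro U_upper[OF ug ad]) auto
            moreover have "U G (Z n - Z m) \<le> U G (X n - X m) + U G (Y n - Y m)"
              unfolding d using f by (intro U_diff[OF ug]) auto
            ultimately show ?thesis using N1[of n m] N2[of n m] n m by simp
          qed
          then have "copn N S (Z n) \<le> 2 * e / 3 + 0"
            using lim[OF S] by (intro tendsto_lowerbound[of "\<lambda>m. 2 * e / 3 + copn N S (Z m)" _ sequentially] tendsto_add tendsto_const)
              (auto simp: eventually_sequentially intro!: exI[of _ "max N1 N2"])
          then show "copn N S (Z n) \<le> 2 * e / 3" by simp
        qed (use e in simp)
      qed
      then show ?thesis using e U_nonneg[OF ug f(3)[of n]] by simp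
    qed
    then show "\<exists>no. \<forall>n\<ge>no. norm (U G (Z n) - 0) < e" by blast
  qed
  then have "?c (alg_add (Cau G) Y Z) = ?c Y" by (rule I.coset_shift)
  moreover have "alg_add (Cau G) Y Z = X" by (simp add: Cau_simps Z_def)
  ultimately show False using ne X(2) Y(2) by simp
qed

end

theorem theorem7p4:
  fixes G :: "('v, 'e) ultragraph" and K :: "'k::field itself"
  assumes "is_ultragraph G" and "RFUM2 G"
  shows "(cstar_RFD (ultragraph_cstar_algebra G) \<longleftrightarrow> algebra_RFD (leavitt_algebra K G)) \<and>
         (algebra_RFD (leavitt_algebra K G) \<longleftrightarrow> graph_RFD G)"
proof -
  have 1: "graph_RFD G" if "cstar_RFD (ultragraph_cstar_algebra G)"
    by (rule graph_RFD_of_reps[OF assms(1) leavitt_rep_of_star_rep[OF assms(1) that] assms(2)])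
  have 2: "graph_RFD G" if "algebra_RFD (leavitt_algebra K G)"
    by (rule graph_RFD_of_reps[OF assms(1) leavitt_rep_of_algebra_rep[OF assms(1) that] assms(2)])
  have 3: "cstar_RFD (ultragraph_cstar_algebra G) \<and> algebra_RFD (leavitt_algebra K G)" if "graph_RFD G"
  proof -
    interpret rfd_ultragraph G using assms that by unfold_locales
    show ?thesis using cstar_RFD leavitt_RFD by blast
  qed
  show ?thesis using 1 2 3 by blast
qed

end
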